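(* Let $\mathfrak C$ be a small 2-category and let $E\colon \mathfrak C\to\mathfrak{Cat}$ and $W\colon \mathfrak C^{op}\to\mathfrak{Cat}$ be pseudo-functors. The bicolimit of $E$ weighted by $W$ is given by \[ E\otimes_{\mathfrak C}W:=(E\times W)\star\mathfrak C(-,-)\simeq E\star_{bi}W, \] that is, by the pseudo-colimit of the product bifunctor $E\times W\colon\mathfrak C\times\mathfrak C^{op}\to\mathfrak{Cat}$, $(C,D)\mapsto EC\times WD$, weighted by the hom-bifunctor $\mathfrak C(-,-)\colon\mathfrak C^{op}\times\mathfrak C\to\mathfrak{Cat}$.
   Context: $\mathfrak{Cat}$ is the 2-category of small categories, functors and natural transformations. $\mathfrak C^{op}$ reverses 1-cells only. All pseudo-functors are assumed normalized (identity 1-cells are preserved strictly). $\mathrm{Hom}(\mathfrak K,\mathfrak L)$ is the 2-category of pseudo-functors $\mathfrak K\to\mathfrak L$, pseudo-natural transformations and modifications. For a pseudo-functor $Q\colon\mathfrak K\to\mathfrak{Cat}$ on a small 2-category and a small category $\mathscr A$, $\mathfrak{Cat}(Q,\mathscr A)\colon\mathfrak K^{op}\to\mathfrak{Cat}$ is $K\mapsto\mathfrak{Cat}(QK,\mathscr A)$, acting by precomposition. Let $Q\colon\mathfrak K\to\mathfrak{Cat}$ and $P\colon\mathfrak K^{op}\to\mathfrak{Cat}$ be pseudo-functors on a small 2-category $\mathfrak K$. The pseudo-colimit $Q\star P$ of $Q$ weighted by $P$ is a category with a pseudo-natural transformation $\xi\colon P\to\mathfrak{Cat}(Q,Q\star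 P)$ inducing an isomorphism of categories $\mathfrak{Cat}(Q\star P,\mathscr A)\cong\mathrm{Hom}(\mathfrak K^{op},\mathfrak{Cat})(P,\mathfrak{Cat}(Q,\mathscr A))$ for every small category $\mathscr A$. The bicolimit $Q\star_{bi}P$ of $Q$ weighted by $P$ is a category with a pseudo-natural transformation $\xi\colon P\to\mathfrak{Cat}(Q,Q\star_{bi}P)$ inducing an equivalence of categories $\mathfrak{Cat}(Q\star_{bi}P,\mathscr A)\simeq\mathrm{Hom}(\mathfrak K^{op},\mathfrak{Cat})(P,\mathfrak{Cat}(Q,\mathscr A))$ for every small category $\mathscr A$. The pseudo-colimit $Q\star P$ is taken to be the explicit category $\pi_0\Delta(Q,P)[\Sigma^{-1}]$, where: $\Delta(Q,P)$ is the 2-category whose objects are triples $(K,X,Y)$ with $X\in QK$, $Y\in PK$; whose arrows $(K,X,Y)\to(L,A,B)$ are triples $(f,u,v)$ with $f\colon K\to L$, $u\colon Q(f)X\to A$, $v\colon Y\to P(f)B$ (composed in the evident way using the coherence isomorphisms of $Q$ and $P$); and whose 2-cells $(f,u,v)\Rightarrow(g,x,y)$ are the $\alpha\colon f\Rightarrow g$ with $x\circ(Q\alpha)_X=u$ and $(P\alpha)_B\circ v=y$. Here $\pi_0$ replaces each hom-category by its set of connected components, $\Sigma$ is the set of images of arrows $(f,u,v)$ with $u$ and $v$ invertible, and $[\Sigma^{-1}]$ is the category of fractions. In the claim $\mathfrak K=\mathfrak C\times\mathfrak C^{op}$. *)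

theory Defs
  imports Main "HOL-Library.FuncSet"
begin

text \<open>
  Every category, 2-category, functor and so on is given by data on carrier sets inside types. Maps are
  required to be \<^const>\<open>extensional\<close> wherever equality of functors, transformations or
  modifications matters, so that HOL equality is the intended one. A small category is a
  category whose objects and arrows form sets in two arbitrary types.
\<close>

section \<open>Categories\<close>

record ('o, 'a) cat =
  Ob :: "'o set"
  Arr :: "'a set"
  Dom :: "'a \<Rightarrow> 'o"
  Cod :: "'a \<Rightarrow> 'o"
  Idt :: "'o \<Rightarrow> 'a"
  Comp :: "'a \<Rightarrow> 'a \<Rightarrow> 'a" (infixr "\<cdot>\<index>" 70)

definition hom :: "('o, 'a) cat \<Rightarrow> 'o \<Rightarrow> 'o \<Rightarrow> 'a set" where
  "hom C x y = {f \<in> Arr C. Dom C f = x \<and> Cod C f = y}"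

locale category =
  fixes C :: "('o, 'a) cat" (structure)
  assumes Dom_in_Ob: "f \<in> Arr C \<Longrightarrow> Dom C f \<in> Ob C"
    and Cod_in_Ob: "f \<in> Arr C \<Longrightarrow> Cod C f \<in> Ob C"
    and Idt_hom: "x \<in> Ob C \<Longrightarrow> Idt C x \<in> hom C x x"
    and Comp_hom: "f \<in> hom C x y \<Longrightarrow> g \<in> hom C y z \<Longrightarrow> g \<cdot> f \<in> hom C x z"
    and Idt_left: "f \<in> hom C x y \<Longrightarrow> Idt C y \<cdot> f = f"
    and Idt_right: "f \<in> hom C x y \<Longrightarrow> f \<cdot> Idt C x = f"
    and Comp_assoc: "f \<in> hom C w x \<Longrightarrow> g \<in> hom C x y \<Longrightarrow> h \<in> hom C y z \<Longrightarrow>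
      (h \<cdot> g) \<cdot> f = h \<cdot> (g \<cdot> f)"

definition inverse_arrows :: "('o, 'a) cat \<Rightarrow> 'a \<Rightarrow> 'a \<Rightarrow> bool" where
  "inverse_arrows C f g \<longleftrightarrow> f \<in> Arr C \<and> g \<in> hom C (Cod C f) (Dom C f) \<and>
     g \<cdot>\<^bsub>C\<^esub> f = Idt C (Dom C f) \<and> f \<cdot>\<^bsub>C\<^esub> g = Idt C (Cod C f)"

definition is_iso :: "('o, 'a) cat \<Rightarrow> 'a \<Rightarrow> bool" where
  "is_iso C f \<longleftrightarrow> (\<exists>g. inverse_arrows C f g)"

definition inv_arrow :: "('o, 'a) cat \<Rightarrow> 'a \<Rightarrow> 'a" where
  "inv_arrow C f = (THE g. inverse_arrows C f g)"

definition prod_cat :: "('o, 'a) cat \<Rightarrow> ('p, 'b) cat \<Rightarrow> ('o \<times> 'p, 'a \<times> 'b) cat" where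
  "prod_cat A B = \<lparr>
     Ob = Ob A \<times> Ob B,
     Arr = Arr A \<times> Arr B,
     Dom = map_prod (Dom A) (Dom B),
     Cod = map_prod (Cod A) (Cod B),
     Idt = map_prod (Idt A) (Idt B),
     Comp = (\<lambda>(g, g') (f, f'). (g \<cdot>\<^bsub>A\<^esub> f, g' \<cdot>\<^bsub>B\<^esub> f'))\<rparr>"

section \<open>Functors and natural transformations\<close>

record ('o, 'a, 'p, 'b) func =
  FOb :: "'o \<Rightarrow> 'p"
  FArr :: "'a \<Rightarrow> 'b"

definition is_functor ::
    "('o, 'a) cat \<Rightarrow> ('p, 'b) cat \<Rightarrow> ('o, 'a, 'p, 'b) func \<Rightarrow> bool" where
  "is_functor A B F \<longleftrightarrow>
     FOb F \<in> extensional (Ob A) \<and> FArr F \<in> extensional (Arr A) \<and>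
     (\<forall>x \<in> Ob A. FOb F x \<in> Ob B) \<and>
     (\<forall>f \<in> Arr A. FArr F f \<in> hom B (FOb F (Dom A f)) (FOb F (Cod A f))) \<and>
     (\<forall>x \<in> Ob A. FArr F (Idt A x) = Idt B (FOb F x)) \<and>
     (\<forall>f \<in> Arr A. \<forall>g \<in> Arr A. Dom A g = Cod A f \<longrightarrow>
        FArr F (g \<cdot>\<^bsub>A\<^esub> f) = FArr F g \<cdot>\<^bsub>B\<^esub> FArr F f)"

definition id_func :: "('o, 'a) cat \<Rightarrow> ('o, 'a, 'o, 'a) func" where
  "id_func A = \<lparr>FOb = (\<lambda>x \<in> Ob A. x), FArr = (\<lambda>f \<in> Arr A. f)\<rparr>"

definition comp_func :: "('o, 'a) cat \<Rightarrow> ('p, 'b, 'q, 'c) func \<Rightarrow> ('o, 'a, 'p, 'b) func \<Rightarrow>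
    ('o, 'a, 'q, 'c) func" where
  "comp_func A G F = \<lparr>FOb = compose (Ob A) (FOb G) (FOb F), FArr = compose (Arr A) (FArr G) (FArr F)\<rparr>"

definition prod_func :: "('o, 'a) cat \<Rightarrow> ('p, 'b) cat \<Rightarrow>
    ('o, 'a, 'q, 'c) func \<Rightarrow> ('p, 'b, 'r, 'd) func \<Rightarrow> ('o \<times> 'p, 'a \<times> 'b, 'q \<times> 'r, 'c \<times> 'd) func" where
  "prod_func A B F G = \<lparr>
     FOb = (\<lambda>(x, y) \<in> Ob A \<times> Ob B. (FOb F x, FOb G y)),
     FArr = (\<lambda>(f, g) \<in> Arr A \<times> Arr B. (FArr F f, FArr G g))\<rparr>"

definition nat_trans :: "('o, 'a) cat \<Rightarrow> ('p, 'b) cat \<Rightarrow>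
    ('o, 'a, 'p, 'b) func \<Rightarrow> ('o, 'a, 'p, 'b) func \<Rightarrow> ('o \<Rightarrow> 'b) \<Rightarrow> bool" where
  "nat_trans A B F G \<eta> \<longleftrightarrow>
     is_functor A B F \<and> is_functor A B G \<and> \<eta> \<in> extensional (Ob A) \<and>
     (\<forall>x \<in> Ob A. \<eta> x \<in> hom B (FOb F x) (FOb G x)) \<and>
     (\<forall>f \<in> Arr A. FArr G f \<cdot>\<^bsub>B\<^esub> \<eta> (Dom A f) = \<eta> (Cod A f) \<cdot>\<^bsub>B\<^esub> FArr F f)"

definition nat_iso :: "('o, 'a) cat \<Rightarrow> ('p, 'b) cat \<Rightarrow>
    ('o, 'a, 'p, 'b) func \<Rightarrow> ('o, 'a, 'p, 'b) func \<Rightarrow> ('o \<Rightarrow> 'b) \<Rightarrow> bool" where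
  "nat_iso A B F G \<eta> \<longleftrightarrow> nat_trans A B F G \<eta> \<and> (\<forall>x \<in> Ob A. is_iso B (\<eta> x))"

definition is_equivalence ::
    "('o, 'a) cat \<Rightarrow> ('p, 'b) cat \<Rightarrow> ('o, 'a, 'p, 'b) func \<Rightarrow> bool" where
  "is_equivalence A B F \<longleftrightarrow> is_functor A B F \<and>
     (\<exists>G \<eta> \<epsilon>. is_functor B A G \<and>
        nat_iso A A (id_func A) (comp_func A G F) \<eta> \<and>
        nat_iso B B (comp_func B F G) (id_func B) \<epsilon>)"

text \<open>An arrow of a functor category carries its domain and codomain.\<close>

type_synonym ('o, 'a, 'p, 'b) ntr =
  "('o, 'a, 'p, 'b) func \<times> ('o \<Rightarrow> 'b) \<times> ('o, 'a, 'p, 'b) func"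

definition functor_cat :: "('o, 'a) cat \<Rightarrow> ('p, 'b) cat \<Rightarrow>
    (('o, 'a, 'p, 'b) func, ('o, 'a, 'p, 'b) ntr) cat" where
  "functor_cat A B = \<lparr>
     Ob = {F. is_functor A B F},
     Arr = {(F, \<eta>, G). nat_trans A B F G \<eta>},
     Dom = (\<lambda>(F, \<eta>, G). F),
     Cod = (\<lambda>(F, \<eta>, G). G),
     Idt = (\<lambda>F. (F, \<lambda>x \<in> Ob A. Idt B (FOb F x), F)),
     Comp = (\<lambda>(G', \<theta>, H) (F, \<eta>, G). (F, \<lambda>x \<in> Ob A. \<theta> x \<cdot>\<^bsub>B\<^esub> \<eta> x, H))\<rparr>"

definition precomp_func :: "('o, 'a) cat \<Rightarrow> ('p, 'b) cat \<Rightarrow> ('q, 'c) cat \<Rightarrow> ('o, 'a, 'p, 'b) func \<Rightarrow>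
    (('p, 'b, 'q, 'c) func, ('p, 'b, 'q, 'c) ntr, ('o, 'a, 'q, 'c) func, ('o, 'a, 'q, 'c) ntr) func"
  where
  "precomp_func A B C H = \<lparr>
     FOb = (\<lambda>F \<in> Ob (functor_cat B C). comp_func A F H),
     FArr = (\<lambda>(F, \<eta>, G) \<in> Arr (functor_cat B C).
       (comp_func A F H, \<lambda>x \<in> Ob A. \<eta> (FOb H x), comp_func A G H))\<rparr>"

definition postcomp_func :: "('o, 'a) cat \<Rightarrow> ('p, 'b) cat \<Rightarrow> ('q, 'c) cat \<Rightarrow> ('p, 'b, 'q, 'c) func \<Rightarrow>
    (('o, 'a, 'p, 'b) func, ('o, 'a, 'p, 'b) ntr, ('o, 'a, 'q, 'c) func, ('o, 'a, 'q, 'c) ntr) func"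
  where
  "postcomp_func A B C H = \<lparr>
     FOb = (\<lambda>F \<in> Ob (functor_cat A B). comp_func A H F),
     FArr = (\<lambda>(F, \<eta>, G) \<in> Arr (functor_cat A B).
       (comp_func A H F, \<lambda>x \<in> Ob A. FArr H (\<eta> x), comp_func A H G))\<rparr>"

section \<open>Strict 2-categories\<close>

record ('o, 'f, 't) two_cat =
  Cell0 :: "'o set"
  Cell1 :: "'f set"
  Src :: "'f \<Rightarrow> 'o"
  Tgt :: "'f \<Rightarrow> 'o"
  Id1 :: "'o \<Rightarrow> 'f"
  Cmp1 :: "'f \<Rightarrow> 'f \<Rightarrow> 'f" (infixr "\<odot>\<index>" 70)
  Cell2 :: "'t set"
  Dom2 :: "'t \<Rightarrow> 'f"
  Cod2 :: "'t \<Rightarrow> 'f"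
  Id2 :: "'f \<Rightarrow> 't"
  VComp :: "'t \<Rightarrow> 't \<Rightarrow> 't" (infixr "\<bullet>\<index>" 70)
  HComp :: "'t \<Rightarrow> 't \<Rightarrow> 't" (infixr "\<star>\<index>" 70)

definition cells1 :: "('o, 'f, 't) two_cat \<Rightarrow> ('o, 'f) cat" where
  "cells1 K = \<lparr>Ob = Cell0 K, Arr = Cell1 K, Dom = Src K, Cod = Tgt K, Idt = Id1 K, Comp = Cmp1 K\<rparr>"

definition vert_cat :: "('o, 'f, 't) two_cat \<Rightarrow> ('f, 't) cat" where
  "vert_cat K = \<lparr>Ob = Cell1 K, Arr = Cell2 K, Dom = Dom2 K, Cod = Cod2 K, Idt = Id2 K, Comp = VComp K\<rparr>"

definition horiz_cat :: "('o, 'f, 't) two_cat \<Rightarrow> ('o, 't) cat" where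
  "horiz_cat K = \<lparr>Ob = Cell0 K, Arr = Cell2 K, Dom = Src K \<circ> Dom2 K, Cod = Tgt K \<circ> Dom2 K,
     Idt = Id2 K \<circ> Id1 K, Comp = HComp K\<rparr>"

locale two_category =
  fixes K :: "('o, 'f, 't) two_cat" (structure)
  assumes category_cells1: "category (cells1 K)"
    and category_vert: "category (vert_cat K)"
    and category_horiz: "category (horiz_cat K)"
    and Src_Cod2: "\<alpha> \<in> Cell2 K \<Longrightarrow> Src K (Cod2 K \<alpha>) = Src K (Dom2 K \<alpha>)"
    and Tgt_Cod2: "\<alpha> \<in> Cell2 K \<Longrightarrow> Tgt K (Cod2 K \<alpha>) = Tgt K (Dom2 K \<alpha>)"
    and Dom2_HComp: "\<alpha> \<in> Cell2 K \<Longrightarrow> \<beta> \<in> Cell2 K \<Longrightarrow> Src K (Dom2 K \<beta>) = Tgt K (Dom2 K \<alpha>) \<Longrightarrow>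
      Dom2 K (\<beta> \<star> \<alpha>) = Dom2 K \<beta> \<odot> Dom2 K \<alpha>"
    and Cod2_HComp: "\<alpha> \<in> Cell2 K \<Longrightarrow> \<beta> \<in> Cell2 K \<Longrightarrow> Src K (Dom2 K \<beta>) = Tgt K (Dom2 K \<alpha>) \<Longrightarrow>
      Cod2 K (\<beta> \<star> \<alpha>) = Cod2 K \<beta> \<odot> Cod2 K \<alpha>"
    and HComp_Id2: "f \<in> Cell1 K \<Longrightarrow> g \<in> Cell1 K \<Longrightarrow> Src K g = Tgt K f \<Longrightarrow>
      Id2 K g \<star> Id2 K f = Id2 K (g \<odot> f)"
    and interchange: "\<alpha> \<in> Cell2 K \<Longrightarrow> \<alpha>' \<in> Cell2 K \<Longrightarrow> \<beta> \<in> Cell2 K \<Longrightarrow> \<beta>' \<in> Cell2 K \<Longrightarrow>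
      Dom2 K \<alpha>' = Cod2 K \<alpha> \<Longrightarrow> Dom2 K \<beta>' = Cod2 K \<beta> \<Longrightarrow> Src K (Dom2 K \<beta>) = Tgt K (Dom2 K \<alpha>) \<Longrightarrow>
      (\<beta>' \<bullet> \<beta>) \<star> (\<alpha>' \<bullet> \<alpha>) = (\<beta>' \<star> \<alpha>') \<bullet> (\<beta> \<star> \<alpha>)"

definition hom_cat :: "('o, 'f, 't) two_cat \<Rightarrow> 'o \<Rightarrow> 'o \<Rightarrow> ('f, 't) cat" where
  "hom_cat K x y = (vert_cat K)\<lparr>Ob := hom (cells1 K) x y,
     Arr := {\<alpha> \<in> Cell2 K. Dom2 K \<alpha> \<in> hom (cells1 K) x y}\<rparr>"

definition op2 :: "('o, 'f, 't) two_cat \<Rightarrow> ('o, 'f, 't) two_cat" where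
  "op2 K = K\<lparr>Src := Tgt K, Tgt := Src K, Cmp1 := (\<lambda>g f. Cmp1 K f g), HComp := (\<lambda>\<beta> \<alpha>. HComp K \<alpha> \<beta>)\<rparr>"

definition prod2 :: "('o, 'f, 't) two_cat \<Rightarrow> ('p, 'g, 's) two_cat \<Rightarrow>
    ('o \<times> 'p, 'f \<times> 'g, 't \<times> 's) two_cat" where
  "prod2 K L = \<lparr>
     Cell0 = Cell0 K \<times> Cell0 L,
     Cell1 = Cell1 K \<times> Cell1 L,
     Src = map_prod (Src K) (Src L),
     Tgt = map_prod (Tgt K) (Tgt L),
     Id1 = map_prod (Id1 K) (Id1 L),
     Cmp1 = (\<lambda>(g, g') (f, f'). (Cmp1 K g f, Cmp1 L g' f')),
     Cell2 = Cell2 K \<times> Cell2 L,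
     Dom2 = map_prod (Dom2 K) (Dom2 L),
     Cod2 = map_prod (Cod2 K) (Cod2 L),
     Id2 = map_prod (Id2 K) (Id2 L),
     VComp = (\<lambda>(\<beta>, \<beta>') (\<alpha>, \<alpha>'). (VComp K \<beta> \<alpha>, VComp L \<beta>' \<alpha>')),
     HComp = (\<lambda>(\<beta>, \<beta>') (\<alpha>, \<alpha>'). (HComp K \<beta> \<alpha>, HComp L \<beta>' \<alpha>'))\<rparr>"

section \<open>Normalized pseudo-functors into Cat\<close>

text \<open>
  \<open>Ps2 Q \<alpha>\<close> gives the components of the natural transformation \<open>Q \<alpha>\<close>, and \<open>Coh Q g f\<close> the
  components of the coherence isomorphism from \<open>Q g \<circ> Q f\<close> to \<open>Q (g \<circ> f)\<close>.
\<close>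

record ('o, 'f, 't, 'x, 'y) psf =
  Ps0 :: "'o \<Rightarrow> ('x, 'y) cat"
  Ps1 :: "'f \<Rightarrow> ('x, 'y, 'x, 'y) func"
  Ps2 :: "'t \<Rightarrow> 'x \<Rightarrow> 'y"
  Coh :: "'f \<Rightarrow> 'f \<Rightarrow> 'x \<Rightarrow> 'y"

locale pseudo_functor =
  fixes K :: "('o, 'f, 't) two_cat" and Q :: "('o, 'f, 't, 'x, 'y) psf"
  assumes Ps0_category: "k \<in> Cell0 K \<Longrightarrow> category (Ps0 Q k)"
    and Ps1_functor: "f \<in> hom (cells1 K) k l \<Longrightarrow> is_functor (Ps0 Q k) (Ps0 Q l) (Ps1 Q f)"
    and Ps2_nat: "f \<in> hom (cells1 K) k l \<Longrightarrow> \<alpha> \<in> hom (vert_cat K) f g \<Longrightarrow>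
      nat_trans (Ps0 Q k) (Ps0 Q l) (Ps1 Q f) (Ps1 Q g) (Ps2 Q \<alpha>)"
    and Ps2_Id2: "f \<in> hom (cells1 K) k l \<Longrightarrow> X \<in> Ob (Ps0 Q k) \<Longrightarrow>
      Ps2 Q (Id2 K f) X = Idt (Ps0 Q l) (FOb (Ps1 Q f) X)"
    and Ps2_VComp: "f \<in> hom (cells1 K) k l \<Longrightarrow> \<alpha> \<in> hom (vert_cat K) f g \<Longrightarrow>
      \<beta> \<in> hom (vert_cat K) g h \<Longrightarrow> X \<in> Ob (Ps0 Q k) \<Longrightarrow>
      Ps2 Q (\<beta> \<bullet>\<^bsub>K\<^esub> \<alpha>) X = Ps2 Q \<beta> X \<cdot>\<^bsub>Ps0 Q l\<^esub> Ps2 Q \<alpha> X"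
    and Ps1_Id1: "k \<in> Cell0 K \<Longrightarrow> Ps1 Q (Id1 K k) = id_func (Ps0 Q k)"
    and Coh_iso: "f \<in> hom (cells1 K) k l \<Longrightarrow> g \<in> hom (cells1 K) l m \<Longrightarrow>
      nat_iso (Ps0 Q k) (Ps0 Q m) (comp_func (Ps0 Q k) (Ps1 Q g) (Ps1 Q f)) (Ps1 Q (g \<odot>\<^bsub>K\<^esub> f))
        (Coh Q g f)"
    and Coh_nat: "f \<in> hom (cells1 K) k l \<Longrightarrow> g \<in> hom (cells1 K) l m \<Longrightarrow>
      \<alpha> \<in> hom (vert_cat K) f f' \<Longrightarrow> \<beta> \<in> hom (vert_cat K) g g' \<Longrightarrow> X \<in> Ob (Ps0 Q k) \<Longrightarrow>
      Coh Q g' f' X \<cdot>\<^bsub>Ps0 Q m\<^esub> Ps2 Q \<beta> (FOb (Ps1 Q f') X) \<cdot>\<^bsub>Ps0 Q m\<^esub> FArr (Ps1 Q g) (Ps2 Q \<alpha> X) =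
      Ps2 Q (\<beta> \<star>\<^bsub>K\<^esub> \<alpha>) X \<cdot>\<^bsub>Ps0 Q m\<^esub> Coh Q g f X"
    and Coh_assoc: "f \<in> hom (cells1 K) k l \<Longrightarrow> g \<in> hom (cells1 K) l m \<Longrightarrow> h \<in> hom (cells1 K) m n \<Longrightarrow>
      X \<in> Ob (Ps0 Q k) \<Longrightarrow>
      Coh Q (h \<odot>\<^bsub>K\<^esub> g) f X \<cdot>\<^bsub>Ps0 Q n\<^esub> Coh Q h g (FOb (Ps1 Q f) X) =
      Coh Q h (g \<odot>\<^bsub>K\<^esub> f) X \<cdot>\<^bsub>Ps0 Q n\<^esub> FArr (Ps1 Q h) (Coh Q g f X)"
    and Coh_Id1_left: "f \<in> hom (cells1 K) k l \<Longrightarrow> X \<in> Ob (Ps0 Q k) \<Longrightarrow>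
      Coh Q (Id1 K l) f X = Idt (Ps0 Q l) (FOb (Ps1 Q f) X)"
    and Coh_Id1_right: "f \<in> hom (cells1 K) k l \<Longrightarrow> X \<in> Ob (Ps0 Q k) \<Longrightarrow>
      Coh Q f (Id1 K k) X = Idt (Ps0 Q l) (FOb (Ps1 Q f) X)"

text \<open>The pseudo-functor \<open>(k, l) \<mapsto> Q k \<times> R l\<close> on \<open>K \<times> L\<close>.\<close>

definition prod_psf :: "('o, 'f, 't) two_cat \<Rightarrow> ('p, 'g, 's) two_cat \<Rightarrow>
    ('o, 'f, 't, 'x, 'y) psf \<Rightarrow> ('p, 'g, 's, 'z, 'w) psf \<Rightarrow>
    ('o \<times> 'p, 'f \<times> 'g, 't \<times> 's, 'x \<times> 'z, 'y \<times> 'w) psf" where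
  "prod_psf K L Q R = \<lparr>
     Ps0 = (\<lambda>(k, l). prod_cat (Ps0 Q k) (Ps0 R l)),
     Ps1 = (\<lambda>(f, g). prod_func (Ps0 Q (Src K f)) (Ps0 R (Src L g)) (Ps1 Q f) (Ps1 R g)),
     Ps2 = (\<lambda>(\<alpha>, \<beta>). \<lambda>(X, Z) \<in> Ob (Ps0 Q (Src K (Dom2 K \<alpha>))) \<times> Ob (Ps0 R (Src L (Dom2 L \<beta>))).
       (Ps2 Q \<alpha> X, Ps2 R \<beta> Z)),
     Coh = (\<lambda>(f', g') (f, g). \<lambda>(X, Z) \<in> Ob (Ps0 Q (Src K f)) \<times> Ob (Ps0 R (Src L g)).
       (Coh Q f' f X, Coh R g' g Z))\<rparr>"

text \<open>
  The hom-bifunctor \<open>(c, d) \<mapsto> K(c, d)\<close>, as a (strict) pseudo-functor on the 1-cell dual of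
  \<open>K \<times> K\<^sup>o\<^sup>p\<close>. A 1-cell \<open>(c, d) \<rightarrow> (c', d')\<close> of \<open>K \<times> K\<^sup>o\<^sup>p\<close> is a pair \<open>p : c \<rightarrow> c'\<close>, \<open>q : d' \<rightarrow> d\<close> of 1-cells of \<open>K\<close>; it
  acts as \<open>K(c', d') \<rightarrow> K(c, d)\<close>, \<open>f \<mapsto> q \<circ> f \<circ> p\<close>.
\<close>

definition hom_psf :: "('o, 'f, 't) two_cat \<Rightarrow> ('o \<times> 'o, 'f \<times> 'f, 't \<times> 't, 'f, 't) psf" where
  "hom_psf K = \<lparr>
     Ps0 = (\<lambda>(c, d). hom_cat K c d),
     Ps1 = (\<lambda>(p, q). \<lparr>
       FOb = (\<lambda>f \<in> Ob (hom_cat K (Tgt K p) (Src K q)). q \<odot>\<^bsub>K\<^esub> f \<odot>\<^bsub>K\<^esub> p),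
       FArr = (\<lambda>\<phi> \<in> Arr (hom_cat K (Tgt K p) (Src K q)). Id2 K q \<star>\<^bsub>K\<^esub> \<phi> \<star>\<^bsub>K\<^esub> Id2 K p)\<rparr>),
     Ps2 = (\<lambda>(\<alpha>, \<beta>). \<lambda>f \<in> Ob (hom_cat K (Tgt K (Dom2 K \<alpha>)) (Src K (Dom2 K \<beta>))).
       \<beta> \<star>\<^bsub>K\<^esub> Id2 K f \<star>\<^bsub>K\<^esub> \<alpha>),
     Coh = (\<lambda>(p, q) (p', q'). \<lambda>f \<in> Ob (hom_cat K (Tgt K p') (Src K q')).
       Id2 K ((q \<odot>\<^bsub>K\<^esub> q') \<odot>\<^bsub>K\<^esub> f \<odot>\<^bsub>K\<^esub> p' \<odot>\<^bsub>K\<^esub> p))\<rparr>"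

text \<open>
  The pseudo-functor \<open>Cat(Q, A)\<close> on \<open>op2 K\<close>. In the field \<open>Coh\<close> the composite of \<open>g\<close> after \<open>f\<close> in
  \<open>op2 K\<close> is \<open>f \<circ> g\<close> in \<open>K\<close>.
\<close>

definition Cat_psf :: "('o, 'f, 't) two_cat \<Rightarrow> ('o, 'f, 't, 'x, 'y) psf \<Rightarrow> ('p, 'q) cat \<Rightarrow>
    ('o, 'f, 't, ('x, 'y, 'p, 'q) func, ('x, 'y, 'p, 'q) ntr) psf" where
  "Cat_psf K Q A = \<lparr>
     Ps0 = (\<lambda>k. functor_cat (Ps0 Q k) A),
     Ps1 = (\<lambda>f. precomp_func (Ps0 Q (Src K f)) (Ps0 Q (Tgt K f)) A (Ps1 Q f)),
     Ps2 = (\<lambda>\<alpha>. let k = Src K (Dom2 K \<alpha>); l = Tgt K (Dom2 K \<alpha>) in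
       (\<lambda>F \<in> Ob (functor_cat (Ps0 Q l) A).
         (comp_func (Ps0 Q k) F (Ps1 Q (Dom2 K \<alpha>)),
          \<lambda>X \<in> Ob (Ps0 Q k). FArr F (Ps2 Q \<alpha> X),
          comp_func (Ps0 Q k) F (Ps1 Q (Cod2 K \<alpha>))))),
     Coh = (\<lambda>g f. let k = Src K g in
       (\<lambda>F \<in> Ob (functor_cat (Ps0 Q (Tgt K f)) A).
         (comp_func (Ps0 Q k) (comp_func (Ps0 Q (Src K f)) F (Ps1 Q f)) (Ps1 Q g),
          \<lambda>X \<in> Ob (Ps0 Q k). FArr F (Coh Q f g X),
          comp_func (Ps0 Q k) F (Ps1 Q (f \<odot>\<^bsub>K\<^esub> g)))))\<rparr>"

section \<open>Pseudo-natural transformations and modifications\<close>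

text \<open>
  For \<open>f : k \<rightarrow> l\<close> the invertible 2-cell \<open>Tr1 \<theta> f\<close> goes from \<open>Q f \<circ> \<theta>\<^sub>k\<close> to \<open>\<theta>\<^sub>l \<circ> P f\<close>. Source and target
  of a transformation may take values in categories over different types.
\<close>

record ('o, 'f, 'x, 'y, 'z, 'w) pstr =
  Tr0 :: "'o \<Rightarrow> ('x, 'y, 'z, 'w) func"
  Tr1 :: "'f \<Rightarrow> 'x \<Rightarrow> 'w"

definition pseudo_nat :: "('o, 'f, 't) two_cat \<Rightarrow> ('o, 'f, 't, 'x, 'y) psf \<Rightarrow>
    ('o, 'f, 't, 'z, 'w) psf \<Rightarrow> ('o, 'f, 'x, 'y, 'z, 'w) pstr \<Rightarrow> bool" where
  "pseudo_nat K P Q \<theta> \<longleftrightarrow>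
     Tr0 \<theta> \<in> extensional (Cell0 K) \<and> Tr1 \<theta> \<in> extensional (Cell1 K) \<and>
     (\<forall>k \<in> Cell0 K. is_functor (Ps0 P k) (Ps0 Q k) (Tr0 \<theta> k)) \<and>
     (\<forall>k l. \<forall>f \<in> hom (cells1 K) k l.
        nat_iso (Ps0 P k) (Ps0 Q l) (comp_func (Ps0 P k) (Ps1 Q f) (Tr0 \<theta> k))
          (comp_func (Ps0 P k) (Tr0 \<theta> l) (Ps1 P f)) (Tr1 \<theta> f)) \<and>
     (\<forall>k l. \<forall>f \<in> hom (cells1 K) k l. \<forall>g. \<forall>\<alpha> \<in> hom (vert_cat K) f g. \<forall>X \<in> Ob (Ps0 P k).
        Tr1 \<theta> g X \<cdot>\<^bsub>Ps0 Q l\<^esub> Ps2 Q \<alpha> (FOb (Tr0 \<theta> k) X) =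
        FArr (Tr0 \<theta> l) (Ps2 P \<alpha> X) \<cdot>\<^bsub>Ps0 Q l\<^esub> Tr1 \<theta> f X) \<and>
     (\<forall>k \<in> Cell0 K. \<forall>X \<in> Ob (Ps0 P k).
        Tr1 \<theta> (Id1 K k) X = Idt (Ps0 Q k) (FOb (Tr0 \<theta> k) X)) \<and>
     (\<forall>k l m. \<forall>f \<in> hom (cells1 K) k l. \<forall>g \<in> hom (cells1 K) l m. \<forall>X \<in> Ob (Ps0 P k).
        Tr1 \<theta> (g \<odot>\<^bsub>K\<^esub> f) X \<cdot>\<^bsub>Ps0 Q m\<^esub> Coh Q g f (FOb (Tr0 \<theta> k) X) =
        FArr (Tr0 \<theta> m) (Coh P g f X) \<cdot>\<^bsub>Ps0 Q m\<^esub> Tr1 \<theta> g (FOb (Ps1 P f) X) \<cdot>\<^bsub>Ps0 Q m\<^esub>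
          FArr (Ps1 Q g) (Tr1 \<theta> f X))"

definition modification :: "('o, 'f, 't) two_cat \<Rightarrow> ('o, 'f, 't, 'x, 'y) psf \<Rightarrow>
    ('o, 'f, 't, 'z, 'w) psf \<Rightarrow> ('o, 'f, 'x, 'y, 'z, 'w) pstr \<Rightarrow> ('o, 'f, 'x, 'y, 'z, 'w) pstr \<Rightarrow>
    ('o \<Rightarrow> 'x \<Rightarrow> 'w) \<Rightarrow> bool" where
  "modification K P Q \<theta> \<phi> \<mu> \<longleftrightarrow>
     pseudo_nat K P Q \<theta> \<and> pseudo_nat K P Q \<phi> \<and> \<mu> \<in> extensional (Cell0 K) \<and>
     (\<forall>k \<in> Cell0 K. nat_trans (Ps0 P k) (Ps0 Q k) (Tr0 \<theta> k) (Tr0 \<phi> k) (\<mu> k)) \<and>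
     (\<forall>k l. \<forall>f \<in> hom (cells1 K) k l. \<forall>X \<in> Ob (Ps0 P k).
        Tr1 \<phi> f X \<cdot>\<^bsub>Ps0 Q l\<^esub> FArr (Ps1 Q f) (\<mu> k X) =
        \<mu> l (FOb (Ps1 P f) X) \<cdot>\<^bsub>Ps0 Q l\<^esub> Tr1 \<theta> f X)"

type_synonym ('o, 'f, 'x, 'y, 'z, 'w) modif =
  "('o, 'f, 'x, 'y, 'z, 'w) pstr \<times> ('o \<Rightarrow> 'x \<Rightarrow> 'w) \<times> ('o, 'f, 'x, 'y, 'z, 'w) pstr"

text \<open>The hom-category \<open>Hom(K, Cat)(P, Q)\<close>.\<close>

definition Hom_cat :: "('o, 'f, 't) two_cat \<Rightarrow> ('o, 'f, 't, 'x, 'y) psf \<Rightarrow> ('o, 'f, 't, 'z, 'w) psf \<Rightarrow>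
    (('o, 'f, 'x, 'y, 'z, 'w) pstr, ('o, 'f, 'x, 'y, 'z, 'w) modif) cat" where
  "Hom_cat K P Q = \<lparr>
     Ob = {\<theta>. pseudo_nat K P Q \<theta>},
     Arr = {(\<theta>, \<mu>, \<phi>). modification K P Q \<theta> \<phi> \<mu>},
     Dom = (\<lambda>(\<theta>, \<mu>, \<phi>). \<theta>),
     Cod = (\<lambda>(\<theta>, \<mu>, \<phi>). \<phi>),
     Idt = (\<lambda>\<theta>. (\<theta>, \<lambda>k \<in> Cell0 K. \<lambda>X \<in> Ob (Ps0 P k). Idt (Ps0 Q k) (FOb (Tr0 \<theta> k) X), \<theta>)),
     Comp = (\<lambda>(\<phi>', \<nu>, \<psi>) (\<theta>, \<mu>, \<phi>).
       (\<theta>, \<lambda>k \<in> Cell0 K. \<lambda>X \<in> Ob (Ps0 P k). \<nu> k X \<cdot>\<^bsub>Ps0 Q k\<^esub> \<mu> k X, \<psi>))\<rparr>"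

section \<open>Weighted bicolimits\<close>

text \<open>
  A transformation \<open>\<xi> : P \<rightarrow> Cat(Q, B)\<close> induces, by postcomposition, a functor
  from \<open>Cat(B, A)\<close> to \<open>Hom(K\<^sup>o\<^sup>p, Cat)(P, Cat(Q, A))\<close>.
\<close>

definition induced_pstr :: "('o, 'f, 't) two_cat \<Rightarrow> ('o, 'f, 't, 'x, 'y) psf \<Rightarrow>
    ('o, 'f, 't, 'z, 'w) psf \<Rightarrow> ('r, 's) cat \<Rightarrow> ('p, 'q) cat \<Rightarrow>
    ('o, 'f, 'z, 'w, ('x, 'y, 'r, 's) func, ('x, 'y, 'r, 's) ntr) pstr \<Rightarrow> ('r, 's, 'p, 'q) func \<Rightarrow>
    ('o, 'f, 'z, 'w, ('x, 'y, 'p, 'q) func, ('x, 'y, 'p, 'q) ntr) pstr" where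
  "induced_pstr K Q P B A \<xi> G = \<lparr>
     Tr0 = (\<lambda>k \<in> Cell0 K. comp_func (Ps0 P k) (postcomp_func (Ps0 Q k) B A G) (Tr0 \<xi> k)),
     Tr1 = (\<lambda>f \<in> Cell1 K. \<lambda>Y \<in> Ob (Ps0 P (Tgt K f)).
       FArr (postcomp_func (Ps0 Q (Src K f)) B A G) (Tr1 \<xi> f Y))\<rparr>"

definition induced_func :: "('o, 'f, 't) two_cat \<Rightarrow> ('o, 'f, 't, 'x, 'y) psf \<Rightarrow>
    ('o, 'f, 't, 'z, 'w) psf \<Rightarrow> ('r, 's) cat \<Rightarrow> ('p, 'q) cat \<Rightarrow>
    ('o, 'f, 'z, 'w, ('x, 'y, 'r, 's) func, ('x, 'y, 'r, 's) ntr) pstr \<Rightarrow>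
    (('r, 's, 'p, 'q) func, ('r, 's, 'p, 'q) ntr,
     ('o, 'f, 'z, 'w, ('x, 'y, 'p, 'q) func, ('x, 'y, 'p, 'q) ntr) pstr,
     ('o, 'f, 'z, 'w, ('x, 'y, 'p, 'q) func, ('x, 'y, 'p, 'q) ntr) modif) func" where
  "induced_func K Q P B A \<xi> = \<lparr>
     FOb = (\<lambda>G \<in> Ob (functor_cat B A). induced_pstr K Q P B A \<xi> G),
     FArr = (\<lambda>(G, \<gamma>, H) \<in> Arr (functor_cat B A).
       (induced_pstr K Q P B A \<xi> G,
        \<lambda>k \<in> Cell0 K. \<lambda>Y \<in> Ob (Ps0 P k). let F = FOb (Tr0 \<xi> k) Y in
          (comp_func (Ps0 Q k) G F, \<lambda>X \<in> Ob (Ps0 Q k). \<gamma> (FOb F X), comp_func (Ps0 Q k) H F),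
        induced_pstr K Q P B A \<xi> H))\<rparr>"

text \<open>
  \<open>B\<close> with \<open>\<xi>\<close> is a bicolimit of \<open>Q\<close> weighted by \<open>P\<close>. Since HOL cannot quantify over types within a
  formula, the types in which the test categories \<open>A\<close> live are a parameter; a theorem stated for type
  variables \<open>'p\<close> and \<open>'q\<close> covers all of them.
\<close>

definition is_bicolimit :: "'p itself \<Rightarrow> 'q itself \<Rightarrow> ('o, 'f, 't) two_cat \<Rightarrow>
    ('o, 'f, 't, 'x, 'y) psf \<Rightarrow> ('o, 'f, 't, 'z, 'w) psf \<Rightarrow> ('r, 's) cat \<Rightarrow>
    ('o, 'f, 'z, 'w, ('x, 'y, 'r, 's) func, ('x, 'y, 'r, 's) ntr) pstr \<Rightarrow> bool" where
  "is_bicolimit _ _ K Q P B \<xi> \<longleftrightarrow>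
     category B \<and> pseudo_nat (op2 K) P (Cat_psf K Q B) \<xi> \<and>
     (\<forall>A :: ('p, 'q) cat. category A \<longrightarrow>
        is_equivalence (functor_cat B A) (Hom_cat (op2 K) P (Cat_psf K Q A))
          (induced_func K Q P B A \<xi>))"

section \<open>Connected components and categories of fractions\<close>

definition equiv_closure :: "'a set \<Rightarrow> ('a \<times> 'a) set \<Rightarrow> ('a \<times> 'a) set" where
  "equiv_closure A R = (R \<union> R\<inverse>)\<^sup>* \<inter> A \<times> A"

definition conn :: "('o, 'f, 't) two_cat \<Rightarrow> ('f \<times> 'f) set" where
  "conn K = equiv_closure (Cell1 K) {(f, g). \<exists>\<alpha>. \<alpha> \<in> hom (vert_cat K) f g}"

definition pi0 :: "('o, 'f, 't) two_cat \<Rightarrow> ('o, 'f set) cat" where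
  "pi0 K = \<lparr>
     Ob = Cell0 K,
     Arr = Cell1 K // conn K,
     Dom = (\<lambda>c. the_elem (Src K ` c)),
     Cod = (\<lambda>c. the_elem (Tgt K ` c)),
     Idt = (\<lambda>x. conn K `` {Id1 K x}),
     Comp = (\<lambda>d c. conn K `` {g \<odot>\<^bsub>K\<^esub> f | g f. g \<in> d \<and> f \<in> c})\<rparr>"

text \<open>
  The category of fractions: its arrows are zigzags of arrows of \<open>C\<close> and formal inverses of arrows in
  \<open>S\<close>, listed from source to target, modulo the congruence generated by the relations of \<open>C\<close> and by
  the cancellation of formal inverses.
\<close>

datatype 'a step = Fwd 'a | Bwd 'a

inductive zigzag :: "('o, 'a) cat \<Rightarrow> 'a set \<Rightarrow> 'o \<Rightarrow> 'a step list \<Rightarrow> 'o \<Rightarrow> bool"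
  for C S where
  zz_Nil: "x \<in> Ob C \<Longrightarrow> zigzag C S x [] x"
| zz_Fwd: "a \<in> Arr C \<Longrightarrow> zigzag C S (Cod C a) p y \<Longrightarrow> zigzag C S (Dom C a) (Fwd a # p) y"
| zz_Bwd: "a \<in> Arr C \<Longrightarrow> a \<in> S \<Longrightarrow> zigzag C S (Dom C a) p y \<Longrightarrow>
    zigzag C S (Cod C a) (Bwd a # p) y"

definition zigzags :: "('o, 'a) cat \<Rightarrow> 'a set \<Rightarrow> ('o \<times> 'a step list \<times> 'o) set" where
  "zigzags C S = {(x, p, y). zigzag C S x p y}"

definition zz_rules :: "('o, 'a) cat \<Rightarrow> 'a set \<Rightarrow> ('a step list \<times> 'a step list) set" where
  "zz_rules C S =
     {([Fwd (Idt C x)], []) | x. x \<in> Ob C} \<union>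
     {([Fwd a, Fwd b], [Fwd (b \<cdot>\<^bsub>C\<^esub> a)]) | a b. a \<in> Arr C \<and> b \<in> Arr C \<and> Dom C b = Cod C a} \<union>
     {([Fwd s, Bwd s], []) | s. s \<in> S} \<union>
     {([Bwd s, Fwd s], []) | s. s \<in> S}"

definition zz_rel ::
    "('o, 'a) cat \<Rightarrow> 'a set \<Rightarrow> (('o \<times> 'a step list \<times> 'o) \<times> ('o \<times> 'a step list \<times> 'o)) set" where
  "zz_rel C S = equiv_closure (zigzags C S)
     {((x, l @ p @ r, y), (x, l @ q @ r, y)) | x y l p q r.
        (p, q) \<in> zz_rules C S \<and> zigzag C S x (l @ p @ r) y \<and> zigzag C S x (l @ q @ r) y}"

definition fractions :: "('o, 'a) cat \<Rightarrow> 'a set \<Rightarrow> ('o, ('o \<times> 'a step list \<times> 'o) set) cat" where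
  "fractions C S = \<lparr>
     Ob = Ob C,
     Arr = zigzags C S // zz_rel C S,
     Dom = (\<lambda>c. the_elem ((\<lambda>(x, p, y). x) ` c)),
     Cod = (\<lambda>c. the_elem ((\<lambda>(x, p, y). y) ` c)),
     Idt = (\<lambda>x. zz_rel C S `` {(x, [], x)}),
     Comp = (\<lambda>d c. zz_rel C S `` {(x, p @ q, z) | x p y q z. (x, p, y) \<in> c \<and> (y, q, z) \<in> d})\<rparr>"

section \<open>The pseudo-colimit\<close>

text \<open>A 1-cell of \<open>\<Delta>(Q, P)\<close> carries its source and target, a 2-cell its domain and codomain.\<close>

type_synonym ('o, 'x, 'z) dob = "'o \<times> 'x \<times> 'z"
type_synonym ('o, 'f, 'x, 'y, 'z, 'w) dar =
  "('o, 'x, 'z) dob \<times> ('f \<times> 'y \<times> 'w) \<times> ('o, 'x, 'z) dob"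
type_synonym ('o, 'f, 't, 'x, 'y, 'z, 'w) d2 =
  "('o, 'f, 'x, 'y, 'z, 'w) dar \<times> 't \<times> ('o, 'f, 'x, 'y, 'z, 'w) dar"

definition Delta_ob :: "('o, 'f, 't) two_cat \<Rightarrow> ('o, 'f, 't, 'x, 'y) psf \<Rightarrow>
    ('o, 'f, 't, 'z, 'w) psf \<Rightarrow> ('o, 'x, 'z) dob set" where
  "Delta_ob K Q P = {(k, X, Y). k \<in> Cell0 K \<and> X \<in> Ob (Ps0 Q k) \<and> Y \<in> Ob (Ps0 P k)}"

definition Delta_arr :: "('o, 'f, 't) two_cat \<Rightarrow> ('o, 'f, 't, 'x, 'y) psf \<Rightarrow>
    ('o, 'f, 't, 'z, 'w) psf \<Rightarrow> ('o, 'f, 'x, 'y, 'z, 'w) dar set" where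
  "Delta_arr K Q P = {((k, X, Y), (f, u, v), (l, A, B)).
     (k, X, Y) \<in> Delta_ob K Q P \<and> (l, A, B) \<in> Delta_ob K Q P \<and>
     f \<in> hom (cells1 K) k l \<and>
     u \<in> hom (Ps0 Q l) (FOb (Ps1 Q f) X) A \<and>
     v \<in> hom (Ps0 P k) Y (FOb (Ps1 P f) B)}"

definition Delta_comp :: "('o, 'f, 't) two_cat \<Rightarrow> ('o, 'f, 't, 'x, 'y) psf \<Rightarrow>
    ('o, 'f, 't, 'z, 'w) psf \<Rightarrow> ('o, 'f, 'x, 'y, 'z, 'w) dar \<Rightarrow> ('o, 'f, 'x, 'y, 'z, 'w) dar \<Rightarrow>
    ('o, 'f, 'x, 'y, 'z, 'w) dar" where
  "Delta_comp K Q P = (\<lambda>((l', A', B'), (g, x, y), (m, C, D)) ((k, X, Y), (f, u, v), (l, A, B)).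
     ((k, X, Y),
      (g \<odot>\<^bsub>K\<^esub> f,
       x \<cdot>\<^bsub>Ps0 Q m\<^esub> FArr (Ps1 Q g) u \<cdot>\<^bsub>Ps0 Q m\<^esub> inv_arrow (Ps0 Q m) (Coh Q g f X),
       Coh P f g D \<cdot>\<^bsub>Ps0 P k\<^esub> FArr (Ps1 P f) y \<cdot>\<^bsub>Ps0 P k\<^esub> v),
      (m, C, D)))"

definition Delta_cell2 :: "('o, 'f, 't) two_cat \<Rightarrow> ('o, 'f, 't, 'x, 'y) psf \<Rightarrow>
    ('o, 'f, 't, 'z, 'w) psf \<Rightarrow> ('o, 'f, 't, 'x, 'y, 'z, 'w) d2 set" where
  "Delta_cell2 K Q P = {(((k, X, Y), (f, u, v), (l, A, B)), \<alpha>, ((k', X', Y'), (g, x, y), (l', A', B'))).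
     ((k, X, Y), (f, u, v), (l, A, B)) \<in> Delta_arr K Q P \<and>
     ((k', X', Y'), (g, x, y), (l', A', B')) \<in> Delta_arr K Q P \<and>
     (k', X', Y') = (k, X, Y) \<and> (l', A', B') = (l, A, B) \<and>
     \<alpha> \<in> hom (vert_cat K) f g \<and>
     x \<cdot>\<^bsub>Ps0 Q l\<^esub> Ps2 Q \<alpha> X = u \<and>
     Ps2 P \<alpha> B \<cdot>\<^bsub>Ps0 P k\<^esub> v = y}"

definition Delta :: "('o, 'f, 't) two_cat \<Rightarrow> ('o, 'f, 't, 'x, 'y) psf \<Rightarrow> ('o, 'f, 't, 'z, 'w) psf \<Rightarrow>
    (('o, 'x, 'z) dob, ('o, 'f, 'x, 'y, 'z, 'w) dar, ('o, 'f, 't, 'x, 'y, 'z, 'w) d2) two_cat" where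
  "Delta K Q P = \<lparr>
     Cell0 = Delta_ob K Q P,
     Cell1 = Delta_arr K Q P,
     Src = (\<lambda>(a, r, b). a),
     Tgt = (\<lambda>(a, r, b). b),
     Id1 = (\<lambda>(k, X, Y). ((k, X, Y), (Id1 K k, Idt (Ps0 Q k) X, Idt (Ps0 P k) Y), (k, X, Y))),
     Cmp1 = Delta_comp K Q P,
     Cell2 = Delta_cell2 K Q P,
     Dom2 = (\<lambda>(r, \<alpha>, s). r),
     Cod2 = (\<lambda>(r, \<alpha>, s). s),
     Id2 = (\<lambda>(a, (f, u, v), b). ((a, (f, u, v), b), Id2 K f, (a, (f, u, v), b))),
     VComp = (\<lambda>(s', \<beta>, t) (r, \<alpha>, s). (r, \<beta> \<bullet>\<^bsub>K\<^esub> \<alpha>, t)),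
     HComp = (\<lambda>(r', \<beta>, s') (r, \<alpha>, s). (Delta_comp K Q P r' r, \<beta> \<star>\<^bsub>K\<^esub> \<alpha>, Delta_comp K Q P s' s))\<rparr>"

definition Sigma_arr :: "('o, 'f, 't) two_cat \<Rightarrow> ('o, 'f, 't, 'x, 'y) psf \<Rightarrow>
    ('o, 'f, 't, 'z, 'w) psf \<Rightarrow> ('o, 'f, 'x, 'y, 'z, 'w) dar set set" where
  "Sigma_arr K Q P = {conn (Delta K Q P) `` {((k, X, Y), (f, u, v), (l, A, B))} | k X Y f u v l A B.
     ((k, X, Y), (f, u, v), (l, A, B)) \<in> Delta_arr K Q P \<and> is_iso (Ps0 Q l) u \<and> is_iso (Ps0 P k) v}"

type_synonym ('o, 'f, 'x, 'y, 'z, 'w) pcolim_arr =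
  "(('o, 'x, 'z) dob \<times> ('o, 'f, 'x, 'y, 'z, 'w) dar set step list \<times> ('o, 'x, 'z) dob) set"

definition pcolim :: "('o, 'f, 't) two_cat \<Rightarrow> ('o, 'f, 't, 'x, 'y) psf \<Rightarrow> ('o, 'f, 't, 'z, 'w) psf \<Rightarrow>
    (('o, 'x, 'z) dob, ('o, 'f, 'x, 'y, 'z, 'w) pcolim_arr) cat" where
  "pcolim K Q P = fractions (pi0 (Delta K Q P)) (Sigma_arr K Q P)"

text \<open>
  The arrow of the pseudo-colimit from \<open>a\<close> to \<open>b\<close> represented by a zigzag of 1-cells of \<open>\<Delta>(Q, P)\<close>.
\<close>

definition pcolim_zz :: "('o, 'f, 't) two_cat \<Rightarrow> ('o, 'f, 't, 'x, 'y) psf \<Rightarrow>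
    ('o, 'f, 't, 'z, 'w) psf \<Rightarrow> ('o, 'x, 'z) dob \<Rightarrow> ('o, 'f, 'x, 'y, 'z, 'w) dar step list \<Rightarrow>
    ('o, 'x, 'z) dob \<Rightarrow> ('o, 'f, 'x, 'y, 'z, 'w) pcolim_arr" where
  "pcolim_zz K Q P a p b = zz_rel (pi0 (Delta K Q P)) (Sigma_arr K Q P) ``
     {(a, map (map_step (\<lambda>r. conn (Delta K Q P) `` {r})) p, b)}"

section \<open>The tensor product of E and W\<close>

abbreviation tensor_psf :: "('o, 'f, 't) two_cat \<Rightarrow> ('o, 'f, 't, 'x, 'y) psf \<Rightarrow>
    ('o, 'f, 't, 'z, 'w) psf \<Rightarrow> ('o \<times> 'o, 'f \<times> 'f, 't \<times> 't, 'x \<times> 'z, 'y \<times> 'w) psf" where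
  "tensor_psf C E W \<equiv> prod_psf C (op2 C) E W"

definition tensor :: "('o, 'f, 't) two_cat \<Rightarrow> ('o, 'f, 't, 'x, 'y) psf \<Rightarrow> ('o, 'f, 't, 'z, 'w) psf \<Rightarrow>
    (('o \<times> 'o, 'x \<times> 'z, 'f) dob,
     ('o \<times> 'o, 'f \<times> 'f, 'x \<times> 'z, 'y \<times> 'w, 'f, 't) pcolim_arr) cat" where
  "tensor C E W = pcolim (prod2 C (op2 C)) (tensor_psf C E W) (hom_psf C)"

definition tensor_zz :: "('o, 'f, 't) two_cat \<Rightarrow> ('o, 'f, 't, 'x, 'y) psf \<Rightarrow>
    ('o, 'f, 't, 'z, 'w) psf \<Rightarrow> ('o \<times> 'o, 'x \<times> 'z, 'f) dob \<Rightarrow>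
    ('o \<times> 'o, 'f \<times> 'f, 'x \<times> 'z, 'y \<times> 'w, 'f, 't) dar step list \<Rightarrow> ('o \<times> 'o, 'x \<times> 'z, 'f) dob \<Rightarrow>
    ('o \<times> 'o, 'f \<times> 'f, 'x \<times> 'z, 'y \<times> 'w, 'f, 't) pcolim_arr" where
  "tensor_zz C E W = pcolim_zz (prod2 C (op2 C)) (tensor_psf C E W) (hom_psf C)"

text \<open>
  The canonical \<open>\<xi> : W \<rightarrow> Cat(E, E \<otimes> W)\<close> sends \<open>w \<in> W c\<close> to the functor \<open>e \<mapsto> ((c, c), (e, w), 1\<^sub>c)\<close>. It
  is the composite of the unit of the pseudo-colimit with the Yoneda element \<open>1\<^sub>c \<in> C(c, c)\<close>. For
  \<open>f : c \<rightarrow> d\<close>, \<open>e \<in> E c\<close> and \<open>w \<in> W d\<close> there are two arrows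
    \<open>((d, d), (E f e, w), 1\<^sub>d) \<leftarrow> ((c, d), (e, w), f) \<rightarrow> ((c, c), (e, W f w), 1\<^sub>c)\<close>
  in \<open>\<Delta>\<close>, lying over \<open>(f, 1\<^sub>d)\<close> and \<open>(1\<^sub>c, f)\<close> and having identity components. Both are inverted, and
  the structural isomorphism of \<open>\<xi>\<close> is the resulting zigzag from left to right.
\<close>

definition unit_ob :: "('o, 'f, 't) two_cat \<Rightarrow> 'o \<Rightarrow> 'x \<Rightarrow> 'z \<Rightarrow> ('o \<times> 'o, 'x \<times> 'z, 'f) dob" where
  "unit_ob C c e w = ((c, c), (e, w), Id1 C c)"

definition unit_arr :: "('o, 'f, 't) two_cat \<Rightarrow> ('o, 'f, 't, 'x, 'y) psf \<Rightarrow>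
    ('o, 'f, 't, 'z, 'w) psf \<Rightarrow> 'o \<Rightarrow> 'y \<Rightarrow> 'w \<Rightarrow>
    ('o \<times> 'o, 'f \<times> 'f, 'x \<times> 'z, 'y \<times> 'w, 'f, 't) pcolim_arr" where
  "unit_arr C E W c a b = (let
       s = unit_ob C c (Dom (Ps0 E c) a) (Dom (Ps0 W c) b);
       t = unit_ob C c (Cod (Ps0 E c) a) (Cod (Ps0 W c) b)
     in tensor_zz C E W s [Fwd (s, ((Id1 C c, Id1 C c), (a, b), Id2 C (Id1 C c)), t)] t)"

definition unit_func :: "('o, 'f, 't) two_cat \<Rightarrow> ('o, 'f, 't, 'x, 'y) psf \<Rightarrow>
    ('o, 'f, 't, 'z, 'w) psf \<Rightarrow> 'o \<Rightarrow> 'z \<Rightarrow>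
    ('x, 'y, ('o \<times> 'o, 'x \<times> 'z, 'f) dob,
     ('o \<times> 'o, 'f \<times> 'f, 'x \<times> 'z, 'y \<times> 'w, 'f, 't) pcolim_arr) func" where
  "unit_func C E W c w = \<lparr>
     FOb = (\<lambda>e \<in> Ob (Ps0 E c). unit_ob C c e w),
     FArr = (\<lambda>a \<in> Arr (Ps0 E c). unit_arr C E W c a (Idt (Ps0 W c) w))\<rparr>"

definition unit_cell :: "('o, 'f, 't) two_cat \<Rightarrow> ('o, 'f, 't, 'x, 'y) psf \<Rightarrow>
    ('o, 'f, 't, 'z, 'w) psf \<Rightarrow> 'f \<Rightarrow> 'x \<Rightarrow> 'z \<Rightarrow>
    ('o \<times> 'o, 'f \<times> 'f, 'x \<times> 'z, 'y \<times> 'w, 'f, 't) pcolim_arr" where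
  "unit_cell C E W f e w = (let
       c = Src C f; d = Tgt C f;
       Efe = FOb (Ps1 E f) e; Wfw = FOb (Ps1 W f) w;
       m = ((c, d), (e, w), f);
       l = unit_ob C d Efe w;
       r = unit_ob C c e Wfw
     in tensor_zz C E W l
          [Bwd (m, ((f, Id1 C d), (Idt (Ps0 E d) Efe, Idt (Ps0 W d) w), Id2 C f), l),
           Fwd (m, ((Id1 C c, f), (Idt (Ps0 E c) e, Idt (Ps0 W c) Wfw), Id2 C f), r)] r)"

definition tensor_unit :: "('o, 'f, 't) two_cat \<Rightarrow> ('o, 'f, 't, 'x, 'y) psf \<Rightarrow>
    ('o, 'f, 't, 'z, 'w) psf \<Rightarrow>
    ('o, 'f, 'z, 'w,
     ('x, 'y, ('o \<times> 'o, 'x \<times> 'z, 'f) dob,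
      ('o \<times> 'o, 'f \<times> 'f, 'x \<times> 'z, 'y \<times> 'w, 'f, 't) pcolim_arr) func,
     ('x, 'y, ('o \<times> 'o, 'x \<times> 'z, 'f) dob,
      ('o \<times> 'o, 'f \<times> 'f, 'x \<times> 'z, 'y \<times> 'w, 'f, 't) pcolim_arr) ntr) pstr" where
  "tensor_unit C E W = \<lparr>
     Tr0 = (\<lambda>c \<in> Cell0 C. \<lparr>
       FOb = (\<lambda>w \<in> Ob (Ps0 W c). unit_func C E W c w),
       FArr = (\<lambda>b \<in> Arr (Ps0 W c).
         (unit_func C E W c (Dom (Ps0 W c) b),
          \<lambda>e \<in> Ob (Ps0 E c). unit_arr C E W c (Idt (Ps0 E c) e) b,
          unit_func C E W c (Cod (Ps0 W c) b)))\<rparr>),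
     Tr1 = (\<lambda>f \<in> Cell1 C. \<lambda>w \<in> Ob (Ps0 W (Tgt C f)).
       (comp_func (Ps0 E (Src C f)) (unit_func C E W (Tgt C f) w) (Ps1 E f),
        \<lambda>e \<in> Ob (Ps0 E (Src C f)). unit_cell C E W f e w,
        unit_func C E W (Src C f) (FOb (Ps1 W f) w)))\<rparr>"

end

theory Submission
  imports Defs
begin

text \<open>
  Write \<open>T\<close> for the tensor product. Its objects are \<open>((c, d), (e, w), h)\<close> with \<open>e \<in> E c\<close>, \<open>w \<in> W d\<close> and \<open>h : c \<rightarrow> d\<close>.

  A pseudo-natural transformation from \<open>W\<close> to \<open>Cat(E, A)\<close> is, uncurried, a balanced family (locale \<open>balanced\<close>):
  bifunctors \<open>M\<^sub>c : E c \<times> W c \<rightarrow> A\<close> with isomorphisms \<open>t\<^sub>f(e, w) : M\<^sub>d(E f e, w) \<rightarrow> M\<^sub>c(e, W f w)\<close> for \<open>f : c \<rightarrow> d\<close>, natural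
  in everything and compatible with identities and composites. Modifications are maps of balanced families. So
  \<open>T\<close> has to represent balanced families, and \<open>tensor_unit\<close> has to be the universal one.

  Universality comes from two arrows of \<open>\<Delta>\<close> that \<open>T\<close> inverts: from each object \<open>((c, d), (e, w), f)\<close>, \<open>Lar\<close> goes to
  \<open>((d, d), (E f e, w), 1)\<close> and \<open>Rar\<close> to \<open>((c, c), (e, W f w), 1)\<close>. The objects with \<open>h = 1\<close> are those in the image of the unit, the
  isomorphism \<open>t\<^sub>f\<close> of the unit is the span formed by \<open>Lar\<close> and \<open>Rar\<close>, and each law of a balanced family says that two
  spans can be compared by an arrow between their vertices (\<open>UVar_natural\<close>, \<open>UVar_2cell\<close>, \<open>UVar_Cmp1\<close>, giving
  \<open>unit_balanced\<close>).

  The same identities show that \<open>T\<close> is generated by the values of the unit on arrows and by \<open>Lar\<close> and \<open>Rar\<close>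
  (\<open>ar_factor\<close>, \<open>T_induct\<close>). A transformation between functors on \<open>T\<close> is hence determined by its restriction along the
  unit, and every map between the restrictions extends, by conjugation with the isomorphisms \<open>Lar\<close>. So restriction along
  the unit is fully faithful (\<open>induced_full_faithful\<close>).

  It is also surjective on objects, even strictly. A balanced family extends to \<open>T\<close> by
  \<open>((c, d), (e, w), h) \<mapsto> M\<^sub>d(E h e, w)\<close>. An arrow of \<open>\<Delta>\<close> over \<open>(p, q)\<close> is sent to a composite of three arrows: one in
  \<open>M\<^sub>d\<close> over an arrow \<open>E h e \<rightarrow> E q (E h' e')\<close> (\<open>sg\<close>), the isomorphism \<open>t\<^sub>q\<close>, and one in \<open>M\<^sub>d\<^sub>'\<close> coming from \<open>W\<close> (\<open>gval\<close>).
  Functoriality of \<open>sg\<close> is coherence of \<open>E\<close> (\<open>sg_Cmp1\<close>), and functoriality of the whole is coherence of \<open>t\<close>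
  (\<open>gval_Comp\<close>). Since pseudo-functors are normalized, the extension sends every \<open>Lar\<close> to an identity, so that its
  restriction along the unit is the given family on the nose (\<open>Gext_unit_cell\<close>). A fully faithful functor that is surjective on
  objects is an equivalence. It is not in general an isomorphism, because the objects with \<open>h \<noteq> 1\<close> are only isomorphic
  to objects in the image of the unit.
\<close>

section \<open>Categories in domain-codomain style\<close>

lemma hom_iff: "f \<in> hom C x y \<longleftrightarrow> f \<in> Arr C \<and> Dom C f = x \<and> Cod C f = y"
  by (auto simp: hom_def)

text \<open>
  Conditions on \<open>Dom\<close> and \<open>Cod\<close> instead of membership in hom-sets contain no variable that is absent from the left-hand
  side, so that rewriting can discharge them. All diagram chases below rely on this form.
\<close>

lemma cat_simps [simp]:
  assumes "category C"
  shows "f \<in> Arr C \<Longrightarrow> Dom C f \<in> Ob C"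
    and "f \<in> Arr C \<Longrightarrow> Cod C f \<in> Ob C"
    and "x \<in> Ob C \<Longrightarrow> Idt C x \<in> Arr C"
    and "x \<in> Ob C \<Longrightarrow> Dom C (Idt C x) = x"
    and "x \<in> Ob C \<Longrightarrow> Cod C (Idt C x) = x"
    and "f \<in> Arr C \<Longrightarrow> g \<in> Arr C \<Longrightarrow> Dom C g = Cod C f \<Longrightarrow> g \<cdot>\<^bsub>C\<^esub> f \<in> Arr C"
    and "f \<in> Arr C \<Longrightarrow> g \<in> Arr C \<Longrightarrow> Dom C g = Cod C f \<Longrightarrow> Dom C (g \<cdot>\<^bsub>C\<^esub> f) = Dom C f"
    and "f \<in> Arr C \<Longrightarrow> g \<in> Arr C \<Longrightarrow> Dom C g = Cod C f \<Longrightarrow> Cod C (g \<cdot>\<^bsub>C\<^esub> f) = Cod C g"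
    and "f \<in> Arr C \<Longrightarrow> Cod C f = y \<Longrightarrow> Idt C y \<cdot>\<^bsub>C\<^esub> f = f"
    and "f \<in> Arr C \<Longrightarrow> Dom C f = x \<Longrightarrow> f \<cdot>\<^bsub>C\<^esub> Idt C x = f"
    and "f \<in> Arr C \<Longrightarrow> g \<in> Arr C \<Longrightarrow> h \<in> Arr C \<Longrightarrow> Dom C g = Cod C f \<Longrightarrow> Dom C h = Cod C g \<Longrightarrow>
      (h \<cdot>\<^bsub>C\<^esub> g) \<cdot>\<^bsub>C\<^esub> f = h \<cdot>\<^bsub>C\<^esub> (g \<cdot>\<^bsub>C\<^esub> f)"
proof -
  interpret category C by fact
  show "f \<in> Arr C \<Longrightarrow> Dom C f \<in> Ob C" "f \<in> Arr C \<Longrightarrow> Cod C f \<in> Ob C"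
    using Dom_in_Ob Cod_in_Ob by auto
  show "x \<in> Ob C \<Longrightarrow> Idt C x \<in> Arr C" "x \<in> Ob C \<Longrightarrow> Dom C (Idt C x) = x"
    "x \<in> Ob C \<Longrightarrow> Cod C (Idt C x) = x"
    using Idt_hom[of x] by (auto simp: hom_iff)
  assume f: "f \<in> Arr C"
  show "Cod C f = y \<Longrightarrow> Idt C y \<cdot>\<^bsub>C\<^esub> f = f" "Dom C f = x \<Longrightarrow> f \<cdot>\<^bsub>C\<^esub> Idt C x = f"
    using Idt_left[of f "Dom C f" y] Idt_right[of f x "Cod C f"] f by (auto simp: hom_iff)
  assume g: "g \<in> Arr C" and fg: "Dom C g = Cod C f"
  show "g \<cdot>\<^bsub>C\<^esub> f \<in> Arr C" "Dom C (g \<cdot>\<^bsub>C\<^esub> f) = Dom C f" "Cod C (g \<cdot>\<^bsub>C\<^esub> f) = Cod C g"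
    using Comp_hom[of f "Dom C f" "Cod C f" g "Cod C g"] f g fg by (auto simp: hom_iff)
  assume h: "h \<in> Arr C" and gh: "Dom C h = Cod C g"
  show "(h \<cdot>\<^bsub>C\<^esub> g) \<cdot>\<^bsub>C\<^esub> f = h \<cdot>\<^bsub>C\<^esub> (g \<cdot>\<^bsub>C\<^esub> f)"
    using Comp_assoc[of f "Dom C f" "Cod C f" g "Cod C g" h "Cod C h"] f g h fg gh
    by (auto simp: hom_iff)
qed

lemma categoryI:
  assumes "\<And>f. f \<in> Arr C \<Longrightarrow> Dom C f \<in> Ob C \<and> Cod C f \<in> Ob C"
    and "\<And>x. x \<in> Ob C \<Longrightarrow> Idt C x \<in> Arr C \<and> Dom C (Idt C x) = x \<and> Cod C (Idt C x) = x"
    and "\<And>f g. f \<in> Arr C \<Longrightarrow> g \<in> Arr C \<Longrightarrow> Dom C g = Cod C f \<Longrightarrow>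
      g \<cdot>\<^bsub>C\<^esub> f \<in> Arr C \<and> Dom C (g \<cdot>\<^bsub>C\<^esub> f) = Dom C f \<and> Cod C (g \<cdot>\<^bsub>C\<^esub> f) = Cod C g"
    and "\<And>f. f \<in> Arr C \<Longrightarrow> Idt C (Cod C f) \<cdot>\<^bsub>C\<^esub> f = f \<and> f \<cdot>\<^bsub>C\<^esub> Idt C (Dom C f) = f"
    and "\<And>f g h. f \<in> Arr C \<Longrightarrow> g \<in> Arr C \<Longrightarrow> h \<in> Arr C \<Longrightarrow> Dom C g = Cod C f \<Longrightarrow> Dom C h = Cod C g \<Longrightarrow>
      (h \<cdot>\<^bsub>C\<^esub> g) \<cdot>\<^bsub>C\<^esub> f = h \<cdot>\<^bsub>C\<^esub> (g \<cdot>\<^bsub>C\<^esub> f)"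
  shows "category C"
  by (rule category.intro) (use assms in \<open>auto simp: hom_iff\<close>)

text \<open>Rewriting a composable pair at the head of a longer composite.\<close>

lemma Comp_reduce:
  assumes "b \<cdot>\<^bsub>C\<^esub> a = b' \<cdot>\<^bsub>C\<^esub> a'" "category C"
    and "a \<in> Arr C" "b \<in> Arr C" "Dom C b = Cod C a" "a' \<in> Arr C" "b' \<in> Arr C" "Dom C b' = Cod C a'"
    and "z \<in> Arr C" "Cod C z = Dom C a"
  shows "b \<cdot>\<^bsub>C\<^esub> (a \<cdot>\<^bsub>C\<^esub> z) = b' \<cdot>\<^bsub>C\<^esub> (a' \<cdot>\<^bsub>C\<^esub> z)"
proof -
  have d: "Dom C a' = Dom C a"
    using assms(1) cat_simps(7)[OF assms(2-5)] cat_simps(7)[OF assms(2) assms(6-8)] by simp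
  have "b \<cdot>\<^bsub>C\<^esub> (a \<cdot>\<^bsub>C\<^esub> z) = (b \<cdot>\<^bsub>C\<^esub> a) \<cdot>\<^bsub>C\<^esub> z"
    by (rule cat_simps(11)[symmetric]) (use assms in simp_all)
  also have "\<dots> = (b' \<cdot>\<^bsub>C\<^esub> a') \<cdot>\<^bsub>C\<^esub> z"
    by (simp only: assms(1))
  also have "\<dots> = b' \<cdot>\<^bsub>C\<^esub> (a' \<cdot>\<^bsub>C\<^esub> z)"
    using assms(2-) d by simp
  finally show ?thesis .
qed

subsection \<open>Isomorphisms\<close>

lemma inverse_arrows_iff: "inverse_arrows C f g \<longleftrightarrow> f \<in> Arr C \<and> g \<in> Arr C \<and> Dom C g = Cod C f \<and>
    Cod C g = Dom C f \<and> g \<cdot>\<^bsub>C\<^esub> f = Idt C (Dom C f) \<and> f \<cdot>\<^bsub>C\<^esub> g = Idt C (Cod C f)"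
  by (auto simp: inverse_arrows_def hom_iff)

lemma inverse_arrows_unique:
  assumes "category C" "inverse_arrows C f g" "inverse_arrows C f g'"
  shows "g = g'"
proof -
  have "g \<cdot>\<^bsub>C\<^esub> (f \<cdot>\<^bsub>C\<^esub> g') = (g \<cdot>\<^bsub>C\<^esub> f) \<cdot>\<^bsub>C\<^esub> g'"
    by (rule cat_simps(11)[symmetric]) (use assms in \<open>simp_all add: inverse_arrows_iff\<close>)
  then show ?thesis
    using assms by (simp add: inverse_arrows_iff)
qed

lemma inv_arrow_eq: "category C \<Longrightarrow> inverse_arrows C f g \<Longrightarrow> inv_arrow C f = g"
  unfolding inv_arrow_def by (rule the_equality) (auto intro: inverse_arrows_unique)

lemma is_isoI: "inverse_arrows C f g \<Longrightarrow> is_iso C f"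
  by (auto simp: is_iso_def)

lemma inverse_arrows_inv: "category C \<Longrightarrow> is_iso C f \<Longrightarrow> inverse_arrows C f (inv_arrow C f)"
  by (metis is_iso_def inv_arrow_eq)

lemma is_iso_Arr: "is_iso C f \<Longrightarrow> f \<in> Arr C"
  by (auto simp: is_iso_def inverse_arrows_iff)

lemma inv_arrow_simps [simp]:
  assumes "category C" "is_iso C f"
  shows "inv_arrow C f \<in> Arr C"
    and "Dom C (inv_arrow C f) = Cod C f"
    and "Cod C (inv_arrow C f) = Dom C f"
    and "inv_arrow C f \<cdot>\<^bsub>C\<^esub> f = Idt C (Dom C f)"
    and "f \<cdot>\<^bsub>C\<^esub> inv_arrow C f = Idt C (Cod C f)"
    and "is_iso C (inv_arrow C f)"
    and "z \<in> Arr C \<Longrightarrow> Cod C z = Dom C f \<Longrightarrow> inv_arrow C f \<cdot>\<^bsub>C\<^esub> (f \<cdot>\<^bsub>C\<^esub> z) = z"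
    and "z \<in> Arr C \<Longrightarrow> Cod C z = Cod C f \<Longrightarrow> f \<cdot>\<^bsub>C\<^esub> (inv_arrow C f \<cdot>\<^bsub>C\<^esub> z) = z"
    and "inv_arrow C (inv_arrow C f) = f"
proof -
  have *: "inverse_arrows C f (inv_arrow C f)"
    using assms by (rule inverse_arrows_inv)
  then have **: "inverse_arrows C (inv_arrow C f) f"
    by (simp add: inverse_arrows_iff)
  show "is_iso C (inv_arrow C f)" "inv_arrow C (inv_arrow C f) = f"
    using is_isoI[OF **] inv_arrow_eq[OF assms(1) **] by auto
  show "inv_arrow C f \<in> Arr C" "Dom C (inv_arrow C f) = Cod C f"
    "Cod C (inv_arrow C f) = Dom C f" "inv_arrow C f \<cdot>\<^bsub>C\<^esub> f = Idt C (Dom C f)"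
    "f \<cdot>\<^bsub>C\<^esub> inv_arrow C f = Idt C (Cod C f)"
    using * by (auto simp: inverse_arrows_iff)
  show "z \<in> Arr C \<Longrightarrow> Cod C z = Dom C f \<Longrightarrow> inv_arrow C f \<cdot>\<^bsub>C\<^esub> (f \<cdot>\<^bsub>C\<^esub> z) = z"
    "z \<in> Arr C \<Longrightarrow> Cod C z = Cod C f \<Longrightarrow> f \<cdot>\<^bsub>C\<^esub> (inv_arrow C f \<cdot>\<^bsub>C\<^esub> z) = z"
    using * assms(1) by (auto simp: inverse_arrows_iff cat_simps(11)[symmetric] simp del: cat_simps(11))
qed

lemma is_iso_Idt [simp]: "category C \<Longrightarrow> x \<in> Ob C \<Longrightarrow> is_iso C (Idt C x)"
  by (rule is_isoI[of _ _ "Idt C x"]) (simp add: inverse_arrows_iff)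

lemma inv_arrow_Idt [simp]: "category C \<Longrightarrow> x \<in> Ob C \<Longrightarrow> inv_arrow C (Idt C x) = Idt C x"
  by (rule inv_arrow_eq) (simp_all add: inverse_arrows_iff)

lemma inverse_arrows_Comp:
  assumes "category C" "is_iso C f" "is_iso C g" "Dom C g = Cod C f"
  shows "inverse_arrows C (g \<cdot>\<^bsub>C\<^esub> f) (inv_arrow C f \<cdot>\<^bsub>C\<^esub> inv_arrow C g)"
  using assms is_iso_Arr[OF assms(2)] is_iso_Arr[OF assms(3)] by (simp add: inverse_arrows_iff)

lemma is_iso_Comp [simp]:
  "category C \<Longrightarrow> is_iso C f \<Longrightarrow> is_iso C g \<Longrightarrow> Dom C g = Cod C f \<Longrightarrow> is_iso C (g \<cdot>\<^bsub>C\<^esub> f)"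
  by (rule is_isoI[OF inverse_arrows_Comp])

lemma iso_cancel_left:
  assumes "category C" "is_iso C f" "f \<cdot>\<^bsub>C\<^esub> a = f \<cdot>\<^bsub>C\<^esub> b"
    and "a \<in> Arr C" "b \<in> Arr C" "Cod C a = Dom C f" "Cod C b = Dom C f"
  shows "a = b"
  using assms by (metis inv_arrow_simps(7))

lemma iso_cancel_right:
  assumes "category C" "is_iso C f" "a \<cdot>\<^bsub>C\<^esub> f = b \<cdot>\<^bsub>C\<^esub> f"
    and "a \<in> Arr C" "b \<in> Arr C" "Dom C a = Cod C f" "Dom C b = Cod C f"
  shows "a = b"
proof -
  have "f \<in> Arr C" using assms(2) by (rule is_iso_Arr)
  then have "a = (a \<cdot>\<^bsub>C\<^esub> f) \<cdot>\<^bsub>C\<^esub> inv_arrow C f" "b = (b \<cdot>\<^bsub>C\<^esub> f) \<cdot>\<^bsub>C\<^esub> inv_arrow C f"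
    using assms(1,2,4-) by simp_all
  then show ?thesis using assms(3) by simp
qed

subsection \<open>Functors and natural transformations\<close>

lemma functorD:
  assumes "is_functor A B F"
  shows "FOb F \<in> extensional (Ob A)" "FArr F \<in> extensional (Arr A)"
    and "x \<in> Ob A \<Longrightarrow> FOb F x \<in> Ob B"
    and "f \<in> Arr A \<Longrightarrow> FArr F f \<in> Arr B"
    and "f \<in> Arr A \<Longrightarrow> Dom B (FArr F f) = FOb F (Dom A f)"
    and "f \<in> Arr A \<Longrightarrow> Cod B (FArr F f) = FOb F (Cod A f)"
    and "x \<in> Ob A \<Longrightarrow> FArr F (Idt A x) = Idt B (FOb F x)"
    and "f \<in> Arr A \<Longrightarrow> g \<in> Arr A \<Longrightarrow> Dom A g = Cod A f \<Longrightarrow>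
      FArr F (g \<cdot>\<^bsub>A\<^esub> f) = FArr F g \<cdot>\<^bsub>B\<^esub> FArr F f"
  using assms by (auto simp: is_functor_def hom_iff)

lemma functorI:
  assumes "FOb F \<in> extensional (Ob A)" "FArr F \<in> extensional (Arr A)"
    and "\<And>x. x \<in> Ob A \<Longrightarrow> FOb F x \<in> Ob B"
    and "\<And>f. f \<in> Arr A \<Longrightarrow> FArr F f \<in> Arr B"
    and "\<And>f. f \<in> Arr A \<Longrightarrow> Dom B (FArr F f) = FOb F (Dom A f)"
    and "\<And>f. f \<in> Arr A \<Longrightarrow> Cod B (FArr F f) = FOb F (Cod A f)"
    and "\<And>x. x \<in> Ob A \<Longrightarrow> FArr F (Idt A x) = Idt B (FOb F x)"
    and "\<And>f g. f \<in> Arr A \<Longrightarrow> g \<in> Arr A \<Longrightarrow> Dom A g = Cod A f \<Longrightarrow>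
      FArr F (g \<cdot>\<^bsub>A\<^esub> f) = FArr F g \<cdot>\<^bsub>B\<^esub> FArr F f"
  shows "is_functor A B F"
  using assms by (auto simp: is_functor_def hom_iff)

text \<open>Functors with different codomains may be compared, since a functor does not record its codomain.\<close>

lemma func_eqI:
  fixes F :: "('o, 'a, 'p, 'b) func"
  assumes "is_functor A B F" "is_functor A B' G"
    and "\<And>x. x \<in> Ob A \<Longrightarrow> FOb F x = FOb G x" "\<And>f. f \<in> Arr A \<Longrightarrow> FArr F f = FArr G f"
  shows "F = G"
proof -
  have "FOb F = FOb G" "FArr F = FArr G"
    using assms functorD(1,2)[OF assms(1)] functorD(1,2)[OF assms(2)] by (auto intro: extensionalityI)
  then show ?thesis by simp
qed

lemma is_functor_comp:
  assumes "category A" "is_functor A B F" "is_functor B C G"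
  shows "is_functor A C (comp_func A G F)"
  using assms functorD(3-)[OF assms(2)] functorD(3-)[OF assms(3)]
  by (intro functorI) (auto simp: comp_func_def compose_eq)

lemma comp_func_simps [simp]:
  "x \<in> Ob A \<Longrightarrow> FOb (comp_func A G F) x = FOb G (FOb F x)"
  "f \<in> Arr A \<Longrightarrow> FArr (comp_func A G F) f = FArr G (FArr F f)"
  by (auto simp: comp_func_def compose_eq)

lemma id_func_simps [simp]:
  "x \<in> Ob A \<Longrightarrow> FOb (id_func A) x = x" "f \<in> Arr A \<Longrightarrow> FArr (id_func A) f = f"
  by (auto simp: id_func_def)

lemma is_functor_id [simp]: "category A \<Longrightarrow> is_functor A A (id_func A)"
  by (rule functorI) (auto simp: id_func_def)

lemma inverse_arrows_functor:
  assumes "category A" "is_functor A B F" "inverse_arrows A f g"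
  shows "inverse_arrows B (FArr F f) (FArr F g)"
  using assms functorD(4-6)[OF assms(2)] functorD(7-8)[OF assms(2), symmetric]
  by (auto simp: inverse_arrows_iff)

lemma functor_iso:
  assumes "category A" "category B" "is_functor A B F" "is_iso A f"
  shows "is_iso B (FArr F f)" and "FArr F (inv_arrow A f) = inv_arrow B (FArr F f)"
proof -
  have *: "inverse_arrows B (FArr F f) (FArr F (inv_arrow A f))"
    by (rule inverse_arrows_functor[OF assms(1,3) inverse_arrows_inv[OF assms(1,4)]])
  show "is_iso B (FArr F f)" by (rule is_isoI[OF *])
  show "FArr F (inv_arrow A f) = inv_arrow B (FArr F f)"
    using inv_arrow_eq[OF assms(2) *] by simp
qed

lemma nat_transD:
  assumes "nat_trans A B F G \<eta>"
  shows "is_functor A B F" "is_functor A B G" "\<eta> \<in> extensional (Ob A)"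
    and "x \<in> Ob A \<Longrightarrow> \<eta> x \<in> Arr B" "x \<in> Ob A \<Longrightarrow> Dom B (\<eta> x) = FOb F x"
    and "x \<in> Ob A \<Longrightarrow> Cod B (\<eta> x) = FOb G x"
    and "f \<in> Arr A \<Longrightarrow> FArr G f \<cdot>\<^bsub>B\<^esub> \<eta> (Dom A f) = \<eta> (Cod A f) \<cdot>\<^bsub>B\<^esub> FArr F f"
  using assms by (auto simp: nat_trans_def hom_iff)

lemma nat_transI:
  assumes "is_functor A B F" "is_functor A B G" "\<eta> \<in> extensional (Ob A)"
    and "\<And>x. x \<in> Ob A \<Longrightarrow> \<eta> x \<in> Arr B \<and> Dom B (\<eta> x) = FOb F x \<and> Cod B (\<eta> x) = FOb G x"
    and "\<And>f. f \<in> Arr A \<Longrightarrow> FArr G f \<cdot>\<^bsub>B\<^esub> \<eta> (Dom A f) = \<eta> (Cod A f) \<cdot>\<^bsub>B\<^esub> FArr F f"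
  shows "nat_trans A B F G \<eta>"
  using assms by (auto simp: nat_trans_def hom_iff)

lemma functor_cat_simps [simp]:
  "Ob (functor_cat A B) = {F. is_functor A B F}"
  "(F, \<eta>, G) \<in> Arr (functor_cat A B) \<longleftrightarrow> nat_trans A B F G \<eta>"
  "Dom (functor_cat A B) (F, \<eta>, G) = F" "Cod (functor_cat A B) (F, \<eta>, G) = G"
  "Idt (functor_cat A B) F = (F, \<lambda>x \<in> Ob A. Idt B (FOb F x), F)"
  "(G', \<theta>, H) \<cdot>\<^bsub>functor_cat A B\<^esub> (F, \<eta>, G) = (F, \<lambda>x \<in> Ob A. \<theta> x \<cdot>\<^bsub>B\<^esub> \<eta> x, H)"
  by (auto simp: functor_cat_def)

lemma nat_trans_Idt:
  assumes "category A" "category B" "is_functor A B F"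
  shows "nat_trans A B F F (\<lambda>x \<in> Ob A. Idt B (FOb F x))"
  using assms functorD(3-6)[OF assms(3)] by (intro nat_transI) auto

lemma nat_trans_Comp:
  assumes "category A" "category B" "nat_trans A B F G \<eta>" "nat_trans A B G H \<theta>"
  shows "nat_trans A B F H (\<lambda>x \<in> Ob A. \<theta> x \<cdot>\<^bsub>B\<^esub> \<eta> x)"
proof (rule nat_transI)
  note F = nat_transD(1)[OF assms(3)] and G = nat_transD(1)[OF assms(4)]
    and H = nat_transD(2)[OF assms(4)]
  show "is_functor A B F" "is_functor A B H" by fact+
  show "(\<lambda>x \<in> Ob A. \<theta> x \<cdot>\<^bsub>B\<^esub> \<eta> x) \<in> extensional (Ob A)" by simp
  note s [simp] = nat_transD(4-6)[OF assms(3)] nat_transD(4-6)[OF assms(4)]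
    functorD(4-6)[OF F] functorD(4-6)[OF G] functorD(4-6)[OF H]
  show "\<And>x. x \<in> Ob A \<Longrightarrow> (\<lambda>x \<in> Ob A. \<theta> x \<cdot>\<^bsub>B\<^esub> \<eta> x) x \<in> Arr B \<and>
      Dom B ((\<lambda>x \<in> Ob A. \<theta> x \<cdot>\<^bsub>B\<^esub> \<eta> x) x) = FOb F x \<and> Cod B ((\<lambda>x \<in> Ob A. \<theta> x \<cdot>\<^bsub>B\<^esub> \<eta> x) x) = FOb H x"
    using assms(1,2) by simp
  fix f assume f: "f \<in> Arr A"
  have "FArr H f \<cdot>\<^bsub>B\<^esub> \<theta> (Dom A f) \<cdot>\<^bsub>B\<^esub> \<eta> (Dom A f) = \<theta> (Cod A f) \<cdot>\<^bsub>B\<^esub> FArr G f \<cdot>\<^bsub>B\<^esub> \<eta> (Dom A f)"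
    by (rule Comp_reduce[OF nat_transD(7)[OF assms(4) f]]) (use assms(1,2) f in simp_all)
  also have "\<dots> = \<theta> (Cod A f) \<cdot>\<^bsub>B\<^esub> \<eta> (Cod A f) \<cdot>\<^bsub>B\<^esub> FArr F f"
    using nat_transD(7)[OF assms(3) f] by simp
  finally show "FArr H f \<cdot>\<^bsub>B\<^esub> (\<lambda>x \<in> Ob A. \<theta> x \<cdot>\<^bsub>B\<^esub> \<eta> x) (Dom A f) =
      (\<lambda>x \<in> Ob A. \<theta> x \<cdot>\<^bsub>B\<^esub> \<eta> x) (Cod A f) \<cdot>\<^bsub>B\<^esub> FArr F f"
    using assms(1,2) f by simp
qed

lemma category_functor_cat [simp]:
  assumes "category A" "category B"
  shows "category (functor_cat A B)"
proof (rule categoryI)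
  fix f assume f: "f \<in> Arr (functor_cat A B)"
  then obtain F \<eta> G where f_eq: "f = (F, \<eta>, G)" and \<eta>: "nat_trans A B F G \<eta>"
    by (cases f) auto
  then show "Dom (functor_cat A B) f \<in> Ob (functor_cat A B) \<and> Cod (functor_cat A B) f \<in> Ob (functor_cat A B)"
    using nat_transD(1,2) by fastforce
  have "(\<lambda>x \<in> Ob A. Idt B (FOb G x) \<cdot>\<^bsub>B\<^esub> \<eta> x) = \<eta>" "(\<lambda>x \<in> Ob A. \<eta> x \<cdot>\<^bsub>B\<^esub> Idt B (FOb F x)) = \<eta>"
    using \<eta> nat_transD(3-6)[OF \<eta>] assms by (auto intro!: extensionalityI[where A = "Ob A"])
  then show "Idt (functor_cat A B) (Cod (functor_cat A B) f) \<cdot>\<^bsub>functor_cat A B\<^esub> f = f \<and>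
      f \<cdot>\<^bsub>functor_cat A B\<^esub> Idt (functor_cat A B) (Dom (functor_cat A B) f) = f"
    by (simp add: f_eq cong: restrict_cong)
  fix g assume g: "g \<in> Arr (functor_cat A B)" and gf: "Dom (functor_cat A B) g = Cod (functor_cat A B) f"
  then obtain \<theta> H where g_eq: "g = (G, \<theta>, H)" and \<theta>: "nat_trans A B G H \<theta>"
    by (cases g) (auto simp: f_eq)
  show "g \<cdot>\<^bsub>functor_cat A B\<^esub> f \<in> Arr (functor_cat A B) \<and>
      Dom (functor_cat A B) (g \<cdot>\<^bsub>functor_cat A B\<^esub> f) = Dom (functor_cat A B) f \<and>
      Cod (functor_cat A B) (g \<cdot>\<^bsub>functor_cat A B\<^esub> f) = Cod (functor_cat A B) g"
    using nat_trans_Comp[OF assms \<eta> \<theta>] by (simp add: f_eq g_eq)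
  fix h assume h: "h \<in> Arr (functor_cat A B)" and hg: "Dom (functor_cat A B) h = Cod (functor_cat A B) g"
  then obtain \<zeta> K where h_eq: "h = (H, \<zeta>, K)" and \<zeta>: "nat_trans A B H K \<zeta>"
    by (cases h) (auto simp: g_eq)
  show "(h \<cdot>\<^bsub>functor_cat A B\<^esub> g) \<cdot>\<^bsub>functor_cat A B\<^esub> f = h \<cdot>\<^bsub>functor_cat A B\<^esub> (g \<cdot>\<^bsub>functor_cat A B\<^esub> f)"
    using nat_transD(4-6)[OF \<eta>] nat_transD(4-6)[OF \<theta>] nat_transD(4-6)[OF \<zeta>] assms
    by (simp add: f_eq g_eq h_eq cong: restrict_cong)
next
  fix F assume "F \<in> Ob (functor_cat A B)"
  then show "Idt (functor_cat A B) F \<in> Arr (functor_cat A B) \<and>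
      Dom (functor_cat A B) (Idt (functor_cat A B) F) = F \<and>
      Cod (functor_cat A B) (Idt (functor_cat A B) F) = F"
    using nat_trans_Idt[OF assms] by simp
qed

lemma inverse_arrows_functor_cat:
  assumes "category A" "category B" "nat_trans A B F G \<eta>" "\<And>x. x \<in> Ob A \<Longrightarrow> is_iso B (\<eta> x)"
  shows "inverse_arrows (functor_cat A B) (F, \<eta>, G) (G, \<lambda>x \<in> Ob A. inv_arrow B (\<eta> x), F)"
proof -
  note F = nat_transD(1)[OF assms(3)] and G = nat_transD(2)[OF assms(3)]
  note s [simp] = nat_transD(4-6)[OF assms(3)] functorD(4-6)[OF F] functorD(4-6)[OF G]
  have "nat_trans A B G F (\<lambda>x \<in> Ob A. inv_arrow B (\<eta> x))"
  proof (rule nat_transI)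
    fix f assume f: "f \<in> Arr A"
    have "\<eta> (Cod A f) \<cdot>\<^bsub>B\<^esub> FArr F f \<cdot>\<^bsub>B\<^esub> inv_arrow B (\<eta> (Dom A f)) =
      FArr G f \<cdot>\<^bsub>B\<^esub> \<eta> (Dom A f) \<cdot>\<^bsub>B\<^esub> inv_arrow B (\<eta> (Dom A f))"
      by (rule Comp_reduce[OF nat_transD(7)[OF assms(3) f, symmetric]]) (use assms(1,2,4) f in simp_all)
    also have "\<dots> = \<eta> (Cod A f) \<cdot>\<^bsub>B\<^esub> inv_arrow B (\<eta> (Cod A f)) \<cdot>\<^bsub>B\<^esub> FArr G f"
      using assms f by simp
    finally have "FArr F f \<cdot>\<^bsub>B\<^esub> inv_arrow B (\<eta> (Dom A f)) = inv_arrow B (\<eta> (Cod A f)) \<cdot>\<^bsub>B\<^esub> FArr G f"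
      by (rule iso_cancel_left[rotated 2]) (use assms(1,2,4) f in simp_all)
    then show "FArr F f \<cdot>\<^bsub>B\<^esub> (\<lambda>x \<in> Ob A. inv_arrow B (\<eta> x)) (Dom A f) =
        (\<lambda>x \<in> Ob A. inv_arrow B (\<eta> x)) (Cod A f) \<cdot>\<^bsub>B\<^esub> FArr G f"
      using assms(1) f by simp
  qed (use F G assms in simp_all)
  then show ?thesis
    using assms by (simp add: inverse_arrows_iff cong: restrict_cong)
qed

lemma is_iso_functor_cat_iff:
  assumes "category A" "category B" "nat_trans A B F G \<eta>"
  shows "is_iso (functor_cat A B) (F, \<eta>, G) \<longleftrightarrow> (\<forall>x \<in> Ob A. is_iso B (\<eta> x))"
proof
  assume "\<forall>x \<in> Ob A. is_iso B (\<eta> x)"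
  then show "is_iso (functor_cat A B) (F, \<eta>, G)"
    by (intro inverse_arrows_functor_cat[OF assms, THEN is_isoI]) simp
next
  assume "is_iso (functor_cat A B) (F, \<eta>, G)"
  then obtain h where "inverse_arrows (functor_cat A B) (F, \<eta>, G) h"
    by (auto simp: is_iso_def)
  then obtain \<theta> where \<theta>: "nat_trans A B G F \<theta>" and
    1: "(\<lambda>x \<in> Ob A. \<theta> x \<cdot>\<^bsub>B\<^esub> \<eta> x) = (\<lambda>x \<in> Ob A. Idt B (FOb F x))" and
    2: "(\<lambda>x \<in> Ob A. \<eta> x \<cdot>\<^bsub>B\<^esub> \<theta> x) = (\<lambda>x \<in> Ob A. Idt B (FOb G x))"
    by (cases h) (auto simp: inverse_arrows_iff)
  show "\<forall>x \<in> Ob A. is_iso B (\<eta> x)"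
  proof
    fix x assume x: "x \<in> Ob A"
    show "is_iso B (\<eta> x)"
      by (rule is_isoI[of _ _ "\<theta> x"])
        (use x fun_cong[OF 1, of x] fun_cong[OF 2, of x] nat_transD(4-6)[OF assms(3)]
          nat_transD(4-6)[OF \<theta>] in \<open>simp add: inverse_arrows_iff\<close>)
  qed
qed

subsection \<open>A criterion for equivalences\<close>

text \<open>
  A fully faithful functor that is surjective on objects has a strict section, given by choosing
  preimages; the counit of the resulting equivalence is an identity.
\<close>

lemma is_equivalence_surjective_on_objects:
  assumes X: "category X" and Y: "category Y" and F: "is_functor X Y F"
    and surj: "\<And>y. y \<in> Ob Y \<Longrightarrow> \<exists>x \<in> Ob X. FOb F x = y"
    and full_faithful: "\<And>x x' g. x \<in> Ob X \<Longrightarrow> x' \<in> Ob X \<Longrightarrow> g \<in> hom Y (FOb F x) (FOb F x') \<Longrightarrow>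
      \<exists>!f. f \<in> hom X x x' \<and> FArr F f = g"
  shows "is_equivalence X Y F"
proof -
  note Fs [simp] = functorD(3-)[OF F]
  define s where "s y = (SOME x. x \<in> Ob X \<and> FOb F x = y)" for y
  have s [simp]: "s y \<in> Ob X" "FOb F (s y) = y" if "y \<in> Ob Y" for y
    using someI_ex[of "\<lambda>x. x \<in> Ob X \<and> FOb F x = y"] surj[OF that] by (auto simp: s_def)
  (* lift x x' g is the arrow from x to x' over g; full faithfulness provides and determines it *)
  define lift where "lift x x' g = (THE f. f \<in> hom X x x' \<and> FArr F f = g)" for x x' g
  have lift: "lift x x' g \<in> Arr X" "Dom X (lift x x' g) = x" "Cod X (lift x x' g) = x'"
      "FArr F (lift x x' g) = g"
    if "x \<in> Ob X" "x' \<in> Ob X" "g \<in> Arr Y" "Dom Y g = FOb F x" "Cod Y g = FOb F x'" for x x' g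
  proof -
    have "lift x x' g \<in> hom X x x' \<and> FArr F (lift x x' g) = g"
      unfolding lift_def by (rule theI'[OF full_faithful]) (use that in \<open>simp_all add: hom_iff\<close>)
    then show "lift x x' g \<in> Arr X" "Dom X (lift x x' g) = x" "Cod X (lift x x' g) = x'"
        "FArr F (lift x x' g) = g"
      by (auto simp: hom_iff)
  qed
  have faithful: "f = f'" if "f \<in> Arr X" "f' \<in> Arr X" "Dom X f = Dom X f'" "Cod X f = Cod X f'"
    "FArr F f = FArr F f'" for f f'
    using full_faithful[of "Dom X f" "Cod X f" "FArr F f"] that X by (auto simp: hom_iff)
  define G where "G = \<lparr>FOb = (\<lambda>y \<in> Ob Y. s y), FArr = (\<lambda>g \<in> Arr Y. lift (s (Dom Y g)) (s (Cod Y g)) g)\<rparr>"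
  have G: "is_functor Y X G"
    by (rule functorI) (use X Y in \<open>auto simp: G_def lift intro!: faithful\<close>)
  note Gs = functorD(3-)[OF G]
  have [simp]: "FOb G y = s y" if "y \<in> Ob Y" for y using that by (simp add: G_def)
  have [simp]: "FArr F (FArr G g) = g" if "g \<in> Arr Y" for g using that Y by (simp add: G_def lift)
  define \<eta> where "\<eta> = (\<lambda>x \<in> Ob X. lift x (s (FOb F x)) (Idt Y (FOb F x)))"
  have \<eta>: "\<eta> x \<in> Arr X" "Dom X (\<eta> x) = x" "Cod X (\<eta> x) = s (FOb F x)" "FArr F (\<eta> x) = Idt Y (FOb F x)"
    if "x \<in> Ob X" for x using that X Y by (simp_all add: \<eta>_def lift)
  have "nat_iso X X (id_func X) (comp_func X G F) \<eta>"
    unfolding nat_iso_def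
  proof (intro conjI ballI nat_transI)
    show "is_functor X X (id_func X)" using X by simp
    show "is_functor X X (comp_func X G F)" using X F G by (rule is_functor_comp)
    show "\<eta> \<in> extensional (Ob X)" by (simp add: \<eta>_def)
  next
    fix f assume f: "f \<in> Arr X"
    show "FArr (comp_func X G F) f \<cdot>\<^bsub>X\<^esub> \<eta> (Dom X f) = \<eta> (Cod X f) \<cdot>\<^bsub>X\<^esub> FArr (id_func X) f"
      by (rule faithful) (use X Y f in \<open>simp_all add: \<eta> Gs\<close>)
  next
    fix x assume x: "x \<in> Ob X"
    define \<zeta> where "\<zeta> = lift (s (FOb F x)) x (Idt Y (FOb F x))"
    have \<zeta>: "\<zeta> \<in> Arr X" "Dom X \<zeta> = s (FOb F x)" "Cod X \<zeta> = x" "FArr F \<zeta> = Idt Y (FOb F x)"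
      using x Y by (simp_all add: \<zeta>_def lift)
    have "\<zeta> \<cdot>\<^bsub>X\<^esub> \<eta> x = Idt X x"
      by (rule faithful) (use x X Y in \<open>simp_all add: \<eta> \<zeta>\<close>)
    moreover have "\<eta> x \<cdot>\<^bsub>X\<^esub> \<zeta> = Idt X (s (FOb F x))"
      by (rule faithful) (use x X Y in \<open>simp_all add: \<eta> \<zeta>\<close>)
    ultimately have "inverse_arrows X (\<eta> x) \<zeta>"
      using x by (simp add: inverse_arrows_iff \<eta> \<zeta>)
    then show "is_iso X (\<eta> x)" by (rule is_isoI)
  qed (use X in \<open>simp_all add: \<eta>\<close>)
  moreover have "nat_iso Y Y (comp_func Y F G) (id_func Y) (\<lambda>y \<in> Ob Y. Idt Y y)"
    unfolding nat_iso_def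
    by (intro conjI ballI nat_transI is_functor_comp[OF Y G F]) (use Y in simp_all)
  ultimately show ?thesis
    using F G unfolding is_equivalence_def by blast
qed

section \<open>Categories of fractions\<close>

lemma equiv_equiv_closure: "equiv A (equiv_closure A R)"
proof (rule equivI)
  have s: "sym ((R \<union> R\<inverse>)\<^sup>*)" by (intro sym_rtrancl) (auto simp: sym_def)
  show "sym (equiv_closure A R)"
    using s by (auto simp: equiv_closure_def sym_def)
  show "trans (equiv_closure A R)"
    by (auto simp: equiv_closure_def trans_def)
qed (auto simp: equiv_closure_def refl_on_def)

lemma equiv_closure_base: "(x, y) \<in> R \<Longrightarrow> x \<in> A \<Longrightarrow> y \<in> A \<Longrightarrow> (x, y) \<in> equiv_closure A R"
  by (auto simp: equiv_closure_def)

lemma equiv_closure_map: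
  assumes "(x, y) \<in> equiv_closure A R" "F x \<in> B" "F y \<in> B"
    and "\<And>x y. (x, y) \<in> R \<Longrightarrow> F x = F y \<or> (F x, F y) \<in> R'"
  shows "(F x, F y) \<in> equiv_closure B R'"
proof -
  have "(x, y) \<in> (R \<union> R\<inverse>)\<^sup>*" using assms(1) by (simp add: equiv_closure_def)
  then have "(F x, F y) \<in> (R' \<union> R'\<inverse>)\<^sup>*"
  proof induction
    case (step y z)
    then have "F y = F z \<or> (F y, F z) \<in> R' \<union> R'\<inverse>" using assms(4) by fastforce
    with step.IH show ?case by (metis rtrancl.rtrancl_into_rtrancl)
  qed simp
  with assms(2,3) show ?thesis by (simp add: equiv_closure_def)
qed

lemma equiv_closure_const:
  assumes "(x, y) \<in> equiv_closure A R" "\<And>x y. (x, y) \<in> R \<Longrightarrow> F x = F y"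
  shows "F x = F y"
proof -
  have "(x, y) \<in> (R \<union> R\<inverse>)\<^sup>*" using assms(1) by (simp add: equiv_closure_def)
  then show ?thesis by induction (use assms(2) in fastforce)+
qed

lemma the_elem_image_const: "A \<noteq> {} \<Longrightarrow> (\<And>x. x \<in> A \<Longrightarrow> f x = y) \<Longrightarrow> the_elem (f ` A) = y"
  by (metis (no_types, lifting) image_cong image_constant_conv the_elem_eq)

text \<open>
  Composition of fractions is concatenation of zigzags, so the laws of the localisation are those of lists. What \<open>C\<close> contributes
  is the typing of its operations.
\<close>

locale precategory =
  fixes C :: "('o, 'a) cat" (structure)
  assumes Dom_Ob: "f \<in> Arr C \<Longrightarrow> Dom C f \<in> Ob C"
    and Cod_Ob: "f \<in> Arr C \<Longrightarrow> Cod C f \<in> Ob C"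
    and Idt_typed: "x \<in> Ob C \<Longrightarrow> Idt C x \<in> Arr C \<and> Dom C (Idt C x) = x \<and> Cod C (Idt C x) = x"
    and Comp_typed: "f \<in> Arr C \<Longrightarrow> g \<in> Arr C \<Longrightarrow> Dom C g = Cod C f \<Longrightarrow>
      g \<cdot> f \<in> Arr C \<and> Dom C (g \<cdot> f) = Dom C f \<and> Cod C (g \<cdot> f) = Cod C g"

definition frac :: "('o, 'a) cat \<Rightarrow> 'a set \<Rightarrow> 'o \<Rightarrow> 'a step list \<Rightarrow> 'o \<Rightarrow> ('o \<times> 'a step list \<times> 'o) set" where
  "frac C S x p y = zz_rel C S `` {(x, p, y)}"

inductive_cases zigzag_NilE: "zigzag C S x [] y"
inductive_cases zigzag_FwdE: "zigzag C S x (Fwd a # p) y"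
inductive_cases zigzag_BwdE: "zigzag C S x (Bwd a # p) y"

lemma zigzag_simps [simp]:
  "zigzag C S x [] y \<longleftrightarrow> x = y \<and> x \<in> Ob C"
  "zigzag C S x (Fwd a # p) y \<longleftrightarrow> a \<in> Arr C \<and> x = Dom C a \<and> zigzag C S (Cod C a) p y"
  "zigzag C S x (Bwd a # p) y \<longleftrightarrow> a \<in> Arr C \<and> a \<in> S \<and> x = Cod C a \<and> zigzag C S (Dom C a) p y"
  by (auto intro: zigzag.intros elim: zigzag_NilE zigzag_FwdE zigzag_BwdE)

lemma zigzag_append:
  "zigzag C S x (p @ q) z \<longleftrightarrow> (\<exists>y. zigzag C S x p y \<and> zigzag C S y q z)" if "precategory C"
proof (induction p arbitrary: x)
  interpret precategory C by fact
  have "x \<in> Ob C" if "zigzag C S x q z" for x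
    using that by cases (auto simp: Dom_Ob Cod_Ob)
  then show "zigzag C S x ([] @ q) z \<longleftrightarrow> (\<exists>y. zigzag C S x [] y \<and> zigzag C S y q z)" for x
    by auto
next
  fix a p x
  assume "\<And>x. zigzag C S x (p @ q) z \<longleftrightarrow> (\<exists>y. zigzag C S x p y \<and> zigzag C S y q z)"
  then show "zigzag C S x ((a # p) @ q) z \<longleftrightarrow> (\<exists>y. zigzag C S x (a # p) y \<and> zigzag C S y q z)"
    by (cases a) auto
qed

locale localization = precategory C for C :: "('o, 'a) cat" (structure) +
  fixes S :: "'a set"
  assumes S_Arr: "S \<subseteq> Arr C"
begin

lemmas append = zigzag_append[OF precategory_axioms]

lemma zigzag_Ob: "zigzag C S x p y \<Longrightarrow> x \<in> Ob C \<and> y \<in> Ob C"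
  by (induction rule: zigzag.induct) (auto simp: Dom_Ob Cod_Ob)

lemma zz_rel_step:
  assumes "(p, q) \<in> zz_rules C S" "zigzag C S x (l @ p @ r) y" "zigzag C S x (l @ q @ r) y"
  shows "((x, l @ p @ r, y), (x, l @ q @ r, y)) \<in> zz_rel C S"
  unfolding zz_rel_def using assms by (intro equiv_closure_base) (auto simp: zigzags_def)

lemma zz_rel_rule:
  assumes "(p, q) \<in> zz_rules C S" "zigzag C S x p y" "zigzag C S x q y"
  shows "((x, p, y), (x, q, y)) \<in> zz_rel C S"
  using zz_rel_step[of p q x "[]" "[]" y] assms by simp

lemma equiv_zz_rel: "equiv (zigzags C S) (zz_rel C S)"
  unfolding zz_rel_def by (rule equiv_equiv_closure)

lemma zz_rel_zigzag: "((x, p, y), (x', q, y')) \<in> zz_rel C S \<Longrightarrow> zigzag C S x p y \<and> zigzag C S x' q y'"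
  using equiv_zz_rel by (auto simp: equiv_def zigzags_def)

lemma zz_rel_endpoints:
  assumes "((x, p, y), (x', q, y')) \<in> zz_rel C S"
  shows "x' = x \<and> y' = y"
proof -
  have "(case (x, p, y) of (x, p, y) \<Rightarrow> (x, y)) = (case (x', q, y') of (x, p, y) \<Rightarrow> (x, y))"
    by (rule equiv_closure_const[OF assms[unfolded zz_rel_def], where F = "\<lambda>(x, p, y). (x, y)"]) auto
  then show ?thesis by simp
qed

text \<open>A generating step already carries a context, so a further context can be put around a whole chain of steps.\<close>

lemma zz_rel_context:
  assumes pp': "((x, p, y), (x, p', y)) \<in> zz_rel C S" and "zigzag C S w l x" "zigzag C S y r z"
  shows "((w, l @ p @ r, z), (w, l @ p' @ r, z)) \<in> zz_rel C S"
proof -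
  (* the generating relation also relates zigzags with other endpoints; they are sent to a fixed zigzag *)
  define F where "F = (\<lambda>(x', s, y'). if x' = x \<and> y' = y then (w, l @ s @ r, z) else (w, l @ p @ r, z))"
  have zz: "zigzag C S w (l @ s @ r) z" if "zigzag C S x s y" for s
    using assms(2,3) that by (auto simp: append)
  have "(F (x, p, y), F (x, p', y)) \<in> zz_rel C S"
    unfolding zz_rel_def
  proof (rule equiv_closure_map[OF pp'[unfolded zz_rel_def]])
    show "F (x, p, y) \<in> zigzags C S" "F (x, p', y) \<in> zigzags C S"
      using zz_rel_zigzag[OF pp'] zz by (auto simp: F_def zigzags_def)
  next
    fix a b
    assume "(a, b) \<in> {((x, l @ p @ r, y), (x, l @ q @ r, y)) | x y l p q r.
        (p, q) \<in> zz_rules C S \<and> zigzag C S x (l @ p @ r) y \<and> zigzag C S x (l @ q @ r) y}"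
    then obtain x' y' l' s s' r' where a: "a = (x', l' @ s @ r', y')" and b: "b = (x', l' @ s' @ r', y')"
      and ss': "(s, s') \<in> zz_rules C S" "zigzag C S x' (l' @ s @ r') y'" "zigzag C S x' (l' @ s' @ r') y'"
      by blast
    show "F a = F b \<or> (F a, F b) \<in> {((x, l @ p @ r, y), (x, l @ q @ r, y)) | x y l p q r.
        (p, q) \<in> zz_rules C S \<and> zigzag C S x (l @ p @ r) y \<and> zigzag C S x (l @ q @ r) y}"
    proof (cases "x' = x \<and> y' = y")
      case True
      have "F a = (w, (l @ l') @ s @ r' @ r, z)" "F b = (w, (l @ l') @ s' @ r' @ r, z)"
        using True by (simp_all add: F_def a b)
      moreover have "zigzag C S w ((l @ l') @ s @ r' @ r) z" "zigzag C S w ((l @ l') @ s' @ r' @ r) z"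
        using zz[of "l' @ s @ r'"] zz[of "l' @ s' @ r'"] ss' True by simp_all
      ultimately show ?thesis using ss'(1) by blast
    qed (auto simp: F_def a b)
  qed
  then show ?thesis by (simp add: F_def)
qed

lemma zz_rel_append:
  assumes "((x, p, y), (x, p', y)) \<in> zz_rel C S" "((y, q, z), (y, q', z)) \<in> zz_rel C S"
  shows "((x, p @ q, z), (x, p' @ q', z)) \<in> zz_rel C S"
proof -
  have "((x, p @ q, z), (x, p' @ q, z)) \<in> zz_rel C S"
    using zz_rel_context[OF assms(1), of x "[]" q z] zz_rel_zigzag[OF assms(1)] zz_rel_zigzag[OF assms(2)]
      zigzag_Ob[of x p y] by auto
  moreover have "((x, p' @ q, z), (x, p' @ q', z)) \<in> zz_rel C S"
    using zz_rel_context[OF assms(2), of x p' "[]" z] zz_rel_zigzag[OF assms(1)] zz_rel_zigzag[OF assms(2)]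
      zigzag_Ob[of y q z] by auto
  ultimately show ?thesis
    using equiv_zz_rel by (meson equivE transD)
qed

lemma mem_frac: "(x', q, y') \<in> frac C S x p y \<longleftrightarrow> x' = x \<and> y' = y \<and> ((x, p, y), (x, q, y)) \<in> zz_rel C S"
  using zz_rel_endpoints unfolding frac_def by blast

lemma self_in_frac: "zigzag C S x p y \<Longrightarrow> (x, p, y) \<in> frac C S x p y"
  using equiv_zz_rel by (auto simp: frac_def equiv_def refl_on_def zigzags_def)

lemma frac_eqI: "((x, p, y), (x, q, y)) \<in> zz_rel C S \<Longrightarrow> frac C S x p y = frac C S x q y"
  unfolding frac_def by (rule equiv_class_eq[OF equiv_zz_rel])

lemma frac_Arr: "c \<in> Arr (fractions C S) \<longleftrightarrow> (\<exists>x p y. zigzag C S x p y \<and> c = frac C S x p y)"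
  by (auto simp: fractions_def frac_def zigzags_def quotient_def)

lemma frac_Comp:
  assumes "zigzag C S x p y" "zigzag C S y q z"
  shows "frac C S y q z \<cdot>\<^bsub>fractions C S\<^esub> frac C S x p y = frac C S x (p @ q) z"
proof -
  let ?M = "{(x, p @ q, z) | x p y' q z. (x, p, y') \<in> frac C S x p y \<and> (y', q, z) \<in> frac C S y q z}"
  have "zz_rel C S `` {(x1, p' @ q', z1) | x1 p' y1 q' z1. (x1, p', y1) \<in> frac C S x p y \<and> (y1, q', z1) \<in> frac C S y q z}
     = frac C S x (p @ q) z" (is "_ `` ?M = _")
  proof
    show "frac C S x (p @ q) z \<subseteq> zz_rel C S `` ?M"
      using self_in_frac[OF assms(1)] self_in_frac[OF assms(2)] unfolding frac_def[of C S x "p @ q"] by blast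
    have "((x, p @ q, z), m) \<in> zz_rel C S" if "m \<in> ?M" for m
      using that by (auto simp: mem_frac intro: zz_rel_append)
    moreover have "trans (zz_rel C S)" using equiv_zz_rel by (simp add: equiv_def)
    ultimately show "zz_rel C S `` ?M \<subseteq> frac C S x (p @ q) z"
      unfolding frac_def Image_def using transD by fast
  qed
  then show ?thesis by (simp add: fractions_def)
qed

lemma fractions_simps [simp]:
  shows "Ob (fractions C S) = Ob C"
    and "zigzag C S x p y \<Longrightarrow> frac C S x p y \<in> Arr (fractions C S)"
    and "zigzag C S x p y \<Longrightarrow> Dom (fractions C S) (frac C S x p y) = x"
    and "zigzag C S x p y \<Longrightarrow> Cod (fractions C S) (frac C S x p y) = y"
    and "Idt (fractions C S) x = frac C S x [] x"
proof -
  show "Ob (fractions C S) = Ob C" "Idt (fractions C S) x = frac C S x [] x"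
    by (simp_all add: fractions_def frac_def)
  assume p: "zigzag C S x p y"
  then show "frac C S x p y \<in> Arr (fractions C S)" by (auto simp: frac_Arr)
  have ne: "frac C S x p y \<noteq> {}" using self_in_frac[OF p] by auto
  show "Dom (fractions C S) (frac C S x p y) = x" "Cod (fractions C S) (frac C S x p y) = y"
    unfolding fractions_def cat.simps by (auto simp: mem_frac intro!: the_elem_image_const[OF ne])
qed

lemma category_fractions: "category (fractions C S)"
proof (rule categoryI)
  fix c assume "c \<in> Arr (fractions C S)"
  then obtain x p y where p: "zigzag C S x p y" and c: "c = frac C S x p y" by (auto simp: frac_Arr)
  have ob: "x \<in> Ob C" "y \<in> Ob C" using zigzag_Ob[OF p] by auto
  with p show "Dom (fractions C S) c \<in> Ob (fractions C S) \<and> Cod (fractions C S) c \<in> Ob (fractions C S)"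
    by (simp add: c)
  show "Idt (fractions C S) (Cod (fractions C S) c) \<cdot>\<^bsub>fractions C S\<^esub> c = c \<and>
      c \<cdot>\<^bsub>fractions C S\<^esub> Idt (fractions C S) (Dom (fractions C S) c) = c"
    using p ob frac_Comp[OF p, of "[]" y] frac_Comp[of x "[]" x p y] by (simp add: c)
  fix d assume "d \<in> Arr (fractions C S)" and dc: "Dom (fractions C S) d = Cod (fractions C S) c"
  then obtain q z where q: "zigzag C S y q z" and d: "d = frac C S y q z"
    using p by (auto simp: frac_Arr c)
  have pq: "zigzag C S x (p @ q) z" using p q by (auto simp: append)
  show "d \<cdot>\<^bsub>fractions C S\<^esub> c \<in> Arr (fractions C S) \<and>
      Dom (fractions C S) (d \<cdot>\<^bsub>fractions C S\<^esub> c) = Dom (fractions C S) c \<and>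
      Cod (fractions C S) (d \<cdot>\<^bsub>fractions C S\<^esub> c) = Cod (fractions C S) d"
    using p q pq by (simp add: c d frac_Comp)
  fix e assume "e \<in> Arr (fractions C S)" and "Dom (fractions C S) e = Cod (fractions C S) d"
  then obtain r u where r: "zigzag C S z r u" and e: "e = frac C S z r u"
    using q by (auto simp: frac_Arr d)
  have qr: "zigzag C S y (q @ r) u" using q r by (auto simp: append)
  show "(e \<cdot>\<^bsub>fractions C S\<^esub> d) \<cdot>\<^bsub>fractions C S\<^esub> c = e \<cdot>\<^bsub>fractions C S\<^esub> (d \<cdot>\<^bsub>fractions C S\<^esub> c)"
    using p q r pq qr by (simp add: c d e frac_Comp)
qed auto

lemma frac_Idt: "x \<in> Ob C \<Longrightarrow> frac C S (Dom C (Idt C x)) [Fwd (Idt C x)] (Cod C (Idt C x)) = frac C S x [] x"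
  using Idt_typed[of x] by (auto simp: zz_rules_def intro!: zz_rel_rule frac_eqI)

lemma frac_Fwd_Comp:
  assumes "a \<in> Arr C" "b \<in> Arr C" "Dom C b = Cod C a"
  shows "frac C S (Dom C b) [Fwd b] (Cod C b) \<cdot>\<^bsub>fractions C S\<^esub> frac C S (Dom C a) [Fwd a] (Cod C a) =
    frac C S (Dom C a) [Fwd (b \<cdot> a)] (Cod C b)"
proof -
  have "([Fwd a, Fwd b], [Fwd (b \<cdot> a)]) \<in> zz_rules C S"
    using assms by (auto simp: zz_rules_def)
  then have "frac C S (Dom C a) [Fwd a, Fwd b] (Cod C b) = frac C S (Dom C a) [Fwd (b \<cdot> a)] (Cod C b)"
    using assms Comp_typed[of a b] Cod_Ob by (intro frac_eqI zz_rel_rule) auto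
  then show ?thesis
    using assms frac_Comp[of "Dom C a" "[Fwd a]" "Cod C a" "[Fwd b]" "Cod C b"] Cod_Ob by simp
qed

lemma frac_inverse:
  assumes "s \<in> S"
  shows "inverse_arrows (fractions C S) (frac C S (Dom C s) [Fwd s] (Cod C s)) (frac C S (Cod C s) [Bwd s] (Dom C s))"
proof -
  have s: "s \<in> Arr C" "Dom C s \<in> Ob C" "Cod C s \<in> Ob C"
    using assms S_Arr by (auto simp: Dom_Ob Cod_Ob)
  have "frac C S (Dom C s) [Fwd s, Bwd s] (Dom C s) = frac C S (Dom C s) [] (Dom C s)"
    "frac C S (Cod C s) [Bwd s, Fwd s] (Cod C s) = frac C S (Cod C s) [] (Cod C s)"
    using s assms by (auto intro!: frac_eqI zz_rel_rule simp: zz_rules_def)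
  then show ?thesis
    using s assms frac_Comp[of "Dom C s" "[Fwd s]" "Cod C s" "[Bwd s]" "Dom C s"]
      frac_Comp[of "Cod C s" "[Bwd s]" "Dom C s" "[Fwd s]" "Cod C s"]
    by (simp add: inverse_arrows_iff)
qed

text \<open>Every zigzag is a composite of zigzags with one step.\<close>

lemma frac_induct:
  assumes "c \<in> Arr (fractions C S)"
    and "\<And>x. x \<in> Ob C \<Longrightarrow> P (frac C S x [] x)"
    and "\<And>a. a \<in> Arr C \<Longrightarrow> P (frac C S (Dom C a) [Fwd a] (Cod C a))"
    and "\<And>a. a \<in> S \<Longrightarrow> P (frac C S (Cod C a) [Bwd a] (Dom C a))"
    and "\<And>c d. c \<in> Arr (fractions C S) \<Longrightarrow> d \<in> Arr (fractions C S) \<Longrightarrow>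
      Dom (fractions C S) d = Cod (fractions C S) c \<Longrightarrow> P c \<Longrightarrow> P d \<Longrightarrow> P (d \<cdot>\<^bsub>fractions C S\<^esub> c)"
  shows "P c"
proof -
  obtain x p y where p: "zigzag C S x p y" and c: "c = frac C S x p y" using assms(1) by (auto simp: frac_Arr)
  show ?thesis
    unfolding c using p
  proof (induction rule: zigzag.induct)
    case (zz_Nil x) then show ?case by (rule assms(2))
  next
    case (zz_Fwd a p y)
    then show ?case
      using assms(3)[of a] assms(5)[of "frac C S (Dom C a) [Fwd a] (Cod C a)" "frac C S (Cod C a) p y"]
        frac_Comp[of "Dom C a" "[Fwd a]" "Cod C a" p y] by (simp add: Cod_Ob)
  next
    case (zz_Bwd a p y)
    then show ?case
      using assms(4)[of a] assms(5)[of "frac C S (Cod C a) [Bwd a] (Dom C a)" "frac C S (Dom C a) p y"]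
        frac_Comp[of "Cod C a" "[Bwd a]" "Dom C a" p y] by (simp add: Dom_Ob)
  qed
qed

end

subsection \<open>The universal property\<close>

fun zz_eval :: "('o, 'a) cat \<Rightarrow> ('p, 'b) cat \<Rightarrow> ('o \<Rightarrow> 'p) \<Rightarrow> ('a \<Rightarrow> 'b) \<Rightarrow> 'o \<Rightarrow> 'a step list \<Rightarrow> 'b" where
  "zz_eval C A Fo Fa x [] = Idt A (Fo x)"
| "zz_eval C A Fo Fa x (Fwd a # p) = zz_eval C A Fo Fa (Cod C a) p \<cdot>\<^bsub>A\<^esub> Fa a"
| "zz_eval C A Fo Fa x (Bwd a # p) = zz_eval C A Fo Fa (Dom C a) p \<cdot>\<^bsub>A\<^esub> inv_arrow A (Fa a)"

text \<open>\<open>Fo\<close> and \<open>Fa\<close> are a functor on \<open>C\<close> that inverts \<open>S\<close>; evaluating zigzags extends it to the category of fractions.\<close>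

locale localization_ext = localization C S + A: category A
  for C :: "('o, 'a) cat" (structure) and S and A :: "('p, 'b) cat" +
  fixes Fo :: "'o \<Rightarrow> 'p" and Fa :: "'a \<Rightarrow> 'b"
  assumes Fo_Ob: "x \<in> Ob C \<Longrightarrow> Fo x \<in> Ob A"
    and Fa_typed: "a \<in> Arr C \<Longrightarrow> Fa a \<in> Arr A \<and> Dom A (Fa a) = Fo (Dom C a) \<and> Cod A (Fa a) = Fo (Cod C a)"
    and Fa_Idt: "x \<in> Ob C \<Longrightarrow> Fa (Idt C x) = Idt A (Fo x)"
    and Fa_Comp: "a \<in> Arr C \<Longrightarrow> b \<in> Arr C \<Longrightarrow> Dom C b = Cod C a \<Longrightarrow> Fa (b \<cdot> a) = Fa b \<cdot>\<^bsub>A\<^esub> Fa a"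
    and Fa_iso: "s \<in> S \<Longrightarrow> is_iso A (Fa s)"
begin

abbreviation "ev \<equiv> zz_eval C A Fo Fa"

lemmas A_cat [simp] = A.category_axioms
lemmas typed [simp] = Fa_iso Fo_Ob Fa_typed[THEN conjunct1] Fa_typed[THEN conjunct2, THEN conjunct1]
  Fa_typed[THEN conjunct2, THEN conjunct2]

lemma ev_typed:
  "zigzag C S x p y \<Longrightarrow> ev x p \<in> Arr A \<and> Dom A (ev x p) = Fo x \<and> Cod A (ev x p) = Fo y"
  by (induction rule: zigzag.induct) auto

lemma ev_append: "zigzag C S x p y \<Longrightarrow> zigzag C S y q z \<Longrightarrow> ev x (p @ q) = ev y q \<cdot>\<^bsub>A\<^esub> ev x p"
proof (induction rule: zigzag.induct)
  case (zz_Nil x) then show ?case using ev_typed[of x q z] by simp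
next
  case (zz_Fwd a p y)
  then show ?case using ev_typed[of _ p y] ev_typed[of y q z] by simp
next
  case (zz_Bwd a p y)
  then show ?case using ev_typed[of _ p y] ev_typed[of y q z] by simp
qed

lemma ev_rule:
  assumes "(p, q) \<in> zz_rules C S" "zigzag C S x p y"
  shows "ev x p = ev x q \<and> zigzag C S x q y"
proof -
  consider (Idt) z where "z \<in> Ob C" "p = [Fwd (Idt C z)]" "q = []"
    | (Comp) a b where "a \<in> Arr C" "b \<in> Arr C" "Dom C b = Cod C a" "p = [Fwd a, Fwd b]" "q = [Fwd (b \<cdot> a)]"
    | (FB) s where "s \<in> S" "p = [Fwd s, Bwd s]" "q = []"
    | (BF) s where "s \<in> S" "p = [Bwd s, Fwd s]" "q = []"
    using assms(1) by (auto simp: zz_rules_def)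
  then show ?thesis
  proof cases
    case Idt then show ?thesis using assms(2) Idt_typed[of z] by (auto simp: Fa_Idt)
  next
    case Comp then show ?thesis using assms(2) Comp_typed[of a b] by (auto simp: Fa_Comp Cod_Ob)
  next
    case FB then show ?thesis using assms(2) S_Arr by (auto simp: Dom_Ob Cod_Ob)
  next
    case BF then show ?thesis using assms(2) S_Arr by (auto simp: Dom_Ob Cod_Ob)
  qed
qed

text \<open>Replacing a part of a zigzag by a part with the same value does not change the value of the zigzag.\<close>

lemma ev_zz_rel:
  assumes "((x, p, y), (x, q, y)) \<in> zz_rel C S"
  shows "ev x p = ev x q"
proof -
  have "(case (x, p, y) of (x, p, y) \<Rightarrow> ev x p) = (case (x, q, y) of (x, p, y) \<Rightarrow> ev x p)"
  proof (rule equiv_closure_const[OF assms[unfolded zz_rel_def], where F = "\<lambda>(x, p, y). ev x p"])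
    fix a b
    assume "(a, b) \<in> {((x, l @ p @ r, y), (x, l @ q @ r, y)) | x y l p q r.
        (p, q) \<in> zz_rules C S \<and> zigzag C S x (l @ p @ r) y \<and> zigzag C S x (l @ q @ r) y}"
    then obtain x y l p q r where a: "a = (x, l @ p @ r, y)" and b: "b = (x, l @ q @ r, y)"
      and pq: "(p, q) \<in> zz_rules C S" and z: "zigzag C S x (l @ p @ r) y"
      by blast
    from z obtain m n where lpr: "zigzag C S x l m" "zigzag C S m p n" "zigzag C S n r y"
      by (auto simp: append)
    have q: "ev m p = ev m q" "zigzag C S m q n" using ev_rule[OF pq lpr(2)] by auto
    have "ev x (l @ p @ r) = ev n r \<cdot>\<^bsub>A\<^esub> ev m p \<cdot>\<^bsub>A\<^esub> ev x l"
      using ev_append[OF lpr(1), of "p @ r" y] ev_append[OF lpr(2,3)] lpr(2,3)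
        ev_typed[OF lpr(1)] ev_typed[OF lpr(2)] ev_typed[OF lpr(3)]
      by (auto simp: append)
    moreover have "ev x (l @ q @ r) = ev n r \<cdot>\<^bsub>A\<^esub> ev m q \<cdot>\<^bsub>A\<^esub> ev x l"
      using ev_append[OF lpr(1), of "q @ r" y] ev_append[OF q(2) lpr(3)] lpr(3) q(2)
        ev_typed[OF lpr(1)] ev_typed[OF q(2)] ev_typed[OF lpr(3)]
      by (auto simp: append)
    ultimately show "(case a of (x, p, y) \<Rightarrow> ev x p) = (case b of (x, p, y) \<Rightarrow> ev x p)"
      using q by (simp add: a b)
  qed
  then show ?thesis by simp
qed

definition frac_ext :: "('o, ('o \<times> 'a step list \<times> 'o) set, 'p, 'b) func" where
  "frac_ext = \<lparr>FOb = (\<lambda>x \<in> Ob C. Fo x),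
     FArr = (\<lambda>c \<in> Arr (fractions C S). the_elem ((\<lambda>(x, p, y). ev x p) ` c))\<rparr>"

lemma frac_ext_frac:
  assumes "zigzag C S x p y"
  shows "FArr frac_ext (frac C S x p y) = ev x p"
proof -
  have "the_elem ((\<lambda>(x, p, y). ev x p) ` frac C S x p y) = ev x p"
  proof (rule the_elem_image_const)
    show "frac C S x p y \<noteq> {}" using self_in_frac[OF assms] by auto
    fix m assume "m \<in> frac C S x p y"
    then show "(case m of (x, p, y) \<Rightarrow> ev x p) = ev x p"
      by (cases m) (auto simp: mem_frac dest: ev_zz_rel)
  qed
  then show ?thesis using assms by (simp add: frac_ext_def)
qed

lemma frac_ext_functor: "is_functor (fractions C S) A frac_ext"
proof (rule functorI)
  fix c assume "c \<in> Arr (fractions C S)"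
  then obtain x p y where p: "zigzag C S x p y" and c: "c = frac C S x p y" by (auto simp: frac_Arr)
  have ob: "x \<in> Ob C" "y \<in> Ob C" using zigzag_Ob[OF p] by auto
  show "FArr frac_ext c \<in> Arr A" "Dom A (FArr frac_ext c) = FOb frac_ext (Dom (fractions C S) c)"
    "Cod A (FArr frac_ext c) = FOb frac_ext (Cod (fractions C S) c)"
    using p ob ev_typed[OF p] frac_ext_frac[OF p] by (simp_all add: c) (simp_all add: frac_ext_def)
  fix d assume "d \<in> Arr (fractions C S)" and dc: "Dom (fractions C S) d = Cod (fractions C S) c"
  then obtain q z where q: "zigzag C S y q z" and d: "d = frac C S y q z"
    using p by (auto simp: frac_Arr c)
  have "zigzag C S x (p @ q) z" using p q by (auto simp: append)
  then show "FArr frac_ext (d \<cdot>\<^bsub>fractions C S\<^esub> c) = FArr frac_ext d \<cdot>\<^bsub>A\<^esub> FArr frac_ext c"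
    using p q frac_ext_frac[of x "p @ q" z] frac_ext_frac[OF p] frac_ext_frac[OF q] ev_append[OF p q]
      by (simp add: c d frac_Comp)
next
  fix x assume "x \<in> Ob (fractions C S)"
  then show "FArr frac_ext (Idt (fractions C S) x) = Idt A (FOb frac_ext x)"
    using frac_ext_frac[of x "[]" x] by simp (simp add: frac_ext_def)
qed (auto simp: frac_ext_def)

end

section \<open>Localising a 2-category at a class of 1-cells\<close>

text \<open>
  Passing to connected components forgets which 2-cells connect two 1-cells. Of the 2-cells it is therefore
  enough to require that the ones needed to make composition of components well defined exist.
\<close>

locale pre_two_category =
  fixes D :: "('o, 'f, 't) two_cat" (structure) and S :: "'f set"
  assumes Src_Ob: "f \<in> Cell1 D \<Longrightarrow> Src D f \<in> Cell0 D"
    and Tgt_Ob: "f \<in> Cell1 D \<Longrightarrow> Tgt D f \<in> Cell0 D"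
    and Id1_typed: "x \<in> Cell0 D \<Longrightarrow> Id1 D x \<in> Cell1 D \<and> Src D (Id1 D x) = x \<and> Tgt D (Id1 D x) = x"
    and Cmp1_typed: "f \<in> Cell1 D \<Longrightarrow> g \<in> Cell1 D \<Longrightarrow> Src D g = Tgt D f \<Longrightarrow>
      g \<odot> f \<in> Cell1 D \<and> Src D (g \<odot> f) = Src D f \<and> Tgt D (g \<odot> f) = Tgt D g"
    and Cell2_typed: "\<alpha> \<in> Cell2 D \<Longrightarrow> Dom2 D \<alpha> \<in> Cell1 D \<and> Cod2 D \<alpha> \<in> Cell1 D \<and>
      Src D (Cod2 D \<alpha>) = Src D (Dom2 D \<alpha>) \<and> Tgt D (Cod2 D \<alpha>) = Tgt D (Dom2 D \<alpha>)"
    and ex_Id2: "f \<in> Cell1 D \<Longrightarrow> \<exists>\<alpha> \<in> Cell2 D. Dom2 D \<alpha> = f \<and> Cod2 D \<alpha> = f"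
    and ex_HComp: "\<alpha> \<in> Cell2 D \<Longrightarrow> \<beta> \<in> Cell2 D \<Longrightarrow> Src D (Dom2 D \<beta>) = Tgt D (Dom2 D \<alpha>) \<Longrightarrow>
      \<exists>\<gamma> \<in> Cell2 D. Dom2 D \<gamma> = Dom2 D \<beta> \<odot> Dom2 D \<alpha> \<and> Cod2 D \<gamma> = Cod2 D \<beta> \<odot> Cod2 D \<alpha>"
    and S_Cell1: "S \<subseteq> Cell1 D"
begin

definition cl :: "'f \<Rightarrow> 'f set" where
  "cl f = conn D `` {f}"

lemma conn_def': "conn D = equiv_closure (Cell1 D) {(f, g). \<exists>\<alpha> \<in> Cell2 D. Dom2 D \<alpha> = f \<and> Cod2 D \<alpha> = g}"
  by (simp add: conn_def hom_def vert_cat_def Bex_def)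

lemma equiv_conn: "equiv (Cell1 D) (conn D)"
  unfolding conn_def by (rule equiv_equiv_closure)

lemma conn_SrcTgt:
  assumes "(f, g) \<in> conn D"
  shows "Src D g = Src D f \<and> Tgt D g = Tgt D f"
proof -
  have "(Src D f, Tgt D f) = (Src D g, Tgt D g)"
    by (rule equiv_closure_const[OF assms[unfolded conn_def'], where F = "\<lambda>f. (Src D f, Tgt D f)"])
      (use Cell2_typed in auto)
  then show ?thesis by simp
qed

lemma conn_Cell1: "(f, g) \<in> conn D \<Longrightarrow> f \<in> Cell1 D \<and> g \<in> Cell1 D"
  using equiv_conn by (auto simp: equiv_def)

text \<open>
  A chain of 2-cells is whiskered step by step. The map \<open>F\<close> in the proof is constant on the 1-cells that cannot be composed
  with \<open>g\<close>, because the relation generating \<open>conn\<close> contains these, too.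
\<close>

lemma conn_whisker_left:
  assumes "(f, f') \<in> conn D" "g \<in> Cell1 D" "Src D g = Tgt D f"
  shows "(g \<odot> f, g \<odot> f') \<in> conn D"
proof -
  define F where "F h = (if Tgt D h = Src D g \<and> h \<in> Cell1 D then g \<odot> h else g \<odot> f)" for h
  note f' = conn_SrcTgt[OF assms(1)] conn_Cell1[OF assms(1)]
  have "(F f, F f') \<in> conn D"
    unfolding conn_def'
  proof (rule equiv_closure_map[OF assms(1)[unfolded conn_def']])
    show "F f \<in> Cell1 D" "F f' \<in> Cell1 D" using f' assms Cmp1_typed by (auto simp: F_def)
    fix h h' assume "(h, h') \<in> {(f, g). \<exists>\<alpha> \<in> Cell2 D. Dom2 D \<alpha> = f \<and> Cod2 D \<alpha> = g}"
    then obtain \<alpha> where \<alpha>: "\<alpha> \<in> Cell2 D" "Dom2 D \<alpha> = h" "Cod2 D \<alpha> = h'" by auto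
    obtain \<iota> where \<iota>: "\<iota> \<in> Cell2 D" "Dom2 D \<iota> = g" "Cod2 D \<iota> = g" using ex_Id2[OF assms(2)] by auto
    show "F h = F h' \<or> (F h, F h') \<in> {(f, g). \<exists>\<alpha> \<in> Cell2 D. Dom2 D \<alpha> = f \<and> Cod2 D \<alpha> = g}"
      using Cell2_typed[OF \<alpha>(1)] ex_HComp[OF \<alpha>(1) \<iota>(1)] \<alpha> \<iota> by (auto simp: F_def)
  qed
  then show ?thesis using f' assms by (simp add: F_def)
qed

lemma conn_whisker_right:
  assumes "(g, g') \<in> conn D" "f \<in> Cell1 D" "Src D g = Tgt D f"
  shows "(g \<odot> f, g' \<odot> f) \<in> conn D"
proof -
  define F where "F h = (if Src D h = Tgt D f \<and> h \<in> Cell1 D then h \<odot> f else g \<odot> f)" for h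
  note f' = conn_SrcTgt[OF assms(1)] conn_Cell1[OF assms(1)]
  have "(F g, F g') \<in> conn D"
    unfolding conn_def'
  proof (rule equiv_closure_map[OF assms(1)[unfolded conn_def']])
    show "F g \<in> Cell1 D" "F g' \<in> Cell1 D" using f' assms Cmp1_typed by (auto simp: F_def)
    fix h h' assume "(h, h') \<in> {(f, g). \<exists>\<alpha> \<in> Cell2 D. Dom2 D \<alpha> = f \<and> Cod2 D \<alpha> = g}"
    then obtain \<alpha> where \<alpha>: "\<alpha> \<in> Cell2 D" "Dom2 D \<alpha> = h" "Cod2 D \<alpha> = h'" by auto
    obtain \<iota> where \<iota>: "\<iota> \<in> Cell2 D" "Dom2 D \<iota> = f" "Cod2 D \<iota> = f" using ex_Id2[OF assms(2)] by auto
    show "F h = F h' \<or> (F h, F h') \<in> {(f, g). \<exists>\<alpha> \<in> Cell2 D. Dom2 D \<alpha> = f \<and> Cod2 D \<alpha> = g}"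
      using Cell2_typed[OF \<alpha>(1)] ex_HComp[OF \<iota>(1) \<alpha>(1)] \<alpha> \<iota> by (auto simp: F_def)
  qed
  then show ?thesis using f' assms by (simp add: F_def)
qed

lemma conn_Cmp1:
  assumes "(f, f') \<in> conn D" "(g, g') \<in> conn D" "Src D g = Tgt D f"
  shows "(g \<odot> f, g' \<odot> f') \<in> conn D"
  using conn_whisker_left[OF assms(1) _ assms(3)] conn_whisker_right[OF assms(2), of f']
    conn_SrcTgt[OF assms(1)] conn_Cell1[OF assms(1)] conn_Cell1[OF assms(2)] assms(3) equiv_conn
  by (metis equivE transD)

lemma mem_cl: "g \<in> cl f \<longleftrightarrow> (f, g) \<in> conn D"
  by (simp add: cl_def)

lemma self_in_cl: "f \<in> Cell1 D \<Longrightarrow> f \<in> cl f"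
  using equiv_conn by (simp add: mem_cl equiv_def refl_on_def)

lemma cl_eqI: "(f, g) \<in> conn D \<Longrightarrow> cl f = cl g"
  unfolding cl_def by (rule equiv_class_eq[OF equiv_conn])

lemma cl_2cell: "\<alpha> \<in> Cell2 D \<Longrightarrow> cl (Dom2 D \<alpha>) = cl (Cod2 D \<alpha>)"
  unfolding conn_def' by (intro cl_eqI) (use Cell2_typed in \<open>auto simp: conn_def' intro!: equiv_closure_base\<close>)

lemma pi0_simps [simp]:
  shows "Ob (pi0 D) = Cell0 D"
    and "Idt (pi0 D) x = cl (Id1 D x)"
    and "f \<in> Cell1 D \<Longrightarrow> cl f \<in> Arr (pi0 D)"
    and "f \<in> Cell1 D \<Longrightarrow> Dom (pi0 D) (cl f) = Src D f"
    and "f \<in> Cell1 D \<Longrightarrow> Cod (pi0 D) (cl f) = Tgt D f"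
proof -
  show "Ob (pi0 D) = Cell0 D" "Idt (pi0 D) x = cl (Id1 D x)" by (simp_all add: pi0_def cl_def)
  assume f: "f \<in> Cell1 D"
  then show "cl f \<in> Arr (pi0 D)" by (auto simp: pi0_def cl_def quotientI)
  have ne: "cl f \<noteq> {}" using self_in_cl[OF f] by auto
  show "Dom (pi0 D) (cl f) = Src D f" "Cod (pi0 D) (cl f) = Tgt D f"
    unfolding pi0_def cat.simps by (rule the_elem_image_const[OF ne]; simp add: mem_cl conn_SrcTgt)+
qed

lemma pi0_ArrE:
  assumes "c \<in> Arr (pi0 D)"
  obtains f where "f \<in> Cell1 D" "c = cl f"
  using assms by (auto simp: pi0_def cl_def quotient_def)

lemma pi0_Comp:
  assumes "f \<in> Cell1 D" "g \<in> Cell1 D" "Src D g = Tgt D f"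
  shows "cl g \<cdot>\<^bsub>pi0 D\<^esub> cl f = cl (g \<odot> f)"
proof -
  let ?M = "{g' \<odot> f' | g' f'. g' \<in> cl g \<and> f' \<in> cl f}"
  have "conn D `` ?M = cl (g \<odot> f)"
  proof
    show "cl (g \<odot> f) \<subseteq> conn D `` ?M"
      using self_in_cl[OF assms(1)] self_in_cl[OF assms(2)] unfolding cl_def[of "g \<odot> f"] by blast
    have "(g \<odot> f, m) \<in> conn D" if "m \<in> ?M" for m
      using that conn_Cmp1[OF _ _ assms(3)] by (auto simp: mem_cl)
    moreover have "trans (conn D)" using equiv_conn by (simp add: equiv_def)
    ultimately show "conn D `` ?M \<subseteq> cl (g \<odot> f)"
      unfolding cl_def[of "g \<odot> f"] Image_def using transD by fast
  qed
  then show ?thesis by (simp add: pi0_def)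
qed

sublocale localization "pi0 D" "cl ` S"
proof
  fix c assume "c \<in> Arr (pi0 D)"
  then obtain f where f: "f \<in> Cell1 D" "c = cl f" by (rule pi0_ArrE)
  then show "Dom (pi0 D) c \<in> Ob (pi0 D)" "Cod (pi0 D) c \<in> Ob (pi0 D)"
    by (simp_all add: Src_Ob Tgt_Ob)
  fix d assume "d \<in> Arr (pi0 D)" and dc: "Dom (pi0 D) d = Cod (pi0 D) c"
  then obtain g where g: "g \<in> Cell1 D" "d = cl g" by (auto elim: pi0_ArrE)
  show "d \<cdot>\<^bsub>pi0 D\<^esub> c \<in> Arr (pi0 D) \<and> Dom (pi0 D) (d \<cdot>\<^bsub>pi0 D\<^esub> c) = Dom (pi0 D) c \<and>
      Cod (pi0 D) (d \<cdot>\<^bsub>pi0 D\<^esub> c) = Cod (pi0 D) d"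
    using f g dc Cmp1_typed[of f g] by (simp add: pi0_Comp)
qed (use Id1_typed S_Cell1 in auto)

abbreviation loc :: "('o, ('o \<times> 'f set step list \<times> 'o) set) cat" where
  "loc \<equiv> fractions (pi0 D) (cl ` S)"

lemmas category_loc [simp] = category_fractions

text \<open>The localisation functor on 1-cells.\<close>

definition ar :: "'f \<Rightarrow> ('o \<times> 'f set step list \<times> 'o) set" where
  "ar f = frac (pi0 D) (cl ` S) (Src D f) [Fwd (cl f)] (Tgt D f)"

lemma ar_simps [simp]:
  "f \<in> Cell1 D \<Longrightarrow> ar f \<in> Arr loc" "f \<in> Cell1 D \<Longrightarrow> Dom loc (ar f) = Src D f"
  "f \<in> Cell1 D \<Longrightarrow> Cod loc (ar f) = Tgt D f"
  by (simp_all add: ar_def Tgt_Ob)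

lemma ar_Id1: "x \<in> Cell0 D \<Longrightarrow> ar (Id1 D x) = Idt loc x"
  using frac_Idt[of x] Id1_typed[of x] by (simp add: ar_def)

lemma ar_Cmp1: "f \<in> Cell1 D \<Longrightarrow> g \<in> Cell1 D \<Longrightarrow> Src D g = Tgt D f \<Longrightarrow> ar (g \<odot> f) = ar g \<cdot>\<^bsub>loc\<^esub> ar f"
  using frac_Fwd_Comp[of "cl f" "cl g"] Cmp1_typed[of f g] by (simp add: ar_def pi0_Comp)

lemma ar_2cell: "\<alpha> \<in> Cell2 D \<Longrightarrow> ar (Dom2 D \<alpha>) = ar (Cod2 D \<alpha>)"
  using Cell2_typed[of \<alpha>] cl_2cell[of \<alpha>] by (simp add: ar_def)

lemma inverse_arrows_ar:
  "s \<in> S \<Longrightarrow> inverse_arrows loc (ar s) (frac (pi0 D) (cl ` S) (Tgt D s) [Bwd (cl s)] (Src D s))"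
  using frac_inverse[of "cl s"] S_Cell1 by (auto simp: ar_def)

lemma ar_iso [simp]: "s \<in> S \<Longrightarrow> is_iso loc (ar s)"
  using inverse_arrows_ar by (rule is_isoI)

text \<open>The structural isomorphisms of the unit are zigzags of this shape.\<close>

lemma frac_Bwd_Fwd:
  assumes "s \<in> S" "f \<in> Cell1 D" "Src D f = Src D s"
  shows "frac (pi0 D) (cl ` S) (Tgt D s) [Bwd (cl s), Fwd (cl f)] (Tgt D f) = ar f \<cdot>\<^bsub>loc\<^esub> inv_arrow loc (ar s)"
  using inv_arrow_eq[OF category_loc inverse_arrows_ar[OF assms(1)]] assms S_Cell1
    frac_Comp[of "Tgt D s" "[Bwd (cl s)]" "Src D s" "[Fwd (cl f)]" "Tgt D f"]
  by (auto simp: ar_def Src_Ob Tgt_Ob subset_iff)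

lemma loc_induct:
  assumes "c \<in> Arr loc"
    and ar: "\<And>f. f \<in> Cell1 D \<Longrightarrow> P (ar f)"
    and inv: "\<And>s. s \<in> S \<Longrightarrow> P (inv_arrow loc (ar s))"
    and comp: "\<And>c d. c \<in> Arr loc \<Longrightarrow> d \<in> Arr loc \<Longrightarrow> Dom loc d = Cod loc c \<Longrightarrow> P c \<Longrightarrow> P d \<Longrightarrow> P (d \<cdot>\<^bsub>loc\<^esub> c)"
  shows "P c"
  using assms(1)
proof (induction rule: frac_induct[consumes 1])
  case (1 x)
  then show ?case using ar[of "Id1 D x"] ar_Id1[of x] Id1_typed[of x] by simp
next
  case (2 a)
  then show ?case using ar by (auto simp: ar_def elim!: pi0_ArrE)
next
  case (3 a)
  then obtain s where s: "s \<in> S" "a = cl s" by auto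
  then show ?case
    using inv[of s] inv_arrow_eq[OF category_loc inverse_arrows_ar[OF s(1)]] S_Cell1 by auto
next
  case (4 c d)
  then show ?case by (intro comp)
qed

end

text \<open>
  \<open>Go\<close> and \<open>Ga\<close> are a functor on the underlying category of \<open>D\<close> that identifies 1-cells connected by a 2-cell and inverts
  \<open>S\<close>, that is, exactly what the localisation classifies.
\<close>

locale pre_two_category_ext = pre_two_category D S + A: category A
  for D :: "('o, 'f, 't) two_cat" (structure) and S and A :: "('p, 'b) cat" +
  fixes Go :: "'o \<Rightarrow> 'p" and Ga :: "'f \<Rightarrow> 'b"
  assumes Go_Ob: "x \<in> Cell0 D \<Longrightarrow> Go x \<in> Ob A"
    and Ga_typed: "f \<in> Cell1 D \<Longrightarrow> Ga f \<in> Arr A \<and> Dom A (Ga f) = Go (Src D f) \<and> Cod A (Ga f) = Go (Tgt D f)"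
    and Ga_Id1: "x \<in> Cell0 D \<Longrightarrow> Ga (Id1 D x) = Idt A (Go x)"
    and Ga_Cmp1: "f \<in> Cell1 D \<Longrightarrow> g \<in> Cell1 D \<Longrightarrow> Src D g = Tgt D f \<Longrightarrow> Ga (g \<odot> f) = Ga g \<cdot>\<^bsub>A\<^esub> Ga f"
    and Ga_2cell: "\<alpha> \<in> Cell2 D \<Longrightarrow> Ga (Dom2 D \<alpha>) = Ga (Cod2 D \<alpha>)"
    and Ga_iso: "s \<in> S \<Longrightarrow> is_iso A (Ga s)"
begin

definition Gcl :: "'f set \<Rightarrow> 'b" where
  "Gcl c = the_elem (Ga ` c)"

lemma Gcl: "f \<in> Cell1 D \<Longrightarrow> Gcl (cl f) = Ga f"
  unfolding Gcl_def
proof (rule the_elem_image_const)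
  fix g assume "g \<in> cl f"
  then have "(f, g) \<in> conn D" by (simp add: mem_cl)
  then show "Ga g = Ga f"
    unfolding conn_def' by (rule equiv_closure_const[symmetric]) (use Ga_2cell in auto)
qed (use self_in_cl in auto)

sublocale ext: localization_ext "pi0 D" "cl ` S" A Go Gcl
proof
  fix a assume "a \<in> Arr (pi0 D)"
  then obtain f where f: "f \<in> Cell1 D" "a = cl f" by (rule pi0_ArrE)
  then show "Gcl a \<in> Arr A \<and> Dom A (Gcl a) = Go (Dom (pi0 D) a) \<and> Cod A (Gcl a) = Go (Cod (pi0 D) a)"
    using Ga_typed[of f] by (simp add: Gcl)
  fix b assume "b \<in> Arr (pi0 D)" "Dom (pi0 D) b = Cod (pi0 D) a"
  then obtain g where g: "g \<in> Cell1 D" "b = cl g" "Src D g = Tgt D f" using f by (auto elim!: pi0_ArrE)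
  then show "Gcl (b \<cdot>\<^bsub>pi0 D\<^esub> a) = Gcl b \<cdot>\<^bsub>A\<^esub> Gcl a"
    using f Cmp1_typed[of f g] by (simp add: pi0_Comp Gcl Ga_Cmp1)
next
  fix s assume "s \<in> cl ` S"
  then show "is_iso A (Gcl s)" using S_Cell1 Ga_iso by (auto simp: Gcl subset_iff)
qed (use Go_Ob Id1_typed in \<open>auto simp: Gcl Ga_Id1\<close>)

definition "loc_ext = ext.frac_ext"

lemma loc_ext_functor: "is_functor loc A loc_ext"
  unfolding loc_ext_def by (rule ext.frac_ext_functor)

lemma loc_ext_FOb: "x \<in> Cell0 D \<Longrightarrow> FOb loc_ext x = Go x"
  by (simp add: loc_ext_def ext.frac_ext_def)

lemma loc_ext_ar: "f \<in> Cell1 D \<Longrightarrow> FArr loc_ext (ar f) = Ga f"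
  using ext.frac_ext_frac[of "Src D f" "[Fwd (cl f)]" "Tgt D f"] Ga_typed[of f]
  by (simp add: loc_ext_def ar_def Gcl Tgt_Ob)

end

section \<open>2-categories and pseudo-functors in domain-codomain style\<close>

context two_category
begin

lemma cells1_simps [simp]:
  shows "f \<in> Cell1 K \<Longrightarrow> Src K f \<in> Cell0 K" "f \<in> Cell1 K \<Longrightarrow> Tgt K f \<in> Cell0 K"
    and "c \<in> Cell0 K \<Longrightarrow> Id1 K c \<in> Cell1 K" "c \<in> Cell0 K \<Longrightarrow> Src K (Id1 K c) = c"
      "c \<in> Cell0 K \<Longrightarrow> Tgt K (Id1 K c) = c"
    and "f \<in> Cell1 K \<Longrightarrow> g \<in> Cell1 K \<Longrightarrow> Src K g = Tgt K f \<Longrightarrow> g \<odot> f \<in> Cell1 K"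
    and "f \<in> Cell1 K \<Longrightarrow> g \<in> Cell1 K \<Longrightarrow> Src K g = Tgt K f \<Longrightarrow> Src K (g \<odot> f) = Src K f"
    and "f \<in> Cell1 K \<Longrightarrow> g \<in> Cell1 K \<Longrightarrow> Src K g = Tgt K f \<Longrightarrow> Tgt K (g \<odot> f) = Tgt K g"
    and "f \<in> Cell1 K \<Longrightarrow> Tgt K f = d \<Longrightarrow> Id1 K d \<odot> f = f" "f \<in> Cell1 K \<Longrightarrow> Src K f = c \<Longrightarrow> f \<odot> Id1 K c = f"
    and "f \<in> Cell1 K \<Longrightarrow> g \<in> Cell1 K \<Longrightarrow> h \<in> Cell1 K \<Longrightarrow> Src K g = Tgt K f \<Longrightarrow> Src K h = Tgt K g \<Longrightarrow>
      (h \<odot> g) \<odot> f = h \<odot> (g \<odot> f)"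
  using cat_simps[OF category_cells1] by (simp_all add: cells1_def)

lemma vert_simps [simp]:
  shows "\<alpha> \<in> Cell2 K \<Longrightarrow> Dom2 K \<alpha> \<in> Cell1 K" "\<alpha> \<in> Cell2 K \<Longrightarrow> Cod2 K \<alpha> \<in> Cell1 K"
    and "f \<in> Cell1 K \<Longrightarrow> Id2 K f \<in> Cell2 K" "f \<in> Cell1 K \<Longrightarrow> Dom2 K (Id2 K f) = f"
      "f \<in> Cell1 K \<Longrightarrow> Cod2 K (Id2 K f) = f"
    and "\<alpha> \<in> Cell2 K \<Longrightarrow> \<beta> \<in> Cell2 K \<Longrightarrow> Dom2 K \<beta> = Cod2 K \<alpha> \<Longrightarrow> \<beta> \<bullet> \<alpha> \<in> Cell2 K"
    and "\<alpha> \<in> Cell2 K \<Longrightarrow> \<beta> \<in> Cell2 K \<Longrightarrow> Dom2 K \<beta> = Cod2 K \<alpha> \<Longrightarrow> Dom2 K (\<beta> \<bullet> \<alpha>) = Dom2 K \<alpha>"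
    and "\<alpha> \<in> Cell2 K \<Longrightarrow> \<beta> \<in> Cell2 K \<Longrightarrow> Dom2 K \<beta> = Cod2 K \<alpha> \<Longrightarrow> Cod2 K (\<beta> \<bullet> \<alpha>) = Cod2 K \<beta>"
    and "\<alpha> \<in> Cell2 K \<Longrightarrow> Cod2 K \<alpha> = g \<Longrightarrow> Id2 K g \<bullet> \<alpha> = \<alpha>" "\<alpha> \<in> Cell2 K \<Longrightarrow> Dom2 K \<alpha> = f \<Longrightarrow> \<alpha> \<bullet> Id2 K f = \<alpha>"
    and "\<alpha> \<in> Cell2 K \<Longrightarrow> \<beta> \<in> Cell2 K \<Longrightarrow> \<gamma> \<in> Cell2 K \<Longrightarrow> Dom2 K \<beta> = Cod2 K \<alpha> \<Longrightarrow> Dom2 K \<gamma> = Cod2 K \<beta> \<Longrightarrow>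
      (\<gamma> \<bullet> \<beta>) \<bullet> \<alpha> = \<gamma> \<bullet> (\<beta> \<bullet> \<alpha>)"
  using cat_simps[OF category_vert] by (simp_all add: vert_cat_def)

lemma horiz_simps [simp]:
  shows "\<alpha> \<in> Cell2 K \<Longrightarrow> Src K (Cod2 K \<alpha>) = Src K (Dom2 K \<alpha>)" "\<alpha> \<in> Cell2 K \<Longrightarrow> Tgt K (Cod2 K \<alpha>) = Tgt K (Dom2 K \<alpha>)"
    and "\<alpha> \<in> Cell2 K \<Longrightarrow> \<beta> \<in> Cell2 K \<Longrightarrow> Src K (Dom2 K \<beta>) = Tgt K (Dom2 K \<alpha>) \<Longrightarrow> \<beta> \<star> \<alpha> \<in> Cell2 K"
    and "\<alpha> \<in> Cell2 K \<Longrightarrow> \<beta> \<in> Cell2 K \<Longrightarrow> Src K (Dom2 K \<beta>) = Tgt K (Dom2 K \<alpha>) \<Longrightarrow> Dom2 K (\<beta> \<star> \<alpha>) = Dom2 K \<beta> \<odot> Dom2 K \<alpha>"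
    and "\<alpha> \<in> Cell2 K \<Longrightarrow> \<beta> \<in> Cell2 K \<Longrightarrow> Src K (Dom2 K \<beta>) = Tgt K (Dom2 K \<alpha>) \<Longrightarrow> Cod2 K (\<beta> \<star> \<alpha>) = Cod2 K \<beta> \<odot> Cod2 K \<alpha>"
    and "\<alpha> \<in> Cell2 K \<Longrightarrow> Tgt K (Dom2 K \<alpha>) = d \<Longrightarrow> Id2 K (Id1 K d) \<star> \<alpha> = \<alpha>"
      "\<alpha> \<in> Cell2 K \<Longrightarrow> Src K (Dom2 K \<alpha>) = c \<Longrightarrow> \<alpha> \<star> Id2 K (Id1 K c) = \<alpha>"
    and "\<alpha> \<in> Cell2 K \<Longrightarrow> \<beta> \<in> Cell2 K \<Longrightarrow> \<gamma> \<in> Cell2 K \<Longrightarrow> Src K (Dom2 K \<beta>) = Tgt K (Dom2 K \<alpha>) \<Longrightarrow>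
      Src K (Dom2 K \<gamma>) = Tgt K (Dom2 K \<beta>) \<Longrightarrow> (\<gamma> \<star> \<beta>) \<star> \<alpha> = \<gamma> \<star> (\<beta> \<star> \<alpha>)"
    and "f \<in> Cell1 K \<Longrightarrow> g \<in> Cell1 K \<Longrightarrow> Src K g = Tgt K f \<Longrightarrow> Id2 K g \<star> Id2 K f = Id2 K (g \<odot> f)"
  using cat_simps[OF category_horiz] by (simp_all add: horiz_cat_def Src_Cod2 Tgt_Cod2 Dom2_HComp Cod2_HComp HComp_Id2)

end

lemma hom_cells1 [simp]: "f \<in> hom (cells1 K) k l \<longleftrightarrow> f \<in> Cell1 K \<and> Src K f = k \<and> Tgt K f = l"
  by (auto simp: hom_def cells1_def)

lemma hom_vert_cat [simp]: "\<alpha> \<in> hom (vert_cat K) f g \<longleftrightarrow> \<alpha> \<in> Cell2 K \<and> Dom2 K \<alpha> = f \<and> Cod2 K \<alpha> = g"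
  by (auto simp: hom_def vert_cat_def)

lemma op2_simps [simp]:
  "Cell0 (op2 K) = Cell0 K" "Cell1 (op2 K) = Cell1 K" "Src (op2 K) = Tgt K" "Tgt (op2 K) = Src K"
  "Id1 (op2 K) = Id1 K" "Cmp1 (op2 K) g f = Cmp1 K f g" "Cell2 (op2 K) = Cell2 K" "Dom2 (op2 K) = Dom2 K"
  "Cod2 (op2 K) = Cod2 K" "Id2 (op2 K) = Id2 K" "VComp (op2 K) = VComp K" "HComp (op2 K) \<beta> \<alpha> = HComp K \<alpha> \<beta>"
  by (simp_all add: op2_def)

context pseudo_functor
begin

lemma Ps0_cat: "k \<in> Cell0 K \<Longrightarrow> category (Ps0 Q k)"
  by (rule Ps0_category)

lemma Ps1_simps:
  assumes "f \<in> Cell1 K"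
  shows "X \<in> Ob (Ps0 Q (Src K f)) \<Longrightarrow> Tgt K f = l \<Longrightarrow> FOb (Ps1 Q f) X \<in> Ob (Ps0 Q l)"
    and "a \<in> Arr (Ps0 Q (Src K f)) \<Longrightarrow> Tgt K f = l \<Longrightarrow> FArr (Ps1 Q f) a \<in> Arr (Ps0 Q l)"
    and "a \<in> Arr (Ps0 Q (Src K f)) \<Longrightarrow> Tgt K f = l \<Longrightarrow>
      Dom (Ps0 Q l) (FArr (Ps1 Q f) a) = FOb (Ps1 Q f) (Dom (Ps0 Q (Src K f)) a)"
    and "a \<in> Arr (Ps0 Q (Src K f)) \<Longrightarrow> Tgt K f = l \<Longrightarrow>
      Cod (Ps0 Q l) (FArr (Ps1 Q f) a) = FOb (Ps1 Q f) (Cod (Ps0 Q (Src K f)) a)"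
    and "X \<in> Ob (Ps0 Q (Src K f)) \<Longrightarrow> Src K f = k \<Longrightarrow>
      FArr (Ps1 Q f) (Idt (Ps0 Q k) X) = Idt (Ps0 Q (Tgt K f)) (FOb (Ps1 Q f) X)"
    and "a \<in> Arr (Ps0 Q (Src K f)) \<Longrightarrow> b \<in> Arr (Ps0 Q (Src K f)) \<Longrightarrow>
      Dom (Ps0 Q (Src K f)) b = Cod (Ps0 Q (Src K f)) a \<Longrightarrow> Src K f = k \<Longrightarrow>
      FArr (Ps1 Q f) (b \<cdot>\<^bsub>Ps0 Q k\<^esub> a) = FArr (Ps1 Q f) b \<cdot>\<^bsub>Ps0 Q (Tgt K f)\<^esub> FArr (Ps1 Q f) a"
  using functorD[OF Ps1_functor[of f "Src K f" "Tgt K f"]] assms by auto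

lemma Ps1_Id1_simps:
  assumes "k \<in> Cell0 K"
  shows "X \<in> Ob (Ps0 Q k) \<Longrightarrow> FOb (Ps1 Q (Id1 K k)) X = X"
    and "a \<in> Arr (Ps0 Q k) \<Longrightarrow> FArr (Ps1 Q (Id1 K k)) a = a"
  using Ps1_Id1[OF assms] by simp_all

lemma Ps2_simps:
  assumes "\<alpha> \<in> Cell2 K" "Dom2 K \<alpha> \<in> Cell1 K"
  shows "X \<in> Ob (Ps0 Q (Src K (Dom2 K \<alpha>))) \<Longrightarrow> Tgt K (Dom2 K \<alpha>) = l \<Longrightarrow> Ps2 Q \<alpha> X \<in> Arr (Ps0 Q l)"
    and "X \<in> Ob (Ps0 Q (Src K (Dom2 K \<alpha>))) \<Longrightarrow> Tgt K (Dom2 K \<alpha>) = l \<Longrightarrow>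
      Dom (Ps0 Q l) (Ps2 Q \<alpha> X) = FOb (Ps1 Q (Dom2 K \<alpha>)) X"
    and "X \<in> Ob (Ps0 Q (Src K (Dom2 K \<alpha>))) \<Longrightarrow> Tgt K (Dom2 K \<alpha>) = l \<Longrightarrow>
      Cod (Ps0 Q l) (Ps2 Q \<alpha> X) = FOb (Ps1 Q (Cod2 K \<alpha>)) X"
  using nat_transD[OF Ps2_nat[of "Dom2 K \<alpha>" "Src K (Dom2 K \<alpha>)" "Tgt K (Dom2 K \<alpha>)" \<alpha> "Cod2 K \<alpha>"]] assms
  by auto

lemma Ps2_natural:
  assumes "\<alpha> \<in> Cell2 K" "Dom2 K \<alpha> \<in> Cell1 K" "a \<in> Arr (Ps0 Q (Src K (Dom2 K \<alpha>)))"
    "Dom2 K \<alpha> = f" "Cod2 K \<alpha> = g" "Src K f = k" "Tgt K f = l"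
  shows "FArr (Ps1 Q g) a \<cdot>\<^bsub>Ps0 Q l\<^esub> Ps2 Q \<alpha> (Dom (Ps0 Q k) a) =
    Ps2 Q \<alpha> (Cod (Ps0 Q k) a) \<cdot>\<^bsub>Ps0 Q l\<^esub> FArr (Ps1 Q f) a"
  using nat_transD(7)[OF Ps2_nat[of f k l \<alpha> g]] assms by auto

lemma Ps2_Id2':
  "f \<in> Cell1 K \<Longrightarrow> X \<in> Ob (Ps0 Q (Src K f)) \<Longrightarrow> Ps2 Q (Id2 K f) X = Idt (Ps0 Q (Tgt K f)) (FOb (Ps1 Q f) X)"
  using Ps2_Id2[of f "Src K f" "Tgt K f" X] by simp

lemma Ps2_VComp':
  "\<alpha> \<in> Cell2 K \<Longrightarrow> \<beta> \<in> Cell2 K \<Longrightarrow> Dom2 K \<alpha> \<in> Cell1 K \<Longrightarrow> Dom2 K \<beta> = Cod2 K \<alpha> \<Longrightarrow> X \<in> Ob (Ps0 Q (Src K (Dom2 K \<alpha>))) \<Longrightarrow>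
    Ps2 Q (\<beta> \<bullet>\<^bsub>K\<^esub> \<alpha>) X = Ps2 Q \<beta> X \<cdot>\<^bsub>Ps0 Q (Tgt K (Dom2 K \<alpha>))\<^esub> Ps2 Q \<alpha> X"
  using Ps2_VComp[of "Dom2 K \<alpha>" "Src K (Dom2 K \<alpha>)" "Tgt K (Dom2 K \<alpha>)" \<alpha> "Cod2 K \<alpha>" \<beta> "Cod2 K \<beta>" X] by simp

lemma Coh_simps:
  assumes "f \<in> Cell1 K" "g \<in> Cell1 K" "Src K g = Tgt K f"
  shows "X \<in> Ob (Ps0 Q (Src K f)) \<Longrightarrow> Tgt K g = m \<Longrightarrow> Coh Q g f X \<in> Arr (Ps0 Q m)"
    and "X \<in> Ob (Ps0 Q (Src K f)) \<Longrightarrow> Tgt K g = m \<Longrightarrow> is_iso (Ps0 Q m) (Coh Q g f X)"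
    and "X \<in> Ob (Ps0 Q (Src K f)) \<Longrightarrow> Tgt K g = m \<Longrightarrow>
      Dom (Ps0 Q m) (Coh Q g f X) = FOb (Ps1 Q g) (FOb (Ps1 Q f) X)"
    and "X \<in> Ob (Ps0 Q (Src K f)) \<Longrightarrow> Tgt K g = m \<Longrightarrow> Cod (Ps0 Q m) (Coh Q g f X) = FOb (Ps1 Q (g \<odot>\<^bsub>K\<^esub> f)) X"
  using nat_transD[of "Ps0 Q (Src K f)" "Ps0 Q (Tgt K g)" "comp_func (Ps0 Q (Src K f)) (Ps1 Q g) (Ps1 Q f)" "Ps1 Q (g \<odot>\<^bsub>K\<^esub> f)"]
    Coh_iso[of f "Src K f" "Tgt K f" g "Tgt K g"] assms
  by (auto simp: nat_iso_def)

lemma Coh_natural: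
  assumes "f \<in> Cell1 K" "g \<in> Cell1 K" "Src K g = Tgt K f" "a \<in> Arr (Ps0 Q (Src K f))" "Src K f = k" "Tgt K g = m"
  shows "FArr (Ps1 Q (g \<odot>\<^bsub>K\<^esub> f)) a \<cdot>\<^bsub>Ps0 Q m\<^esub> Coh Q g f (Dom (Ps0 Q k) a) =
    Coh Q g f (Cod (Ps0 Q k) a) \<cdot>\<^bsub>Ps0 Q m\<^esub> FArr (Ps1 Q g) (FArr (Ps1 Q f) a)"
  using nat_transD(7)[of "Ps0 Q k" "Ps0 Q m" "comp_func (Ps0 Q k) (Ps1 Q g) (Ps1 Q f)" "Ps1 Q (g \<odot>\<^bsub>K\<^esub> f)"]
    Coh_iso[of f k "Tgt K f" g m] assms
  by (auto simp: nat_iso_def)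

lemma Coh_Id1_simps:
  "f \<in> Cell1 K \<Longrightarrow> X \<in> Ob (Ps0 Q (Src K f)) \<Longrightarrow> Tgt K f = l \<Longrightarrow> Coh Q (Id1 K l) f X = Idt (Ps0 Q l) (FOb (Ps1 Q f) X)"
  "f \<in> Cell1 K \<Longrightarrow> X \<in> Ob (Ps0 Q (Src K f)) \<Longrightarrow> Src K f = k \<Longrightarrow>
    Coh Q f (Id1 K k) X = Idt (Ps0 Q (Tgt K f)) (FOb (Ps1 Q f) X)"
  using Coh_Id1_left[of f "Src K f" "Tgt K f" X] Coh_Id1_right[of f "Src K f" "Tgt K f" X] by auto

lemmas psf_simps = Ps0_cat Ps1_simps Ps2_simps Coh_simps

text \<open>
  The first two components of a composite in \<open>\<Delta>\<close> have the form \<open>b \<circ> Q g' a \<circ> coh\<close>, where \<open>coh\<close> is an inverse coherence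
  isomorphism. By naturality of the coherence isomorphisms and of \<open>Q \<beta>\<close>, a horizontal composite \<open>\<beta> \<star> \<alpha>\<close> moves through such a
  composite and splits into \<open>\<beta>\<close> acting on \<open>b\<close> and \<open>\<alpha>\<close> acting on \<open>a\<close>. This is why composition in \<open>\<Delta>\<close> respects 2-cells, and it is
  used for \<open>E\<close> and for \<open>W\<close>.
\<close>

lemma transport_HComp:
  assumes f: "f \<in> Cell1 K" "Src K f = k" "Tgt K f = l" and f': "f' \<in> Cell1 K" "Src K f' = k" "Tgt K f' = l"
    and g: "g \<in> Cell1 K" "Src K g = l" "Tgt K g = m" and g': "g' \<in> Cell1 K" "Src K g' = l" "Tgt K g' = m"
    and kl: "k \<in> Cell0 K" "l \<in> Cell0 K" "m \<in> Cell0 K"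
    and \<alpha>: "\<alpha> \<in> Cell2 K" "Dom2 K \<alpha> = f" "Cod2 K \<alpha> = f'" and \<beta>: "\<beta> \<in> Cell2 K" "Dom2 K \<beta> = g" "Cod2 K \<beta> = g'"
    and \<beta>\<alpha>: "\<beta> \<star>\<^bsub>K\<^esub> \<alpha> \<in> Cell2 K" "Dom2 K (\<beta> \<star>\<^bsub>K\<^esub> \<alpha>) = g \<odot>\<^bsub>K\<^esub> f" "Cod2 K (\<beta> \<star>\<^bsub>K\<^esub> \<alpha>) = g' \<odot>\<^bsub>K\<^esub> f'"
      "g \<odot>\<^bsub>K\<^esub> f \<in> Cell1 K" "Src K (g \<odot>\<^bsub>K\<^esub> f) = k" "Tgt K (g \<odot>\<^bsub>K\<^esub> f) = m"
    and X: "X \<in> Ob (Ps0 Q k)"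
    and a: "a \<in> Arr (Ps0 Q l)" "Dom (Ps0 Q l) a = FOb (Ps1 Q f') X" "Cod (Ps0 Q l) a = A"
    and b: "b \<in> Arr (Ps0 Q m)" "Dom (Ps0 Q m) b = FOb (Ps1 Q g') A"
  shows "(b \<cdot>\<^bsub>Ps0 Q m\<^esub> FArr (Ps1 Q g') a \<cdot>\<^bsub>Ps0 Q m\<^esub> inv_arrow (Ps0 Q m) (Coh Q g' f' X)) \<cdot>\<^bsub>Ps0 Q m\<^esub>
      Ps2 Q (\<beta> \<star>\<^bsub>K\<^esub> \<alpha>) X =
    (b \<cdot>\<^bsub>Ps0 Q m\<^esub> Ps2 Q \<beta> A) \<cdot>\<^bsub>Ps0 Q m\<^esub> FArr (Ps1 Q g) (a \<cdot>\<^bsub>Ps0 Q l\<^esub> Ps2 Q \<alpha> X) \<cdot>\<^bsub>Ps0 Q m\<^esub>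
      inv_arrow (Ps0 Q m) (Coh Q g f X)"
    (is "(b \<cdot>\<^bsub>_\<^esub> ?a \<cdot>\<^bsub>_\<^esub> inv_arrow _ ?c') \<cdot>\<^bsub>_\<^esub> ?\<beta>\<alpha> = (b \<cdot>\<^bsub>_\<^esub> ?\<beta>) \<cdot>\<^bsub>_\<^esub> _ \<cdot>\<^bsub>_\<^esub> inv_arrow _ ?c")
proof -
  note [simp] = psf_simps assms
  have [simp]: "A \<in> Ob (Ps0 Q l)" using a cat_simps(2)[of "Ps0 Q l" a] by simp
  let ?M = "Ps0 Q m"
  have "Coh Q g' f' X \<cdot>\<^bsub>?M\<^esub> Ps2 Q \<beta> (FOb (Ps1 Q f') X) \<cdot>\<^bsub>?M\<^esub> FArr (Ps1 Q g) (Ps2 Q \<alpha> X) \<cdot>\<^bsub>?M\<^esub> inv_arrow ?M ?c =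
      (Coh Q g' f' X \<cdot>\<^bsub>?M\<^esub> Ps2 Q \<beta> (FOb (Ps1 Q f') X) \<cdot>\<^bsub>?M\<^esub> FArr (Ps1 Q g) (Ps2 Q \<alpha> X)) \<cdot>\<^bsub>?M\<^esub> inv_arrow ?M ?c"
    by simp
  also have "\<dots> = ?\<beta>\<alpha>"
    using Coh_nat[of f k l g m \<alpha> f' \<beta> g' X] by simp
  finally have "inv_arrow ?M ?c' \<cdot>\<^bsub>?M\<^esub> ?\<beta>\<alpha> =
      Ps2 Q \<beta> (FOb (Ps1 Q f') X) \<cdot>\<^bsub>?M\<^esub> FArr (Ps1 Q g) (Ps2 Q \<alpha> X) \<cdot>\<^bsub>?M\<^esub> inv_arrow ?M ?c"
    by (rule subst) simp
  moreover have "?a \<cdot>\<^bsub>?M\<^esub> Ps2 Q \<beta> (FOb (Ps1 Q f') X) \<cdot>\<^bsub>?M\<^esub> FArr (Ps1 Q g) (Ps2 Q \<alpha> X) \<cdot>\<^bsub>?M\<^esub> inv_arrow ?M ?c =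
      ?\<beta> \<cdot>\<^bsub>?M\<^esub> FArr (Ps1 Q g) a \<cdot>\<^bsub>?M\<^esub> FArr (Ps1 Q g) (Ps2 Q \<alpha> X) \<cdot>\<^bsub>?M\<^esub> inv_arrow ?M ?c"
    using Ps2_natural[of \<beta> a g g' l m] by (intro Comp_reduce) simp_all
  ultimately show ?thesis by simp
qed

end

subsection \<open>Products and hom-categories\<close>

lemma prod_cat_simps [simp]:
  "Ob (prod_cat A B) = Ob A \<times> Ob B" "Arr (prod_cat A B) = Arr A \<times> Arr B"
  "Dom (prod_cat A B) (a, b) = (Dom A a, Dom B b)" "Cod (prod_cat A B) (a, b) = (Cod A a, Cod B b)"
  "Idt (prod_cat A B) (x, y) = (Idt A x, Idt B y)"
  "(a', b') \<cdot>\<^bsub>prod_cat A B\<^esub> (a, b) = (a' \<cdot>\<^bsub>A\<^esub> a, b' \<cdot>\<^bsub>B\<^esub> b)"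
  by (simp_all add: prod_cat_def)

lemma inverse_arrows_prod_cat [simp]:
  "inverse_arrows (prod_cat A B) (a, b) (a', b') \<longleftrightarrow> inverse_arrows A a a' \<and> inverse_arrows B b b'"
  by (auto simp: inverse_arrows_iff)

lemma is_iso_prod_cat [simp]: "is_iso (prod_cat A B) (a, b) \<longleftrightarrow> is_iso A a \<and> is_iso B b"
  by (auto simp: is_iso_def)

lemma category_prod_cat [simp]: "category A \<Longrightarrow> category B \<Longrightarrow> category (prod_cat A B)"
  by (rule categoryI) auto

lemma inv_arrow_prod_cat [simp]:
  assumes "category A" "category B" "is_iso A a" "is_iso B b"
  shows "inv_arrow (prod_cat A B) (a, b) = (inv_arrow A a, inv_arrow B b)"
  using assms by (intro inv_arrow_eq) (auto intro: inverse_arrows_inv)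

lemma hom_prod_cat [simp]:
  "(a, b) \<in> hom (prod_cat A B) (x, y) (x', y') \<longleftrightarrow> a \<in> hom A x x' \<and> b \<in> hom B y y'"
  by (auto simp: hom_iff)

lemma prod_func_simps [simp]:
  "x \<in> Ob A \<Longrightarrow> y \<in> Ob B \<Longrightarrow> FOb (prod_func A B F G) (x, y) = (FOb F x, FOb G y)"
  "a \<in> Arr A \<Longrightarrow> b \<in> Arr B \<Longrightarrow> FArr (prod_func A B F G) (a, b) = (FArr F a, FArr G b)"
  by (simp_all add: prod_func_def)

lemma prod2_simps [simp]:
  "Cell0 (prod2 K L) = Cell0 K \<times> Cell0 L" "Cell1 (prod2 K L) = Cell1 K \<times> Cell1 L"
  "Src (prod2 K L) (f, g) = (Src K f, Src L g)" "Tgt (prod2 K L) (f, g) = (Tgt K f, Tgt L g)"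
  "Id1 (prod2 K L) (k, l) = (Id1 K k, Id1 L l)" "Cmp1 (prod2 K L) (f', g') (f, g) = (Cmp1 K f' f, Cmp1 L g' g)"
  "Cell2 (prod2 K L) = Cell2 K \<times> Cell2 L" "Dom2 (prod2 K L) (\<alpha>, \<beta>) = (Dom2 K \<alpha>, Dom2 L \<beta>)"
  "Cod2 (prod2 K L) (\<alpha>, \<beta>) = (Cod2 K \<alpha>, Cod2 L \<beta>)"
  "Id2 (prod2 K L) (f, g) = (Id2 K f, Id2 L g)"
  "HComp (prod2 K L) (\<alpha>', \<beta>') (\<alpha>, \<beta>) = (HComp K \<alpha>' \<alpha>, HComp L \<beta>' \<beta>)"
  by (simp_all add: prod2_def)

lemma prod_psf_simps [simp]:
  "Ps0 (prod_psf K L Q R) (k, l) = prod_cat (Ps0 Q k) (Ps0 R l)"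
  "Ps1 (prod_psf K L Q R) (f, g) = prod_func (Ps0 Q (Src K f)) (Ps0 R (Src L g)) (Ps1 Q f) (Ps1 R g)"
  "X \<in> Ob (Ps0 Q (Src K (Dom2 K \<alpha>))) \<Longrightarrow> Z \<in> Ob (Ps0 R (Src L (Dom2 L \<beta>))) \<Longrightarrow>
    Ps2 (prod_psf K L Q R) (\<alpha>, \<beta>) (X, Z) = (Ps2 Q \<alpha> X, Ps2 R \<beta> Z)"
  "X \<in> Ob (Ps0 Q (Src K f)) \<Longrightarrow> Z \<in> Ob (Ps0 R (Src L g)) \<Longrightarrow>
    Coh (prod_psf K L Q R) (f', g') (f, g) (X, Z) = (Coh Q f' f X, Coh R g' g Z)"
  by (simp_all add: prod_psf_def)

lemma hom_cat_simps [simp]: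
  "f \<in> Ob (hom_cat K x y) \<longleftrightarrow> f \<in> Cell1 K \<and> Src K f = x \<and> Tgt K f = y"
  "\<alpha> \<in> Arr (hom_cat K x y) \<longleftrightarrow> \<alpha> \<in> Cell2 K \<and> Dom2 K \<alpha> \<in> Cell1 K \<and> Src K (Dom2 K \<alpha>) = x \<and> Tgt K (Dom2 K \<alpha>) = y"
  "Dom (hom_cat K x y) = Dom2 K" "Cod (hom_cat K x y) = Cod2 K" "Idt (hom_cat K x y) = Id2 K"
  "\<beta> \<cdot>\<^bsub>hom_cat K x y\<^esub> \<alpha> = \<beta> \<bullet>\<^bsub>K\<^esub> \<alpha>"
  by (auto simp: hom_cat_def vert_cat_def)

lemma hom_hom_cat [simp]:
  "\<alpha> \<in> hom (hom_cat K x y) f g \<longleftrightarrow>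
    \<alpha> \<in> Cell2 K \<and> f \<in> Cell1 K \<and> Src K f = x \<and> Tgt K f = y \<and> Dom2 K \<alpha> = f \<and> Cod2 K \<alpha> = g"
  by (auto simp: hom_def)

lemma hom_psf_simps [simp]:
  "Ps0 (hom_psf K) (c, d) = hom_cat K c d"
  "f \<in> Cell1 K \<Longrightarrow> Src K f = Tgt K p \<Longrightarrow> Tgt K f = Src K q \<Longrightarrow> FOb (Ps1 (hom_psf K) (p, q)) f = q \<odot>\<^bsub>K\<^esub> f \<odot>\<^bsub>K\<^esub> p"
  "\<phi> \<in> Cell2 K \<Longrightarrow> Dom2 K \<phi> \<in> Cell1 K \<Longrightarrow> Src K (Dom2 K \<phi>) = Tgt K p \<Longrightarrow> Tgt K (Dom2 K \<phi>) = Src K q \<Longrightarrow>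
    FArr (Ps1 (hom_psf K) (p, q)) \<phi> = Id2 K q \<star>\<^bsub>K\<^esub> \<phi> \<star>\<^bsub>K\<^esub> Id2 K p"
  "f \<in> Cell1 K \<Longrightarrow> Src K f = Tgt K (Dom2 K \<alpha>) \<Longrightarrow> Tgt K f = Src K (Dom2 K \<beta>) \<Longrightarrow>
    Ps2 (hom_psf K) (\<alpha>, \<beta>) f = \<beta> \<star>\<^bsub>K\<^esub> Id2 K f \<star>\<^bsub>K\<^esub> \<alpha>"
  "f \<in> Cell1 K \<Longrightarrow> Src K f = Tgt K p' \<Longrightarrow> Tgt K f = Src K q' \<Longrightarrow>
    Coh (hom_psf K) (p, q) (p', q') f = Id2 K ((q \<odot>\<^bsub>K\<^esub> q') \<odot>\<^bsub>K\<^esub> f \<odot>\<^bsub>K\<^esub> p' \<odot>\<^bsub>K\<^esub> p)"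
  by (simp_all add: hom_psf_def)

section \<open>The 2-category underlying the tensor product\<close>

locale weight = two_category C + E: pseudo_functor C E + W: pseudo_functor "op2 C" W
  for C :: "('o, 'f, 't) two_cat" (structure)
    and E :: "('o, 'f, 't, 'x, 'y) psf" and W :: "('o, 'f, 't, 'z, 'w) psf"
begin

lemmas E_simps [simp] = E.Ps0_cat E.Ps1_simps E.Ps1_Id1_simps E.Ps2_simps[OF _ vert_simps(1)] E.Ps2_Id2'
  E.Coh_simps E.Coh_Id1_simps E.Ps2_VComp'[OF _ _ vert_simps(1)]

lemmas W_simps [simp] = W.Ps0_cat[simplified] W.Ps1_simps[simplified] W.Ps1_Id1_simps[simplified]
  W.Ps2_simps[simplified, OF _ vert_simps(1)] W.Ps2_Id2'[simplified] W.Coh_simps[simplified]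
  W.Coh_Id1_simps[simplified] W.Ps2_VComp'[simplified, OF _ _ vert_simps(1)]

lemmas Coh_assoc = E.Coh_assoc[simplified]

abbreviation "DD \<equiv> Delta (prod2 C (op2 C)) (tensor_psf C E W) (hom_psf C)"

text \<open>Representatives of the arrows in \<open>Sigma_arr\<close>.\<close>

definition Sig :: "('o \<times> 'o, 'f \<times> 'f, 'x \<times> 'z, 'y \<times> 'w, 'f, 't) dar set" where
  "Sig = {((k, X, Y), (f, u, v), (l, A, B)) | k X Y f u v l A B.
     ((k, X, Y), (f, u, v), (l, A, B)) \<in> Cell1 DD \<and> is_iso (Ps0 (tensor_psf C E W) l) u \<and>
     is_iso (Ps0 (hom_psf C) k) v}"

lemma Delta_sel [simp]:
  "Src DD (x, r, y) = x" "Tgt DD (x, r, y) = y"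
  "Dom2 DD (r1, \<gamma>, r2) = r1" "Cod2 DD (r1, \<gamma>, r2) = r2"
  by (simp_all add: Delta_def)

lemma Cell0_DD: "Cell0 DD = Delta_ob (prod2 C (op2 C)) (tensor_psf C E W) (hom_psf C)"
  and Cell1_DD: "Cell1 DD = Delta_arr (prod2 C (op2 C)) (tensor_psf C E W) (hom_psf C)"
  and Cell2_DD: "Cell2 DD = Delta_cell2 (prod2 C (op2 C)) (tensor_psf C E W) (hom_psf C)"
  and Cmp1_DD: "Cmp1 DD = Delta_comp (prod2 C (op2 C)) (tensor_psf C E W) (hom_psf C)"
  by (simp_all add: Delta_def)

lemma Delta_Cell0 [simp]: "((c, d), (e, w), h) \<in> Cell0 DD \<longleftrightarrow> c \<in> Cell0 C \<and> d \<in> Cell0 C \<and>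
    e \<in> Ob (Ps0 E c) \<and> w \<in> Ob (Ps0 W d) \<and> h \<in> Cell1 C \<and> Src C h = c \<and> Tgt C h = d"
  by (auto simp: Delta_def Delta_ob_def)

lemma Delta_Cell1 [simp]:
  "(((c, d), (e, w), h), ((p, q), (u, v), \<phi>), ((c', d'), (e', w'), h')) \<in> Cell1 DD \<longleftrightarrow>
    ((c, d), (e, w), h) \<in> Cell0 DD \<and> ((c', d'), (e', w'), h') \<in> Cell0 DD \<and>
    p \<in> Cell1 C \<and> Src C p = c \<and> Tgt C p = c' \<and> q \<in> Cell1 C \<and> Src C q = d' \<and> Tgt C q = d \<and>
    u \<in> Arr (Ps0 E c') \<and> Dom (Ps0 E c') u = FOb (Ps1 E p) e \<and> Cod (Ps0 E c') u = e' \<and>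
    v \<in> Arr (Ps0 W d') \<and> Dom (Ps0 W d') v = FOb (Ps1 W q) w \<and> Cod (Ps0 W d') v = w' \<and>
    \<phi> \<in> Cell2 C \<and> Dom2 C \<phi> = h \<and> Cod2 C \<phi> = q \<odot> h' \<odot> p"
  unfolding Cell1_DD Cell0_DD Delta_arr_def Delta_ob_def
  by (simp cong: conj_cong) (auto simp: hom_iff[of _ "Ps0 E c'"] hom_iff[of _ "Ps0 W d'"])

lemma Delta_Cell1E:
  assumes "r \<in> Cell1 DD"
  obtains c d e w h p q u v \<phi> c' d' e' w' h' where
    "r = (((c, d), (e, w), h), ((p, q), (u, v), \<phi>), ((c', d'), (e', w'), h'))"
  by (metis surj_pair)

lemma Delta_Id1 [simp]: "Id1 DD ((c, d), (e, w), h) =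
    (((c, d), (e, w), h), ((Id1 C c, Id1 C d), (Idt (Ps0 E c) e, Idt (Ps0 W d) w), Id2 C h), ((c, d), (e, w), h))"
  by (simp add: Delta_def)

lemma Delta_Cmp1 [simp]:
  assumes "(((c, d), (e, w), h), ((p, q), (u, v), \<phi>), ((c', d'), (e', w'), h')) \<in> Cell1 DD"
    and "(((c', d'), (e', w'), h'), ((p', q'), (u', v'), \<phi>'), ((c'', d''), (e'', w''), h'')) \<in> Cell1 DD"
  shows "(((c', d'), (e', w'), h'), ((p', q'), (u', v'), \<phi>'), ((c'', d''), (e'', w''), h'')) \<odot>\<^bsub>DD\<^esub>
      (((c, d), (e, w), h), ((p, q), (u, v), \<phi>), ((c', d'), (e', w'), h')) =
    (((c, d), (e, w), h), ((p' \<odot> p, q \<odot> q'),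
      (u' \<cdot>\<^bsub>Ps0 E c''\<^esub> FArr (Ps1 E p') u \<cdot>\<^bsub>Ps0 E c''\<^esub> inv_arrow (Ps0 E c'') (Coh E p' p e),
       v' \<cdot>\<^bsub>Ps0 W d''\<^esub> FArr (Ps1 W q') v \<cdot>\<^bsub>Ps0 W d''\<^esub> inv_arrow (Ps0 W d'') (Coh W q' q w)),
      (Id2 C q \<star> \<phi>' \<star> Id2 C p) \<bullet> \<phi>), ((c'', d''), (e'', w''), h''))"
  using assms[simplified] by (auto simp: Cmp1_DD Delta_comp_def)

lemma Delta_Cell2 [simp]:
  "((((c, d), (e, w), h), ((p, q), (u, v), \<phi>), ((c', d'), (e', w'), h')), (\<alpha>, \<beta>),
    (((c1, d1), (e1, w1), h1), ((p1, q1), (u1, v1), \<phi>1), ((c1', d1'), (e1', w1'), h1'))) \<in> Cell2 DD \<longleftrightarrow>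
    (((c, d), (e, w), h), ((p, q), (u, v), \<phi>), ((c', d'), (e', w'), h')) \<in> Cell1 DD \<and>
    (((c, d), (e, w), h), ((p1, q1), (u1, v1), \<phi>1), ((c', d'), (e', w'), h')) \<in> Cell1 DD \<and>
    ((c1, d1), (e1, w1), h1) = ((c, d), (e, w), h) \<and> ((c1', d1'), (e1', w1'), h1') = ((c', d'), (e', w'), h') \<and>
    \<alpha> \<in> Cell2 C \<and> Dom2 C \<alpha> = p \<and> Cod2 C \<alpha> = p1 \<and> \<beta> \<in> Cell2 C \<and> Dom2 C \<beta> = q \<and> Cod2 C \<beta> = q1 \<and>
    u1 \<cdot>\<^bsub>Ps0 E c'\<^esub> Ps2 E \<alpha> e = u \<and> v1 \<cdot>\<^bsub>Ps0 W d'\<^esub> Ps2 W \<beta> w = v \<and> (\<beta> \<star> Id2 C h' \<star> \<alpha>) \<bullet> \<phi> = \<phi>1"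
    (is "(?r, _, ?s) \<in> _ \<longleftrightarrow> ?r \<in> _ \<and> ?s' \<in> _ \<and> _")
proof -
  have *: "(u1, v1) \<cdot>\<^bsub>prod_cat (Ps0 E c') (Ps0 W d')\<^esub> Ps2 (tensor_psf C E W) (\<alpha>, \<beta>) (e, w) =
      (u1 \<cdot>\<^bsub>Ps0 E c'\<^esub> Ps2 E \<alpha> e, v1 \<cdot>\<^bsub>Ps0 W d'\<^esub> Ps2 W \<beta> w)"
    "Ps2 (hom_psf C) (\<alpha>, \<beta>) h' = \<beta> \<star> Id2 C h' \<star> \<alpha>"
    if "?r \<in> Cell1 DD" "Dom2 C \<alpha> = p" "Dom2 C \<beta> = q"
    using that(1)[simplified] that(2,3) by auto
  show ?thesis
    unfolding Cell2_DD Delta_cell2_def Cell1_DD[symmetric]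
    by (auto simp: * simp del: Delta_Cell1 prod_psf_simps(3) hom_psf_simps(4))
qed

lemma Sig_iff: "(((c, d), (e, w), h), ((p, q), (u, v), \<phi>), ((c', d'), (e', w'), h')) \<in> Sig \<longleftrightarrow>
    (((c, d), (e, w), h), ((p, q), (u, v), \<phi>), ((c', d'), (e', w'), h')) \<in> Cell1 DD \<and>
    is_iso (Ps0 E c') u \<and> is_iso (Ps0 W d') v \<and> is_iso (hom_cat C c d) \<phi>"
  by (simp add: Sig_def del: Delta_Cell1)

text \<open>
  The horizontal composite of two 2-cells lies over their horizontal composite in \<open>C \<times> C\<^sup>o\<^sup>p\<close>. That it satisfies the equations
  for a 2-cell of \<open>\<Delta>\<close> is \<open>transport_HComp\<close> for the components in \<open>E\<close> and \<open>W\<close> and the interchange law for the component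
  in \<open>C\<close>.
\<close>

lemma Delta_pre_two_category: "pre_two_category DD Sig"
proof
  fix r assume r: "r \<in> Cell1 DD"
  then obtain c d e w h p q u v \<phi> c' d' e' w' h' where
    r_eq: "r = (((c, d), (e, w), h), ((p, q), (u, v), \<phi>), ((c', d'), (e', w'), h'))"
    by (rule Delta_Cell1E)
  show "Src DD r \<in> Cell0 DD" "Tgt DD r \<in> Cell0 DD"
    using r by (auto simp: r_eq)
  show "\<exists>\<alpha> \<in> Cell2 DD. Dom2 DD \<alpha> = r \<and> Cod2 DD \<alpha> = r"
    by (rule bexI[of _ "(r, (Id2 C p, Id2 C q), r)"]) (use r in \<open>auto simp: r_eq\<close>)
  fix s assume s: "s \<in> Cell1 DD" "Src DD s = Tgt DD r"
  then obtain p' q' u' v' \<phi>' c'' d'' e'' w'' h'' where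
    s_eq: "s = (((c', d'), (e', w'), h'), ((p', q'), (u', v'), \<phi>'), ((c'', d''), (e'', w''), h''))"
    by (auto simp: r_eq elim: Delta_Cell1E)
  show "s \<odot>\<^bsub>DD\<^esub> r \<in> Cell1 DD \<and> Src DD (s \<odot>\<^bsub>DD\<^esub> r) = Src DD r \<and> Tgt DD (s \<odot>\<^bsub>DD\<^esub> r) = Tgt DD s"
    using r s unfolding r_eq s_eq by (subst (1 2 3) Delta_Cmp1) auto
next
  fix x assume "x \<in> Cell0 DD"
  then show "Id1 DD x \<in> Cell1 DD \<and> Src DD (Id1 DD x) = x \<and> Tgt DD (Id1 DD x) = x"
    by (cases x) auto
next
  fix \<gamma> assume "\<gamma> \<in> Cell2 DD"
  then show "Dom2 DD \<gamma> \<in> Cell1 DD \<and> Cod2 DD \<gamma> \<in> Cell1 DD \<and> Src DD (Cod2 DD \<gamma>) = Src DD (Dom2 DD \<gamma>) \<and>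
      Tgt DD (Cod2 DD \<gamma>) = Tgt DD (Dom2 DD \<gamma>)"
    by (cases \<gamma>) (auto simp del: Delta_Cell1)
next
  show "Sig \<subseteq> Cell1 DD" by (auto simp: Sig_def)
next
  fix \<gamma> \<delta> assume \<gamma>: "\<gamma> \<in> Cell2 DD" and \<delta>: "\<delta> \<in> Cell2 DD" "Src DD (Dom2 DD \<delta>) = Tgt DD (Dom2 DD \<gamma>)"
  obtain c d e w h p q u v \<phi> c' d' e' w' h' \<alpha> \<beta> p1 q1 u1 v1 \<phi>1 where
    \<gamma>_eq: "\<gamma> = ((((c, d), (e, w), h), ((p, q), (u, v), \<phi>), ((c', d'), (e', w'), h')), (\<alpha>, \<beta>),
      (((c, d), (e, w), h), ((p1, q1), (u1, v1), \<phi>1), ((c', d'), (e', w'), h')))"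
    using \<gamma> by (cases \<gamma>) (auto simp del: Delta_Cell1)
  obtain c'' d'' e'' w'' h'' p' q' u' v' \<phi>' \<alpha>' \<beta>' p1' q1' u1' v1' \<phi>1' where
    \<delta>_eq: "\<delta> = ((((c', d'), (e', w'), h'), ((p', q'), (u', v'), \<phi>'), ((c'', d''), (e'', w''), h'')), (\<alpha>', \<beta>'),
      (((c', d'), (e', w'), h'), ((p1', q1'), (u1', v1'), \<phi>1'), ((c'', d''), (e'', w''), h'')))"
    using \<delta> by (cases \<delta>) (auto simp: \<gamma>_eq simp del: Delta_Cell1)
  have 2: "(((c, d), (e, w), h), ((p, q), (u, v), \<phi>), ((c', d'), (e', w'), h')) \<in> Cell1 DD"
    "(((c, d), (e, w), h), ((p1, q1), (u1, v1), \<phi>1), ((c', d'), (e', w'), h')) \<in> Cell1 DD"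
    "(((c', d'), (e', w'), h'), ((p', q'), (u', v'), \<phi>'), ((c'', d''), (e'', w''), h'')) \<in> Cell1 DD"
    "(((c', d'), (e', w'), h'), ((p1', q1'), (u1', v1'), \<phi>1'), ((c'', d''), (e'', w''), h'')) \<in> Cell1 DD"
    "\<alpha> \<in> Cell2 C" "Dom2 C \<alpha> = p" "Cod2 C \<alpha> = p1" "\<beta> \<in> Cell2 C" "Dom2 C \<beta> = q" "Cod2 C \<beta> = q1"
    "\<alpha>' \<in> Cell2 C" "Dom2 C \<alpha>' = p'" "Cod2 C \<alpha>' = p1'" "\<beta>' \<in> Cell2 C" "Dom2 C \<beta>' = q'" "Cod2 C \<beta>' = q1'"
    "u = u1 \<cdot>\<^bsub>Ps0 E c'\<^esub> Ps2 E \<alpha> e" "v = v1 \<cdot>\<^bsub>Ps0 W d'\<^esub> Ps2 W \<beta> w" "\<phi>1 = (\<beta> \<star> Id2 C h' \<star> \<alpha>) \<bullet> \<phi>"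
    "u' = u1' \<cdot>\<^bsub>Ps0 E c''\<^esub> Ps2 E \<alpha>' e'" "v' = v1' \<cdot>\<^bsub>Ps0 W d''\<^esub> Ps2 W \<beta>' w'"
    "\<phi>1' = (\<beta>' \<star> Id2 C h'' \<star> \<alpha>') \<bullet> \<phi>'"
    using \<gamma> \<delta>(1) by (auto simp: \<gamma>_eq \<delta>_eq simp del: Delta_Cell1)
  note t = 2(1-4)[simplified]
  have u: "(u1' \<cdot>\<^bsub>Ps0 E c''\<^esub> FArr (Ps1 E p1') u1 \<cdot>\<^bsub>Ps0 E c''\<^esub> inv_arrow (Ps0 E c'') (Coh E p1' p1 e)) \<cdot>\<^bsub>Ps0 E c''\<^esub>
      Ps2 E (\<alpha>' \<star> \<alpha>) e = u' \<cdot>\<^bsub>Ps0 E c''\<^esub> FArr (Ps1 E p') u \<cdot>\<^bsub>Ps0 E c''\<^esub> inv_arrow (Ps0 E c'') (Coh E p' p e)"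
    using t 2(5-16) unfolding 2(17,20) by (intro E.transport_HComp[where k = c and l = c']) auto
  have v: "(v1' \<cdot>\<^bsub>Ps0 W d''\<^esub> FArr (Ps1 W q1') v1 \<cdot>\<^bsub>Ps0 W d''\<^esub> inv_arrow (Ps0 W d'') (Coh W q1' q1 w)) \<cdot>\<^bsub>Ps0 W d''\<^esub>
      Ps2 W (\<beta> \<star> \<beta>') w = v' \<cdot>\<^bsub>Ps0 W d''\<^esub> FArr (Ps1 W q') v \<cdot>\<^bsub>Ps0 W d''\<^esub> inv_arrow (Ps0 W d'') (Coh W q' q w)"
    using t 2(5-16) unfolding 2(18,21) op2_simps(12)[of C \<beta>' \<beta>, symmetric]
    by (intro W.transport_HComp[where k = d and l = d']) auto
  have \<phi>: "((\<beta> \<star> \<beta>') \<star> Id2 C h'' \<star> (\<alpha>' \<star> \<alpha>)) \<bullet> (Id2 C q \<star> \<phi>' \<star> Id2 C p) \<bullet> \<phi> =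
      (Id2 C q1 \<star> \<phi>1' \<star> Id2 C p1) \<bullet> \<phi>1"
  proof -
    have "(Id2 C q1 \<star> \<phi>1' \<star> Id2 C p1) \<bullet> (\<beta> \<star> Id2 C h' \<star> \<alpha>) = \<beta> \<star> \<phi>1' \<star> \<alpha>"
      using t 2(5-16) by (simp add: interchange[symmetric])
    also have "\<dots> = (\<beta> \<star> (\<beta>' \<star> Id2 C h'' \<star> \<alpha>') \<star> \<alpha>) \<bullet> (Id2 C q \<star> \<phi>' \<star> Id2 C p)"
    proof -
      have "\<beta> \<star> (\<psi> \<bullet> \<phi>') \<star> \<alpha> = (\<beta> \<star> \<psi> \<star> \<alpha>) \<bullet> (Id2 C q \<star> \<phi>' \<star> Id2 C p)"
        if "\<psi> \<in> Cell2 C" "Dom2 C \<psi> = q' \<odot> h'' \<odot> p'" for \<psi>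
        using t 2(5-16) that by (simp add: interchange[symmetric])
      from this[of "\<beta>' \<star> Id2 C h'' \<star> \<alpha>'"] show ?thesis using t 2(5-16) by (simp add: 2(22))
    qed
    finally have *: "(Id2 C q1 \<star> \<phi>1' \<star> Id2 C p1) \<bullet> (\<beta> \<star> Id2 C h' \<star> \<alpha>) =
        (\<beta> \<star> (\<beta>' \<star> Id2 C h'' \<star> \<alpha>') \<star> \<alpha>) \<bullet> (Id2 C q \<star> \<phi>' \<star> Id2 C p)" .
    have "(Id2 C q1 \<star> \<phi>1' \<star> Id2 C p1) \<bullet> \<phi>1 = ((Id2 C q1 \<star> \<phi>1' \<star> Id2 C p1) \<bullet> (\<beta> \<star> Id2 C h' \<star> \<alpha>)) \<bullet> \<phi>"
      using t 2(5-16) unfolding 2(19) by simp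
    also have "\<dots> = ((\<beta> \<star> \<beta>') \<star> Id2 C h'' \<star> (\<alpha>' \<star> \<alpha>)) \<bullet> (Id2 C q \<star> \<phi>' \<star> Id2 C p) \<bullet> \<phi>"
      unfolding * using t 2(5-16) by simp
    finally show ?thesis by simp
  qed
  show "\<exists>\<gamma>' \<in> Cell2 DD. Dom2 DD \<gamma>' = Dom2 DD \<delta> \<odot>\<^bsub>DD\<^esub> Dom2 DD \<gamma> \<and> Cod2 DD \<gamma>' = Cod2 DD \<delta> \<odot>\<^bsub>DD\<^esub> Cod2 DD \<gamma>"
  proof (rule bexI)
    show "(Dom2 DD \<delta> \<odot>\<^bsub>DD\<^esub> Dom2 DD \<gamma>, (\<alpha>' \<star> \<alpha>, \<beta> \<star> \<beta>'), Cod2 DD \<delta> \<odot>\<^bsub>DD\<^esub> Cod2 DD \<gamma>) \<in> Cell2 DD"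
      unfolding \<gamma>_eq \<delta>_eq Delta_sel Delta_Cmp1[OF 2(1,3)] Delta_Cmp1[OF 2(2,4)] Delta_Cell2
      unfolding u v \<phi>
      using t 2(5-16) by auto
  qed simp
qed

sublocale T: pre_two_category DD Sig
  by (rule Delta_pre_two_category)

lemma Sigma_arr_eq: "Sigma_arr (prod2 C (op2 C)) (tensor_psf C E W) (hom_psf C) = T.cl ` Sig"
  unfolding Sigma_arr_def Sig_def T.cl_def Cell1_DD by (auto simp: image_iff) blast+

lemma tensor_eq: "tensor C E W = T.loc"
  by (simp add: tensor_def pcolim_def Sigma_arr_eq)

lemma tensor_zz_eq: "tensor_zz C E W x p y = frac (pi0 DD) (T.cl ` Sig) x (map (map_step T.cl) p) y"
  unfolding tensor_zz_def pcolim_zz_def frac_def Sigma_arr_eq T.cl_def by simp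

end

section \<open>Balanced families\<close>

text \<open>
  A balanced family is a pseudo-natural transformation from \<open>W\<close> to \<open>Cat(E, A)\<close> with both arguments \<open>e\<close> and \<open>w\<close> written out:
  \<open>Mo\<close> and \<open>Ma\<close> are bifunctors \<open>E c \<times> W c \<rightarrow> A\<close>, and \<open>t f\<close> is the isomorphism over a 1-cell \<open>f\<close>. In this form composition
  takes place in \<open>A\<close> itself instead of in functor categories.
\<close>

locale balanced = weight C E W + A: category A
  for C :: "('o, 'f, 't) two_cat" (structure)
    and E :: "('o, 'f, 't, 'x, 'y) psf" and W :: "('o, 'f, 't, 'z, 'w) psf" and A :: "('p, 'q) cat" +
  fixes Mo :: "'o \<Rightarrow> 'x \<Rightarrow> 'z \<Rightarrow> 'p" and Ma :: "'o \<Rightarrow> 'y \<Rightarrow> 'w \<Rightarrow> 'q" and t :: "'f \<Rightarrow> 'x \<Rightarrow> 'z \<Rightarrow> 'q"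
  assumes Mo_Ob: "c \<in> Cell0 C \<Longrightarrow> e \<in> Ob (Ps0 E c) \<Longrightarrow> w \<in> Ob (Ps0 W c) \<Longrightarrow> Mo c e w \<in> Ob A"
    and Ma_typed: "c \<in> Cell0 C \<Longrightarrow> a \<in> Arr (Ps0 E c) \<Longrightarrow> b \<in> Arr (Ps0 W c) \<Longrightarrow> Ma c a b \<in> Arr A \<and>
      Dom A (Ma c a b) = Mo c (Dom (Ps0 E c) a) (Dom (Ps0 W c) b) \<and>
      Cod A (Ma c a b) = Mo c (Cod (Ps0 E c) a) (Cod (Ps0 W c) b)"
    and Ma_Idt: "c \<in> Cell0 C \<Longrightarrow> e \<in> Ob (Ps0 E c) \<Longrightarrow> w \<in> Ob (Ps0 W c) \<Longrightarrow>
      Ma c (Idt (Ps0 E c) e) (Idt (Ps0 W c) w) = Idt A (Mo c e w)"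
    and Ma_Comp: "c \<in> Cell0 C \<Longrightarrow> a \<in> Arr (Ps0 E c) \<Longrightarrow> b \<in> Arr (Ps0 W c) \<Longrightarrow> a' \<in> Arr (Ps0 E c) \<Longrightarrow>
      b' \<in> Arr (Ps0 W c) \<Longrightarrow> Dom (Ps0 E c) a' = Cod (Ps0 E c) a \<Longrightarrow> Dom (Ps0 W c) b' = Cod (Ps0 W c) b \<Longrightarrow>
      Ma c (a' \<cdot>\<^bsub>Ps0 E c\<^esub> a) (b' \<cdot>\<^bsub>Ps0 W c\<^esub> b) = Ma c a' b' \<cdot>\<^bsub>A\<^esub> Ma c a b"
    and t_typed: "f \<in> Cell1 C \<Longrightarrow> e \<in> Ob (Ps0 E (Src C f)) \<Longrightarrow> w \<in> Ob (Ps0 W (Tgt C f)) \<Longrightarrow>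
      is_iso A (t f e w) \<and> Dom A (t f e w) = Mo (Tgt C f) (FOb (Ps1 E f) e) w \<and>
      Cod A (t f e w) = Mo (Src C f) e (FOb (Ps1 W f) w)"
    and t_natural: "f \<in> Cell1 C \<Longrightarrow> a \<in> Arr (Ps0 E (Src C f)) \<Longrightarrow> b \<in> Arr (Ps0 W (Tgt C f)) \<Longrightarrow>
      t f (Cod (Ps0 E (Src C f)) a) (Cod (Ps0 W (Tgt C f)) b) \<cdot>\<^bsub>A\<^esub> Ma (Tgt C f) (FArr (Ps1 E f) a) b =
      Ma (Src C f) a (FArr (Ps1 W f) b) \<cdot>\<^bsub>A\<^esub> t f (Dom (Ps0 E (Src C f)) a) (Dom (Ps0 W (Tgt C f)) b)"
    and t_2cell: "\<alpha> \<in> Cell2 C \<Longrightarrow> Dom2 C \<alpha> = f \<Longrightarrow> Cod2 C \<alpha> = g \<Longrightarrow> e \<in> Ob (Ps0 E (Src C f)) \<Longrightarrow> w \<in> Ob (Ps0 W (Tgt C f)) \<Longrightarrow>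
      t g e w \<cdot>\<^bsub>A\<^esub> Ma (Tgt C f) (Ps2 E \<alpha> e) (Idt (Ps0 W (Tgt C f)) w) =
      Ma (Src C f) (Idt (Ps0 E (Src C f)) e) (Ps2 W \<alpha> w) \<cdot>\<^bsub>A\<^esub> t f e w"
    and t_Id1: "c \<in> Cell0 C \<Longrightarrow> e \<in> Ob (Ps0 E c) \<Longrightarrow> w \<in> Ob (Ps0 W c) \<Longrightarrow> t (Id1 C c) e w = Idt A (Mo c e w)"
    and t_Cmp1: "f \<in> Cell1 C \<Longrightarrow> g \<in> Cell1 C \<Longrightarrow> Src C g = Tgt C f \<Longrightarrow>
      e \<in> Ob (Ps0 E (Src C f)) \<Longrightarrow> w \<in> Ob (Ps0 W (Tgt C g)) \<Longrightarrow>
      t (g \<odot> f) e w \<cdot>\<^bsub>A\<^esub> Ma (Tgt C g) (Coh E g f e) (Idt (Ps0 W (Tgt C g)) w) =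
      Ma (Src C f) (Idt (Ps0 E (Src C f)) e) (Coh W f g w) \<cdot>\<^bsub>A\<^esub>
        t f e (FOb (Ps1 W g) w) \<cdot>\<^bsub>A\<^esub> t g (FOb (Ps1 E f) e) w"

section \<open>The universal balanced family\<close>

context weight
begin

declare T.fractions_simps(5) [simp del]

text \<open>
  Three kinds of arrows of \<open>\<Delta>\<close>. An arrow \<open>Nar\<close> lies over identities of \<open>C\<close>. The arrow \<open>Uar f g e w\<close> lies over
  \<open>(f, 1)\<close> and moves \<open>f\<close> from the 1-cell \<open>g \<circ> f\<close> to the object \<open>e\<close>; \<open>Var f g e w\<close> lies over \<open>(1, g)\<close> and moves \<open>g\<close> to
  the object \<open>w\<close>. The components of \<open>Uar\<close> and \<open>Var\<close> are identities, so both are inverted in the tensor product. If nothing remains of the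
  1-cell, these are the arrows \<open>Lar\<close> and \<open>Rar\<close>, the legs of the structural isomorphisms of the unit.
\<close>

definition Nar :: "'f \<Rightarrow> 'f \<Rightarrow> 'y \<Rightarrow> 'w \<Rightarrow> 't \<Rightarrow> ('o \<times> 'o, 'f \<times> 'f, 'x \<times> 'z, 'y \<times> 'w, 'f, 't) dar" where
  "Nar h h' a b \<phi> = (let c = Src C h; d = Tgt C h in
     (((c, d), (Dom (Ps0 E c) a, Dom (Ps0 W d) b), h), ((Id1 C c, Id1 C d), (a, b), \<phi>),
      ((c, d), (Cod (Ps0 E c) a, Cod (Ps0 W d) b), h')))"

definition Uar :: "'f \<Rightarrow> 'f \<Rightarrow> 'x \<Rightarrow> 'z \<Rightarrow> ('o \<times> 'o, 'f \<times> 'f, 'x \<times> 'z, 'y \<times> 'w, 'f, 't) dar" where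
  "Uar f g e w = (let c = Src C f; d = Tgt C f; k = Tgt C g in
     (((c, k), (e, w), g \<odot> f),
      ((f, Id1 C k), (Idt (Ps0 E d) (FOb (Ps1 E f) e), Idt (Ps0 W k) w), Id2 C (g \<odot> f)),
      ((d, k), (FOb (Ps1 E f) e, w), g)))"

definition Var :: "'f \<Rightarrow> 'f \<Rightarrow> 'x \<Rightarrow> 'z \<Rightarrow> ('o \<times> 'o, 'f \<times> 'f, 'x \<times> 'z, 'y \<times> 'w, 'f, 't) dar" where
  "Var f g e w = (let c = Src C f; d = Tgt C f; k = Tgt C g in
     (((c, k), (e, w), g \<odot> f),
      ((Id1 C c, g), (Idt (Ps0 E c) e, Idt (Ps0 W d) (FOb (Ps1 W g) w)), Id2 C (g \<odot> f)),
      ((c, d), (e, FOb (Ps1 W g) w), f)))"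

lemma Nar_typed [simp]:
  assumes "h \<in> Cell1 C" "h' \<in> Cell1 C" "Src C h' = Src C h" "Tgt C h' = Tgt C h" "\<phi> \<in> Cell2 C" "Dom2 C \<phi> = h" "Cod2 C \<phi> = h'"
    "a \<in> Arr (Ps0 E (Src C h))" "b \<in> Arr (Ps0 W (Tgt C h))"
  shows "Nar h h' a b \<phi> \<in> Cell1 DD"
  using assms by (simp add: Nar_def Let_def)

lemma Nar_sel [simp]:
  "Src DD (Nar h h' a b \<phi>) = ((Src C h, Tgt C h), (Dom (Ps0 E (Src C h)) a, Dom (Ps0 W (Tgt C h)) b), h)"
  "Tgt DD (Nar h h' a b \<phi>) = ((Src C h, Tgt C h), (Cod (Ps0 E (Src C h)) a, Cod (Ps0 W (Tgt C h)) b), h')"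
  by (simp_all add: Nar_def Let_def)

lemma UVar_typed [simp]:
  assumes "f \<in> Cell1 C" "g \<in> Cell1 C" "Src C g = Tgt C f" "e \<in> Ob (Ps0 E (Src C f))" "w \<in> Ob (Ps0 W (Tgt C g))"
  shows "Uar f g e w \<in> Cell1 DD" "Var f g e w \<in> Cell1 DD" "Uar f g e w \<in> Sig" "Var f g e w \<in> Sig"
proof -
  show U: "Uar f g e w \<in> Cell1 DD" and V: "Var f g e w \<in> Cell1 DD"
    using assms by (simp_all add: Uar_def Var_def Let_def)
  have "is_iso (hom_cat C (Src C f) (Tgt C g)) (Id2 C (g \<odot> f))"
    using assms by (intro is_isoI[of _ _ "Id2 C (g \<odot> f)"]) (simp add: inverse_arrows_iff)
  then show "Uar f g e w \<in> Sig" "Var f g e w \<in> Sig"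
    using assms U V by (simp_all add: Uar_def Var_def Sig_iff Let_def)
qed

lemma UVar_sel [simp]:
  "Src DD (Uar f g e w) = ((Src C f, Tgt C g), (e, w), g \<odot> f)"
  "Tgt DD (Uar f g e w) = ((Tgt C f, Tgt C g), (FOb (Ps1 E f) e, w), g)"
  "Src DD (Var f g e w) = ((Src C f, Tgt C g), (e, w), g \<odot> f)"
  "Tgt DD (Var f g e w) = ((Src C f, Tgt C f), (e, FOb (Ps1 W g) w), f)"
  by (simp_all add: Uar_def Var_def Let_def)

abbreviation "Lar f e w \<equiv> Uar f (Id1 C (Tgt C f)) e w"
abbreviation "Rar f e w \<equiv> Var (Id1 C (Src C f)) f e w"
abbreviation "Mar c a b \<equiv> Nar (Id1 C c) (Id1 C c) a b (Id2 C (Id1 C c))"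
abbreviation comp_loc (infixr "\<diamondop>" 70) where "x \<diamondop> y \<equiv> x \<cdot>\<^bsub>T.loc\<^esub> y"

lemma ar_comp: "r \<in> Cell1 DD \<Longrightarrow> s \<in> Cell1 DD \<Longrightarrow> Src DD s = Tgt DD r \<Longrightarrow> T.ar s \<diamondop> T.ar r = T.ar (s \<odot>\<^bsub>DD\<^esub> r)"
  by (simp add: T.ar_Cmp1)

lemma Nar_Nar:
  assumes "h \<in> Cell1 C" "\<phi> \<in> Cell2 C" "Dom2 C \<phi> = h" "Cod2 C \<phi> = h'" "\<phi>' \<in> Cell2 C" "Dom2 C \<phi>' = h'" "Cod2 C \<phi>' = h''"
    "a \<in> Arr (Ps0 E (Src C h))" "b \<in> Arr (Ps0 W (Tgt C h))" "a' \<in> Arr (Ps0 E (Src C h))" "b' \<in> Arr (Ps0 W (Tgt C h))"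
    "Dom (Ps0 E (Src C h)) a' = Cod (Ps0 E (Src C h)) a" "Dom (Ps0 W (Tgt C h)) b' = Cod (Ps0 W (Tgt C h)) b"
  shows "T.ar (Nar h' h'' a' b' \<phi>') \<diamondop> T.ar (Nar h h' a b \<phi>) =
    T.ar (Nar h h'' (a' \<cdot>\<^bsub>Ps0 E (Src C h)\<^esub> a) (b' \<cdot>\<^bsub>Ps0 W (Tgt C h)\<^esub> b) (\<phi>' \<bullet> \<phi>))"
proof -
  have [simp]: "h' \<in> Cell1 C" "h'' \<in> Cell1 C" "Src C h' = Src C h" "Tgt C h' = Tgt C h" "Src C h'' = Src C h" "Tgt C h'' = Tgt C h"
    using assms vert_simps(2)[of \<phi>] vert_simps(2)[of \<phi>'] horiz_simps(1,2)[of \<phi>] horiz_simps(1,2)[of \<phi>'] by auto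
  have "Nar h' h'' a' b' \<phi>' \<odot>\<^bsub>DD\<^esub> Nar h h' a b \<phi> =
      Nar h h'' (a' \<cdot>\<^bsub>Ps0 E (Src C h)\<^esub> a) (b' \<cdot>\<^bsub>Ps0 W (Tgt C h)\<^esub> b) (\<phi>' \<bullet> \<phi>)"
    using assms by (simp add: Nar_def Let_def)
  then show ?thesis
    using assms by (simp add: ar_comp)
qed

lemma UVar_natural:
  assumes [simp]: "f \<in> Cell1 C" "g \<in> Cell1 C" "Src C g = Tgt C f" "a \<in> Arr (Ps0 E (Src C f))" "b \<in> Arr (Ps0 W (Tgt C g))"
  shows "T.ar (Uar f g (Cod (Ps0 E (Src C f)) a) (Cod (Ps0 W (Tgt C g)) b)) \<diamondop>
      T.ar (Nar (g \<odot> f) (g \<odot> f) a b (Id2 C (g \<odot> f))) =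
    T.ar (Nar g g (FArr (Ps1 E f) a) b (Id2 C g)) \<diamondop>
      T.ar (Uar f g (Dom (Ps0 E (Src C f)) a) (Dom (Ps0 W (Tgt C g)) b))"
    and "T.ar (Var f g (Cod (Ps0 E (Src C f)) a) (Cod (Ps0 W (Tgt C g)) b)) \<diamondop>
      T.ar (Nar (g \<odot> f) (g \<odot> f) a b (Id2 C (g \<odot> f))) =
    T.ar (Nar f f a (FArr (Ps1 W g) b) (Id2 C f)) \<diamondop>
      T.ar (Var f g (Dom (Ps0 E (Src C f)) a) (Dom (Ps0 W (Tgt C g)) b))"
  by (simp_all add: ar_comp) (simp_all add: Nar_def Uar_def Var_def Let_def)

lemma ar_2cell: "(r, \<gamma>, s) \<in> Cell2 DD \<Longrightarrow> T.ar r = T.ar s"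
  using T.ar_2cell[of "(r, \<gamma>, s)"] by simp

text \<open>In \<open>\<Delta>\<close> the two sides lie over different 1-cells and are connected by a 2-cell over \<open>\<alpha>\<close>.\<close>

lemma UVar_2cell:
  assumes [simp]: "\<alpha> \<in> Cell2 C" "Dom2 C \<alpha> = f" "Cod2 C \<alpha> = g" "e \<in> Ob (Ps0 E (Src C f))" "w \<in> Ob (Ps0 W (Tgt C f))"
  shows "T.ar (Lar g e w) \<diamondop> T.ar (Nar f g (Idt (Ps0 E (Src C f)) e) (Idt (Ps0 W (Tgt C f)) w) \<alpha>) =
      T.ar (Mar (Tgt C f) (Ps2 E \<alpha> e) (Idt (Ps0 W (Tgt C f)) w)) \<diamondop> T.ar (Lar f e w)" (is "_ \<diamondop> T.ar ?N = T.ar ?M1 \<diamondop> _")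
    and "T.ar (Rar g e w) \<diamondop> T.ar (Nar f g (Idt (Ps0 E (Src C f)) e) (Idt (Ps0 W (Tgt C f)) w) \<alpha>) =
      T.ar (Mar (Src C f) (Idt (Ps0 E (Src C f)) e) (Ps2 W \<alpha> w)) \<diamondop> T.ar (Rar f e w)" (is "_ = T.ar ?M2 \<diamondop> _")
proof -
  have [simp]: "f \<in> Cell1 C" "g \<in> Cell1 C" "Src C g = Src C f" "Tgt C g = Tgt C f"
    using vert_simps(1,2)[of \<alpha>] horiz_simps(1,2)[of \<alpha>] by simp_all
  have "(?M1 \<odot>\<^bsub>DD\<^esub> Lar f e w, (\<alpha>, Id2 C (Id1 C (Tgt C f))), Lar g e w \<odot>\<^bsub>DD\<^esub> ?N) \<in> Cell2 DD"
    "(?M2 \<odot>\<^bsub>DD\<^esub> Rar f e w, (Id2 C (Id1 C (Src C f)), \<alpha>), Rar g e w \<odot>\<^bsub>DD\<^esub> ?N) \<in> Cell2 DD"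
    by (simp_all add: Nar_def Uar_def Var_def Let_def)
  then show "T.ar (Lar g e w) \<diamondop> T.ar ?N = T.ar ?M1 \<diamondop> T.ar (Lar f e w)" "T.ar (Rar g e w) \<diamondop> T.ar ?N = T.ar ?M2 \<diamondop> T.ar (Rar f e w)"
    by (simp_all add: ar_comp ar_2cell)
qed

text \<open>
  Moving \<open>f\<close> and then \<open>g\<close> to the object of \<open>E\<close> agrees with moving \<open>g \<circ> f\<close> up to the coherence of \<open>E\<close>, and dually for \<open>W\<close>. The
  third identity is the square over \<open>(f, g)\<close> that connects the span of \<open>g\<close> at \<open>E f e\<close> with the span of \<open>f\<close> at \<open>W g w\<close>. Together
  the identities say that these two spans compose to the span of \<open>g \<circ> f\<close>.
\<close>

lemma UVar_Cmp1:
  assumes [simp]: "f \<in> Cell1 C" "g \<in> Cell1 C" "Src C g = Tgt C f" "e \<in> Ob (Ps0 E (Src C f))" "w \<in> Ob (Ps0 W (Tgt C g))"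
  shows "T.ar (Mar (Tgt C g) (Coh E g f e) (Idt (Ps0 W (Tgt C g)) w)) \<diamondop> T.ar (Lar g (FOb (Ps1 E f) e) w) \<diamondop>
      T.ar (Uar f g e w) = T.ar (Lar (g \<odot> f) e w)"
    and "T.ar (Mar (Src C f) (Idt (Ps0 E (Src C f)) e) (Coh W f g w)) \<diamondop> T.ar (Rar f e (FOb (Ps1 W g) w)) \<diamondop>
      T.ar (Var f g e w) = T.ar (Rar (g \<odot> f) e w)"
    and "T.ar (Rar g (FOb (Ps1 E f) e) w) \<diamondop> T.ar (Uar f g e w) =
      T.ar (Lar f e (FOb (Ps1 W g) w)) \<diamondop> T.ar (Var f g e w)"
  by (simp_all add: ar_comp T.Cmp1_typed) (simp_all add: Nar_def Uar_def Var_def Let_def)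

text \<open>
  An arrow of \<open>\<Delta>\<close> over \<open>(p, q)\<close> is done in four steps: apply the 2-cell, move \<open>p\<close> to the object of \<open>E\<close>, move \<open>q\<close> to the object of
  \<open>W\<close>, and apply the components \<open>u\<close> and \<open>v\<close>.
\<close>

lemma ar_factor:
  assumes "(((c, d), (e, w), h), ((p, q), (u, v), \<phi>), ((c', d'), (e', w'), h')) \<in> Cell1 DD"
  shows "T.ar (((c, d), (e, w), h), ((p, q), (u, v), \<phi>), ((c', d'), (e', w'), h')) =
    T.ar (Nar h' h' u v (Id2 C h')) \<diamondop> T.ar (Var h' q (FOb (Ps1 E p) e) w) \<diamondop> T.ar (Uar p (q \<odot> h') e w) \<diamondop>
      T.ar (Nar h (q \<odot> h' \<odot> p) (Idt (Ps0 E c) e) (Idt (Ps0 W d) w) \<phi>)"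
proof -
  note [simp] = assms[simplified]
  have 1: "Uar p (q \<odot> h') e w \<odot>\<^bsub>DD\<^esub> Nar h (q \<odot> h' \<odot> p) (Idt (Ps0 E c) e) (Idt (Ps0 W d) w) \<phi> =
      (((c, d), (e, w), h), ((p, Id1 C d), (Idt (Ps0 E c') (FOb (Ps1 E p) e), Idt (Ps0 W d) w), \<phi>),
        ((c', d), (FOb (Ps1 E p) e, w), q \<odot> h'))" (is "?UN = ?r1")
    by (simp add: Nar_def Uar_def Let_def)
  have 2: "Var h' q (FOb (Ps1 E p) e) w \<odot>\<^bsub>DD\<^esub> ?r1 =
      (((c, d), (e, w), h), ((p, q), (Idt (Ps0 E c') (FOb (Ps1 E p) e), Idt (Ps0 W d') (FOb (Ps1 W q) w)), \<phi>),
        ((c', d'), (FOb (Ps1 E p) e, FOb (Ps1 W q) w), h'))" (is "_ = ?r2")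
    by (simp add: Var_def Let_def)
  have 3: "Nar h' h' u v (Id2 C h') \<odot>\<^bsub>DD\<^esub> ?r2 = (((c, d), (e, w), h), ((p, q), (u, v), \<phi>), ((c', d'), (e', w'), h'))"
    by (simp add: Nar_def Let_def)
  have "?r1 \<in> Cell1 DD" "?r2 \<in> Cell1 DD" by simp_all
  then show ?thesis
    unfolding 3[symmetric] by (simp add: ar_comp 1 2)
qed

lemma unit_arr_eq:
  "c \<in> Cell0 C \<Longrightarrow> a \<in> Arr (Ps0 E c) \<Longrightarrow> b \<in> Arr (Ps0 W c) \<Longrightarrow> unit_arr C E W c a b = T.ar (Mar c a b)"
  by (simp add: unit_arr_def unit_ob_def tensor_zz_eq T.ar_def Nar_def Let_def)

lemma unit_cell_eq:
  assumes "f \<in> Cell1 C" "e \<in> Ob (Ps0 E (Src C f))" "w \<in> Ob (Ps0 W (Tgt C f))"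
  shows "unit_cell C E W f e w = T.ar (Rar f e w) \<diamondop> inv_arrow T.loc (T.ar (Lar f e w))"
  using assms T.frac_Bwd_Fwd[of "Lar f e w" "Rar f e w"]
  by (simp add: unit_cell_def unit_ob_def tensor_zz_eq Let_def) (simp add: Uar_def Var_def Let_def)

lemma Mar_Sig:
  assumes "c \<in> Cell0 C" "is_iso (Ps0 E c) a" "is_iso (Ps0 W c) b"
  shows "Mar c a b \<in> Sig"
  using assms is_iso_Arr[OF assms(2)] is_iso_Arr[OF assms(3)]
    is_isoI[of "hom_cat C c c" "Id2 C (Id1 C c)" "Id2 C (Id1 C c)"]
  by (simp add: Nar_def Sig_iff Let_def inverse_arrows_iff)

lemma ar_Mar_Idt:
  assumes "c \<in> Cell0 C" "e \<in> Ob (Ps0 E c)" "w \<in> Ob (Ps0 W c)"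
  shows "T.ar (Mar c (Idt (Ps0 E c) e) (Idt (Ps0 W c) w)) = Idt T.loc (unit_ob C c e w)"
  using T.ar_Id1[of "unit_ob C c e w"] assms by (simp add: Nar_def Let_def unit_ob_def)

lemma Lar_Rar_Id1:
  assumes "c \<in> Cell0 C" "e \<in> Ob (Ps0 E c)" "w \<in> Ob (Ps0 W c)"
  shows "T.ar (Lar (Id1 C c) e w) = Idt T.loc (unit_ob C c e w)" "T.ar (Rar (Id1 C c) e w) = Idt T.loc (unit_ob C c e w)"
  using T.ar_Id1[of "unit_ob C c e w"] assms by (simp_all add: Uar_def Var_def Let_def unit_ob_def)

end

text \<open>
  Conjugation along a pair of spans: if a morphism \<open>N\<close> of spans covers \<open>M\<^sub>1\<close> on the left and \<open>M\<^sub>2\<close> on the right,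
  then \<open>M\<^sub>1\<close> and \<open>M\<^sub>2\<close> are intertwined by the composites of the spans.
\<close>

lemma span_transport:
  assumes X: "category X" and iso: "is_iso X L" "is_iso X L'"
    and arr: "R \<in> Arr X" "R' \<in> Arr X" "N \<in> Arr X" "M1 \<in> Arr X" "M2 \<in> Arr X"
    and dc: "Dom X R = Dom X L" "Dom X R' = Dom X L'" "Dom X N = Dom X L" "Cod X N = Dom X L'"
      "Dom X M1 = Cod X L" "Cod X M1 = Cod X L'" "Dom X M2 = Cod X R" "Cod X M2 = Cod X R'"
    and eq: "L' \<cdot>\<^bsub>X\<^esub> N = M1 \<cdot>\<^bsub>X\<^esub> L" "R' \<cdot>\<^bsub>X\<^esub> N = M2 \<cdot>\<^bsub>X\<^esub> R"
  shows "(R' \<cdot>\<^bsub>X\<^esub> inv_arrow X L') \<cdot>\<^bsub>X\<^esub> M1 = M2 \<cdot>\<^bsub>X\<^esub> (R \<cdot>\<^bsub>X\<^esub> inv_arrow X L)"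
proof (rule iso_cancel_right[OF X iso(1)])
  note [simp] = X iso arr dc is_iso_Arr[OF iso(1)] is_iso_Arr[OF iso(2)]
  have "((R' \<cdot>\<^bsub>X\<^esub> inv_arrow X L') \<cdot>\<^bsub>X\<^esub> M1) \<cdot>\<^bsub>X\<^esub> L = R' \<cdot>\<^bsub>X\<^esub> inv_arrow X L' \<cdot>\<^bsub>X\<^esub> L' \<cdot>\<^bsub>X\<^esub> N"
    by (simp add: eq(1))
  also have "\<dots> = (M2 \<cdot>\<^bsub>X\<^esub> (R \<cdot>\<^bsub>X\<^esub> inv_arrow X L)) \<cdot>\<^bsub>X\<^esub> L"
    by (simp add: eq(2))
  finally show "((R' \<cdot>\<^bsub>X\<^esub> inv_arrow X L') \<cdot>\<^bsub>X\<^esub> M1) \<cdot>\<^bsub>X\<^esub> L = (M2 \<cdot>\<^bsub>X\<^esub> (R \<cdot>\<^bsub>X\<^esub> inv_arrow X L)) \<cdot>\<^bsub>X\<^esub> L" .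
qed (use assms is_iso_Arr in simp_all)

context weight
begin

text \<open>
  Naturality of the unit is \<open>span_transport\<close> for the arrows \<open>Nar\<close> between the vertices of its spans. For a composite 1-cell,
  both sides are compared after composition with the isomorphism from the vertex over \<open>g \<circ> f\<close> to \<open>((k, k), (E g (E f e), w), 1)\<close>.
\<close>

lemma unit_balanced: "balanced C E W T.loc (unit_ob C) (unit_arr C E W) (unit_cell C E W)"
proof (intro balanced.intro balanced_axioms.intro)
  show "weight C E W" by (rule weight_axioms)
  show "category T.loc" by simp
next
  fix f a b assume [simp]: "f \<in> Cell1 C" "a \<in> Arr (Ps0 E (Src C f))" "b \<in> Arr (Ps0 W (Tgt C f))"
  show "unit_cell C E W f (Cod (Ps0 E (Src C f)) a) (Cod (Ps0 W (Tgt C f)) b) \<diamondop>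
        unit_arr C E W (Tgt C f) (FArr (Ps1 E f) a) b =
      unit_arr C E W (Src C f) a (FArr (Ps1 W f) b) \<diamondop>
        unit_cell C E W f (Dom (Ps0 E (Src C f)) a) (Dom (Ps0 W (Tgt C f)) b)"
    using span_transport[OF T.category_loc _ _ _ _ _ _ _ _ _ _ _ _ _ _ _
        UVar_natural(1)[of f "Id1 C (Tgt C f)" a b, simplified]
        UVar_natural(2)[of "Id1 C (Src C f)" f a b, simplified]]
    by (simp add: unit_cell_eq unit_arr_eq)
next
  fix \<alpha> f g e w assume [simp]: "\<alpha> \<in> Cell2 C" "Dom2 C \<alpha> = f" "Cod2 C \<alpha> = g"
    "e \<in> Ob (Ps0 E (Src C f))" "w \<in> Ob (Ps0 W (Tgt C f))"
  have [simp]: "f \<in> Cell1 C" "g \<in> Cell1 C" "Src C g = Src C f" "Tgt C g = Tgt C f"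
    using vert_simps(1,2)[of \<alpha>] horiz_simps(1,2)[of \<alpha>] by simp_all
  show "unit_cell C E W g e w \<diamondop> unit_arr C E W (Tgt C f) (Ps2 E \<alpha> e) (Idt (Ps0 W (Tgt C f)) w) =
      unit_arr C E W (Src C f) (Idt (Ps0 E (Src C f)) e) (Ps2 W \<alpha> w) \<diamondop> unit_cell C E W f e w"
    using span_transport[OF T.category_loc _ _ _ _ _ _ _ _ _ _ _ _ _ _ _
        UVar_2cell(1)[of \<alpha> f g e w, simplified] UVar_2cell(2)[of \<alpha> f g e w, simplified]]
    by (simp add: unit_cell_eq unit_arr_eq)
next
  fix f g e w assume [simp]: "f \<in> Cell1 C" "g \<in> Cell1 C" "Src C g = Tgt C f"
    "e \<in> Ob (Ps0 E (Src C f))" "w \<in> Ob (Ps0 W (Tgt C g))"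
  let ?M1 = "T.ar (Mar (Tgt C g) (Coh E g f e) (Idt (Ps0 W (Tgt C g)) w))"
  let ?M2 = "T.ar (Mar (Src C f) (Idt (Ps0 E (Src C f)) e) (Coh W f g w))"
  let ?Lg = "T.ar (Lar g (FOb (Ps1 E f) e) w)" and ?Lf = "T.ar (Lar f e (FOb (Ps1 W g) w))"
  let ?Rg = "T.ar (Rar g (FOb (Ps1 E f) e) w)" and ?Rf = "T.ar (Rar f e (FOb (Ps1 W g) w))"
  let ?L = "T.ar (Lar (g \<odot> f) e w)" and ?R = "T.ar (Rar (g \<odot> f) e w)"
  let ?U = "T.ar (Uar f g e w)" and ?V = "T.ar (Var f g e w)"
  note eq = UVar_Cmp1[of f g e w, simplified]
  have "((?R \<diamondop> inv_arrow T.loc ?L) \<diamondop> ?M1) \<diamondop> (?Lg \<diamondop> ?U) = ?R \<diamondop> inv_arrow T.loc ?L \<diamondop> (?M1 \<diamondop> ?Lg \<diamondop> ?U)"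
    by simp
  also have "\<dots> = ?M2 \<diamondop> ?Rf \<diamondop> ?V"
    unfolding eq by simp
  also have "\<dots> = ?M2 \<diamondop> ?Rf \<diamondop> inv_arrow T.loc ?Lf \<diamondop> (?Lf \<diamondop> ?V)"
    by simp
  also have "\<dots> = (?M2 \<diamondop> (?Rf \<diamondop> inv_arrow T.loc ?Lf) \<diamondop> (?Rg \<diamondop> inv_arrow T.loc ?Lg)) \<diamondop> (?Lg \<diamondop> ?U)"
    unfolding eq(3)[symmetric] by simp
  finally have "(?R \<diamondop> inv_arrow T.loc ?L) \<diamondop> ?M1 = ?M2 \<diamondop> (?Rf \<diamondop> inv_arrow T.loc ?Lf) \<diamondop> (?Rg \<diamondop> inv_arrow T.loc ?Lg)"
    by (rule iso_cancel_right[rotated 2]) simp_all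
  then show "unit_cell C E W (g \<odot> f) e w \<diamondop> unit_arr C E W (Tgt C g) (Coh E g f e) (Idt (Ps0 W (Tgt C g)) w) =
      unit_arr C E W (Src C f) (Idt (Ps0 E (Src C f)) e) (Coh W f g w) \<diamondop>
        unit_cell C E W f e (FOb (Ps1 W g) w) \<diamondop> unit_cell C E W g (FOb (Ps1 E f) e) w"
    by (simp add: unit_cell_eq unit_arr_eq)
next
  fix c e w assume [simp]: "c \<in> Cell0 C" "e \<in> Ob (Ps0 E c)" "w \<in> Ob (Ps0 W c)"
  show ob: "unit_ob C c e w \<in> Ob T.loc" by (simp add: unit_ob_def)
  show "unit_arr C E W c (Idt (Ps0 E c) e) (Idt (Ps0 W c) w) = Idt T.loc (unit_ob C c e w)"
    by (simp add: unit_arr_eq ar_Mar_Idt)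
  show "unit_cell C E W (Id1 C c) e w = Idt T.loc (unit_ob C c e w)"
    using ob Lar_Rar_Id1[of c e w] by (simp add: unit_cell_eq)
next
  fix c a b a' b' assume [simp]: "c \<in> Cell0 C" "a \<in> Arr (Ps0 E c)" "b \<in> Arr (Ps0 W c)" "a' \<in> Arr (Ps0 E c)"
    "b' \<in> Arr (Ps0 W c)" "Dom (Ps0 E c) a' = Cod (Ps0 E c) a" "Dom (Ps0 W c) b' = Cod (Ps0 W c) b"
  show "unit_arr C E W c (a' \<cdot>\<^bsub>Ps0 E c\<^esub> a) (b' \<cdot>\<^bsub>Ps0 W c\<^esub> b) = unit_arr C E W c a' b' \<diamondop> unit_arr C E W c a b"
    by (simp add: unit_arr_eq Nar_Nar)
qed (simp_all add: unit_arr_eq unit_cell_eq, simp_all add: unit_ob_def)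

text \<open>
  The identities for \<open>Uar\<close>, \<open>Var\<close> and \<open>Nar\<close> express each of these arrows through values of the unit and the arrows \<open>Lar\<close> and \<open>Rar\<close>,
  since the other arrows in them can be cancelled. By \<open>ar_factor\<close> the latter generate the tensor product, which
  is what makes restriction along the unit fully faithful.
\<close>

lemma T_induct:
  assumes "x \<in> Arr T.loc"
    and M: "\<And>c a b. c \<in> Cell0 C \<Longrightarrow> a \<in> Arr (Ps0 E c) \<Longrightarrow> b \<in> Arr (Ps0 W c) \<Longrightarrow> P (T.ar (Mar c a b))"
    and L: "\<And>f e w. f \<in> Cell1 C \<Longrightarrow> e \<in> Ob (Ps0 E (Src C f)) \<Longrightarrow> w \<in> Ob (Ps0 W (Tgt C f)) \<Longrightarrow> P (T.ar (Lar f e w))"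
    and R: "\<And>f e w. f \<in> Cell1 C \<Longrightarrow> e \<in> Ob (Ps0 E (Src C f)) \<Longrightarrow> w \<in> Ob (Ps0 W (Tgt C f)) \<Longrightarrow> P (T.ar (Rar f e w))"
    and inv: "\<And>x. is_iso T.loc x \<Longrightarrow> P x \<Longrightarrow> P (inv_arrow T.loc x)"
    and comp: "\<And>x y. x \<in> Arr T.loc \<Longrightarrow> y \<in> Arr T.loc \<Longrightarrow> Dom T.loc y = Cod T.loc x \<Longrightarrow> P x \<Longrightarrow> P y \<Longrightarrow> P (y \<diamondop> x)"
  shows "P x"
proof -
  (* a class of arrows closed under inverses and composition may be cancelled *)
  have cancel: "P y" if "is_iso T.loc z" "P z" "P (z \<diamondop> y)" "y \<in> Arr T.loc" "Dom T.loc z = Cod T.loc y" for y z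
    using comp[OF _ _ _ that(3) inv[OF that(1,2)]] that is_iso_Arr[OF that(1)] by simp
  have U: "P (T.ar (Uar f g e w))" and V: "P (T.ar (Var f g e w))"
    if [simp]: "f \<in> Cell1 C" "g \<in> Cell1 C" "Src C g = Tgt C f" "e \<in> Ob (Ps0 E (Src C f))" "w \<in> Ob (Ps0 W (Tgt C g))"
    for f g e w
  proof -
    have "P (T.ar (Lar g (FOb (Ps1 E f) e) w) \<diamondop> T.ar (Uar f g e w))"
      by (rule cancel[of "T.ar (Mar (Tgt C g) (Coh E g f e) (Idt (Ps0 W (Tgt C g)) w))"])
        (use L[of "g \<odot> f" e w] in \<open>simp_all add: UVar_Cmp1 Mar_Sig M L\<close>)
    then show U: "P (T.ar (Uar f g e w))"
      by (rule cancel[rotated 2]) (simp_all add: L)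
    have "P (T.ar (Rar g (FOb (Ps1 E f) e) w) \<diamondop> T.ar (Uar f g e w))"
      by (rule comp) (use R[of g "FOb (Ps1 E f) e" w] in \<open>simp_all add: U\<close>)
    then show "P (T.ar (Var f g e w))"
      unfolding UVar_Cmp1[OF that] by (rule cancel[rotated 2]) (simp_all add: L)
  qed
  have N: "P (T.ar (Nar h h a b (Id2 C h)))" if [simp]: "h \<in> Cell1 C" "a \<in> Arr (Ps0 E (Src C h))" "b \<in> Arr (Ps0 W (Tgt C h))"
    for h a b
  proof (rule cancel[of "T.ar (Lar h (Cod (Ps0 E (Src C h)) a) (Cod (Ps0 W (Tgt C h)) b))"])
    show "P (T.ar (Lar h (Cod (Ps0 E (Src C h)) a) (Cod (Ps0 W (Tgt C h)) b)) \<diamondop> T.ar (Nar h h a b (Id2 C h)))"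
      using UVar_natural(1)[of h "Id1 C (Tgt C h)" a b] by (simp add: comp M L)
  qed (simp_all add: L)
  have N\<phi>: "P (T.ar (Nar h h' (Idt (Ps0 E (Src C h)) e) (Idt (Ps0 W (Tgt C h)) w) \<phi>))"
    if [simp]: "\<phi> \<in> Cell2 C" "Dom2 C \<phi> = h" "Cod2 C \<phi> = h'" "e \<in> Ob (Ps0 E (Src C h))" "w \<in> Ob (Ps0 W (Tgt C h))"
    for h h' e w \<phi>
  proof (rule cancel[of "T.ar (Lar h' e w)"])
    have [simp]: "h \<in> Cell1 C" "h' \<in> Cell1 C" "Src C h' = Src C h" "Tgt C h' = Tgt C h"
      using vert_simps(1,2)[of \<phi>] horiz_simps(1,2)[of \<phi>] by simp_all
    show "P (T.ar (Lar h' e w) \<diamondop> T.ar (Nar h h' (Idt (Ps0 E (Src C h)) e) (Idt (Ps0 W (Tgt C h)) w) \<phi>))"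
      using UVar_2cell(1)[of \<phi> h h' e w] by (simp add: comp M L)
    show "is_iso T.loc (T.ar (Lar h' e w))" "P (T.ar (Lar h' e w))"
      "T.ar (Nar h h' (Idt (Ps0 E (Src C h)) e) (Idt (Ps0 W (Tgt C h)) w) \<phi>) \<in> Arr T.loc"
      "Dom T.loc (T.ar (Lar h' e w)) =
        Cod T.loc (T.ar (Nar h h' (Idt (Ps0 E (Src C h)) e) (Idt (Ps0 W (Tgt C h)) w) \<phi>))"
      using L[of h' e w] by simp_all
  qed
  have ar: "P (T.ar r)" if r: "r \<in> Cell1 DD" for r
  proof -
    obtain c d e w h p q u v \<phi> c' d' e' w' h' where
      r_eq: "r = (((c, d), (e, w), h), ((p, q), (u, v), \<phi>), ((c', d'), (e', w'), h'))"
      using r by (rule Delta_Cell1E)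
    note [simp] = r[unfolded r_eq, simplified]
    have "P (T.ar (Nar h (q \<odot> h' \<odot> p) (Idt (Ps0 E c) e) (Idt (Ps0 W d) w) \<phi>))"
      using N\<phi>[of \<phi> h "q \<odot> h' \<odot> p" e w] by simp
    moreover have "P (T.ar (Nar h' h' u v (Id2 C h')))" by (rule N) simp_all
    ultimately show ?thesis
      unfolding r_eq ar_factor[OF r[unfolded r_eq]] by (simp add: comp U V)
  qed
  show ?thesis
    using assms(1)
  proof (induction rule: T.loc_induct[consumes 1])
    case (2 s)
    have "s \<in> Cell1 DD" using 2 T.S_Cell1 by blast
    then show ?case using 2 by (intro inv ar) simp_all
  qed (simp_all add: ar comp)
qed

end

section \<open>Extending a balanced family to the tensor product\<close>

context weight
begin

text \<open>For an arrow \<open>a : E f e \<rightarrow> x\<close> this is the composite \<open>E (g \<circ> f) e \<rightarrow> E g (E f e) \<rightarrow> E g x\<close>.\<close>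

definition act :: "'f \<Rightarrow> 'f \<Rightarrow> 'y \<Rightarrow> 'x \<Rightarrow> 'y" where
  "act g f a e = FArr (Ps1 E g) a \<cdot>\<^bsub>Ps0 E (Tgt C g)\<^esub> inv_arrow (Ps0 E (Tgt C g)) (Coh E g f e)"

lemma act_typed [simp]:
  assumes "f \<in> Cell1 C" "g \<in> Cell1 C" "Src C g = Tgt C f" "e \<in> Ob (Ps0 E (Src C f))"
    "a \<in> Arr (Ps0 E (Tgt C f))" "Dom (Ps0 E (Tgt C f)) a = FOb (Ps1 E f) e" "Tgt C g = k"
  shows "act g f a e \<in> Arr (Ps0 E k)" "Dom (Ps0 E k) (act g f a e) = FOb (Ps1 E (g \<odot> f)) e"
    "Cod (Ps0 E k) (act g f a e) = FOb (Ps1 E g) (Cod (Ps0 E (Tgt C f)) a)"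
  using assms cells1_simps(1,2)[OF assms(1)] cells1_simps(1,2)[OF assms(2)]
  by (simp_all add: act_def)

lemma E_iso:
  assumes "f \<in> Cell1 C" "is_iso (Ps0 E (Src C f)) a" "Tgt C f = d"
  shows "is_iso (Ps0 E d) (FArr (Ps1 E f) a)"
  using assms functor_iso(1)[OF E.Ps0_cat E.Ps0_cat E.Ps1_functor[of f "Src C f" d]] cells1_simps(1,2)[OF assms(1)] by auto

lemma act_iso:
  assumes "f \<in> Cell1 C" "g \<in> Cell1 C" "Src C g = Tgt C f" "e \<in> Ob (Ps0 E (Src C f))"
    "is_iso (Ps0 E (Tgt C f)) a" "Dom (Ps0 E (Tgt C f)) a = FOb (Ps1 E f) e" "Tgt C g = k"
  shows "is_iso (Ps0 E k) (act g f a e)"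
  using assms is_iso_Arr[OF assms(5)] cells1_simps(1,2)[OF assms(1)] cells1_simps(1,2)[OF assms(2)]
  by (simp add: act_def E_iso)

lemma act_Comp:
  assumes "f \<in> Cell1 C" "g \<in> Cell1 C" "Src C g = Tgt C f" "e \<in> Ob (Ps0 E (Src C f))"
    "a \<in> Arr (Ps0 E (Tgt C f))" "Dom (Ps0 E (Tgt C f)) a = FOb (Ps1 E f) e" "Tgt C f = d" "Tgt C g = k"
    "b \<in> Arr (Ps0 E (Tgt C f))" "Dom (Ps0 E (Tgt C f)) b = Cod (Ps0 E (Tgt C f)) a"
  shows "act g f (b \<cdot>\<^bsub>Ps0 E d\<^esub> a) e = FArr (Ps1 E g) b \<cdot>\<^bsub>Ps0 E k\<^esub> act g f a e"
  using assms cells1_simps(1,2)[OF assms(1)] cells1_simps(1,2)[OF assms(2)]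
  by (simp add: act_def)

lemma act_2cell:
  assumes "f \<in> Cell1 C" "g \<in> Cell1 C" "Src C g = Tgt C f" "e \<in> Ob (Ps0 E (Src C f))"
    and \<alpha>: "\<alpha> \<in> Cell2 C" "Dom2 C \<alpha> = f" "Cod2 C \<alpha> = f'" and \<beta>: "\<beta> \<in> Cell2 C" "Dom2 C \<beta> = g" "Cod2 C \<beta> = g'"
    and a: "a \<in> Arr (Ps0 E d)" "Dom (Ps0 E d) a = FOb (Ps1 E f') e" and k: "Tgt C g = k" "Tgt C f = d"
  shows "act g' f' a e \<cdot>\<^bsub>Ps0 E k\<^esub> Ps2 E (\<beta> \<star> \<alpha>) e =
    Ps2 E \<beta> (Cod (Ps0 E d) a) \<cdot>\<^bsub>Ps0 E k\<^esub> act g f (a \<cdot>\<^bsub>Ps0 E d\<^esub> Ps2 E \<alpha> e) e"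
proof -
  have [simp]: "f' \<in> Cell1 C" "g' \<in> Cell1 C" "Src C f' = Src C f" "Src C g' = Src C g" "Tgt C f' = Tgt C f" "Tgt C g' = Tgt C g"
    using \<alpha> \<beta> vert_simps(2)[of \<alpha>] vert_simps(2)[of \<beta>] horiz_simps(1,2)[of \<alpha>] horiz_simps(1,2)[of \<beta>] by auto
  note [simp] = assms cells1_simps(1,2)[OF assms(1), unfolded k] cells1_simps(1,2)[OF assms(2), unfolded k]
  have A: "Cod (Ps0 E d) a \<in> Ob (Ps0 E d)" using cat_simps(2)[of "Ps0 E d" a] a k by simp
  have "(Idt (Ps0 E k) (FOb (Ps1 E g') (Cod (Ps0 E d) a)) \<cdot>\<^bsub>Ps0 E k\<^esub> FArr (Ps1 E g') a \<cdot>\<^bsub>Ps0 E k\<^esub>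
      inv_arrow (Ps0 E k) (Coh E g' f' e)) \<cdot>\<^bsub>Ps0 E k\<^esub> Ps2 E (\<beta> \<star> \<alpha>) e =
    (Idt (Ps0 E k) (FOb (Ps1 E g') (Cod (Ps0 E d) a)) \<cdot>\<^bsub>Ps0 E k\<^esub> Ps2 E \<beta> (Cod (Ps0 E d) a)) \<cdot>\<^bsub>Ps0 E k\<^esub>
      FArr (Ps1 E g) (a \<cdot>\<^bsub>Ps0 E d\<^esub> Ps2 E \<alpha> e) \<cdot>\<^bsub>Ps0 E k\<^esub> inv_arrow (Ps0 E k) (Coh E g f e)"
    by (rule E.transport_HComp[where k = "Src C f" and l = d]) (use A in simp_all)
  then show ?thesis
    using A by (simp add: act_def)
qed

text \<open>
  This is the associativity law of the coherence isomorphisms of \<open>E\<close>, written with the inverses that occur in \<open>\<Delta>\<close>.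
\<close>

lemma Coh_act:
  assumes "f \<in> Cell1 C" "g \<in> Cell1 C" "h \<in> Cell1 C" "Src C g = Tgt C f" "Src C h = Tgt C g" "e \<in> Ob (Ps0 E (Src C f))"
    "a \<in> Arr (Ps0 E d)" "Dom (Ps0 E d) a = FOb (Ps1 E f) e" "Tgt C f = d" "Tgt C h = k"
  shows "Coh E h g (Cod (Ps0 E d) a) \<cdot>\<^bsub>Ps0 E k\<^esub> act h (g \<odot> f) (act g f a e) e = act (h \<odot> g) f a e"
proof (rule iso_cancel_right[where f = "Coh E h (g \<odot> f) e \<cdot>\<^bsub>Ps0 E k\<^esub> FArr (Ps1 E h) (Coh E g f e)" and C = "Ps0 E k"])
  have [simp]: "d \<in> Cell0 C" "k \<in> Cell0 C" using assms by auto
  note [simp] = assms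
  let ?X = "Ps0 E k"
  have [simp]: "Cod (Ps0 E d) a \<in> Ob (Ps0 E d)" using cat_simps(2)[of "Ps0 E d" a] assms by simp
  have i: "FArr (Ps1 E h) (inv_arrow (Ps0 E (Tgt C g)) (Coh E g f e)) \<cdot>\<^bsub>Ps0 E (Tgt C h)\<^esub> FArr (Ps1 E h) (Coh E g f e) =
      FArr (Ps1 E h) (inv_arrow (Ps0 E (Tgt C g)) (Coh E g f e) \<cdot>\<^bsub>Ps0 E (Tgt C g)\<^esub> Coh E g f e)"
    by (rule E.Ps1_simps(6)[symmetric]) simp_all
  have j: "FArr (Ps1 E h) (inv_arrow (Ps0 E (Tgt C g)) (Coh E g f e)) \<cdot>\<^bsub>?X\<^esub> FArr (Ps1 E h) (Coh E g f e) =
      Idt ?X (FOb (Ps1 E h) (FOb (Ps1 E g) (FOb (Ps1 E f) e)))"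
    using i by simp
  have "(Coh E h g (Cod (Ps0 E d) a) \<cdot>\<^bsub>?X\<^esub> act h (g \<odot> f) (act g f a e) e) \<cdot>\<^bsub>?X\<^esub>
      (Coh E h (g \<odot> f) e \<cdot>\<^bsub>?X\<^esub> FArr (Ps1 E h) (Coh E g f e)) =
    Coh E h g (Cod (Ps0 E d) a) \<cdot>\<^bsub>?X\<^esub> FArr (Ps1 E h) (FArr (Ps1 E g) a) \<cdot>\<^bsub>?X\<^esub>
      (FArr (Ps1 E h) (inv_arrow (Ps0 E (Tgt C g)) (Coh E g f e)) \<cdot>\<^bsub>?X\<^esub> FArr (Ps1 E h) (Coh E g f e))"
    by (simp add: act_def del: E_simps(7))
      (simp add: E.Ps1_simps(6))
  also have "\<dots> = FArr (Ps1 E (h \<odot> g)) a \<cdot>\<^bsub>?X\<^esub> Coh E h g (FOb (Ps1 E f) e)"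
    using E.Coh_natural[of g h a d k] by (simp add: j)
  also have "\<dots> = act (h \<odot> g) f a e \<cdot>\<^bsub>?X\<^esub> (Coh E (h \<odot> g) f e \<cdot>\<^bsub>?X\<^esub> Coh E h g (FOb (Ps1 E f) e))"
    by (simp add: act_def)
  also have "\<dots> = act (h \<odot> g) f a e \<cdot>\<^bsub>?X\<^esub> (Coh E h (g \<odot> f) e \<cdot>\<^bsub>?X\<^esub> FArr (Ps1 E h) (Coh E g f e))"
    using Coh_assoc[of f "Src C f" d g "Tgt C g" h k e] by simp
  finally show "(Coh E h g (Cod (Ps0 E d) a) \<cdot>\<^bsub>?X\<^esub> act h (g \<odot> f) (act g f a e) e) \<cdot>\<^bsub>?X\<^esub>
      (Coh E h (g \<odot> f) e \<cdot>\<^bsub>?X\<^esub> FArr (Ps1 E h) (Coh E g f e)) =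
    act (h \<odot> g) f a e \<cdot>\<^bsub>?X\<^esub> (Coh E h (g \<odot> f) e \<cdot>\<^bsub>?X\<^esub> FArr (Ps1 E h) (Coh E g f e))" .
qed (use assms cat_simps(2)[of "Ps0 E d" a] cells1_simps(1,2)[OF assms(1)] cells1_simps(1,2)[OF assms(3)]
    in \<open>simp_all add: E_iso\<close>)

lemma act_act:
  assumes "f \<in> Cell1 C" "g \<in> Cell1 C" "h \<in> Cell1 C" "Src C g = Tgt C f" "Src C h = Tgt C g" "e \<in> Ob (Ps0 E (Src C f))"
    "a \<in> Arr (Ps0 E d)" "Dom (Ps0 E d) a = FOb (Ps1 E f) e" "Tgt C f = d" "Tgt C g = l" "Tgt C h = k"
    "b \<in> Arr (Ps0 E l)" "Dom (Ps0 E l) b = FOb (Ps1 E g) (Cod (Ps0 E d) a)"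
  shows "act h g b (Cod (Ps0 E d) a) \<cdot>\<^bsub>Ps0 E k\<^esub> act (h \<odot> g) f a e = act h (g \<odot> f) (b \<cdot>\<^bsub>Ps0 E l\<^esub> act g f a e) e"
proof -
  have [simp]: "d \<in> Cell0 C" "l \<in> Cell0 C" "k \<in> Cell0 C" using assms by auto
  note [simp] = assms
  have [simp]: "Cod (Ps0 E d) a \<in> Ob (Ps0 E d)" using cat_simps(2)[of "Ps0 E d" a] assms by simp
  have "act h g b (Cod (Ps0 E d) a) \<cdot>\<^bsub>Ps0 E k\<^esub> act (h \<odot> g) f a e =
      act h g b (Cod (Ps0 E d) a) \<cdot>\<^bsub>Ps0 E k\<^esub> Coh E h g (Cod (Ps0 E d) a) \<cdot>\<^bsub>Ps0 E k\<^esub> act h (g \<odot> f) (act g f a e) e"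
    using Coh_act[of f g h e a d k] by simp
  also have "\<dots> = FArr (Ps1 E h) b \<cdot>\<^bsub>Ps0 E k\<^esub> act h (g \<odot> f) (act g f a e) e"
    by (simp add: act_def[of h g])
  also have "\<dots> = act h (g \<odot> f) (b \<cdot>\<^bsub>Ps0 E l\<^esub> act g f a e) e"
    by (simp add: act_Comp)
  finally show ?thesis .
qed

text \<open>
  The component in \<open>E\<close> of the value of the extension on an arrow of \<open>\<Delta>\<close> over \<open>(p, q)\<close>: the composite
  \<open>E h e \<rightarrow> E (q \<circ> h' \<circ> p) e \<rightarrow> E q (E (h' \<circ> p) e) \<rightarrow> E q (E h' e')\<close> built from the 2-cell \<open>\<phi>\<close>, coherence, and \<open>u\<close>.
\<close>

definition sg :: "'f \<Rightarrow> 'f \<Rightarrow> 'f \<Rightarrow> 'y \<Rightarrow> 't \<Rightarrow> 'x \<Rightarrow> 'y" where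
  "sg h' p q u \<phi> e = act q (h' \<odot> p) (act h' p u e) e \<cdot>\<^bsub>Ps0 E (Tgt C q)\<^esub> Ps2 E \<phi> e"

context
  fixes c d e w h p q u v \<phi> c' d' e' w' h'
  assumes r: "(((c, d), (e, w), h), ((p, q), (u, v), \<phi>), ((c', d'), (e', w'), h')) \<in> Cell1 DD"
begin

lemma sg_typed:
  "sg h' p q u \<phi> e \<in> Arr (Ps0 E d)" "Dom (Ps0 E d) (sg h' p q u \<phi> e) = FOb (Ps1 E h) e"
  "Cod (Ps0 E d) (sg h' p q u \<phi> e) = FOb (Ps1 E q) (FOb (Ps1 E h') e')"
  using r[simplified] by (simp_all add: sg_def)

text \<open>
  The components in \<open>E\<close> compose up to the coherence isomorphism for \<open>q\<close> and \<open>q'\<close>. The second 2-cell \<open>\<phi>'\<close> has to be moved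
  past \<open>u\<close> and then past \<open>q\<close> (\<open>act_2cell\<close>); what is left is the associativity law \<open>Coh_act\<close>.
\<close>

lemma sg_Cmp1:
  assumes s: "(((c', d'), (e', w'), h'), ((p', q'), (u', v'), \<phi>'), ((c'', d''), (e'', w''), h'')) \<in> Cell1 DD"
  shows "sg h'' (p' \<odot> p) (q \<odot> q') (u' \<cdot>\<^bsub>Ps0 E c''\<^esub> act p' p u e) ((Id2 C q \<star> \<phi>' \<star> Id2 C p) \<bullet> \<phi>) e =
    Coh E q q' (FOb (Ps1 E h'') e'') \<cdot>\<^bsub>Ps0 E d\<^esub> FArr (Ps1 E q) (sg h'' p' q' u' \<phi>' e') \<cdot>\<^bsub>Ps0 E d\<^esub> sg h' p q u \<phi> e"
proof -
  note [simp] = r[simplified] s[simplified]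
  let ?x = "act h'' (p' \<odot> p) (u' \<cdot>\<^bsub>Ps0 E c''\<^esub> act p' p u e) e"
  have 1: "act h'' p' u' e' \<cdot>\<^bsub>Ps0 E d''\<^esub> act (h'' \<odot> p') p u e = ?x"
    using act_act[of p p' h'' e u c' c'' d'' u'] by simp
  have "sg h'' p' q' u' \<phi>' e' \<cdot>\<^bsub>Ps0 E d'\<^esub> act h' p u e =
      act q' (h'' \<odot> p') (act h'' p' u' e') e' \<cdot>\<^bsub>Ps0 E d'\<^esub> (Ps2 E \<phi>' e' \<cdot>\<^bsub>Ps0 E d'\<^esub> act h' p u e)"
    by (simp add: sg_def)
  also have "Ps2 E \<phi>' e' \<cdot>\<^bsub>Ps0 E d'\<^esub> act h' p u e = act (q' \<odot> h'' \<odot> p') p u e \<cdot>\<^bsub>Ps0 E d'\<^esub> Ps2 E (\<phi>' \<star> Id2 C p) e"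
    using act_2cell[of p h' e "Id2 C p" p \<phi>' "q' \<odot> h'' \<odot> p'" u c' d'] by simp
  also have "act q' (h'' \<odot> p') (act h'' p' u' e') e' \<cdot>\<^bsub>Ps0 E d'\<^esub> act (q' \<odot> h'' \<odot> p') p u e \<cdot>\<^bsub>Ps0 E d'\<^esub> Ps2 E (\<phi>' \<star> Id2 C p) e =
      (act q' (h'' \<odot> p') (act h'' p' u' e') e' \<cdot>\<^bsub>Ps0 E d'\<^esub> act (q' \<odot> h'' \<odot> p') p u e) \<cdot>\<^bsub>Ps0 E d'\<^esub> Ps2 E (\<phi>' \<star> Id2 C p) e"
    by simp
  also have "act q' (h'' \<odot> p') (act h'' p' u' e') e' \<cdot>\<^bsub>Ps0 E d'\<^esub> act (q' \<odot> h'' \<odot> p') p u e =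
      act q' (h'' \<odot> p' \<odot> p) ?x e"
    using act_act[of p "h'' \<odot> p'" q' e u c' d'' d' "act h'' p' u' e'"] by (simp add: 1)
  finally have 2: "sg h'' p' q' u' \<phi>' e' \<cdot>\<^bsub>Ps0 E d'\<^esub> act h' p u e =
      act q' (h'' \<odot> p' \<odot> p) ?x e \<cdot>\<^bsub>Ps0 E d'\<^esub> Ps2 E (\<phi>' \<star> Id2 C p) e" .
  have s': "sg h'' p' q' u' \<phi>' e' \<in> Arr (Ps0 E d')" "Dom (Ps0 E d') (sg h'' p' q' u' \<phi>' e') = FOb (Ps1 E h') e'"
    "Cod (Ps0 E d') (sg h'' p' q' u' \<phi>' e') = FOb (Ps1 E q') (FOb (Ps1 E h'') e'')"
    by (simp_all add: sg_def)
  have "FArr (Ps1 E q) (sg h'' p' q' u' \<phi>' e') \<cdot>\<^bsub>Ps0 E d\<^esub> act q (h' \<odot> p) (act h' p u e) e =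
      act q (h' \<odot> p) (sg h'' p' q' u' \<phi>' e' \<cdot>\<^bsub>Ps0 E d'\<^esub> act h' p u e) e"
    using act_Comp[of "h' \<odot> p" q e "act h' p u e" d' d "sg h'' p' q' u' \<phi>' e'"] s' by simp
  also have "\<dots> = act q (q' \<odot> h'' \<odot> p' \<odot> p) (act q' (h'' \<odot> p' \<odot> p) ?x e) e \<cdot>\<^bsub>Ps0 E d\<^esub> Ps2 E (Id2 C q \<star> \<phi>' \<star> Id2 C p) e"
    unfolding 2
    using act_2cell[of "h' \<odot> p" q e "\<phi>' \<star> Id2 C p" "q' \<odot> h'' \<odot> p' \<odot> p" "Id2 C q" q "act q' (h'' \<odot> p' \<odot> p) ?x e" d' d]
    by simp
  finally have 3: "FArr (Ps1 E q) (sg h'' p' q' u' \<phi>' e') \<cdot>\<^bsub>Ps0 E d\<^esub> act q (h' \<odot> p) (act h' p u e) e =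
      act q (q' \<odot> h'' \<odot> p' \<odot> p) (act q' (h'' \<odot> p' \<odot> p) ?x e) e \<cdot>\<^bsub>Ps0 E d\<^esub> Ps2 E (Id2 C q \<star> \<phi>' \<star> Id2 C p) e" .
  have 4: "act (q \<odot> q') (h'' \<odot> p' \<odot> p) ?x e =
      Coh E q q' (FOb (Ps1 E h'') e'') \<cdot>\<^bsub>Ps0 E d\<^esub> act q (q' \<odot> h'' \<odot> p' \<odot> p) (act q' (h'' \<odot> p' \<odot> p) ?x e) e"
    using Coh_act[of "h'' \<odot> p' \<odot> p" q' q e ?x d'' d] by simp
  have "Coh E q q' (FOb (Ps1 E h'') e'') \<cdot>\<^bsub>Ps0 E d\<^esub> FArr (Ps1 E q) (sg h'' p' q' u' \<phi>' e') \<cdot>\<^bsub>Ps0 E d\<^esub> sg h' p q u \<phi> e =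
      Coh E q q' (FOb (Ps1 E h'') e'') \<cdot>\<^bsub>Ps0 E d\<^esub> (FArr (Ps1 E q) (sg h'' p' q' u' \<phi>' e') \<cdot>\<^bsub>Ps0 E d\<^esub>
        act q (h' \<odot> p) (act h' p u e) e) \<cdot>\<^bsub>Ps0 E d\<^esub> Ps2 E \<phi> e"
    using s' by (simp add: sg_def[of h'])
  also have "\<dots> = act (q \<odot> q') (h'' \<odot> p' \<odot> p) ?x e \<cdot>\<^bsub>Ps0 E d\<^esub> Ps2 E ((Id2 C q \<star> \<phi>' \<star> Id2 C p) \<bullet> \<phi>) e"
    unfolding 3 4 by simp
  finally show ?thesis by (simp add: sg_def[of h''])
qed

lemma sg_2cell:
  assumes s: "(((c, d), (e, w), h), ((p1, q1), (u1, v1), \<phi>1), ((c', d'), (e', w'), h')) \<in> Cell1 DD"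
    and \<alpha>\<beta>: "\<alpha> \<in> Cell2 C" "Dom2 C \<alpha> = p" "Cod2 C \<alpha> = p1" "\<beta> \<in> Cell2 C" "Dom2 C \<beta> = q" "Cod2 C \<beta> = q1"
    and eq: "u1 \<cdot>\<^bsub>Ps0 E c'\<^esub> Ps2 E \<alpha> e = u" "(\<beta> \<star> Id2 C h' \<star> \<alpha>) \<bullet> \<phi> = \<phi>1"
  shows "sg h' p1 q1 u1 \<phi>1 e = Ps2 E \<beta> (FOb (Ps1 E h') e') \<cdot>\<^bsub>Ps0 E d\<^esub> sg h' p q u \<phi> e"
proof -
  note [simp] = r[simplified] s[simplified] \<alpha>\<beta>
  have 1: "act h' p1 u1 e \<cdot>\<^bsub>Ps0 E d'\<^esub> Ps2 E (Id2 C h' \<star> \<alpha>) e = act h' p u e"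
    using act_2cell[of p h' e \<alpha> p1 "Id2 C h'" h' u1 c' d'] by (simp add: eq)
  have 2: "act q1 (h' \<odot> p1) (act h' p1 u1 e) e \<cdot>\<^bsub>Ps0 E d\<^esub> Ps2 E (\<beta> \<star> Id2 C h' \<star> \<alpha>) e =
      Ps2 E \<beta> (FOb (Ps1 E h') e') \<cdot>\<^bsub>Ps0 E d\<^esub> act q (h' \<odot> p) (act h' p u e) e"
    using act_2cell[of "h' \<odot> p" q e "Id2 C h' \<star> \<alpha>" "h' \<odot> p1" \<beta> q1 "act h' p1 u1 e" d' d] by (simp add: 1)
  have "sg h' p1 q1 u1 \<phi>1 e =
      (act q1 (h' \<odot> p1) (act h' p1 u1 e) e \<cdot>\<^bsub>Ps0 E d\<^esub> Ps2 E (\<beta> \<star> Id2 C h' \<star> \<alpha>) e) \<cdot>\<^bsub>Ps0 E d\<^esub> Ps2 E \<phi> e"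
    by (simp add: sg_def eq(2)[symmetric])
  also have "\<dots> = Ps2 E \<beta> (FOb (Ps1 E h') e') \<cdot>\<^bsub>Ps0 E d\<^esub> sg h' p q u \<phi> e"
    unfolding 2 by (simp add: sg_def)
  finally show ?thesis .
qed

lemma sg_iso:
  assumes "is_iso (Ps0 E c') u" "is_iso (hom_cat C c d) \<phi>"
  shows "is_iso (Ps0 E d) (sg h' p q u \<phi> e)"
proof -
  note [simp] = r[simplified]
  obtain \<psi> where "inverse_arrows (hom_cat C c d) \<phi> \<psi>" using assms(2) by (auto simp: is_iso_def)
  then have \<psi>: "\<psi> \<in> Cell2 C" "Dom2 C \<psi> = q \<odot> h' \<odot> p" "Cod2 C \<psi> = h" "\<psi> \<bullet> \<phi> = Id2 C h" "\<phi> \<bullet> \<psi> = Id2 C (q \<odot> h' \<odot> p)"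
    by (auto simp: inverse_arrows_iff)
  have "Ps2 E \<psi> e \<cdot>\<^bsub>Ps0 E d\<^esub> Ps2 E \<phi> e = Idt (Ps0 E d) (FOb (Ps1 E h) e)"
    "Ps2 E \<phi> e \<cdot>\<^bsub>Ps0 E d\<^esub> Ps2 E \<psi> e = Idt (Ps0 E d) (FOb (Ps1 E (q \<odot> h' \<odot> p)) e)"
    using arg_cong[OF \<psi>(4), of "\<lambda>\<phi>. Ps2 E \<phi> e"] arg_cong[OF \<psi>(5), of "\<lambda>\<phi>. Ps2 E \<phi> e"] \<psi>(1-3) by simp_all
  then have "inverse_arrows (Ps0 E d) (Ps2 E \<phi> e) (Ps2 E \<psi> e)"
    using \<psi>(1-3) by (simp add: inverse_arrows_iff)
  then have [simp]: "is_iso (Ps0 E d) (Ps2 E \<phi> e)" by (rule is_isoI)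
  show ?thesis
    using assms(1) is_iso_Arr[OF assms(1)] by (simp add: sg_def act_iso)
qed

end

end

text \<open>
  The shape of the computation in \<open>gval_Comp\<close>, with the arrows made opaque: two composites of three arrows are brought into the
  form of one by moving \<open>c\<close> to the right and \<open>d\<close> to the left.
\<close>

lemma exchange_chain:
  assumes X: "category X" and arr: "a \<in> Arr X" "b \<in> Arr X" "c \<in> Arr X" "d \<in> Arr X" "e \<in> Arr X" "f \<in> Arr X"
    "c1 \<in> Arr X" "d1 \<in> Arr X" "b2 \<in> Arr X" "d2 \<in> Arr X" "c2 \<in> Arr X" "e1 \<in> Arr X" "i \<in> Arr X" "t \<in> Arr X" "k \<in> Arr X"
    and dc: "Dom X a = Cod X b" "Dom X b = Cod X c" "Dom X c = Cod X d" "Dom X d = Cod X e" "Dom X e = Cod X f"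
      "Dom X d1 = Cod X c1" "Dom X d2 = Cod X b2" "Dom X e1 = Cod X c2" "Dom X i = Cod X t" "Dom X t = Cod X k"
      "Cod X d1 = Cod X c" "Cod X d2 = Cod X b" "Dom X c1 = Dom X d" "Dom X b2 = Dom X d1" "Cod X i = Cod X b2"
      "Dom X k = Cod X c2" "Dom X c2 = Dom X e" "Cod X e1 = Cod X c1"
    and eq: "c \<cdot>\<^bsub>X\<^esub> d = d1 \<cdot>\<^bsub>X\<^esub> c1" "b \<cdot>\<^bsub>X\<^esub> d1 = d2 \<cdot>\<^bsub>X\<^esub> b2" "c1 \<cdot>\<^bsub>X\<^esub> e = e1 \<cdot>\<^bsub>X\<^esub> c2"
      "b2 \<cdot>\<^bsub>X\<^esub> e1 = i \<cdot>\<^bsub>X\<^esub> t \<cdot>\<^bsub>X\<^esub> k"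
  shows "(a \<cdot>\<^bsub>X\<^esub> b \<cdot>\<^bsub>X\<^esub> c) \<cdot>\<^bsub>X\<^esub> (d \<cdot>\<^bsub>X\<^esub> e \<cdot>\<^bsub>X\<^esub> f) = (a \<cdot>\<^bsub>X\<^esub> d2 \<cdot>\<^bsub>X\<^esub> i) \<cdot>\<^bsub>X\<^esub> t \<cdot>\<^bsub>X\<^esub> (k \<cdot>\<^bsub>X\<^esub> c2 \<cdot>\<^bsub>X\<^esub> f)"
proof -
  note [simp] = X arr dc
  have "(a \<cdot>\<^bsub>X\<^esub> b \<cdot>\<^bsub>X\<^esub> c) \<cdot>\<^bsub>X\<^esub> (d \<cdot>\<^bsub>X\<^esub> e \<cdot>\<^bsub>X\<^esub> f) = a \<cdot>\<^bsub>X\<^esub> b \<cdot>\<^bsub>X\<^esub> (c \<cdot>\<^bsub>X\<^esub> d) \<cdot>\<^bsub>X\<^esub> e \<cdot>\<^bsub>X\<^esub> f" by simp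
  also have "\<dots> = a \<cdot>\<^bsub>X\<^esub> (b \<cdot>\<^bsub>X\<^esub> d1) \<cdot>\<^bsub>X\<^esub> (c1 \<cdot>\<^bsub>X\<^esub> e) \<cdot>\<^bsub>X\<^esub> f" unfolding eq(1) by simp
  also have "\<dots> = a \<cdot>\<^bsub>X\<^esub> d2 \<cdot>\<^bsub>X\<^esub> (b2 \<cdot>\<^bsub>X\<^esub> e1) \<cdot>\<^bsub>X\<^esub> c2 \<cdot>\<^bsub>X\<^esub> f" unfolding eq(2,3) by simp
  also have "\<dots> = (a \<cdot>\<^bsub>X\<^esub> d2 \<cdot>\<^bsub>X\<^esub> i) \<cdot>\<^bsub>X\<^esub> t \<cdot>\<^bsub>X\<^esub> (k \<cdot>\<^bsub>X\<^esub> c2 \<cdot>\<^bsub>X\<^esub> f)" unfolding eq(4) by simp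
  finally show ?thesis .
qed

context balanced
begin

lemmas A_cat [simp] = A.category_axioms

lemma M_simps [simp]:
  "c \<in> Cell0 C \<Longrightarrow> e \<in> Ob (Ps0 E c) \<Longrightarrow> w \<in> Ob (Ps0 W c) \<Longrightarrow> Mo c e w \<in> Ob A"
  "c \<in> Cell0 C \<Longrightarrow> a \<in> Arr (Ps0 E c) \<Longrightarrow> b \<in> Arr (Ps0 W c) \<Longrightarrow> Ma c a b \<in> Arr A"
  "c \<in> Cell0 C \<Longrightarrow> a \<in> Arr (Ps0 E c) \<Longrightarrow> b \<in> Arr (Ps0 W c) \<Longrightarrow>
    Dom A (Ma c a b) = Mo c (Dom (Ps0 E c) a) (Dom (Ps0 W c) b)"
  "c \<in> Cell0 C \<Longrightarrow> a \<in> Arr (Ps0 E c) \<Longrightarrow> b \<in> Arr (Ps0 W c) \<Longrightarrow>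
    Cod A (Ma c a b) = Mo c (Cod (Ps0 E c) a) (Cod (Ps0 W c) b)"
  "c \<in> Cell0 C \<Longrightarrow> e \<in> Ob (Ps0 E c) \<Longrightarrow> w \<in> Ob (Ps0 W c) \<Longrightarrow> Ma c (Idt (Ps0 E c) e) (Idt (Ps0 W c) w) = Idt A (Mo c e w)"
  using Mo_Ob Ma_typed Ma_Idt by blast+

lemma t_simps [simp]:
  assumes "f \<in> Cell1 C" "e \<in> Ob (Ps0 E (Src C f))" "w \<in> Ob (Ps0 W (Tgt C f))"
  shows "t f e w \<in> Arr A" "is_iso A (t f e w)" "Dom A (t f e w) = Mo (Tgt C f) (FOb (Ps1 E f) e) w"
    "Cod A (t f e w) = Mo (Src C f) e (FOb (Ps1 W f) w)"
  using t_typed[OF assms] is_iso_Arr by auto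

lemma Ma_Comp_left:
  assumes "c \<in> Cell0 C" "a \<in> Arr (Ps0 E c)" "a' \<in> Arr (Ps0 E c)" "Dom (Ps0 E c) a' = Cod (Ps0 E c) a" "w \<in> Ob (Ps0 W c)"
  shows "Ma c (a' \<cdot>\<^bsub>Ps0 E c\<^esub> a) (Idt (Ps0 W c) w) = Ma c a' (Idt (Ps0 W c) w) \<cdot>\<^bsub>A\<^esub> Ma c a (Idt (Ps0 W c) w)"
  using Ma_Comp[of c a "Idt (Ps0 W c) w" a' "Idt (Ps0 W c) w"] assms by simp

lemma Ma_Comp_right:
  assumes "c \<in> Cell0 C" "b \<in> Arr (Ps0 W c)" "b' \<in> Arr (Ps0 W c)" "Dom (Ps0 W c) b' = Cod (Ps0 W c) b" "e \<in> Ob (Ps0 E c)"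
  shows "Ma c (Idt (Ps0 E c) e) (b' \<cdot>\<^bsub>Ps0 W c\<^esub> b) = Ma c (Idt (Ps0 E c) e) b' \<cdot>\<^bsub>A\<^esub> Ma c (Idt (Ps0 E c) e) b"
  using Ma_Comp[of c "Idt (Ps0 E c) e" b "Idt (Ps0 E c) e" b'] assms by simp

lemma Ma_split:
  assumes "c \<in> Cell0 C" "a \<in> Arr (Ps0 E c)" "b \<in> Arr (Ps0 W c)"
  shows "Ma c (Idt (Ps0 E c) (Cod (Ps0 E c) a)) b \<cdot>\<^bsub>A\<^esub> Ma c a (Idt (Ps0 W c) (Dom (Ps0 W c) b)) = Ma c a b"
    and "Ma c a (Idt (Ps0 W c) (Cod (Ps0 W c) b)) \<cdot>\<^bsub>A\<^esub> Ma c (Idt (Ps0 E c) (Dom (Ps0 E c) a)) b = Ma c a b"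
  using Ma_Comp[of c a "Idt (Ps0 W c) (Dom (Ps0 W c) b)" "Idt (Ps0 E c) (Cod (Ps0 E c) a)" b]
    Ma_Comp[of c "Idt (Ps0 E c) (Dom (Ps0 E c) a)" b a "Idt (Ps0 W c) (Cod (Ps0 W c) b)"] assms by simp_all

lemma Ma_iso:
  assumes "c \<in> Cell0 C" "is_iso (Ps0 E c) a" "is_iso (Ps0 W c) b"
  shows "is_iso A (Ma c a b)"
proof (rule is_isoI)
  note [simp] = assms is_iso_Arr[OF assms(2)] is_iso_Arr[OF assms(3)]
  show "inverse_arrows A (Ma c a b) (Ma c (inv_arrow (Ps0 E c) a) (inv_arrow (Ps0 W c) b))"
    by (simp add: inverse_arrows_iff Ma_Comp[symmetric])
qed

text \<open>
  The value of the extension on an arrow of \<open>\<Delta>\<close> over \<open>(p, q)\<close> depends on the part of the arrow in \<open>E\<close> only through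
  an arrow \<open>s\<close> into \<open>E q e\<close>, where \<open>e\<close> is the object \<open>E h' e'\<close>; \<open>v\<close> is the component of the arrow in \<open>W\<close>.
\<close>

definition gval :: "'f \<Rightarrow> 'x \<Rightarrow> 'w \<Rightarrow> 'z \<Rightarrow> 'y \<Rightarrow> 'q" where
  "gval q e v w s = Ma (Src C q) (Idt (Ps0 E (Src C q)) e) v \<cdot>\<^bsub>A\<^esub> t q e w \<cdot>\<^bsub>A\<^esub> Ma (Tgt C q) s (Idt (Ps0 W (Tgt C q)) w)"

lemma gval_typed:
  assumes "q \<in> Cell1 C" "e \<in> Ob (Ps0 E (Src C q))" "w \<in> Ob (Ps0 W (Tgt C q))"
    "s \<in> Arr (Ps0 E (Tgt C q))" "Cod (Ps0 E (Tgt C q)) s = FOb (Ps1 E q) e"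
    "v \<in> Arr (Ps0 W (Src C q))" "Dom (Ps0 W (Src C q)) v = FOb (Ps1 W q) w"
  shows "gval q e v w s \<in> Arr A" "Dom A (gval q e v w s) = Mo (Tgt C q) (Dom (Ps0 E (Tgt C q)) s) w"
    "Cod A (gval q e v w s) = Mo (Src C q) e (Cod (Ps0 W (Src C q)) v)"
  using assms by (simp_all add: gval_def)

lemma t_Cmp1':
  assumes [simp]: "f \<in> Cell1 C" "g \<in> Cell1 C" "Src C g = Tgt C f" "e \<in> Ob (Ps0 E (Src C f))" "w \<in> Ob (Ps0 W (Tgt C g))"
  shows "t f e (FOb (Ps1 W g) w) \<cdot>\<^bsub>A\<^esub> t g (FOb (Ps1 E f) e) w =
    Ma (Src C f) (Idt (Ps0 E (Src C f)) e) (inv_arrow (Ps0 W (Src C f)) (Coh W f g w)) \<cdot>\<^bsub>A\<^esub> t (g \<odot> f) e w \<cdot>\<^bsub>A\<^esub>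
      Ma (Tgt C g) (Coh E g f e) (Idt (Ps0 W (Tgt C g)) w)"
proof -
  let ?coh = "Ma (Src C f) (Idt (Ps0 E (Src C f)) e) (Coh W f g w)"
  let ?inv = "Ma (Src C f) (Idt (Ps0 E (Src C f)) e) (inv_arrow (Ps0 W (Src C f)) (Coh W f g w))"
  let ?tt = "t f e (FOb (Ps1 W g) w) \<cdot>\<^bsub>A\<^esub> t g (FOb (Ps1 E f) e) w"
  have "?inv \<cdot>\<^bsub>A\<^esub> t (g \<odot> f) e w \<cdot>\<^bsub>A\<^esub> Ma (Tgt C g) (Coh E g f e) (Idt (Ps0 W (Tgt C g)) w) = ?inv \<cdot>\<^bsub>A\<^esub> ?coh \<cdot>\<^bsub>A\<^esub> ?tt"
    using t_Cmp1[of f g e w] by simp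
  also have "\<dots> = (?inv \<cdot>\<^bsub>A\<^esub> ?coh) \<cdot>\<^bsub>A\<^esub> ?tt" by simp
  also have "?inv \<cdot>\<^bsub>A\<^esub> ?coh = Idt A (Mo (Src C f) e (FOb (Ps1 W f) (FOb (Ps1 W g) w)))"
    by (simp add: Ma_Comp_right[symmetric])
  finally show ?thesis by simp
qed

text \<open>
  Bifunctoriality exchanges \<open>s'\<close> with \<open>v\<close>, and naturality of \<open>t\<close> moves \<open>v\<close> to the left of \<open>t q'\<close> and \<open>s'\<close> to the right of
  \<open>t q\<close>. Then \<open>t q'\<close> and \<open>t q\<close> meet, and the coherence law \<open>t_Cmp1'\<close> merges them to \<open>t (q \<circ> q')\<close>.
\<close>

lemma gval_Comp:
  assumes [simp]: "q \<in> Cell1 C" "q' \<in> Cell1 C" "Tgt C q' = Src C q" "e \<in> Ob (Ps0 E (Src C q))" "e' \<in> Ob (Ps0 E (Src C q'))"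
    "w \<in> Ob (Ps0 W (Tgt C q))" "s \<in> Arr (Ps0 E (Tgt C q))" "Cod (Ps0 E (Tgt C q)) s = FOb (Ps1 E q) e"
    "v \<in> Arr (Ps0 W (Src C q))" "Dom (Ps0 W (Src C q)) v = FOb (Ps1 W q) w" "Cod (Ps0 W (Src C q)) v = w'"
    "s' \<in> Arr (Ps0 E (Src C q))" "Dom (Ps0 E (Src C q)) s' = e" "Cod (Ps0 E (Src C q)) s' = FOb (Ps1 E q') e'"
    "v' \<in> Arr (Ps0 W (Src C q'))" "Dom (Ps0 W (Src C q')) v' = FOb (Ps1 W q') w'"
  shows "gval q' e' v' w' s' \<cdot>\<^bsub>A\<^esub> gval q e v w s =
    gval (q \<odot> q') e' (v' \<cdot>\<^bsub>Ps0 W (Src C q')\<^esub> FArr (Ps1 W q') v \<cdot>\<^bsub>Ps0 W (Src C q')\<^esub> inv_arrow (Ps0 W (Src C q')) (Coh W q' q w)) w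
      (Coh E q q' e' \<cdot>\<^bsub>Ps0 E (Tgt C q)\<^esub> FArr (Ps1 E q) s' \<cdot>\<^bsub>Ps0 E (Tgt C q)\<^esub> s)"
proof -
  let ?d = "Tgt C q" and ?d' = "Src C q" and ?d'' = "Src C q'"
  have w': "w' \<in> Ob (Ps0 W ?d')"
    using cat_simps(2)[of "Ps0 W ?d'" v] by simp
  note [simp] = w'
  have 1: "Ma ?d' s' (Idt (Ps0 W ?d') w') \<cdot>\<^bsub>A\<^esub> Ma ?d' (Idt (Ps0 E ?d') e) v =
      Ma ?d' (Idt (Ps0 E ?d') (FOb (Ps1 E q') e')) v \<cdot>\<^bsub>A\<^esub> Ma ?d' s' (Idt (Ps0 W ?d') (FOb (Ps1 W q) w))"
    using Ma_split[of ?d' s' v] by simp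
  have 2: "t q' e' w' \<cdot>\<^bsub>A\<^esub> Ma ?d' (Idt (Ps0 E ?d') (FOb (Ps1 E q') e')) v =
      Ma ?d'' (Idt (Ps0 E ?d'') e') (FArr (Ps1 W q') v) \<cdot>\<^bsub>A\<^esub> t q' e' (FOb (Ps1 W q) w)"
    using t_natural[of q' "Idt (Ps0 E ?d'') e'" v] by simp
  have 3: "Ma ?d' s' (Idt (Ps0 W ?d') (FOb (Ps1 W q) w)) \<cdot>\<^bsub>A\<^esub> t q e w =
      t q (FOb (Ps1 E q') e') w \<cdot>\<^bsub>A\<^esub> Ma ?d (FArr (Ps1 E q) s') (Idt (Ps0 W ?d) w)"
    using t_natural[of q s' "Idt (Ps0 W ?d) w"] by simp
  show ?thesis
    unfolding gval_def
    using exchange_chain[OF A_cat _ _ _ _ _ _ _ _ _ _ _ _ _ _ _ _ _ _ _ _ _ _ _ _ _ _ _ _ _ _ _ _ _ 1 2 3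
        t_Cmp1'[of q' q e' w, simplified],
        of "Ma ?d'' (Idt (Ps0 E ?d'') e') v'" "Ma ?d s (Idt (Ps0 W ?d) w)"]
    by (simp add: Ma_Comp_left Ma_Comp_right)
qed

definition Go :: "('o \<times> 'o) \<times> ('x \<times> 'z) \<times> 'f \<Rightarrow> 'p" where
  "Go = (\<lambda>((c, d), (e, w), h). Mo d (FOb (Ps1 E h) e) w)"

definition Ga :: "('o \<times> 'o, 'f \<times> 'f, 'x \<times> 'z, 'y \<times> 'w, 'f, 't) dar \<Rightarrow> 'q" where
  "Ga = (\<lambda>(((c, d), (e, w), h), ((p, q), (u, v), \<phi>), ((c', d'), (e', w'), h')).
     gval q (FOb (Ps1 E h') e') v w (sg h' p q u \<phi> e))"

sublocale G: pre_two_category_ext DD Sig A Go Ga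
proof
  fix x assume "x \<in> Cell0 DD"
  then obtain c d e w h where x: "x = ((c, d), (e, w), h)" and [simp]: "((c, d), (e, w), h) \<in> Cell0 DD" by (cases x) auto
  note t = this(2)[simplified]
  show "Go x \<in> Ob A" using t by (simp add: x Go_def)
  show "Ga (Id1 DD x) = Idt A (Go x)"
    using t by (simp add: x Go_def Ga_def gval_def sg_def act_def t_Id1)
next
  fix r assume r: "r \<in> Cell1 DD"
  then obtain c d e w h p q u v \<phi> c' d' e' w' h' where
    r_eq: "r = (((c, d), (e, w), h), ((p, q), (u, v), \<phi>), ((c', d'), (e', w'), h'))"
    by (rule Delta_Cell1E)
  note r = r[unfolded r_eq]
  note [simp] = r[simplified]
  note sr [simp] = sg_typed[OF r]
  show "Ga r \<in> Arr A \<and> Dom A (Ga r) = Go (Src DD r) \<and> Cod A (Ga r) = Go (Tgt DD r)"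
    using gval_typed[of q "FOb (Ps1 E h') e'" w "sg h' p q u \<phi> e" v] by (simp add: r_eq Ga_def Go_def)
  fix s assume s: "s \<in> Cell1 DD" "Src DD s = Tgt DD r"
  then obtain p' q' u' v' \<phi>' c'' d'' e'' w'' h'' where
    s_eq: "s = (((c', d'), (e', w'), h'), ((p', q'), (u', v'), \<phi>'), ((c'', d''), (e'', w''), h''))"
    by (auto simp: r_eq elim: Delta_Cell1E)
  note s = s(1)[unfolded s_eq]
  note [simp] = s[simplified]
  note ss [simp] = sg_typed[OF s]
  have "Ga (s \<odot>\<^bsub>DD\<^esub> r) = gval (q \<odot> q') (FOb (Ps1 E h'') e'')
      (v' \<cdot>\<^bsub>Ps0 W d''\<^esub> FArr (Ps1 W q') v \<cdot>\<^bsub>Ps0 W d''\<^esub> inv_arrow (Ps0 W d'') (Coh W q' q w)) w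
      (sg h'' (p' \<odot> p) (q \<odot> q') (u' \<cdot>\<^bsub>Ps0 E c''\<^esub> act p' p u e) ((Id2 C q \<star> \<phi>' \<star> Id2 C p) \<bullet> \<phi>) e)"
    unfolding r_eq s_eq Delta_Cmp1[OF r s] by (simp add: Ga_def act_def)
  also have "\<dots> = Ga s \<cdot>\<^bsub>A\<^esub> Ga r"
    unfolding sg_Cmp1[OF r s]
    using gval_Comp[of q q' "FOb (Ps1 E h') e'" "FOb (Ps1 E h'') e''" w "sg h' p q u \<phi> e" v w' "sg h'' p' q' u' \<phi>' e'" v']
    by (simp add: Ga_def r_eq s_eq)
  finally show "Ga (s \<odot>\<^bsub>DD\<^esub> r) = Ga s \<cdot>\<^bsub>A\<^esub> Ga r" .
next
  fix \<gamma> assume "\<gamma> \<in> Cell2 DD"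
  then obtain c d e w h p q u v \<phi> c' d' e' w' h' \<alpha> \<beta> p1 q1 u1 v1 \<phi>1 where
    \<gamma>_eq: "\<gamma> = ((((c, d), (e, w), h), ((p, q), (u, v), \<phi>), ((c', d'), (e', w'), h')), (\<alpha>, \<beta>),
      (((c, d), (e, w), h), ((p1, q1), (u1, v1), \<phi>1), ((c', d'), (e', w'), h')))"
    and r: "(((c, d), (e, w), h), ((p, q), (u, v), \<phi>), ((c', d'), (e', w'), h')) \<in> Cell1 DD"
    and s: "(((c, d), (e, w), h), ((p1, q1), (u1, v1), \<phi>1), ((c', d'), (e', w'), h')) \<in> Cell1 DD"
    and \<alpha>\<beta>: "\<alpha> \<in> Cell2 C" "Dom2 C \<alpha> = p" "Cod2 C \<alpha> = p1" "\<beta> \<in> Cell2 C" "Dom2 C \<beta> = q" "Cod2 C \<beta> = q1"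
    and eq: "u1 \<cdot>\<^bsub>Ps0 E c'\<^esub> Ps2 E \<alpha> e = u" "v1 \<cdot>\<^bsub>Ps0 W d'\<^esub> Ps2 W \<beta> w = v" "(\<beta> \<star> Id2 C h' \<star> \<alpha>) \<bullet> \<phi> = \<phi>1"
    by (cases \<gamma>) (auto simp del: Delta_Cell1)
  note [simp] = r[simplified] s[simplified] \<alpha>\<beta>
  note sr [simp] = sg_typed[OF r]
  let ?e = "FOb (Ps1 E h') e'"
  have "Ga (Cod2 DD \<gamma>) = Ma d' (Idt (Ps0 E d') ?e) v1 \<cdot>\<^bsub>A\<^esub> (t q1 ?e w \<cdot>\<^bsub>A\<^esub> Ma d (Ps2 E \<beta> ?e) (Idt (Ps0 W d) w)) \<cdot>\<^bsub>A\<^esub>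
      Ma d (sg h' p q u \<phi> e) (Idt (Ps0 W d) w)"
    by (simp add: \<gamma>_eq Ga_def gval_def sg_2cell[OF r s \<alpha>\<beta> eq(1,3)] Ma_Comp_left)
  also have "t q1 ?e w \<cdot>\<^bsub>A\<^esub> Ma d (Ps2 E \<beta> ?e) (Idt (Ps0 W d) w) =
      Ma d' (Idt (Ps0 E d') ?e) (Ps2 W \<beta> w) \<cdot>\<^bsub>A\<^esub> t q ?e w"
    using t_2cell[of \<beta> q q1 ?e w] by simp
  also have "Ma d' (Idt (Ps0 E d') ?e) v1 \<cdot>\<^bsub>A\<^esub> (Ma d' (Idt (Ps0 E d') ?e) (Ps2 W \<beta> w) \<cdot>\<^bsub>A\<^esub> t q ?e w) \<cdot>\<^bsub>A\<^esub>
      Ma d (sg h' p q u \<phi> e) (Idt (Ps0 W d) w) = Ga (Dom2 DD \<gamma>)"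
    by (simp add: \<gamma>_eq Ga_def gval_def eq(2)[symmetric] Ma_Comp_right)
  finally show "Ga (Dom2 DD \<gamma>) = Ga (Cod2 DD \<gamma>)" by simp
next
  fix r assume r: "r \<in> Sig"
  then have "r \<in> Cell1 DD" using T.S_Cell1 by blast
  then obtain c d e w h p q u v \<phi> c' d' e' w' h' where
    r_eq: "r = (((c, d), (e, w), h), ((p, q), (u, v), \<phi>), ((c', d'), (e', w'), h'))"
    by (rule Delta_Cell1E)
  have r: "(((c, d), (e, w), h), ((p, q), (u, v), \<phi>), ((c', d'), (e', w'), h')) \<in> Cell1 DD"
    "is_iso (Ps0 E c') u" "is_iso (Ps0 W d') v" "is_iso (hom_cat C c d) \<phi>"
    using r unfolding r_eq Sig_iff by auto
  note [simp] = r(1)[simplified] sg_typed[OF r(1)] sg_iso[OF r(1,2,4)] r(3)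
  show "is_iso A (Ga r)"
    by (simp add: r_eq Ga_def gval_def Ma_iso)
qed

definition "Gext = G.loc_ext"

lemma Gext_functor: "is_functor T.loc A Gext"
  unfolding Gext_def by (rule G.loc_ext_functor)

lemma Gext_unit_ob: "c \<in> Cell0 C \<Longrightarrow> e \<in> Ob (Ps0 E c) \<Longrightarrow> w \<in> Ob (Ps0 W c) \<Longrightarrow> FOb Gext (unit_ob C c e w) = Mo c e w"
  by (simp add: Gext_def G.loc_ext_FOb unit_ob_def) (simp add: Go_def)

lemma Gext_unit_arr:
  assumes "c \<in> Cell0 C" "a \<in> Arr (Ps0 E c)" "b \<in> Arr (Ps0 W c)"
  shows "FArr Gext (unit_arr C E W c a b) = Ma c a b"
  using assms Ma_split(1)[of c a b]
  by (simp add: Gext_def unit_arr_eq G.loc_ext_ar) (simp add: Nar_def Ga_def gval_def sg_def act_def t_Id1 Let_def)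

text \<open>
  By normalization the extension sends the left leg of the span to an identity and the right leg to \<open>t f e w\<close>. It is here that the
  extension restricts to the given family strictly and not only up to isomorphism.
\<close>

lemma Gext_unit_cell:
  assumes "f \<in> Cell1 C" "e \<in> Ob (Ps0 E (Src C f))" "w \<in> Ob (Ps0 W (Tgt C f))"
  shows "FArr Gext (unit_cell C E W f e w) = t f e w"
proof -
  have R: "FArr Gext (T.ar (Rar f e w)) = t f e w"
    using assms by (simp add: Gext_def G.loc_ext_ar) (simp add: Var_def Ga_def gval_def sg_def act_def Let_def)
  have L: "FArr Gext (T.ar (Lar f e w)) = Idt A (Mo (Tgt C f) (FOb (Ps1 E f) e) w)"
    using assms by (simp add: Gext_def G.loc_ext_ar) (simp add: Uar_def Ga_def gval_def sg_def act_def Let_def t_Id1)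
  show ?thesis
    using assms functorD(8)[OF Gext_functor, of "inv_arrow T.loc (T.ar (Lar f e w))" "T.ar (Rar f e w)"]
      functor_iso(2)[OF _ _ Gext_functor, of "T.ar (Lar f e w)"]
    by (simp add: unit_cell_eq R L)
qed

end

section \<open>The category of pseudo-natural transformations\<close>

lemma pseudo_natD:
  assumes "pseudo_nat K P Q \<theta>"
  shows "Tr0 \<theta> \<in> extensional (Cell0 K)" "Tr1 \<theta> \<in> extensional (Cell1 K)"
    and "k \<in> Cell0 K \<Longrightarrow> is_functor (Ps0 P k) (Ps0 Q k) (Tr0 \<theta> k)"
    and "f \<in> Cell1 K \<Longrightarrow> Src K f = k \<Longrightarrow> Tgt K f = l \<Longrightarrow>
      nat_iso (Ps0 P k) (Ps0 Q l) (comp_func (Ps0 P k) (Ps1 Q f) (Tr0 \<theta> k)) (comp_func (Ps0 P k) (Tr0 \<theta> l) (Ps1 P f)) (Tr1 \<theta> f)"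
    and "\<alpha> \<in> Cell2 K \<Longrightarrow> Dom2 K \<alpha> = f \<Longrightarrow> Cod2 K \<alpha> = g \<Longrightarrow> f \<in> Cell1 K \<Longrightarrow> Src K f = k \<Longrightarrow> Tgt K f = l \<Longrightarrow> X \<in> Ob (Ps0 P k) \<Longrightarrow>
      Tr1 \<theta> g X \<cdot>\<^bsub>Ps0 Q l\<^esub> Ps2 Q \<alpha> (FOb (Tr0 \<theta> k) X) = FArr (Tr0 \<theta> l) (Ps2 P \<alpha> X) \<cdot>\<^bsub>Ps0 Q l\<^esub> Tr1 \<theta> f X"
    and "k \<in> Cell0 K \<Longrightarrow> X \<in> Ob (Ps0 P k) \<Longrightarrow> Tr1 \<theta> (Id1 K k) X = Idt (Ps0 Q k) (FOb (Tr0 \<theta> k) X)"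
    and "f \<in> Cell1 K \<Longrightarrow> g \<in> Cell1 K \<Longrightarrow> Src K f = k \<Longrightarrow> Tgt K f = l \<Longrightarrow> Src K g = l \<Longrightarrow> Tgt K g = m \<Longrightarrow> X \<in> Ob (Ps0 P k) \<Longrightarrow>
      Tr1 \<theta> (g \<odot>\<^bsub>K\<^esub> f) X \<cdot>\<^bsub>Ps0 Q m\<^esub> Coh Q g f (FOb (Tr0 \<theta> k) X) =
        FArr (Tr0 \<theta> m) (Coh P g f X) \<cdot>\<^bsub>Ps0 Q m\<^esub> Tr1 \<theta> g (FOb (Ps1 P f) X) \<cdot>\<^bsub>Ps0 Q m\<^esub> FArr (Ps1 Q g) (Tr1 \<theta> f X)"
proof -
  note d = assms[unfolded pseudo_nat_def]
  show "Tr0 \<theta> \<in> extensional (Cell0 K)" "Tr1 \<theta> \<in> extensional (Cell1 K)"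
    "k \<in> Cell0 K \<Longrightarrow> is_functor (Ps0 P k) (Ps0 Q k) (Tr0 \<theta> k)"
    "k \<in> Cell0 K \<Longrightarrow> X \<in> Ob (Ps0 P k) \<Longrightarrow> Tr1 \<theta> (Id1 K k) X = Idt (Ps0 Q k) (FOb (Tr0 \<theta> k) X)"
    using d by simp_all
  show "f \<in> Cell1 K \<Longrightarrow> Src K f = k \<Longrightarrow> Tgt K f = l \<Longrightarrow>
      nat_iso (Ps0 P k) (Ps0 Q l) (comp_func (Ps0 P k) (Ps1 Q f) (Tr0 \<theta> k)) (comp_func (Ps0 P k) (Tr0 \<theta> l) (Ps1 P f)) (Tr1 \<theta> f)"
    using d by simp
  show "\<alpha> \<in> Cell2 K \<Longrightarrow> Dom2 K \<alpha> = f \<Longrightarrow> Cod2 K \<alpha> = g \<Longrightarrow> f \<in> Cell1 K \<Longrightarrow> Src K f = k \<Longrightarrow> Tgt K f = l \<Longrightarrow> X \<in> Ob (Ps0 P k) \<Longrightarrow>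
      Tr1 \<theta> g X \<cdot>\<^bsub>Ps0 Q l\<^esub> Ps2 Q \<alpha> (FOb (Tr0 \<theta> k) X) = FArr (Tr0 \<theta> l) (Ps2 P \<alpha> X) \<cdot>\<^bsub>Ps0 Q l\<^esub> Tr1 \<theta> f X"
    using d by simp
  show "f \<in> Cell1 K \<Longrightarrow> g \<in> Cell1 K \<Longrightarrow> Src K f = k \<Longrightarrow> Tgt K f = l \<Longrightarrow> Src K g = l \<Longrightarrow> Tgt K g = m \<Longrightarrow> X \<in> Ob (Ps0 P k) \<Longrightarrow>
      Tr1 \<theta> (g \<odot>\<^bsub>K\<^esub> f) X \<cdot>\<^bsub>Ps0 Q m\<^esub> Coh Q g f (FOb (Tr0 \<theta> k) X) =
        FArr (Tr0 \<theta> m) (Coh P g f X) \<cdot>\<^bsub>Ps0 Q m\<^esub> Tr1 \<theta> g (FOb (Ps1 P f) X) \<cdot>\<^bsub>Ps0 Q m\<^esub> FArr (Ps1 Q g) (Tr1 \<theta> f X)"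
    using d by simp
qed

lemma modificationD:
  assumes "modification K P Q \<theta> \<phi> \<mu>"
  shows "pseudo_nat K P Q \<theta>" "pseudo_nat K P Q \<phi>" "\<mu> \<in> extensional (Cell0 K)"
    and "k \<in> Cell0 K \<Longrightarrow> nat_trans (Ps0 P k) (Ps0 Q k) (Tr0 \<theta> k) (Tr0 \<phi> k) (\<mu> k)"
    and "f \<in> Cell1 K \<Longrightarrow> Src K f = k \<Longrightarrow> Tgt K f = l \<Longrightarrow> X \<in> Ob (Ps0 P k) \<Longrightarrow>
      Tr1 \<phi> f X \<cdot>\<^bsub>Ps0 Q l\<^esub> FArr (Ps1 Q f) (\<mu> k X) = \<mu> l (FOb (Ps1 P f) X) \<cdot>\<^bsub>Ps0 Q l\<^esub> Tr1 \<theta> f X"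
  using assms by (simp_all add: modification_def)

lemma Hom_cat_simps [simp]:
  "Ob (Hom_cat K P Q) = {\<theta>. pseudo_nat K P Q \<theta>}"
  "(\<theta>, \<mu>, \<phi>) \<in> Arr (Hom_cat K P Q) \<longleftrightarrow> modification K P Q \<theta> \<phi> \<mu>"
  "Dom (Hom_cat K P Q) (\<theta>, \<mu>, \<phi>) = \<theta>" "Cod (Hom_cat K P Q) (\<theta>, \<mu>, \<phi>) = \<phi>"
  "Idt (Hom_cat K P Q) \<theta> = (\<theta>, \<lambda>k \<in> Cell0 K. \<lambda>X \<in> Ob (Ps0 P k). Idt (Ps0 Q k) (FOb (Tr0 \<theta> k) X), \<theta>)"
  "(\<phi>', \<nu>, \<psi>) \<cdot>\<^bsub>Hom_cat K P Q\<^esub> (\<theta>, \<mu>, \<phi>) = (\<theta>, \<lambda>k \<in> Cell0 K. \<lambda>X \<in> Ob (Ps0 P k). \<nu> k X \<cdot>\<^bsub>Ps0 Q k\<^esub> \<mu> k X, \<psi>)"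
  by (auto simp: Hom_cat_def)

text \<open>The part of the structure of two pseudo-functors that is involved in composing modifications between them.\<close>

locale psf_pair =
  fixes K :: "('o, 'f, 't) two_cat" and P :: "('o, 'f, 't, 'x, 'y) psf" and Q :: "('o, 'f, 't, 'z, 'w) psf"
  assumes ends: "f \<in> Cell1 K \<Longrightarrow> Src K f \<in> Cell0 K \<and> Tgt K f \<in> Cell0 K"
    and cats: "k \<in> Cell0 K \<Longrightarrow> category (Ps0 P k)" "k \<in> Cell0 K \<Longrightarrow> category (Ps0 Q k)"
    and functors: "f \<in> Cell1 K \<Longrightarrow> is_functor (Ps0 P (Src K f)) (Ps0 P (Tgt K f)) (Ps1 P f)"
      "f \<in> Cell1 K \<Longrightarrow> is_functor (Ps0 Q (Src K f)) (Ps0 Q (Tgt K f)) (Ps1 Q f)"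
begin

lemma component_typed:
  assumes "pseudo_nat K P Q \<theta>" "k \<in> Cell0 K" "X \<in> Ob (Ps0 P k)"
  shows "FOb (Tr0 \<theta> k) X \<in> Ob (Ps0 Q k)"
  using functorD(3)[OF pseudo_natD(3)[OF assms(1,2)] assms(3)] .

lemma cell_typed:
  assumes "pseudo_nat K P Q \<theta>" "f \<in> Cell1 K" "Src K f = k" "Tgt K f = l" "X \<in> Ob (Ps0 P k)"
  shows "Tr1 \<theta> f X \<in> Arr (Ps0 Q l)" "Dom (Ps0 Q l) (Tr1 \<theta> f X) = FOb (Ps1 Q f) (FOb (Tr0 \<theta> k) X)"
    "Cod (Ps0 Q l) (Tr1 \<theta> f X) = FOb (Tr0 \<theta> l) (FOb (Ps1 P f) X)"
  using nat_transD(4-6)[of "Ps0 P k" "Ps0 Q l" _ _ "Tr1 \<theta> f" X] pseudo_natD(4)[OF assms(1-4)] assms(5)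
  by (simp_all add: nat_iso_def, fastforce+)

lemma modification_typed:
  assumes "modification K P Q \<theta> \<phi> \<mu>" "k \<in> Cell0 K" "X \<in> Ob (Ps0 P k)"
  shows "\<mu> k X \<in> Arr (Ps0 Q k)" "Dom (Ps0 Q k) (\<mu> k X) = FOb (Tr0 \<theta> k) X" "Cod (Ps0 Q k) (\<mu> k X) = FOb (Tr0 \<phi> k) X"
  using nat_transD(4-6)[OF modificationD(4)[OF assms(1,2)]] assms(3) by auto

lemma modification_Idt:
  assumes "pseudo_nat K P Q \<theta>"
  shows "modification K P Q \<theta> \<theta> (\<lambda>k \<in> Cell0 K. \<lambda>X \<in> Ob (Ps0 P k). Idt (Ps0 Q k) (FOb (Tr0 \<theta> k) X))"
  unfolding modification_def
proof (intro conjI allI ballI assms)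
  fix k assume k: "k \<in> Cell0 K"
  then show "nat_trans (Ps0 P k) (Ps0 Q k) (Tr0 \<theta> k) (Tr0 \<theta> k)
      ((\<lambda>k \<in> Cell0 K. \<lambda>X \<in> Ob (Ps0 P k). Idt (Ps0 Q k) (FOb (Tr0 \<theta> k) X)) k)"
    using nat_trans_Idt[OF cats(1)[OF k] cats(2)[OF k] pseudo_natD(3)[OF assms k]] by simp
next
  fix k l f X assume f: "f \<in> hom (cells1 K) k l" and X: "X \<in> Ob (Ps0 P k)"
  have kl: "k \<in> Cell0 K" "l \<in> Cell0 K" and f': "f \<in> Cell1 K" "Src K f = k" "Tgt K f = l" using f ends by auto
  show "Tr1 \<theta> f X \<cdot>\<^bsub>Ps0 Q l\<^esub> FArr (Ps1 Q f) ((\<lambda>k \<in> Cell0 K. \<lambda>X \<in> Ob (Ps0 P k). Idt (Ps0 Q k) (FOb (Tr0 \<theta> k) X)) k X) =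
      (\<lambda>k \<in> Cell0 K. \<lambda>X \<in> Ob (Ps0 P k). Idt (Ps0 Q k) (FOb (Tr0 \<theta> k) X)) l (FOb (Ps1 P f) X) \<cdot>\<^bsub>Ps0 Q l\<^esub> Tr1 \<theta> f X"
    using kl f' X functorD(7)[OF functors(2)[OF f'(1)], of "FOb (Tr0 \<theta> k) X"]
      functorD(3)[OF functors(1)[OF f'(1)], of X] component_typed[OF assms kl(1) X]
      cell_typed[OF assms f' X] cats[OF kl(2)] by simp
qed simp

lemma modification_Comp:
  assumes \<mu>: "modification K P Q \<theta> \<phi> \<mu>" and \<nu>: "modification K P Q \<phi> \<psi> \<nu>"
  shows "modification K P Q \<theta> \<psi> (\<lambda>k \<in> Cell0 K. \<lambda>X \<in> Ob (Ps0 P k). \<nu> k X \<cdot>\<^bsub>Ps0 Q k\<^esub> \<mu> k X)"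
  unfolding modification_def
proof (intro conjI allI ballI modificationD(1)[OF \<mu>] modificationD(2)[OF \<nu>])
  fix k assume k: "k \<in> Cell0 K"
  then show "nat_trans (Ps0 P k) (Ps0 Q k) (Tr0 \<theta> k) (Tr0 \<psi> k)
      ((\<lambda>k \<in> Cell0 K. \<lambda>X \<in> Ob (Ps0 P k). \<nu> k X \<cdot>\<^bsub>Ps0 Q k\<^esub> \<mu> k X) k)"
    using nat_trans_Comp[OF cats(1)[OF k] cats(2)[OF k] modificationD(4)[OF \<mu> k] modificationD(4)[OF \<nu> k]] by simp
next
  fix k l f X assume f: "f \<in> hom (cells1 K) k l" and X: "X \<in> Ob (Ps0 P k)"
  have kl: "k \<in> Cell0 K" "l \<in> Cell0 K" and f': "f \<in> Cell1 K" "Src K f = k" "Tgt K f = l" using f ends by auto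
  note cat = cats(2)[OF kl(1)] cats(2)[OF kl(2)]
  have fX: "FOb (Ps1 P f) X \<in> Ob (Ps0 P l)" using functorD(3)[OF functors(1)[OF f'(1)], of X] f' X by simp
  note F = functorD(3-)[OF functors(2)[OF f'(1), unfolded f']]
  note [simp] = f' X kl cat fX F cell_typed[OF modificationD(1)[OF \<mu>] f' X] cell_typed[OF modificationD(2)[OF \<mu>] f' X]
    cell_typed[OF modificationD(2)[OF \<nu>] f' X]
    modification_typed[OF \<mu> kl(1) X] modification_typed[OF \<nu> kl(1) X]
    modification_typed[OF \<mu> kl(2) fX] modification_typed[OF \<nu> kl(2) fX]
  note m = modificationD(5)[OF \<mu> f' X] and n = modificationD(5)[OF \<nu> f' X]
  have "Tr1 \<psi> f X \<cdot>\<^bsub>Ps0 Q l\<^esub> FArr (Ps1 Q f) (\<nu> k X \<cdot>\<^bsub>Ps0 Q k\<^esub> \<mu> k X) =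
      (Tr1 \<psi> f X \<cdot>\<^bsub>Ps0 Q l\<^esub> FArr (Ps1 Q f) (\<nu> k X)) \<cdot>\<^bsub>Ps0 Q l\<^esub> FArr (Ps1 Q f) (\<mu> k X)"
    by simp
  also have "\<dots> = \<nu> l (FOb (Ps1 P f) X) \<cdot>\<^bsub>Ps0 Q l\<^esub> (Tr1 \<phi> f X \<cdot>\<^bsub>Ps0 Q l\<^esub> FArr (Ps1 Q f) (\<mu> k X))"
    unfolding n by simp
  also have "\<dots> = (\<nu> l (FOb (Ps1 P f) X) \<cdot>\<^bsub>Ps0 Q l\<^esub> \<mu> l (FOb (Ps1 P f) X)) \<cdot>\<^bsub>Ps0 Q l\<^esub> Tr1 \<theta> f X"
    unfolding m by simp
  finally show "Tr1 \<psi> f X \<cdot>\<^bsub>Ps0 Q l\<^esub> FArr (Ps1 Q f) ((\<lambda>k \<in> Cell0 K. \<lambda>X \<in> Ob (Ps0 P k). \<nu> k X \<cdot>\<^bsub>Ps0 Q k\<^esub> \<mu> k X) k X) =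
      (\<lambda>k \<in> Cell0 K. \<lambda>X \<in> Ob (Ps0 P k). \<nu> k X \<cdot>\<^bsub>Ps0 Q k\<^esub> \<mu> k X) l (FOb (Ps1 P f) X) \<cdot>\<^bsub>Ps0 Q l\<^esub> Tr1 \<theta> f X"
    by simp
qed simp

lemma modification_eqI:
  assumes "modification K P Q \<theta> \<phi> \<mu>" "modification K P Q \<theta> \<phi> \<mu>'"
    and "\<And>k X. k \<in> Cell0 K \<Longrightarrow> X \<in> Ob (Ps0 P k) \<Longrightarrow> \<mu> k X = \<mu>' k X"
  shows "\<mu> = \<mu>'"
proof (rule extensionalityI[OF modificationD(3)[OF assms(1)] modificationD(3)[OF assms(2)]])
  fix k assume k: "k \<in> Cell0 K"
  show "\<mu> k = \<mu>' k"
    by (rule extensionalityI[OF nat_transD(3)[OF modificationD(4)[OF assms(1) k]]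
          nat_transD(3)[OF modificationD(4)[OF assms(2) k]]]) (rule assms(3)[OF k])
qed

lemma category_Hom_cat: "category (Hom_cat K P Q)"
proof (rule categoryI)
  fix f assume "f \<in> Arr (Hom_cat K P Q)"
  then obtain \<theta> \<mu> \<phi> where f: "f = (\<theta>, \<mu>, \<phi>)" and \<mu>: "modification K P Q \<theta> \<phi> \<mu>" by (cases f) auto
  show "Dom (Hom_cat K P Q) f \<in> Ob (Hom_cat K P Q) \<and> Cod (Hom_cat K P Q) f \<in> Ob (Hom_cat K P Q)"
    using modificationD(1,2)[OF \<mu>] by (simp add: f)
  have "(\<lambda>k \<in> Cell0 K. \<lambda>X \<in> Ob (Ps0 P k). (\<lambda>k \<in> Cell0 K. \<lambda>X \<in> Ob (Ps0 P k). Idt (Ps0 Q k) (FOb (Tr0 \<phi> k) X)) k X \<cdot>\<^bsub>Ps0 Q k\<^esub> \<mu> k X) = \<mu>"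
    by (rule modification_eqI[OF modification_Comp[OF \<mu> modification_Idt[OF modificationD(2)[OF \<mu>]]] \<mu>])
      (use modification_typed[OF \<mu>] cats in simp)
  moreover have "(\<lambda>k \<in> Cell0 K. \<lambda>X \<in> Ob (Ps0 P k). \<mu> k X \<cdot>\<^bsub>Ps0 Q k\<^esub> (\<lambda>k \<in> Cell0 K. \<lambda>X \<in> Ob (Ps0 P k). Idt (Ps0 Q k) (FOb (Tr0 \<theta> k) X)) k X) = \<mu>"
    by (rule modification_eqI[OF modification_Comp[OF modification_Idt[OF modificationD(1)[OF \<mu>]] \<mu>] \<mu>])
      (use modification_typed[OF \<mu>] cats in simp)
  ultimately show "Idt (Hom_cat K P Q) (Cod (Hom_cat K P Q) f) \<cdot>\<^bsub>Hom_cat K P Q\<^esub> f = f \<and>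
      f \<cdot>\<^bsub>Hom_cat K P Q\<^esub> Idt (Hom_cat K P Q) (Dom (Hom_cat K P Q) f) = f"
    by (simp add: f)
  fix g assume "g \<in> Arr (Hom_cat K P Q)" "Dom (Hom_cat K P Q) g = Cod (Hom_cat K P Q) f"
  then obtain \<nu> \<psi> where g: "g = (\<phi>, \<nu>, \<psi>)" and \<nu>: "modification K P Q \<phi> \<psi> \<nu>" by (cases g) (auto simp: f)
  show "g \<cdot>\<^bsub>Hom_cat K P Q\<^esub> f \<in> Arr (Hom_cat K P Q) \<and>
      Dom (Hom_cat K P Q) (g \<cdot>\<^bsub>Hom_cat K P Q\<^esub> f) = Dom (Hom_cat K P Q) f \<and>
      Cod (Hom_cat K P Q) (g \<cdot>\<^bsub>Hom_cat K P Q\<^esub> f) = Cod (Hom_cat K P Q) g"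
    using modification_Comp[OF \<mu> \<nu>] by (simp add: f g)
  fix h assume "h \<in> Arr (Hom_cat K P Q)" "Dom (Hom_cat K P Q) h = Cod (Hom_cat K P Q) g"
  then obtain \<zeta> \<chi> where h: "h = (\<psi>, \<zeta>, \<chi>)" and \<zeta>: "modification K P Q \<psi> \<chi> \<zeta>" by (cases h) (auto simp: g)
  show "(h \<cdot>\<^bsub>Hom_cat K P Q\<^esub> g) \<cdot>\<^bsub>Hom_cat K P Q\<^esub> f = h \<cdot>\<^bsub>Hom_cat K P Q\<^esub> (g \<cdot>\<^bsub>Hom_cat K P Q\<^esub> f)"
    using modification_typed[OF \<mu>] modification_typed[OF \<nu>] modification_typed[OF \<zeta>] cats
    by (simp add: f g h cong: restrict_cong)
next
  fix \<theta> assume "\<theta> \<in> Ob (Hom_cat K P Q)"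
  then show "Idt (Hom_cat K P Q) \<theta> \<in> Arr (Hom_cat K P Q) \<and> Dom (Hom_cat K P Q) (Idt (Hom_cat K P Q) \<theta>) = \<theta> \<and>
      Cod (Hom_cat K P Q) (Idt (Hom_cat K P Q) \<theta>) = \<theta>"
    using modification_Idt by simp
qed

end

section \<open>Balanced families are pseudo-natural transformations\<close>

lemma precomp_func_simps [simp]:
  "is_functor B C F \<Longrightarrow> FOb (precomp_func A B C H) F = comp_func A F H"
  "nat_trans B C F G \<eta> \<Longrightarrow> FArr (precomp_func A B C H) (F, \<eta>, G) = (comp_func A F H, \<lambda>x \<in> Ob A. \<eta> (FOb H x), comp_func A G H)"
  by (simp_all add: precomp_func_def)

lemma is_functor_precomp:
  assumes "category A" "category B" "category C" "is_functor A B H"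
  shows "is_functor (functor_cat B C) (functor_cat A C) (precomp_func A B C H)"
proof (rule functorI)
  note H [simp] = functorD(3-6)[OF assms(4)]
  fix f assume "f \<in> Arr (functor_cat B C)"
  then obtain F \<eta> G where f: "f = (F, \<eta>, G)" and \<eta>: "nat_trans B C F G \<eta>" by (cases f) auto
  note F = nat_transD(1)[OF \<eta>] and G = nat_transD(2)[OF \<eta>]
  have nat: "FArr G (FArr H a) \<cdot>\<^bsub>C\<^esub> \<eta> (FOb H (Dom A a)) = \<eta> (FOb H (Cod A a)) \<cdot>\<^bsub>C\<^esub> FArr F (FArr H a)"
    if "a \<in> Arr A" for a
    using nat_transD(7)[OF \<eta>, of "FArr H a"] that by simp
  have "nat_trans A C (comp_func A F H) (comp_func A G H) (\<lambda>x \<in> Ob A. \<eta> (FOb H x))"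
    using nat_transD(4-6)[OF \<eta>] nat assms(1)
    by (intro nat_transI is_functor_comp[OF assms(1,4)] F G) simp_all
  then show "FArr (precomp_func A B C H) f \<in> Arr (functor_cat A C)"
    "Dom (functor_cat A C) (FArr (precomp_func A B C H) f) = FOb (precomp_func A B C H) (Dom (functor_cat B C) f)"
    "Cod (functor_cat A C) (FArr (precomp_func A B C H) f) = FOb (precomp_func A B C H) (Cod (functor_cat B C) f)"
    using F G \<eta> by (simp_all add: f)
  fix g assume "g \<in> Arr (functor_cat B C)" "Dom (functor_cat B C) g = Cod (functor_cat B C) f"
  then obtain \<theta> K where g: "g = (G, \<theta>, K)" and \<theta>: "nat_trans B C G K \<theta>" by (cases g) (auto simp: f)
  show "FArr (precomp_func A B C H) (g \<cdot>\<^bsub>functor_cat B C\<^esub> f) =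
      FArr (precomp_func A B C H) g \<cdot>\<^bsub>functor_cat A C\<^esub> FArr (precomp_func A B C H) f"
    using nat_trans_Comp[OF assms(2,3) \<eta> \<theta>] \<eta> \<theta> by (simp add: f g cong: restrict_cong)
next
  fix F assume "F \<in> Ob (functor_cat B C)"
  then have F: "is_functor B C F" by simp
  show "FOb (precomp_func A B C H) F \<in> Ob (functor_cat A C)"
    using is_functor_comp[OF assms(1,4) F] F by simp
  show "FArr (precomp_func A B C H) (Idt (functor_cat B C) F) = Idt (functor_cat A C) (FOb (precomp_func A B C H) F)"
    using F nat_trans_Idt[OF assms(2,3) F] functorD(3)[OF assms(4)] by (simp cong: restrict_cong)
qed (simp_all add: precomp_func_def)

lemma Cat_psf_simps [simp]:
  "Ps0 (Cat_psf K Q A) k = functor_cat (Ps0 Q k) A"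
  "Ps1 (Cat_psf K Q A) f = precomp_func (Ps0 Q (Src K f)) (Ps0 Q (Tgt K f)) A (Ps1 Q f)"
  "is_functor (Ps0 Q (Tgt K (Dom2 K \<alpha>))) A F \<Longrightarrow> Ps2 (Cat_psf K Q A) \<alpha> F =
    (comp_func (Ps0 Q (Src K (Dom2 K \<alpha>))) F (Ps1 Q (Dom2 K \<alpha>)), \<lambda>X \<in> Ob (Ps0 Q (Src K (Dom2 K \<alpha>))). FArr F (Ps2 Q \<alpha> X),
     comp_func (Ps0 Q (Src K (Dom2 K \<alpha>))) F (Ps1 Q (Cod2 K \<alpha>)))"
  "is_functor (Ps0 Q (Tgt K f)) A F \<Longrightarrow> Coh (Cat_psf K Q A) g f F =
    (comp_func (Ps0 Q (Src K g)) (comp_func (Ps0 Q (Src K f)) F (Ps1 Q f)) (Ps1 Q g),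
     \<lambda>X \<in> Ob (Ps0 Q (Src K g)). FArr F (Coh Q f g X), comp_func (Ps0 Q (Src K g)) F (Ps1 Q (f \<odot>\<^bsub>K\<^esub> g)))"
  by (simp_all add: Cat_psf_def Let_def)

text \<open>
  The following three definitions turn balanced families and their maps back into functors, pseudo-natural transformations and modifications. They apply to
  arbitrary data, so that the unit of the tensor product can be recognised as such a transformation before its
  laws are known.
\<close>

definition cur_func :: "('o, 'f, 't, 'x, 'y) psf \<Rightarrow> ('o, 'f, 't, 'z, 'w) psf \<Rightarrow> ('o \<Rightarrow> 'x \<Rightarrow> 'z \<Rightarrow> 'p) \<Rightarrow>
    ('o \<Rightarrow> 'y \<Rightarrow> 'w \<Rightarrow> 'q) \<Rightarrow> 'o \<Rightarrow> 'z \<Rightarrow> ('x, 'y, 'p, 'q) func" where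
  "cur_func E W Mo Ma c w =
     \<lparr>FOb = (\<lambda>e \<in> Ob (Ps0 E c). Mo c e w), FArr = (\<lambda>a \<in> Arr (Ps0 E c). Ma c a (Idt (Ps0 W c) w))\<rparr>"

definition curry_pstr :: "('o, 'f, 't) two_cat \<Rightarrow> ('o, 'f, 't, 'x, 'y) psf \<Rightarrow> ('o, 'f, 't, 'z, 'w) psf \<Rightarrow>
    ('o \<Rightarrow> 'x \<Rightarrow> 'z \<Rightarrow> 'p) \<Rightarrow> ('o \<Rightarrow> 'y \<Rightarrow> 'w \<Rightarrow> 'q) \<Rightarrow> ('f \<Rightarrow> 'x \<Rightarrow> 'z \<Rightarrow> 'q) \<Rightarrow>
    ('o, 'f, 'z, 'w, ('x, 'y, 'p, 'q) func, ('x, 'y, 'p, 'q) ntr) pstr" where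
  "curry_pstr C E W Mo Ma t = \<lparr>
     Tr0 = (\<lambda>c \<in> Cell0 C. \<lparr>
       FOb = (\<lambda>w \<in> Ob (Ps0 W c). cur_func E W Mo Ma c w),
       FArr = (\<lambda>b \<in> Arr (Ps0 W c). (cur_func E W Mo Ma c (Dom (Ps0 W c) b),
         \<lambda>e \<in> Ob (Ps0 E c). Ma c (Idt (Ps0 E c) e) b, cur_func E W Mo Ma c (Cod (Ps0 W c) b)))\<rparr>),
     Tr1 = (\<lambda>f \<in> Cell1 C. \<lambda>w \<in> Ob (Ps0 W (Tgt C f)).
       (comp_func (Ps0 E (Src C f)) (cur_func E W Mo Ma (Tgt C f) w) (Ps1 E f),
        \<lambda>e \<in> Ob (Ps0 E (Src C f)). t f e w, cur_func E W Mo Ma (Src C f) (FOb (Ps1 W f) w)))\<rparr>"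

lemma tensor_unit_curry:
  "tensor_unit C E W = curry_pstr C E W (unit_ob C) (unit_arr C E W) (unit_cell C E W)"
  by (simp add: tensor_unit_def curry_pstr_def unit_func_def cur_func_def)

definition cur_mod :: "('o, 'f, 't) two_cat \<Rightarrow> ('o, 'f, 't, 'x, 'y) psf \<Rightarrow> ('o, 'f, 't, 'z, 'w) psf \<Rightarrow>
    ('o \<Rightarrow> 'x \<Rightarrow> 'z \<Rightarrow> 'p) \<Rightarrow> ('o \<Rightarrow> 'y \<Rightarrow> 'w \<Rightarrow> 'q) \<Rightarrow> ('o \<Rightarrow> 'x \<Rightarrow> 'z \<Rightarrow> 'p) \<Rightarrow> ('o \<Rightarrow> 'y \<Rightarrow> 'w \<Rightarrow> 'q) \<Rightarrow>
    ('o \<Rightarrow> 'x \<Rightarrow> 'z \<Rightarrow> 'q) \<Rightarrow> 'o \<Rightarrow> 'z \<Rightarrow> ('x, 'y, 'p, 'q) ntr" where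
  "cur_mod C E W Mo Ma Mo' Ma' m = (\<lambda>c \<in> Cell0 C. \<lambda>w \<in> Ob (Ps0 W c).
     (cur_func E W Mo Ma c w, \<lambda>e \<in> Ob (Ps0 E c). m c e w, cur_func E W Mo' Ma' c w))"

context balanced
begin

abbreviation "cf \<equiv> cur_func E W Mo Ma"
abbreviation "cp \<equiv> curry_pstr C E W Mo Ma t"

lemma cf_simps [simp]:
  "e \<in> Ob (Ps0 E c) \<Longrightarrow> FOb (cf c w) e = Mo c e w"
  "a \<in> Arr (Ps0 E c) \<Longrightarrow> FArr (cf c w) a = Ma c a (Idt (Ps0 W c) w)"
  by (simp_all add: cur_func_def)

lemma cf_functor [simp]: "c \<in> Cell0 C \<Longrightarrow> w \<in> Ob (Ps0 W c) \<Longrightarrow> is_functor (Ps0 E c) A (cf c w)"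
  by (rule functorI) (auto simp: Ma_Comp_left, simp_all add: cur_func_def)

lemma cp_simps [simp]:
  "c \<in> Cell0 C \<Longrightarrow> w \<in> Ob (Ps0 W c) \<Longrightarrow> FOb (Tr0 cp c) w = cf c w"
  "c \<in> Cell0 C \<Longrightarrow> b \<in> Arr (Ps0 W c) \<Longrightarrow> FArr (Tr0 cp c) b =
    (cf c (Dom (Ps0 W c) b), \<lambda>e \<in> Ob (Ps0 E c). Ma c (Idt (Ps0 E c) e) b, cf c (Cod (Ps0 W c) b))"
  "f \<in> Cell1 C \<Longrightarrow> w \<in> Ob (Ps0 W (Tgt C f)) \<Longrightarrow> Tr1 cp f w =
    (comp_func (Ps0 E (Src C f)) (cf (Tgt C f) w) (Ps1 E f), \<lambda>e \<in> Ob (Ps0 E (Src C f)). t f e w,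
     cf (Src C f) (FOb (Ps1 W f) w))"
  by (simp_all add: curry_pstr_def)

lemma cf_nat [simp]:
  assumes "c \<in> Cell0 C" "b \<in> Arr (Ps0 W c)" "Dom (Ps0 W c) b = w" "Cod (Ps0 W c) b = w'"
  shows "nat_trans (Ps0 E c) A (cf c w) (cf c w') (\<lambda>e \<in> Ob (Ps0 E c). Ma c (Idt (Ps0 E c) e) b)"
proof (rule nat_transI)
  have "w \<in> Ob (Ps0 W c)" "w' \<in> Ob (Ps0 W c)"
    using cat_simps(1,2)[of "Ps0 W c" b] assms by auto
  then show "is_functor (Ps0 E c) A (cf c w)" "is_functor (Ps0 E c) A (cf c w')" using assms by simp_all
  fix a assume "a \<in> Arr (Ps0 E c)"
  then show "FArr (cf c w') a \<cdot>\<^bsub>A\<^esub> (\<lambda>e \<in> Ob (Ps0 E c). Ma c (Idt (Ps0 E c) e) b) (Dom (Ps0 E c) a) =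
      (\<lambda>e \<in> Ob (Ps0 E c). Ma c (Idt (Ps0 E c) e) b) (Cod (Ps0 E c) a) \<cdot>\<^bsub>A\<^esub> FArr (cf c w) a"
    using assms Ma_split[of c a b] by simp
qed (use assms in simp_all)

lemma cp_functor: "c \<in> Cell0 C \<Longrightarrow> is_functor (Ps0 W c) (functor_cat (Ps0 E c) A) (Tr0 cp c)"
proof (rule functorI)
  assume c: "c \<in> Cell0 C"
  show "FOb (Tr0 cp c) \<in> extensional (Ob (Ps0 W c))" "FArr (Tr0 cp c) \<in> extensional (Arr (Ps0 W c))"
    using c by (simp_all add: curry_pstr_def)
qed (simp_all add: Ma_Comp_right cong: restrict_cong)

lemma cp_cell:
  assumes [simp]: "f \<in> Cell1 C" "w \<in> Ob (Ps0 W (Tgt C f))" "Src C f = c"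
  shows "nat_trans (Ps0 E c) A (comp_func (Ps0 E c) (cf (Tgt C f) w) (Ps1 E f)) (cf c (FOb (Ps1 W f) w))
      (\<lambda>e \<in> Ob (Ps0 E c). t f e w)"
proof (rule nat_transI)
  have [simp]: "c \<in> Cell0 C" using cells1_simps(1)[of f] by simp
  show "is_functor (Ps0 E c) A (comp_func (Ps0 E c) (cf (Tgt C f) w) (Ps1 E f))"
    by (rule is_functor_comp[OF _ E.Ps1_functor[of f _ "Tgt C f"]]) simp_all
  show "is_functor (Ps0 E c) A (cf c (FOb (Ps1 W f) w))" by simp
  fix a assume [simp]: "a \<in> Arr (Ps0 E c)"
  show "FArr (cf c (FOb (Ps1 W f) w)) a \<cdot>\<^bsub>A\<^esub> (\<lambda>e \<in> Ob (Ps0 E c). t f e w) (Dom (Ps0 E c) a) =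
      (\<lambda>e \<in> Ob (Ps0 E c). t f e w) (Cod (Ps0 E c) a) \<cdot>\<^bsub>A\<^esub> FArr (comp_func (Ps0 E c) (cf (Tgt C f) w) (Ps1 E f)) a"
    using t_natural[of f a "Idt (Ps0 W (Tgt C f)) w"] by simp
qed simp_all

text \<open>
  Each law of a pseudo-natural transformation is an equation between natural transformations, and its component at \<open>e\<close> is
  the corresponding law of the balanced family with an identity in \<open>E\<close> or in \<open>W\<close>.
\<close>

lemma cp_pseudo_nat: "pseudo_nat (op2 C) W (Cat_psf C E A) cp"
  unfolding pseudo_nat_def
proof (intro conjI allI ballI)
  show "Tr0 cp \<in> extensional (Cell0 (op2 C))" "Tr1 cp \<in> extensional (Cell1 (op2 C))"
    by (simp_all add: curry_pstr_def)
  show "is_functor (Ps0 W k) (Ps0 (Cat_psf C E A) k) (Tr0 cp k)" if "k \<in> Cell0 (op2 C)" for k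
    using that cp_functor by simp
next
  fix k l f assume "f \<in> hom (cells1 (op2 C)) k l"
  then have [simp]: "f \<in> Cell1 C" "Src C f = l" "Tgt C f = k" by auto
  have [simp]: "k \<in> Cell0 C" "l \<in> Cell0 C" using cells1_simps(1,2)[of f] by simp_all
  show "nat_iso (Ps0 W k) (Ps0 (Cat_psf C E A) l) (comp_func (Ps0 W k) (Ps1 (Cat_psf C E A) f) (Tr0 cp k))
      (comp_func (Ps0 W k) (Tr0 cp l) (Ps1 W f)) (Tr1 cp f)"
    unfolding nat_iso_def
  proof (intro conjI ballI nat_transI)
    show "is_functor (Ps0 W k) (Ps0 (Cat_psf C E A) l) (comp_func (Ps0 W k) (Ps1 (Cat_psf C E A) f) (Tr0 cp k))"
      using E.Ps1_functor[of f l k] by (intro is_functor_comp[OF _ cp_functor]) (simp_all add: is_functor_precomp)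
    show "is_functor (Ps0 W k) (Ps0 (Cat_psf C E A) l) (comp_func (Ps0 W k) (Tr0 cp l) (Ps1 W f))"
      using W.Ps1_functor[of f k l] cp_functor[of l] by (intro is_functor_comp) simp_all
    show "Tr1 cp f \<in> extensional (Ob (Ps0 W k))" by (simp add: curry_pstr_def)
  next
    fix w assume [simp]: "w \<in> Ob (Ps0 W k)"
    show "Tr1 cp f w \<in> Arr (Ps0 (Cat_psf C E A) l)" using cp_cell[of f w l] by simp
    show "Dom (Ps0 (Cat_psf C E A) l) (Tr1 cp f w) = FOb (comp_func (Ps0 W k) (Ps1 (Cat_psf C E A) f) (Tr0 cp k)) w"
      "Cod (Ps0 (Cat_psf C E A) l) (Tr1 cp f w) = FOb (comp_func (Ps0 W k) (Tr0 cp l) (Ps1 W f)) w"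
      by simp_all
    show "is_iso (Ps0 (Cat_psf C E A) l) (Tr1 cp f w)"
      using is_iso_functor_cat_iff[OF _ _ cp_cell[of f w l]] by simp
  next
    fix b assume [simp]: "b \<in> Arr (Ps0 W k)"
    have "Ma l (Idt (Ps0 E l) e) (FArr (Ps1 W f) b) \<cdot>\<^bsub>A\<^esub> t f e (Dom (Ps0 W k) b) =
        t f e (Cod (Ps0 W k) b) \<cdot>\<^bsub>A\<^esub> Ma k (Idt (Ps0 E k) (FOb (Ps1 E f) e)) b" if "e \<in> Ob (Ps0 E l)" for e
      using t_natural[of f "Idt (Ps0 E l) e" b] that by simp
    then show "FArr (comp_func (Ps0 W k) (Tr0 cp l) (Ps1 W f)) b \<cdot>\<^bsub>Ps0 (Cat_psf C E A) l\<^esub> Tr1 cp f (Dom (Ps0 W k) b) =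
        Tr1 cp f (Cod (Ps0 W k) b) \<cdot>\<^bsub>Ps0 (Cat_psf C E A) l\<^esub> FArr (comp_func (Ps0 W k) (Ps1 (Cat_psf C E A) f) (Tr0 cp k)) b"
      by (simp cong: restrict_cong)
  qed
next
  fix k l f g \<alpha> w assume "f \<in> hom (cells1 (op2 C)) k l" "\<alpha> \<in> hom (vert_cat (op2 C)) f g" "w \<in> Ob (Ps0 W k)"
  then have [simp]: "f \<in> Cell1 C" "Src C f = l" "Tgt C f = k" "\<alpha> \<in> Cell2 C" "Dom2 C \<alpha> = f" "Cod2 C \<alpha> = g" "w \<in> Ob (Ps0 W k)"
    by auto
  have [simp]: "k \<in> Cell0 C" "l \<in> Cell0 C" using cells1_simps(1,2)[of f] by simp_all
  have [simp]: "g \<in> Cell1 C" "Src C g = l" "Tgt C g = k" using vert_simps(2)[of \<alpha>] horiz_simps(1,2)[of \<alpha>] by simp_all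
  have "t g e w \<cdot>\<^bsub>A\<^esub> Ma k (Ps2 E \<alpha> e) (Idt (Ps0 W k) w) = Ma l (Idt (Ps0 E l) e) (Ps2 W \<alpha> w) \<cdot>\<^bsub>A\<^esub> t f e w"
    if "e \<in> Ob (Ps0 E l)" for e
    using t_2cell[of \<alpha> f g e w] that by simp
  then show "Tr1 cp g w \<cdot>\<^bsub>Ps0 (Cat_psf C E A) l\<^esub> Ps2 (Cat_psf C E A) \<alpha> (FOb (Tr0 cp k) w) =
      FArr (Tr0 cp l) (Ps2 W \<alpha> w) \<cdot>\<^bsub>Ps0 (Cat_psf C E A) l\<^esub> Tr1 cp f w"
    by (simp cong: restrict_cong)
next
  fix k w assume "k \<in> Cell0 (op2 C)" "w \<in> Ob (Ps0 W k)"
  then have [simp]: "k \<in> Cell0 C" "w \<in> Ob (Ps0 W k)" by simp_all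
  have "comp_func (Ps0 E k) (cf k w) (Ps1 E (Id1 C k)) = cf k w"
    by (rule func_eqI[OF is_functor_comp[OF _ E.Ps1_functor[of "Id1 C k" k k] cf_functor[of k w]] cf_functor[of k w]]) simp_all
  then show "Tr1 cp (Id1 (op2 C) k) w = Idt (Ps0 (Cat_psf C E A) k) (FOb (Tr0 cp k) w)"
    by (simp add: t_Id1 cong: restrict_cong)
next
  fix k l m f g w assume "f \<in> hom (cells1 (op2 C)) k l" "g \<in> hom (cells1 (op2 C)) l m" "w \<in> Ob (Ps0 W k)"
  then have [simp]: "f \<in> Cell1 C" "Src C f = l" "Tgt C f = k" "g \<in> Cell1 C" "Src C g = m" "Tgt C g = l" "w \<in> Ob (Ps0 W k)"
    by auto
  have [simp]: "k \<in> Cell0 C" "l \<in> Cell0 C" "m \<in> Cell0 C" using cells1_simps(1,2)[of f] cells1_simps(1)[of g] by simp_all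
  have "t (f \<odot> g) e w \<cdot>\<^bsub>A\<^esub> Ma k (Coh E f g e) (Idt (Ps0 W k) w) =
      Ma m (Idt (Ps0 E m) e) (Coh W g f w) \<cdot>\<^bsub>A\<^esub> t g e (FOb (Ps1 W f) w) \<cdot>\<^bsub>A\<^esub> t f (FOb (Ps1 E g) e) w"
    if "e \<in> Ob (Ps0 E m)" for e
    using t_Cmp1[of g f e w] that by simp
  then show "Tr1 cp (g \<odot>\<^bsub>op2 C\<^esub> f) w \<cdot>\<^bsub>Ps0 (Cat_psf C E A) m\<^esub> Coh (Cat_psf C E A) g f (FOb (Tr0 cp k) w) =
      FArr (Tr0 cp m) (Coh W g f w) \<cdot>\<^bsub>Ps0 (Cat_psf C E A) m\<^esub> Tr1 cp g (FOb (Ps1 W f) w) \<cdot>\<^bsub>Ps0 (Cat_psf C E A) m\<^esub>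
        FArr (Ps1 (Cat_psf C E A) g) (Tr1 cp f w)"
    using cp_cell[of f w l] by (simp cong: restrict_cong)
qed

end

subsection \<open>Uncurrying\<close>

abbreviation tm :: "'a \<times> 'b \<times> 'c \<Rightarrow> 'b" where
  "tm \<eta> \<equiv> fst (snd \<eta>)"

text \<open>
  A pseudo-natural transformation acts on arrows of \<open>E c\<close> and of \<open>W c\<close> separately; \<open>unc_arr\<close> acts on a pair by doing the arrow of \<open>W c\<close>
  first.
\<close>

definition unc_ob :: "('o, 'f, 'z, 'w, ('x, 'y, 'p, 'q) func, ('x, 'y, 'p, 'q) ntr) pstr \<Rightarrow> 'o \<Rightarrow> 'x \<Rightarrow> 'z \<Rightarrow> 'p" where
  "unc_ob \<theta> c e w = FOb (FOb (Tr0 \<theta> c) w) e"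

definition unc_arr :: "('o, 'f, 't, 'x, 'y) psf \<Rightarrow> ('o, 'f, 't, 'z, 'w) psf \<Rightarrow>
    ('o, 'f, 'z, 'w, ('x, 'y, 'p, 'q) func, ('x, 'y, 'p, 'q) ntr) pstr \<Rightarrow> ('p, 'q) cat \<Rightarrow> 'o \<Rightarrow> 'y \<Rightarrow> 'w \<Rightarrow> 'q" where
  "unc_arr E W \<theta> A c a b =
     FArr (FOb (Tr0 \<theta> c) (Cod (Ps0 W c) b)) a \<cdot>\<^bsub>A\<^esub> tm (FArr (Tr0 \<theta> c) b) (Dom (Ps0 E c) a)"

definition unc_cell :: "('o, 'f, 'z, 'w, ('x, 'y, 'p, 'q) func, ('x, 'y, 'p, 'q) ntr) pstr \<Rightarrow> 'f \<Rightarrow> 'x \<Rightarrow> 'z \<Rightarrow> 'q" where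
  "unc_cell \<theta> f e w = tm (Tr1 \<theta> f w) e"

locale weight_pseudo_nat = weight C E W + A: category A
  for C :: "('o, 'f, 't) two_cat" (structure)
    and E :: "('o, 'f, 't, 'x, 'y) psf" and W :: "('o, 'f, 't, 'z, 'w) psf" and A :: "('p, 'q) cat" +
  fixes \<theta> :: "('o, 'f, 'z, 'w, ('x, 'y, 'p, 'q) func, ('x, 'y, 'p, 'q) ntr) pstr"
  assumes \<theta>: "pseudo_nat (op2 C) W (Cat_psf C E A) \<theta>"
begin

lemmas A_cat [simp] = A.category_axioms

abbreviation "F c w \<equiv> FOb (Tr0 \<theta> c) w"
abbreviation "\<eta> c b \<equiv> tm (FArr (Tr0 \<theta> c) b)"
abbreviation "\<tau> f w \<equiv> tm (Tr1 \<theta> f w)"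

lemma Tr0_functor: "c \<in> Cell0 C \<Longrightarrow> is_functor (Ps0 W c) (functor_cat (Ps0 E c) A) (Tr0 \<theta> c)"
  using pseudo_natD(3)[OF \<theta>, of c] by simp

lemma F_functor: "c \<in> Cell0 C \<Longrightarrow> w \<in> Ob (Ps0 W c) \<Longrightarrow> is_functor (Ps0 E c) A (F c w)"
  using functorD(3)[OF Tr0_functor, of c w] by simp

lemmas F_simps [simp] = functorD(3-8)[OF F_functor]

lemma \<eta>_nat:
  assumes "c \<in> Cell0 C" "b \<in> Arr (Ps0 W c)"
  shows "FArr (Tr0 \<theta> c) b = (F c (Dom (Ps0 W c) b), \<eta> c b, F c (Cod (Ps0 W c) b))"
    and "nat_trans (Ps0 E c) A (F c (Dom (Ps0 W c) b)) (F c (Cod (Ps0 W c) b)) (\<eta> c b)"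
  using functorD(4-6)[OF Tr0_functor[OF assms(1)] assms(2)]
  by (cases "FArr (Tr0 \<theta> c) b", simp)+

lemma \<eta>_simps [simp]:
  assumes "c \<in> Cell0 C" "b \<in> Arr (Ps0 W c)" "e \<in> Ob (Ps0 E c)"
  shows "\<eta> c b e \<in> Arr A" "Dom A (\<eta> c b e) = FOb (F c (Dom (Ps0 W c) b)) e" "Cod A (\<eta> c b e) = FOb (F c (Cod (Ps0 W c) b)) e"
  using nat_transD(4-6)[OF \<eta>_nat(2)] assms by auto

lemma \<eta>_natural:
  assumes "c \<in> Cell0 C" "b \<in> Arr (Ps0 W c)" "a \<in> Arr (Ps0 E c)"
  shows "FArr (F c (Cod (Ps0 W c) b)) a \<cdot>\<^bsub>A\<^esub> \<eta> c b (Dom (Ps0 E c) a) =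
    \<eta> c b (Cod (Ps0 E c) a) \<cdot>\<^bsub>A\<^esub> FArr (F c (Dom (Ps0 W c) b)) a"
  using nat_transD(7)[OF \<eta>_nat(2)] assms by simp

lemma \<eta>_Idt [simp]:
  "c \<in> Cell0 C \<Longrightarrow> w \<in> Ob (Ps0 W c) \<Longrightarrow> e \<in> Ob (Ps0 E c) \<Longrightarrow> \<eta> c (Idt (Ps0 W c) w) e = Idt A (FOb (F c w) e)"
  using functorD(7)[OF Tr0_functor, of c w] by simp

lemma \<eta>_Comp:
  assumes "c \<in> Cell0 C" "b \<in> Arr (Ps0 W c)" "b' \<in> Arr (Ps0 W c)" "Dom (Ps0 W c) b' = Cod (Ps0 W c) b" "e \<in> Ob (Ps0 E c)"
  shows "\<eta> c (b' \<cdot>\<^bsub>Ps0 W c\<^esub> b) e = \<eta> c b' e \<cdot>\<^bsub>A\<^esub> \<eta> c b e"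
proof -
  have "FArr (Tr0 \<theta> c) (b' \<cdot>\<^bsub>Ps0 W c\<^esub> b) =
      (F c (Cod (Ps0 W c) b), \<eta> c b', F c (Cod (Ps0 W c) b')) \<cdot>\<^bsub>functor_cat (Ps0 E c) A\<^esub>
        (F c (Dom (Ps0 W c) b), \<eta> c b, F c (Cod (Ps0 W c) b))"
    using functorD(8)[OF Tr0_functor, of c b b'] assms \<eta>_nat(1)[of c b] \<eta>_nat(1)[of c b'] by simp
  then show ?thesis using assms(5) by simp
qed

lemma \<tau>_iso:
  assumes [simp]: "f \<in> Cell1 C"
  shows "nat_iso (Ps0 W (Tgt C f)) (functor_cat (Ps0 E (Src C f)) A)
    (comp_func (Ps0 W (Tgt C f)) (precomp_func (Ps0 E (Src C f)) (Ps0 E (Tgt C f)) A (Ps1 E f)) (Tr0 \<theta> (Tgt C f)))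
    (comp_func (Ps0 W (Tgt C f)) (Tr0 \<theta> (Src C f)) (Ps1 W f)) (Tr1 \<theta> f)"
  using pseudo_natD(4)[OF \<theta>, of f "Tgt C f" "Src C f"] by simp

lemma \<tau>_nat:
  assumes [simp]: "f \<in> Cell1 C" "w \<in> Ob (Ps0 W (Tgt C f))"
  shows "Tr1 \<theta> f w = (comp_func (Ps0 E (Src C f)) (F (Tgt C f) w) (Ps1 E f), \<tau> f w, F (Src C f) (FOb (Ps1 W f) w))"
    and "nat_trans (Ps0 E (Src C f)) A (comp_func (Ps0 E (Src C f)) (F (Tgt C f) w) (Ps1 E f))
      (F (Src C f) (FOb (Ps1 W f) w)) (\<tau> f w)"
    and "e \<in> Ob (Ps0 E (Src C f)) \<Longrightarrow> is_iso A (\<tau> f w e)"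
proof -
  note n = \<tau>_iso[of f, unfolded nat_iso_def, simplified]
  have "Tr1 \<theta> f w \<in> Arr (functor_cat (Ps0 E (Src C f)) A)"
    "Dom (functor_cat (Ps0 E (Src C f)) A) (Tr1 \<theta> f w) = comp_func (Ps0 E (Src C f)) (F (Tgt C f) w) (Ps1 E f)"
    "Cod (functor_cat (Ps0 E (Src C f)) A) (Tr1 \<theta> f w) = F (Src C f) (FOb (Ps1 W f) w)"
    using nat_transD(4-6)[OF n[THEN conjunct1], of w] F_functor[of "Tgt C f" w] by simp_all
  then show 1: "Tr1 \<theta> f w = (comp_func (Ps0 E (Src C f)) (F (Tgt C f) w) (Ps1 E f), \<tau> f w, F (Src C f) (FOb (Ps1 W f) w))"
    and 2: "nat_trans (Ps0 E (Src C f)) A (comp_func (Ps0 E (Src C f)) (F (Tgt C f) w) (Ps1 E f))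
      (F (Src C f) (FOb (Ps1 W f) w)) (\<tau> f w)"
    by (cases "Tr1 \<theta> f w", simp)+
  have "is_iso (functor_cat (Ps0 E (Src C f)) A) (Tr1 \<theta> f w)" using n by simp
  then show "e \<in> Ob (Ps0 E (Src C f)) \<Longrightarrow> is_iso A (\<tau> f w e)"
    using is_iso_functor_cat_iff[OF _ _ 2] 1 by simp
qed

lemma \<tau>_simps [simp]:
  assumes "f \<in> Cell1 C" "w \<in> Ob (Ps0 W (Tgt C f))" "e \<in> Ob (Ps0 E (Src C f))"
  shows "\<tau> f w e \<in> Arr A" "Dom A (\<tau> f w e) = FOb (F (Tgt C f) w) (FOb (Ps1 E f) e)"
    "Cod A (\<tau> f w e) = FOb (F (Src C f) (FOb (Ps1 W f) w)) e"
  using nat_transD(4-6)[OF \<tau>_nat(2)] assms by auto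

lemma unc_balanced: "balanced C E W A (unc_ob \<theta>) (unc_arr E W \<theta> A) (unc_cell \<theta>)"
proof (intro balanced.intro balanced_axioms.intro)
  show "weight C E W" by (rule weight_axioms)
  show "category A" by simp
next
  fix c a b assume [simp]: "c \<in> Cell0 C" "a \<in> Arr (Ps0 E c)" "b \<in> Arr (Ps0 W c)"
  show "unc_arr E W \<theta> A c a b \<in> Arr A \<and>
      Dom A (unc_arr E W \<theta> A c a b) = unc_ob \<theta> c (Dom (Ps0 E c) a) (Dom (Ps0 W c) b) \<and>
      Cod A (unc_arr E W \<theta> A c a b) = unc_ob \<theta> c (Cod (Ps0 E c) a) (Cod (Ps0 W c) b)"
    by (simp add: unc_arr_def unc_ob_def)
  fix a' b' assume [simp]: "a' \<in> Arr (Ps0 E c)" "b' \<in> Arr (Ps0 W c)"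
    "Dom (Ps0 E c) a' = Cod (Ps0 E c) a" "Dom (Ps0 W c) b' = Cod (Ps0 W c) b"
  have "FArr (F c (Cod (Ps0 W c) b')) a \<cdot>\<^bsub>A\<^esub> \<eta> c b' (Dom (Ps0 E c) a) \<cdot>\<^bsub>A\<^esub> \<eta> c b (Dom (Ps0 E c) a) =
      \<eta> c b' (Cod (Ps0 E c) a) \<cdot>\<^bsub>A\<^esub> FArr (F c (Cod (Ps0 W c) b)) a \<cdot>\<^bsub>A\<^esub> \<eta> c b (Dom (Ps0 E c) a)"
    using \<eta>_natural[of c b' a] by (intro Comp_reduce) simp_all
  then show "unc_arr E W \<theta> A c (a' \<cdot>\<^bsub>Ps0 E c\<^esub> a) (b' \<cdot>\<^bsub>Ps0 W c\<^esub> b) = unc_arr E W \<theta> A c a' b' \<cdot>\<^bsub>A\<^esub> unc_arr E W \<theta> A c a b"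
    by (simp add: unc_arr_def \<eta>_Comp)
next
  fix f e w assume [simp]: "f \<in> Cell1 C" "e \<in> Ob (Ps0 E (Src C f))" "w \<in> Ob (Ps0 W (Tgt C f))"
  show "is_iso A (unc_cell \<theta> f e w) \<and> Dom A (unc_cell \<theta> f e w) = unc_ob \<theta> (Tgt C f) (FOb (Ps1 E f) e) w \<and>
      Cod A (unc_cell \<theta> f e w) = unc_ob \<theta> (Src C f) e (FOb (Ps1 W f) w)"
    using \<tau>_nat(3)[of f w e] by (simp add: unc_cell_def unc_ob_def)
next
  fix f a b assume [simp]: "f \<in> Cell1 C" "a \<in> Arr (Ps0 E (Src C f))" "b \<in> Arr (Ps0 W (Tgt C f))"
  let ?c = "Src C f" and ?d = "Tgt C f"
  let ?a = "Dom (Ps0 E ?c) a" and ?a' = "Cod (Ps0 E ?c) a" and ?b = "Dom (Ps0 W ?d) b" and ?b' = "Cod (Ps0 W ?d) b"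
  have "Tr1 \<theta> f ?b' \<cdot>\<^bsub>functor_cat (Ps0 E ?c) A\<^esub> FArr (comp_func (Ps0 W ?d) (precomp_func (Ps0 E ?c) (Ps0 E ?d) A (Ps1 E f)) (Tr0 \<theta> ?d)) b =
      FArr (comp_func (Ps0 W ?d) (Tr0 \<theta> ?c) (Ps1 W f)) b \<cdot>\<^bsub>functor_cat (Ps0 E ?c) A\<^esub> Tr1 \<theta> f ?b"
    using nat_transD(7)[OF \<tau>_iso[of f, unfolded nat_iso_def, THEN conjunct1], of b] by simp
  then have "(comp_func (Ps0 E ?c) (F ?d ?b') (Ps1 E f), \<tau> f ?b', F ?c (FOb (Ps1 W f) ?b')) \<cdot>\<^bsub>functor_cat (Ps0 E ?c) A\<^esub>
        FArr (precomp_func (Ps0 E ?c) (Ps0 E ?d) A (Ps1 E f)) (F ?d ?b, \<eta> ?d b, F ?d ?b') =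
      (F ?c (FOb (Ps1 W f) ?b), \<eta> ?c (FArr (Ps1 W f) b), F ?c (FOb (Ps1 W f) ?b')) \<cdot>\<^bsub>functor_cat (Ps0 E ?c) A\<^esub>
        (comp_func (Ps0 E ?c) (F ?d ?b) (Ps1 E f), \<tau> f ?b, F ?c (FOb (Ps1 W f) ?b))"
    using \<tau>_nat(1)[of f ?b] \<tau>_nat(1)[of f ?b'] \<eta>_nat(1)[of ?d b] \<eta>_nat(1)[of ?c "FArr (Ps1 W f) b"] by simp
  then have 1: "\<tau> f ?b' e \<cdot>\<^bsub>A\<^esub> \<eta> ?d b (FOb (Ps1 E f) e) = \<eta> ?c (FArr (Ps1 W f) b) e \<cdot>\<^bsub>A\<^esub> \<tau> f ?b e"
    if "e \<in> Ob (Ps0 E ?c)" for e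
    using that \<eta>_nat(2)[of ?d b] by (auto dest!: fun_cong[of _ _ e])
  have 2: "FArr (F ?c (FOb (Ps1 W f) ?b')) a \<cdot>\<^bsub>A\<^esub> \<tau> f ?b' ?a = \<tau> f ?b' ?a' \<cdot>\<^bsub>A\<^esub> FArr (F ?d ?b') (FArr (Ps1 E f) a)"
    using nat_transD(7)[OF \<tau>_nat(2)[of f ?b'], of a] by simp
  have "\<tau> f ?b' ?a' \<cdot>\<^bsub>A\<^esub> FArr (F ?d ?b') (FArr (Ps1 E f) a) \<cdot>\<^bsub>A\<^esub> \<eta> ?d b (FOb (Ps1 E f) ?a) =
      FArr (F ?c (FOb (Ps1 W f) ?b')) a \<cdot>\<^bsub>A\<^esub> \<tau> f ?b' ?a \<cdot>\<^bsub>A\<^esub> \<eta> ?d b (FOb (Ps1 E f) ?a)"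
    using 2 by (intro Comp_reduce) simp_all
  then show "unc_cell \<theta> f ?a' ?b' \<cdot>\<^bsub>A\<^esub> unc_arr E W \<theta> A ?d (FArr (Ps1 E f) a) b =
      unc_arr E W \<theta> A ?c a (FArr (Ps1 W f) b) \<cdot>\<^bsub>A\<^esub> unc_cell \<theta> f ?a ?b"
    by (simp add: unc_arr_def unc_cell_def 1)
next
  fix \<alpha> f g e w assume [simp]: "\<alpha> \<in> Cell2 C" "Dom2 C \<alpha> = f" "Cod2 C \<alpha> = g"
    "e \<in> Ob (Ps0 E (Src C f))" "w \<in> Ob (Ps0 W (Tgt C f))"
  let ?c = "Src C f" and ?d = "Tgt C f"
  have [simp]: "f \<in> Cell1 C" "g \<in> Cell1 C" "Src C g = ?c" "Tgt C g = ?d"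
    using vert_simps(1,2)[of \<alpha>] horiz_simps(1,2)[of \<alpha>] by simp_all
  have "Tr1 \<theta> g w \<cdot>\<^bsub>functor_cat (Ps0 E ?c) A\<^esub> Ps2 (Cat_psf C E A) \<alpha> (F ?d w) =
      FArr (Tr0 \<theta> ?c) (Ps2 W \<alpha> w) \<cdot>\<^bsub>functor_cat (Ps0 E ?c) A\<^esub> Tr1 \<theta> f w"
    using pseudo_natD(5)[OF \<theta>, of \<alpha> f g ?d ?c w] by simp
  then have "(comp_func (Ps0 E ?c) (F ?d w) (Ps1 E g), \<tau> g w, F ?c (FOb (Ps1 W g) w)) \<cdot>\<^bsub>functor_cat (Ps0 E ?c) A\<^esub>
      Ps2 (Cat_psf C E A) \<alpha> (F ?d w) =
      (F ?c (FOb (Ps1 W f) w), \<eta> ?c (Ps2 W \<alpha> w), F ?c (FOb (Ps1 W g) w)) \<cdot>\<^bsub>functor_cat (Ps0 E ?c) A\<^esub>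
      (comp_func (Ps0 E ?c) (F ?d w) (Ps1 E f), \<tau> f w, F ?c (FOb (Ps1 W f) w))"
    using \<tau>_nat(1)[of f w] \<tau>_nat(1)[of g w] \<eta>_nat(1)[of ?c "Ps2 W \<alpha> w"] by simp
  then have "\<tau> g w e \<cdot>\<^bsub>A\<^esub> FArr (F ?d w) (Ps2 E \<alpha> e) = \<eta> ?c (Ps2 W \<alpha> w) e \<cdot>\<^bsub>A\<^esub> \<tau> f w e"
    using F_functor[of ?d w] by (auto dest!: fun_cong[of _ _ e])
  then show "unc_cell \<theta> g e w \<cdot>\<^bsub>A\<^esub> unc_arr E W \<theta> A ?d (Ps2 E \<alpha> e) (Idt (Ps0 W ?d) w) =
      unc_arr E W \<theta> A ?c (Idt (Ps0 E ?c) e) (Ps2 W \<alpha> w) \<cdot>\<^bsub>A\<^esub> unc_cell \<theta> f e w"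
    by (simp add: unc_cell_def unc_arr_def)
next
  fix c e w assume [simp]: "c \<in> Cell0 C" "e \<in> Ob (Ps0 E c)" "w \<in> Ob (Ps0 W c)"
  show "unc_ob \<theta> c e w \<in> Ob A" by (simp add: unc_ob_def)
  show "unc_arr E W \<theta> A c (Idt (Ps0 E c) e) (Idt (Ps0 W c) w) = Idt A (unc_ob \<theta> c e w)"
    by (simp add: unc_arr_def unc_ob_def)
  show "unc_cell \<theta> (Id1 C c) e w = Idt A (unc_ob \<theta> c e w)"
    using pseudo_natD(6)[OF \<theta>, of c w] by (simp add: unc_cell_def unc_ob_def)
next
  fix f g e w assume [simp]: "f \<in> Cell1 C" "g \<in> Cell1 C" "Src C g = Tgt C f"
    "e \<in> Ob (Ps0 E (Src C f))" "w \<in> Ob (Ps0 W (Tgt C g))"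
  let ?c = "Src C f" and ?d = "Tgt C f" and ?k = "Tgt C g"
  have "Tr1 \<theta> (g \<odot> f) w \<cdot>\<^bsub>functor_cat (Ps0 E ?c) A\<^esub> Coh (Cat_psf C E A) f g (F ?k w) =
      FArr (Tr0 \<theta> ?c) (Coh W f g w) \<cdot>\<^bsub>functor_cat (Ps0 E ?c) A\<^esub> Tr1 \<theta> f (FOb (Ps1 W g) w) \<cdot>\<^bsub>functor_cat (Ps0 E ?c) A\<^esub>
        FArr (Ps1 (Cat_psf C E A) f) (Tr1 \<theta> g w)"
    using pseudo_natD(7)[OF \<theta>, of g f ?k ?d ?c w] by simp
  then have "(comp_func (Ps0 E ?c) (F ?k w) (Ps1 E (g \<odot> f)), \<tau> (g \<odot> f) w, F ?c (FOb (Ps1 W (g \<odot> f)) w))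
      \<cdot>\<^bsub>functor_cat (Ps0 E ?c) A\<^esub> Coh (Cat_psf C E A) f g (F ?k w) =
      (F ?c (FOb (Ps1 W f) (FOb (Ps1 W g) w)), \<eta> ?c (Coh W f g w), F ?c (FOb (Ps1 W (g \<odot> f)) w)) \<cdot>\<^bsub>functor_cat (Ps0 E ?c) A\<^esub>
      (comp_func (Ps0 E ?c) (F ?d (FOb (Ps1 W g) w)) (Ps1 E f), \<tau> f (FOb (Ps1 W g) w), F ?c (FOb (Ps1 W f) (FOb (Ps1 W g) w)))
      \<cdot>\<^bsub>functor_cat (Ps0 E ?c) A\<^esub> FArr (Ps1 (Cat_psf C E A) f)
        (comp_func (Ps0 E ?d) (F ?k w) (Ps1 E g), \<tau> g w, F ?d (FOb (Ps1 W g) w))"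
    using \<tau>_nat(1)[of "g \<odot> f" w] \<tau>_nat(1)[of f "FOb (Ps1 W g) w"] \<tau>_nat(1)[of g w] \<eta>_nat(1)[of ?c "Coh W f g w"]
    by simp
  then have "\<tau> (g \<odot> f) w e \<cdot>\<^bsub>A\<^esub> FArr (F ?k w) (Coh E g f e) =
      \<eta> ?c (Coh W f g w) e \<cdot>\<^bsub>A\<^esub> \<tau> f (FOb (Ps1 W g) w) e \<cdot>\<^bsub>A\<^esub> \<tau> g w (FOb (Ps1 E f) e)"
    using F_functor[of ?k w] \<tau>_nat(2)[of g w] by (auto dest!: fun_cong[of _ _ e])
  then show "unc_cell \<theta> (g \<odot> f) e w \<cdot>\<^bsub>A\<^esub> unc_arr E W \<theta> A ?k (Coh E g f e) (Idt (Ps0 W ?k) w) =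
      unc_arr E W \<theta> A ?c (Idt (Ps0 E ?c) e) (Coh W f g w) \<cdot>\<^bsub>A\<^esub> unc_cell \<theta> f e (FOb (Ps1 W g) w) \<cdot>\<^bsub>A\<^esub>
        unc_cell \<theta> g (FOb (Ps1 E f) e) w"
    by (simp add: unc_cell_def unc_arr_def)
qed

lemma cur_func_unc:
  assumes [simp]: "c \<in> Cell0 C" "w \<in> Ob (Ps0 W c)"
  shows "cur_func E W (unc_ob \<theta>) (unc_arr E W \<theta> A) c w = F c w"
  by (rule func_eqI[OF balanced.cf_functor[OF unc_balanced assms] F_functor[OF assms]])
    (simp_all add: cur_func_def unc_ob_def unc_arr_def)

lemma curry_unc: "curry_pstr C E W (unc_ob \<theta>) (unc_arr E W \<theta> A) (unc_cell \<theta>) = \<theta>"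
proof -
  let ?cp = "curry_pstr C E W (unc_ob \<theta>) (unc_arr E W \<theta> A) (unc_cell \<theta>)"
  note cp = balanced.cp_pseudo_nat[OF unc_balanced]
  have "Tr0 ?cp = Tr0 \<theta>"
  proof (rule extensionalityI[OF pseudo_natD(1)[OF cp] pseudo_natD(1)[OF \<theta>]])
    fix c assume "c \<in> Cell0 (op2 C)"
    then have [simp]: "c \<in> Cell0 C" by simp
    show "Tr0 ?cp c = Tr0 \<theta> c"
    proof (rule func_eqI[OF balanced.cp_functor[OF unc_balanced] Tr0_functor])
      fix w assume "w \<in> Ob (Ps0 W c)"
      then show "FOb (Tr0 ?cp c) w = F c w" by (simp add: balanced.cp_simps[OF unc_balanced] cur_func_unc)
    next
      fix b assume [simp]: "b \<in> Arr (Ps0 W c)"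
      have "(\<lambda>e \<in> Ob (Ps0 E c). unc_arr E W \<theta> A c (Idt (Ps0 E c) e) b) = \<eta> c b"
        by (rule extensionalityI[OF _ nat_transD(3)[OF \<eta>_nat(2)]]) (simp_all add: unc_arr_def)
      then show "FArr (Tr0 ?cp c) b = FArr (Tr0 \<theta> c) b"
        using \<eta>_nat(1)[of c b] by (simp add: balanced.cp_simps[OF unc_balanced] cur_func_unc)
    qed simp_all
  qed
  moreover have "Tr1 ?cp = Tr1 \<theta>"
  proof (rule extensionalityI[OF pseudo_natD(2)[OF cp] pseudo_natD(2)[OF \<theta>]])
    fix f assume "f \<in> Cell1 (op2 C)"
    then have [simp]: "f \<in> Cell1 C" by simp
    have x: "Tr1 \<theta> f \<in> extensional (Ob (Ps0 W (Tgt C f)))"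
      using nat_transD(3)[OF \<tau>_iso[of f, unfolded nat_iso_def, THEN conjunct1]] by simp
    have "Tr1 ?cp f \<in> extensional (Ob (Ps0 W (Tgt C f)))" by (simp add: curry_pstr_def)
    then show "Tr1 ?cp f = Tr1 \<theta> f"
    proof (rule extensionalityI[OF _ x])
      fix w assume [simp]: "w \<in> Ob (Ps0 W (Tgt C f))"
      have "(\<lambda>e \<in> Ob (Ps0 E (Src C f)). unc_cell \<theta> f e w) = \<tau> f w"
        by (rule extensionalityI[OF _ nat_transD(3)[OF \<tau>_nat(2)]]) (simp_all add: unc_cell_def)
      then show "Tr1 ?cp f w = Tr1 \<theta> f w"
        using \<tau>_nat(1)[of f w] by (simp add: balanced.cp_simps[OF unc_balanced] cur_func_unc)
    qed
  qed
  ultimately show ?thesis by simp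
qed

end

section \<open>Morphisms of balanced families\<close>

text \<open>The uncurried form of a modification.\<close>

locale balanced_map = B: balanced C E W A Mo Ma t + B': balanced C E W A Mo' Ma' t'
  for C :: "('o, 'f, 't) two_cat" and E :: "('o, 'f, 't, 'x, 'y) psf" and W :: "('o, 'f, 't, 'z, 'w) psf"
    and A :: "('p, 'q) cat" and Mo Ma t Mo' Ma' t' +
  fixes m :: "'o \<Rightarrow> 'x \<Rightarrow> 'z \<Rightarrow> 'q"
  assumes m_typed: "c \<in> Cell0 C \<Longrightarrow> e \<in> Ob (Ps0 E c) \<Longrightarrow> w \<in> Ob (Ps0 W c) \<Longrightarrow>
      m c e w \<in> Arr A \<and> Dom A (m c e w) = Mo c e w \<and> Cod A (m c e w) = Mo' c e w"
    and m_natural: "c \<in> Cell0 C \<Longrightarrow> a \<in> Arr (Ps0 E c) \<Longrightarrow> b \<in> Arr (Ps0 W c) \<Longrightarrow>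
      Ma' c a b \<cdot>\<^bsub>A\<^esub> m c (Dom (Ps0 E c) a) (Dom (Ps0 W c) b) = m c (Cod (Ps0 E c) a) (Cod (Ps0 W c) b) \<cdot>\<^bsub>A\<^esub> Ma c a b"
    and m_cell: "f \<in> Cell1 C \<Longrightarrow> e \<in> Ob (Ps0 E (Src C f)) \<Longrightarrow> w \<in> Ob (Ps0 W (Tgt C f)) \<Longrightarrow>
      t' f e w \<cdot>\<^bsub>A\<^esub> m (Tgt C f) (FOb (Ps1 E f) e) w = m (Src C f) e (FOb (Ps1 W f) w) \<cdot>\<^bsub>A\<^esub> t f e w"
begin

lemmas m_simps [simp] = m_typed[THEN conjunct1] m_typed[THEN conjunct2, THEN conjunct1] m_typed[THEN conjunct2, THEN conjunct2]

abbreviation "cm \<equiv> cur_mod C E W Mo Ma Mo' Ma' m"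

lemma cm_nat:
  assumes "c \<in> Cell0 C" "w \<in> Ob (Ps0 W c)"
  shows "nat_trans (Ps0 E c) A (B.cf c w) (B'.cf c w) (\<lambda>e \<in> Ob (Ps0 E c). m c e w)"
proof (rule nat_transI)
  fix a assume "a \<in> Arr (Ps0 E c)"
  then show "FArr (B'.cf c w) a \<cdot>\<^bsub>A\<^esub> (\<lambda>e \<in> Ob (Ps0 E c). m c e w) (Dom (Ps0 E c) a) =
      (\<lambda>e \<in> Ob (Ps0 E c). m c e w) (Cod (Ps0 E c) a) \<cdot>\<^bsub>A\<^esub> FArr (B.cf c w) a"
    using assms m_natural[of c a "Idt (Ps0 W c) w"] by simp
qed (use assms in simp_all)

lemma cm_modification: "modification (op2 C) W (Cat_psf C E A) B.cp B'.cp cm"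
  unfolding modification_def
proof (intro conjI allI ballI B.cp_pseudo_nat B'.cp_pseudo_nat)
  show "cm \<in> extensional (Cell0 (op2 C))" by (simp add: cur_mod_def)
next
  fix c assume "c \<in> Cell0 (op2 C)"
  then have [simp]: "c \<in> Cell0 C" by simp
  show "nat_trans (Ps0 W c) (Ps0 (Cat_psf C E A) c) (Tr0 B.cp c) (Tr0 B'.cp c) (cm c)"
  proof (rule nat_transI)
    fix b assume [simp]: "b \<in> Arr (Ps0 W c)"
    have "Ma' c (Idt (Ps0 E c) e) b \<cdot>\<^bsub>A\<^esub> m c e (Dom (Ps0 W c) b) = m c e (Cod (Ps0 W c) b) \<cdot>\<^bsub>A\<^esub> Ma c (Idt (Ps0 E c) e) b"
      if "e \<in> Ob (Ps0 E c)" for e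
      using m_natural[of c "Idt (Ps0 E c) e" b] that by simp
    then show "FArr (Tr0 B'.cp c) b \<cdot>\<^bsub>Ps0 (Cat_psf C E A) c\<^esub> cm c (Dom (Ps0 W c) b) =
        cm c (Cod (Ps0 W c) b) \<cdot>\<^bsub>Ps0 (Cat_psf C E A) c\<^esub> FArr (Tr0 B.cp c) b"
      by (simp add: cur_mod_def cong: restrict_cong)
  qed (use cm_nat B.cp_functor B'.cp_functor in \<open>simp_all add: cur_mod_def\<close>)
next
  fix k l f w assume "f \<in> hom (cells1 (op2 C)) k l" "w \<in> Ob (Ps0 W k)"
  then have [simp]: "f \<in> Cell1 C" "Src C f = l" "Tgt C f = k" "w \<in> Ob (Ps0 W k)" by auto
  have [simp]: "k \<in> Cell0 C" "l \<in> Cell0 C" using B.cells1_simps(1,2)[of f] by simp_all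
  have "t' f e w \<cdot>\<^bsub>A\<^esub> m k (FOb (Ps1 E f) e) w = m l e (FOb (Ps1 W f) w) \<cdot>\<^bsub>A\<^esub> t f e w" if "e \<in> Ob (Ps0 E l)" for e
    using m_cell[of f e w] that by simp
  then show "Tr1 B'.cp f w \<cdot>\<^bsub>Ps0 (Cat_psf C E A) l\<^esub> FArr (Ps1 (Cat_psf C E A) f) (cm k w) =
      cm l (FOb (Ps1 W f) w) \<cdot>\<^bsub>Ps0 (Cat_psf C E A) l\<^esub> Tr1 B.cp f w"
    using cm_nat[of k w] by (simp add: cur_mod_def cong: restrict_cong)
qed

end

lemma modification_uncurry:
  assumes B: "balanced C E W A Mo Ma t" and B': "balanced C E W A Mo' Ma' t'"
    and \<mu>: "modification (op2 C) W (Cat_psf C E A) (curry_pstr C E W Mo Ma t) (curry_pstr C E W Mo' Ma' t') \<mu>"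
  shows "balanced_map C E W A Mo Ma t Mo' Ma' t' (\<lambda>c e w. tm (\<mu> c w) e)"
    and "cur_mod C E W Mo Ma Mo' Ma' (\<lambda>c e w. tm (\<mu> c w) e) = \<mu>"
proof -
  interpret B: balanced C E W A Mo Ma t by fact
  interpret B': balanced C E W A Mo' Ma' t' by fact
  have tr: "\<mu> c w = (B.cf c w, tm (\<mu> c w), B'.cf c w)"
    and nt: "nat_trans (Ps0 E c) A (B.cf c w) (B'.cf c w) (tm (\<mu> c w))"
    if "c \<in> Cell0 C" "w \<in> Ob (Ps0 W c)" for c w
    using nat_transD(4-6)[OF modificationD(4)[OF \<mu>], of c w] that by (cases "\<mu> c w", simp)+
  have [simp]: "tm (\<mu> c w) e \<in> Arr A" "Dom A (tm (\<mu> c w) e) = Mo c e w" "Cod A (tm (\<mu> c w) e) = Mo' c e w"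
    if "c \<in> Cell0 C" "w \<in> Ob (Ps0 W c)" "e \<in> Ob (Ps0 E c)" for c w e
    using nat_transD(4-6)[OF nt] that by auto
  show map: "balanced_map C E W A Mo Ma t Mo' Ma' t' (\<lambda>c e w. tm (\<mu> c w) e)"
  proof (intro balanced_map.intro balanced_map_axioms.intro B B')
    fix c a b assume [simp]: "c \<in> Cell0 C" "a \<in> Arr (Ps0 E c)" "b \<in> Arr (Ps0 W c)"
    let ?a = "Dom (Ps0 E c) a" and ?a' = "Cod (Ps0 E c) a" and ?b = "Dom (Ps0 W c) b" and ?b' = "Cod (Ps0 W c) b"
    have "FArr (Tr0 B'.cp c) b \<cdot>\<^bsub>functor_cat (Ps0 E c) A\<^esub> \<mu> c ?b = \<mu> c ?b' \<cdot>\<^bsub>functor_cat (Ps0 E c) A\<^esub> FArr (Tr0 B.cp c) b"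
      using nat_transD(7)[OF modificationD(4)[OF \<mu>], of c b] by simp
    then have "FArr (Tr0 B'.cp c) b \<cdot>\<^bsub>functor_cat (Ps0 E c) A\<^esub> (B.cf c ?b, tm (\<mu> c ?b), B'.cf c ?b) =
        (B.cf c ?b', tm (\<mu> c ?b'), B'.cf c ?b') \<cdot>\<^bsub>functor_cat (Ps0 E c) A\<^esub> FArr (Tr0 B.cp c) b"
      using tr[of c ?b] tr[of c ?b'] by simp
    then have 1: "Ma' c (Idt (Ps0 E c) ?a) b \<cdot>\<^bsub>A\<^esub> tm (\<mu> c ?b) ?a = tm (\<mu> c ?b') ?a \<cdot>\<^bsub>A\<^esub> Ma c (Idt (Ps0 E c) ?a) b"
      by (auto dest!: fun_cong[of _ _ ?a])
    have 2: "Ma' c a (Idt (Ps0 W c) ?b') \<cdot>\<^bsub>A\<^esub> tm (\<mu> c ?b') ?a = tm (\<mu> c ?b') ?a' \<cdot>\<^bsub>A\<^esub> Ma c a (Idt (Ps0 W c) ?b')"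
      using nat_transD(7)[OF nt[of c ?b'], of a] by simp
    have "Ma' c a b \<cdot>\<^bsub>A\<^esub> tm (\<mu> c ?b) ?a = Ma' c a (Idt (Ps0 W c) ?b') \<cdot>\<^bsub>A\<^esub> Ma' c (Idt (Ps0 E c) ?a) b \<cdot>\<^bsub>A\<^esub> tm (\<mu> c ?b) ?a"
      by (simp add: B'.Ma_split(2)[of c a b, symmetric])
    also have "\<dots> = (Ma' c a (Idt (Ps0 W c) ?b') \<cdot>\<^bsub>A\<^esub> tm (\<mu> c ?b') ?a) \<cdot>\<^bsub>A\<^esub> Ma c (Idt (Ps0 E c) ?a) b"
      unfolding 1 by simp
    also have "\<dots> = tm (\<mu> c ?b') ?a' \<cdot>\<^bsub>A\<^esub> Ma c a b"
      unfolding 2 by (simp add: B.Ma_split(2)[of c a b, symmetric])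
    finally show "Ma' c a b \<cdot>\<^bsub>A\<^esub> tm (\<mu> c ?b) ?a = tm (\<mu> c ?b') ?a' \<cdot>\<^bsub>A\<^esub> Ma c a b" .
  next
    fix f e w assume [simp]: "f \<in> Cell1 C" "e \<in> Ob (Ps0 E (Src C f))" "w \<in> Ob (Ps0 W (Tgt C f))"
    let ?c = "Src C f" and ?d = "Tgt C f"
    have "Tr1 B'.cp f w \<cdot>\<^bsub>functor_cat (Ps0 E ?c) A\<^esub> FArr (Ps1 (Cat_psf C E A) f) (\<mu> ?d w) =
        \<mu> ?c (FOb (Ps1 W f) w) \<cdot>\<^bsub>functor_cat (Ps0 E ?c) A\<^esub> Tr1 B.cp f w"
      using modificationD(5)[OF \<mu>, of f ?d ?c w] by simp
    then have "Tr1 B'.cp f w \<cdot>\<^bsub>functor_cat (Ps0 E ?c) A\<^esub>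
          FArr (Ps1 (Cat_psf C E A) f) (B.cf ?d w, tm (\<mu> ?d w), B'.cf ?d w) =
        (B.cf ?c (FOb (Ps1 W f) w), tm (\<mu> ?c (FOb (Ps1 W f) w)), B'.cf ?c (FOb (Ps1 W f) w)) \<cdot>\<^bsub>functor_cat (Ps0 E ?c) A\<^esub> Tr1 B.cp f w"
      using tr[of ?d w] tr[of ?c "FOb (Ps1 W f) w"] by simp
    then show "t' f e w \<cdot>\<^bsub>A\<^esub> tm (\<mu> ?d w) (FOb (Ps1 E f) e) = tm (\<mu> ?c (FOb (Ps1 W f) w)) e \<cdot>\<^bsub>A\<^esub> t f e w"
      using nt[of ?d w] by (auto dest!: fun_cong[of _ _ e])
  qed simp
  show "cur_mod C E W Mo Ma Mo' Ma' (\<lambda>c e w. tm (\<mu> c w) e) = \<mu>"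
  proof (rule extensionalityI[OF _ modificationD(3)[OF \<mu>]])
    fix c assume "c \<in> Cell0 (op2 C)"
    then have [simp]: "c \<in> Cell0 C" by simp
    show "cur_mod C E W Mo Ma Mo' Ma' (\<lambda>c e w. tm (\<mu> c w) e) c = \<mu> c"
    proof (rule extensionalityI[OF _ nat_transD(3)[OF modificationD(4)[OF \<mu>]]])
      fix w assume [simp]: "w \<in> Ob (Ps0 W c)"
      have "(\<lambda>e \<in> Ob (Ps0 E c). tm (\<mu> c w) e) = tm (\<mu> c w)"
        by (rule extensionalityI[OF _ nat_transD(3)[OF nt]]) simp_all
      then show "cur_mod C E W Mo Ma Mo' Ma' (\<lambda>c e w. tm (\<mu> c w) e) c w = \<mu> c w"
        using tr[of c w] by (simp add: cur_mod_def)
    qed (simp_all add: cur_mod_def)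
  qed (simp add: cur_mod_def)
qed

lemma comp_cur_func: "comp_func (Ps0 E c) G (cur_func E W Mo Ma c w) =
    cur_func E W (\<lambda>c e w. FOb G (Mo c e w)) (\<lambda>c a b. FArr G (Ma c a b)) c w"
  by (simp add: comp_func_def cur_func_def compose_def cong: restrict_cong)

context balanced
begin

lemma image_balanced:
  assumes A': "category A'" and G: "is_functor A A' G"
  shows "balanced C E W A' (\<lambda>c e w. FOb G (Mo c e w)) (\<lambda>c a b. FArr G (Ma c a b)) (\<lambda>f e w. FArr G (t f e w))"
proof (intro balanced.intro balanced_axioms.intro A')
  note [simp] = functorD(3-7)[OF G] functorD(8)[OF G, symmetric]
  show "weight C E W" by (rule weight_axioms)
  show "is_iso A' (FArr G (t f e w)) \<and> Dom A' (FArr G (t f e w)) = FOb G (Mo (Tgt C f) (FOb (Ps1 E f) e) w) \<and>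
      Cod A' (FArr G (t f e w)) = FOb G (Mo (Src C f) e (FOb (Ps1 W f) w))"
    if "f \<in> Cell1 C" "e \<in> Ob (Ps0 E (Src C f))" "w \<in> Ob (Ps0 W (Tgt C f))" for f e w
    using that functor_iso(1)[OF _ A' G] by simp
  fix \<alpha> f g e w assume a [simp]: "\<alpha> \<in> Cell2 C" "Dom2 C \<alpha> = f" "Cod2 C \<alpha> = g"
    "e \<in> Ob (Ps0 E (Src C f))" "w \<in> Ob (Ps0 W (Tgt C f))"
  have [simp]: "f \<in> Cell1 C" "g \<in> Cell1 C" "Src C g = Src C f" "Tgt C g = Tgt C f"
    using vert_simps(1,2)[of \<alpha>] horiz_simps(1,2)[of \<alpha>] by simp_all
  show "FArr G (t g e w) \<cdot>\<^bsub>A'\<^esub> FArr G (Ma (Tgt C f) (Ps2 E \<alpha> e) (Idt (Ps0 W (Tgt C f)) w)) =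
      FArr G (Ma (Src C f) (Idt (Ps0 E (Src C f)) e) (Ps2 W \<alpha> w)) \<cdot>\<^bsub>A'\<^esub> FArr G (t f e w)"
    using t_2cell[OF a] by simp
qed (simp_all add: functorD(3-7)[OF G] functorD(8)[OF G, symmetric] Ma_Comp t_natural t_Id1 t_Cmp1)

lemma induced_pstr_cp:
  assumes A': "category A'" and G: "is_functor A A' G"
  shows "induced_pstr C E W A A' cp G =
    curry_pstr C E W (\<lambda>c e w. FOb G (Mo c e w)) (\<lambda>c a b. FArr G (Ma c a b)) (\<lambda>f e w. FArr G (t f e w))"
proof -
  have ob: "FOb (postcomp_func (Ps0 E c) A A' G) F = comp_func (Ps0 E c) G F" if "is_functor (Ps0 E c) A F" for c F
    using that by (simp add: postcomp_func_def)
  have ar: "FArr (postcomp_func (Ps0 E c) A A' G) (F, \<eta>, F') =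
      (comp_func (Ps0 E c) G F, \<lambda>x \<in> Ob (Ps0 E c). FArr G (\<eta> x), comp_func (Ps0 E c) G F')"
    if "nat_trans (Ps0 E c) A F F' \<eta>" for c F F' \<eta>
    using that by (simp add: postcomp_func_def)
  have assoc: "comp_func (Ps0 E c) G (comp_func (Ps0 E c) (cf d w) (Ps1 E f)) =
      comp_func (Ps0 E c) (comp_func (Ps0 E d) G (cf d w)) (Ps1 E f)"
    if "f \<in> Cell1 C" "Src C f = c" "Tgt C f = d" for c d f w
    using that by (auto simp: comp_func_def compose_def)
  show ?thesis
    unfolding induced_pstr_def
    by (simp add: curry_pstr_def comp_func_def[of "Ps0 W _"] compose_def ob ar cp_cell assoc comp_cur_func
        cong: restrict_cong)
qed

end

section \<open>The universal property of the tensor product\<close>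

locale weight_target = weight C E W + A: category A
  for C :: "('o, 'f, 't) two_cat" (structure)
    and E :: "('o, 'f, 't, 'x, 'y) psf" and W :: "('o, 'f, 't, 'z, 'w) psf" and A :: "('p, 'q) cat"
begin

sublocale U: balanced C E W T.loc "unit_ob C" "unit_arr C E W" "unit_cell C E W"
  by (rule unit_balanced)

lemmas A_cat [simp] = A.category_axioms

text \<open>
  \<open>gp G\<close> is the restriction of a functor \<open>G\<close> along the unit, and \<open>gm G H m\<close> the modification between two restrictions
  with uncurried components \<open>m\<close>.
\<close>

abbreviation "gp G \<equiv> curry_pstr C E W (\<lambda>c e w. FOb G (unit_ob C c e w)) (\<lambda>c a b. FArr G (unit_arr C E W c a b))
  (\<lambda>f e w. FArr G (unit_cell C E W f e w))"
abbreviation "gm G H m \<equiv> cur_mod C E W (\<lambda>c e w. FOb G (unit_ob C c e w)) (\<lambda>c a b. FArr G (unit_arr C E W c a b))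
  (\<lambda>c e w. FOb H (unit_ob C c e w)) (\<lambda>c a b. FArr H (unit_arr C E W c a b)) m"
abbreviation "HomA \<equiv> Hom_cat (op2 C) W (Cat_psf C E A)"
abbreviation "induced \<equiv> induced_func C E W T.loc A (tensor_unit C E W)"

lemma category_HomA: "category HomA"
proof (rule psf_pair.category_Hom_cat[OF psf_pair.intro])
  fix f assume "f \<in> Cell1 (op2 C)"
  then have f: "f \<in> Cell1 C" by simp
  then show "Src (op2 C) f \<in> Cell0 (op2 C) \<and> Tgt (op2 C) f \<in> Cell0 (op2 C)" by simp
  show "is_functor (Ps0 W (Src (op2 C) f)) (Ps0 W (Tgt (op2 C) f)) (Ps1 W f)"
    using W.Ps1_functor[of f "Tgt C f" "Src C f"] f by simp
  show "is_functor (Ps0 (Cat_psf C E A) (Src (op2 C) f)) (Ps0 (Cat_psf C E A) (Tgt (op2 C) f)) (Ps1 (Cat_psf C E A) f)"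
    using E.Ps1_functor[of f "Src C f" "Tgt C f"] f by (simp add: is_functor_precomp)
qed simp_all

lemma induced_FOb: "is_functor T.loc A G \<Longrightarrow> FOb induced G = gp G"
  using U.induced_pstr_cp[of A G] by (simp add: induced_func_def tensor_unit_curry)

lemma induced_FArr:
  assumes "nat_trans T.loc A G H \<gamma>"
  shows "FArr induced (G, \<gamma>, H) = (gp G, gm G H (\<lambda>c e w. \<gamma> (unit_ob C c e w)), gp H)"
  using assms nat_transD(1,2)[OF assms] U.induced_pstr_cp[of A G] U.induced_pstr_cp[of A H]
  by (simp add: induced_func_def tensor_unit_curry cur_mod_def comp_cur_func cong: restrict_cong)

lemma gp_balanced:
  assumes "is_functor T.loc A G"
  shows "balanced C E W A (\<lambda>c e w. FOb G (unit_ob C c e w)) (\<lambda>c a b. FArr G (unit_arr C E W c a b))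
    (\<lambda>f e w. FArr G (unit_cell C E W f e w))"
  using assms by (rule U.image_balanced[OF A_cat])

lemma gp_map:
  assumes \<gamma>: "nat_trans T.loc A G H \<gamma>"
  shows "balanced_map C E W A (\<lambda>c e w. FOb G (unit_ob C c e w)) (\<lambda>c a b. FArr G (unit_arr C E W c a b))
    (\<lambda>f e w. FArr G (unit_cell C E W f e w)) (\<lambda>c e w. FOb H (unit_ob C c e w)) (\<lambda>c a b. FArr H (unit_arr C E W c a b))
    (\<lambda>f e w. FArr H (unit_cell C E W f e w)) (\<lambda>c e w. \<gamma> (unit_ob C c e w))"
proof (intro balanced_map.intro balanced_map_axioms.intro gp_balanced nat_transD(1)[OF \<gamma>] nat_transD(2)[OF \<gamma>])
  show "FArr H (unit_arr C E W c a b) \<cdot>\<^bsub>A\<^esub> \<gamma> (unit_ob C c (Dom (Ps0 E c) a) (Dom (Ps0 W c) b)) =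
      \<gamma> (unit_ob C c (Cod (Ps0 E c) a) (Cod (Ps0 W c) b)) \<cdot>\<^bsub>A\<^esub> FArr G (unit_arr C E W c a b)"
    if "c \<in> Cell0 C" "a \<in> Arr (Ps0 E c)" "b \<in> Arr (Ps0 W c)" for c a b
    using that nat_transD(7)[OF \<gamma>, of "unit_arr C E W c a b"] by simp
  show "FArr H (unit_cell C E W f e w) \<cdot>\<^bsub>A\<^esub> \<gamma> (unit_ob C (Tgt C f) (FOb (Ps1 E f) e) w) =
      \<gamma> (unit_ob C (Src C f) e (FOb (Ps1 W f) w)) \<cdot>\<^bsub>A\<^esub> FArr G (unit_cell C E W f e w)"
    if "f \<in> Cell1 C" "e \<in> Ob (Ps0 E (Src C f))" "w \<in> Ob (Ps0 W (Tgt C f))" for f e w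
    using that nat_transD(7)[OF \<gamma>, of "unit_cell C E W f e w"] by simp
qed (use nat_transD(4-6)[OF \<gamma>] U.Mo_Ob in simp_all)

lemma induced_functor: "is_functor (functor_cat T.loc A) HomA induced"
proof (rule functorI)
  fix x assume "x \<in> Arr (functor_cat T.loc A)"
  then obtain G \<gamma> H where x: "x = (G, \<gamma>, H)" and \<gamma>: "nat_trans T.loc A G H \<gamma>" by (cases x) auto
  note GH = nat_transD(1,2)[OF \<gamma>]
  show "FArr induced x \<in> Arr HomA" "Dom HomA (FArr induced x) = FOb induced (Dom (functor_cat T.loc A) x)"
    "Cod HomA (FArr induced x) = FOb induced (Cod (functor_cat T.loc A) x)"
    using balanced_map.cm_modification[OF gp_map[OF \<gamma>]] GH by (simp_all add: x induced_FArr[OF \<gamma>] induced_FOb)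
  fix y assume "y \<in> Arr (functor_cat T.loc A)" "Dom (functor_cat T.loc A) y = Cod (functor_cat T.loc A) x"
  then obtain \<delta> K where y: "y = (H, \<delta>, K)" and \<delta>: "nat_trans T.loc A H K \<delta>" by (cases y) (auto simp: x)
  show "FArr induced (y \<cdot>\<^bsub>functor_cat T.loc A\<^esub> x) = FArr induced y \<cdot>\<^bsub>HomA\<^esub> FArr induced x"
    unfolding x y functor_cat_simps(6) induced_FArr[OF \<gamma>] induced_FArr[OF \<delta>]
      induced_FArr[OF nat_trans_Comp[OF T.category_loc A_cat \<gamma> \<delta>]]
    using U.Mo_Ob by (simp add: cur_mod_def cong: restrict_cong)
next
  fix G assume "G \<in> Ob (functor_cat T.loc A)"
  then have G: "is_functor T.loc A G" by simp
  show "FOb induced G \<in> Ob HomA"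
    using balanced.cp_pseudo_nat[OF gp_balanced[OF G]] G by (simp add: induced_FOb)
  show "FArr induced (Idt (functor_cat T.loc A) G) = Idt HomA (FOb induced G)"
    unfolding functor_cat_simps(5) induced_FArr[OF nat_trans_Idt[OF T.category_loc A_cat G]] induced_FOb[OF G]
    using U.Mo_Ob balanced.cf_simps(1)[OF gp_balanced[OF G]] balanced.cp_simps(1)[OF gp_balanced[OF G]]
    by (simp add: cur_mod_def cong: restrict_cong)
qed (simp_all add: induced_func_def)

text \<open>The extension of a balanced family is a strict preimage.\<close>

lemma induced_surjective:
  assumes "\<theta> \<in> Ob HomA"
  shows "\<exists>G \<in> Ob (functor_cat T.loc A). FOb induced G = \<theta>"
proof -
  interpret P: weight_pseudo_nat C E W A \<theta>
    using assms by unfold_locales simp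
  interpret B: balanced C E W A "unc_ob \<theta>" "unc_arr E W \<theta> A" "unc_cell \<theta>"
    by (rule P.unc_balanced)
  have "gp B.Gext = curry_pstr C E W (unc_ob \<theta>) (unc_arr E W \<theta> A) (unc_cell \<theta>)"
    by (simp add: curry_pstr_def cur_func_def comp_func_def compose_def B.Gext_unit_ob B.Gext_unit_arr B.Gext_unit_cell
        cong: restrict_cong)
  then have "FOb induced B.Gext = \<theta>"
    by (simp add: induced_FOb B.Gext_functor P.curry_unc)
  then show ?thesis using B.Gext_functor by auto
qed

lemma loc_ObE:
  assumes "x \<in> Ob T.loc"
  obtains h e w where "h \<in> Cell1 C" "e \<in> Ob (Ps0 E (Src C h))" "w \<in> Ob (Ps0 W (Tgt C h))" "x = ((Src C h, Tgt C h), (e, w), h)"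
proof -
  obtain c d e w h where "x = ((c, d), (e, w), h)" by (metis surj_pair)
  then show thesis using assms that[of h e w] by simp
qed

text \<open>
  Every object of the tensor product is isomorphic, along \<open>Lar\<close>, to an object in the image of the unit, so naturality determines all
  components from those at such objects.
\<close>

lemma Lar_natural:
  assumes \<gamma>: "nat_trans T.loc A G H \<gamma>" and [simp]: "h \<in> Cell1 C" "e \<in> Ob (Ps0 E (Src C h))" "w \<in> Ob (Ps0 W (Tgt C h))"
  shows "\<gamma> ((Src C h, Tgt C h), (e, w), h) = inv_arrow A (FArr H (T.ar (Lar h e w))) \<cdot>\<^bsub>A\<^esub>
    \<gamma> (unit_ob C (Tgt C h) (FOb (Ps1 E h) e) w) \<cdot>\<^bsub>A\<^esub> FArr G (T.ar (Lar h e w))"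
proof -
  note [simp] = nat_transD(4-6)[OF \<gamma>] functorD(3-6)[OF nat_transD(1)[OF \<gamma>]] functorD(3-6)[OF nat_transD(2)[OF \<gamma>]]
    functor_iso(1)[OF T.category_loc A_cat nat_transD(2)[OF \<gamma>]]
  have "FArr H (T.ar (Lar h e w)) \<cdot>\<^bsub>A\<^esub> \<gamma> ((Src C h, Tgt C h), (e, w), h) =
      \<gamma> (unit_ob C (Tgt C h) (FOb (Ps1 E h) e) w) \<cdot>\<^bsub>A\<^esub> FArr G (T.ar (Lar h e w))"
    using nat_transD(7)[OF \<gamma>, of "T.ar (Lar h e w)"] by (simp add: unit_ob_def)
  from this[symmetric] show ?thesis by simp
qed

text \<open>
  \<open>Lar_natural\<close> determines a transformation by its restriction along the unit. Read as a definition, it extends a given map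
  between restrictions, and \<open>T_induct\<close> reduces naturality of the result to the generators: on values of the unit it is naturality of the
  map, on \<open>Lar\<close> it holds by construction, and on \<open>Rar\<close> it is compatibility of the map with the isomorphisms \<open>t\<close>.
\<close>

lemma induced_full_faithful:
  assumes G: "is_functor T.loc A G" and H: "is_functor T.loc A H"
    and x: "x \<in> hom HomA (FOb induced G) (FOb induced H)"
  shows "\<exists>!f. f \<in> hom (functor_cat T.loc A) G H \<and> FArr induced f = x"
proof (rule ex_ex1I)
  obtain \<mu> where x_eq: "x = (gp G, \<mu>, gp H)" and \<mu>: "modification (op2 C) W (Cat_psf C E A) (gp G) (gp H) \<mu>"
    using x G H by (cases x) (auto simp: hom_iff induced_FOb)
  define m where "m = (\<lambda>c e w. tm (\<mu> c w) e)"
  interpret m: balanced_map C E W A "\<lambda>c e w. FOb G (unit_ob C c e w)" "\<lambda>c a b. FArr G (unit_arr C E W c a b)"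
      "\<lambda>f e w. FArr G (unit_cell C E W f e w)" "\<lambda>c e w. FOb H (unit_ob C c e w)" "\<lambda>c a b. FArr H (unit_arr C E W c a b)"
      "\<lambda>f e w. FArr H (unit_cell C E W f e w)" m
    unfolding m_def by (rule modification_uncurry(1)[OF gp_balanced[OF G] gp_balanced[OF H] \<mu>])
  have gm: "gm G H m = \<mu>"
    unfolding m_def by (rule modification_uncurry(2)[OF gp_balanced[OF G] gp_balanced[OF H] \<mu>])
  note Gs [simp] = functorD(3-8)[OF G] functor_iso[OF T.category_loc A_cat G]
  note Hs [simp] = functorD(3-8)[OF H] functor_iso[OF T.category_loc A_cat H]
  define \<gamma> where "\<gamma> = (\<lambda>x \<in> Ob T.loc. case x of ((c, d), (e, w), h) \<Rightarrow>
    inv_arrow A (FArr H (T.ar (Lar h e w))) \<cdot>\<^bsub>A\<^esub> m d (FOb (Ps1 E h) e) w \<cdot>\<^bsub>A\<^esub> FArr G (T.ar (Lar h e w)))"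
  have \<gamma>: "\<gamma> ((Src C h, Tgt C h), (e, w), h) = inv_arrow A (FArr H (T.ar (Lar h e w))) \<cdot>\<^bsub>A\<^esub>
      m (Tgt C h) (FOb (Ps1 E h) e) w \<cdot>\<^bsub>A\<^esub> FArr G (T.ar (Lar h e w))"
    if "h \<in> Cell1 C" "e \<in> Ob (Ps0 E (Src C h))" "w \<in> Ob (Ps0 W (Tgt C h))" for h e w
    using that by (simp add: \<gamma>_def)
  have \<gamma>_unit [simp]: "\<gamma> (unit_ob C c e w) = m c e w"
    if "c \<in> Cell0 C" "e \<in> Ob (Ps0 E c)" "w \<in> Ob (Ps0 W c)" for c e w
    using \<gamma>[of "Id1 C c" e w] that Lar_Rar_Id1(1)[of c e w] U.Mo_Ob[of c e w] m.m_simps[of c e w]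
    by (simp add: unit_ob_def)
  have \<gamma>_typed [simp]: "\<gamma> x \<in> Arr A" "Dom A (\<gamma> x) = FOb G x" "Cod A (\<gamma> x) = FOb H x"
    if x_Ob: "x \<in> Ob T.loc" for x
  proof -
    obtain h e w where [simp]: "h \<in> Cell1 C" "e \<in> Ob (Ps0 E (Src C h))" "w \<in> Ob (Ps0 W (Tgt C h))"
      and x: "x = ((Src C h, Tgt C h), (e, w), h)"
      using x_Ob by (rule loc_ObE)
    have u: "((Tgt C h, Tgt C h), (FOb (Ps1 E h) e, w), Id1 C (Tgt C h)) = unit_ob C (Tgt C h) (FOb (Ps1 E h) e) w"
      by (simp add: unit_ob_def)
    show "\<gamma> x \<in> Arr A" "Dom A (\<gamma> x) = FOb G x" "Cod A (\<gamma> x) = FOb H x"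
      unfolding x by (simp_all add: \<gamma> u)
  qed
  have [simp]: "Dom T.loc z \<in> Cell0 DD" "Cod T.loc z \<in> Cell0 DD" if "z \<in> Arr T.loc" for z
    using cat_simps(1,2)[OF T.category_loc that] by simp_all
  have nat: "FArr H z \<cdot>\<^bsub>A\<^esub> \<gamma> (Dom T.loc z) = \<gamma> (Cod T.loc z) \<cdot>\<^bsub>A\<^esub> FArr G z" if "z \<in> Arr T.loc" for z
    using that
  proof (induction rule: T_induct[consumes 1])
    case (1 c a b)
    then show ?case
      using m.m_natural[of c a b] by (simp add: unit_arr_eq[symmetric])
  next
    case L: (2 f e w)
    then have [simp]: "f \<in> Cell1 C" "e \<in> Ob (Ps0 E (Src C f))" "w \<in> Ob (Ps0 W (Tgt C f))" .
    have u: "((Tgt C f, Tgt C f), (FOb (Ps1 E f) e, w), Id1 C (Tgt C f)) = unit_ob C (Tgt C f) (FOb (Ps1 E f) e) w"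
      by (simp add: unit_ob_def)
    show ?case by (simp add: \<gamma> u)
  next
    case (3 f e w)
    then have [simp]: "f \<in> Cell1 C" "e \<in> Ob (Ps0 E (Src C f))" "w \<in> Ob (Ps0 W (Tgt C f))" .
    have u: "((Tgt C f, Tgt C f), (FOb (Ps1 E f) e, w), Id1 C (Tgt C f)) = unit_ob C (Tgt C f) (FOb (Ps1 E f) e) w"
      "((Src C f, Src C f), (e, FOb (Ps1 W f) w), Id1 C (Src C f)) = unit_ob C (Src C f) e (FOb (Ps1 W f) w)"
      by (simp_all add: unit_ob_def)
    let ?L = "T.ar (Lar f e w)" and ?R = "T.ar (Rar f e w)" and ?t = "unit_cell C E W f e w"
    have R: "?R = ?t \<diamondop> ?L" by (simp add: unit_cell_eq)
    have "FArr H ?R \<cdot>\<^bsub>A\<^esub> \<gamma> (Dom T.loc ?R) = FArr H ?t \<cdot>\<^bsub>A\<^esub> m (Tgt C f) (FOb (Ps1 E f) e) w \<cdot>\<^bsub>A\<^esub> FArr G ?L"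
      unfolding R by (simp add: \<gamma> u)
    also have "\<dots> = (FArr H ?t \<cdot>\<^bsub>A\<^esub> m (Tgt C f) (FOb (Ps1 E f) e) w) \<cdot>\<^bsub>A\<^esub> FArr G ?L"
      by (simp add: u)
    also have "\<dots> = (m (Src C f) e (FOb (Ps1 W f) w) \<cdot>\<^bsub>A\<^esub> FArr G ?t) \<cdot>\<^bsub>A\<^esub> FArr G ?L"
      using m.m_cell[of f e w] by simp
    also have "\<dots> = \<gamma> (Cod T.loc ?R) \<cdot>\<^bsub>A\<^esub> FArr G ?R"
      unfolding R by (simp add: u)
    finally show ?case .
  next
    case (4 z)
    have z: "z \<in> Arr T.loc" using 4(1) by (rule is_iso_Arr)
    have "FArr H (inv_arrow T.loc z) \<cdot>\<^bsub>A\<^esub> \<gamma> (Cod T.loc z) =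
        FArr H (inv_arrow T.loc z) \<cdot>\<^bsub>A\<^esub> (\<gamma> (Cod T.loc z) \<cdot>\<^bsub>A\<^esub> FArr G z) \<cdot>\<^bsub>A\<^esub> FArr G (inv_arrow T.loc z)"
      using 4(1) z by simp
    also have "\<dots> = \<gamma> (Dom T.loc z) \<cdot>\<^bsub>A\<^esub> FArr G (inv_arrow T.loc z)"
      unfolding 4(2)[symmetric] using 4(1) z by simp
    finally show ?case using 4(1) z by simp
  next
    case (5 y z)
    have z: "FArr H z \<cdot>\<^bsub>A\<^esub> \<gamma> (Dom T.loc z) = \<gamma> (Cod T.loc z) \<cdot>\<^bsub>A\<^esub> FArr G z" by fact
    have "FArr H z \<cdot>\<^bsub>A\<^esub> FArr H y \<cdot>\<^bsub>A\<^esub> \<gamma> (Dom T.loc y) = FArr H z \<cdot>\<^bsub>A\<^esub> \<gamma> (Cod T.loc y) \<cdot>\<^bsub>A\<^esub> FArr G y"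
      using 5 by simp
    also have "\<dots> = (FArr H z \<cdot>\<^bsub>A\<^esub> \<gamma> (Dom T.loc z)) \<cdot>\<^bsub>A\<^esub> FArr G y"
      using \<open>y \<in> Arr T.loc\<close> \<open>z \<in> Arr T.loc\<close> \<open>Dom T.loc z = Cod T.loc y\<close> by simp
    also have "\<dots> = \<gamma> (Cod T.loc z) \<cdot>\<^bsub>A\<^esub> FArr G z \<cdot>\<^bsub>A\<^esub> FArr G y"
      unfolding z using \<open>y \<in> Arr T.loc\<close> \<open>z \<in> Arr T.loc\<close> \<open>Dom T.loc z = Cod T.loc y\<close> by simp
    finally show ?case using 5 by simp
  qed
  have \<gamma>_nat: "nat_trans T.loc A G H \<gamma>"
    by (rule nat_transI[OF G H]) (use nat in \<open>auto simp: \<gamma>_def[THEN arg_cong, of "\<lambda>f. f \<in> _"]\<close>)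
  have "FArr induced (G, \<gamma>, H) = x"
    using gm by (simp add: induced_FArr[OF \<gamma>_nat] x_eq cur_mod_def cong: restrict_cong)
  then show "\<exists>f. f \<in> hom (functor_cat T.loc A) G H \<and> FArr induced f = x"
    using \<gamma>_nat by (intro exI[of _ "(G, \<gamma>, H)"]) (simp add: hom_iff)
next
  fix f g assume f: "f \<in> hom (functor_cat T.loc A) G H \<and> FArr induced f = x"
    and g: "g \<in> hom (functor_cat T.loc A) G H \<and> FArr induced g = x"
  obtain \<gamma> where f_eq: "f = (G, \<gamma>, H)" and \<gamma>: "nat_trans T.loc A G H \<gamma>" using f by (cases f) (auto simp: hom_iff)
  obtain \<delta> where g_eq: "g = (G, \<delta>, H)" and \<delta>: "nat_trans T.loc A G H \<delta>" using g by (cases g) (auto simp: hom_iff)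
  have "gm G H (\<lambda>c e w. \<gamma> (unit_ob C c e w)) = gm G H (\<lambda>c e w. \<delta> (unit_ob C c e w))"
    using f g by (auto simp: f_eq g_eq induced_FArr[OF \<gamma>] induced_FArr[OF \<delta>])
  then have unit: "\<gamma> (unit_ob C c e w) = \<delta> (unit_ob C c e w)"
    if "c \<in> Cell0 C" "e \<in> Ob (Ps0 E c)" "w \<in> Ob (Ps0 W c)" for c e w
    using that by (auto simp: cur_mod_def dest!: fun_cong[of _ _ c] fun_cong[of _ _ w] fun_cong[of _ _ e])
  have "\<gamma> = \<delta>"
  proof (rule extensionalityI[OF nat_transD(3)[OF \<gamma>] nat_transD(3)[OF \<delta>]])
    fix x assume "x \<in> Ob T.loc"
    then obtain h e w where h: "h \<in> Cell1 C" "e \<in> Ob (Ps0 E (Src C h))" "w \<in> Ob (Ps0 W (Tgt C h))"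
      and x: "x = ((Src C h, Tgt C h), (e, w), h)" by (rule loc_ObE)
    show "\<gamma> x = \<delta> x"
      using h unit by (simp add: x Lar_natural[OF \<gamma>] Lar_natural[OF \<delta>])
  qed
  then show "f = g" by (simp add: f_eq g_eq)
qed

lemma induced_equivalence: "is_equivalence (functor_cat T.loc A) HomA induced"
proof (rule is_equivalence_surjective_on_objects[OF _ category_HomA induced_functor])
  show "category (functor_cat T.loc A)" by simp
qed (use induced_surjective induced_full_faithful in auto)

end

theorem theorem4p5:
  fixes C :: "('o, 'f, 't) two_cat"
    and E :: "('o, 'f, 't, 'x, 'y) psf"
    and W :: "('o, 'f, 't, 'z, 'w) psf"
  assumes "two_category C"
    and "pseudo_functor C E"
    and "pseudo_functor (op2 C) W"
  shows "is_bicolimit TYPE('p) TYPE('q) C E W (tensor C E W) (tensor_unit C E W)"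
proof -
  interpret weight C E W
    using assms by (rule weight.intro)
  have "is_equivalence (functor_cat T.loc A) (Hom_cat (op2 C) W (Cat_psf C E A))
      (induced_func C E W T.loc A (tensor_unit C E W))" if "category A" for A :: "('p, 'q) cat"
  proof -
    interpret A: category A by fact
    interpret weight_target C E W A by unfold_locales
    show ?thesis by (rule induced_equivalence)
  qed
  then show ?thesis
    unfolding is_bicolimit_def tensor_eq
    using balanced.cp_pseudo_nat[OF unit_balanced] by (simp add: tensor_unit_curry)
qed

end
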